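(* Let $X$ be a meromorphic Lévy process started from zero, with Laplace exponent $\psi$, determined by $\sigma\ge 0$, $\mu\in\mathbb{R}$ and the coefficients $a_n,\hat a_n,\rho_n,\hat\rho_n$ ($n\ge 1$) as described in the context. Let $q>0$, let $\{\zeta_n\}_{n\ge1}$ and $\{-\hat\zeta_n\}_{n\ge 1}$ be the positive and negative solutions of $\psi(z)=q$ (see the context), and let $I_q=\int_0^{\mathrm{e}(q)} e^{X_u}\,du$, where $\mathrm{e}(q)$ is an exponential random variable with mean $1/q$ independent of $X$. Set $\hat\rho_0=0$ and define the four sequences $$\zeta=\{\zeta_n\}_{n\ge 1},\quad \rho=\{\rho_n\}_{n\ge 1},\quad \tilde\zeta=\{1+\hat\zeta_n\}_{n\ge 1},\quad \tilde\rho=\{1+\hat\rho_{n-1}\}_{n\ge 1}.$$ Then the following identity in distribution holds: $$I_q \stackrel{d}{=} C\times \frac{X(\tilde\rho,\tilde\zeta)}{X(\zeta,\rho)},\qquad\text{where}\qquad C=C(q):=q^{-1}\prod_{n\ge 1}\frac{1+\frac{1}{\hat\rho_n}}{1+\frac{1}{\hat\zeta_n}},$$ and the random variables $X(\tilde\rho,\tilde\zeta)$ and $X(\zeta,\rho)$ are independent (with $X(\cdot,\cdot)$ the infinite product of independent beta random variables defined in the context). Moreover, the Mellin transform $\mathcal{M}(s):=\mathbb{E}[I_q^{s-1}]$ is finite for $0<\mathrm{Re}(s)<1+\zeta_1$ and is given by $$\mathcal{M}(s)=C^{s-1}\prod_{n\ge 1}\frac{\Gamma(\hat\zeta_n+1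)\,\Gamma(\hat\rho_{n-1}+s)}{\Gamma(\hat\rho_{n-1}+1)\,\Gamma(\hat\zeta_n+s)}\left(\frac{\hat\zeta_n+1}{\hat\rho_{n-1}+1}\right)^{s-1}\frac{\Gamma(\rho_n)\,\Gamma(\zeta_n+1-s)}{\Gamma(\zeta_n)\,\Gamma(\rho_n+1-s)}\left(\frac{\zeta_n}{\rho_n}\right)^{s-1}.$$
   Context: Meromorphic Lévy process: a Lévy process $X$ on $\mathbb{R}$ whose Lévy measure has density $$\pi(x)=\mathbf{1}_{\{x>0\}}\sum_{n\ge1} a_n\rho_n e^{-\rho_n x}+\mathbf{1}_{\{x<0\}}\sum_{n\ge 1}\hat a_n\hat\rho_n e^{\hat\rho_n x},$$ where all $a_n,\hat a_n,\rho_n,\hat\rho_n$ ($n\ge 1$) are strictly positive, the sequences $\{\rho_n\}_{n\ge1}$ and $\{\hat\rho_n\}_{n\ge1}$ are strictly increasing and unbounded, and $\sum_{n\ge 1}\left(a_n/\rho_n^2+\hat a_n/\hat\rho_n^2\right)<\infty$. Its Laplace exponent $\psi(z):=\ln\mathbb{E}[\exp(zX_1)]$ is $$\psi(z)=\tfrac12\sigma^2z^2+\mu z+z^2\sum_{n\ge1}\frac{a_n}{\rho_n(\rho_n-z)}+z^2\sum_{n\ge1}\frac{\hat a_n}{\hat\rho_n(\hat\rho_n+z)},\qquad -\hat\rho_1<\mathrm{Re}(z)<\rho_1,$$ with $\sigma\ge0$, $\mu\in\mathbb{R}$, and $\psi$ is extended by this formula to a meromorphic function on $\mathbb{C}$ with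 simple poles exactly at the points $\rho_n$, $-\hat\rho_n$. Known facts fixing the notation: for every $q>0$ all solutions in $\mathbb{C}$ of $\psi(z)=q$ are real and simple; they are denoted $\zeta_n$, $-\hat\zeta_n$ ($n\ge1$), where $\cdots<-\hat\rho_2<-\hat\zeta_2<-\hat\rho_1<-\hat\zeta_1<0<\zeta_1<\rho_1<\zeta_2<\rho_2<\cdots$. Moreover $$q-\psi(z)=q\prod_{n\ge1}\frac{1-z/\zeta_n}{1-z/\rho_n}\times\prod_{n\ge1}\frac{1+z/\hat\zeta_n}{1+z/\hat\rho_n},\qquad z\in\mathbb{C}.$$ Infinite product of beta variables: for $a,b>0$, $B_{(a,b)}$ denotes a beta random variable with density $\frac{\Gamma(a+b)}{\Gamma(a)\Gamma(b)}x^{a-1}(1-x)^{b-1}$ on $(0,1)$. For two unbounded sequences $\alpha=\{\alpha_n\}_{n\ge1}$, $\beta=\{\beta_n\}_{n\ge1}$ with $0<\alpha_1<\beta_1<\alpha_2<\beta_2<\cdots$, define $$X(\alpha,\beta):=\prod_{n\ge1}B_{(\alpha_n,\,\beta_n-\alpha_n)}\frac{\beta_n}{\alpha_n},$$ where the beta random variables are independent (the product converges almost surely). For $x>0$ and $w\in\mathbb{C}$, $x^{w}=\exp(w\ln x)$. *)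

theory Defs
  imports "HOL-Probability.Probability"
begin

text \<open>
  Sequences indexed by \<open>n \<ge> 1\<close> are functions on \<open>nat\<close> evaluated at positive arguments, so
  \<open>\<Sum>n. f (Suc n)\<close> and \<open>\<Prod>n. f (Suc n)\<close> are the sum and product of \<open>f n\<close> over \<open>n \<ge> 1\<close>.
\<close>

section \<open>Levy processes\<close>

definition cadlag :: "(real \<Rightarrow> real) \<Rightarrow> bool" where
  "cadlag x \<longleftrightarrow> (\<forall>t\<ge>0. continuous (at_right t) x) \<and> (\<forall>t>0. \<exists>l. (x \<longlongrightarrow> l) (at_left t))"

text \<open>Only the values \<open>X t\<close> with \<open>t \<ge> 0\<close> are constrained.\<close>

definition levy_process :: "'a measure \<Rightarrow> (real \<Rightarrow> 'a \<Rightarrow> real) \<Rightarrow> bool" where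
  "levy_process M X \<longleftrightarrow>
     prob_space M \<and>
     (\<forall>t\<ge>0. X t \<in> borel_measurable M) \<and>
     (AE \<omega> in M. X 0 \<omega> = 0) \<and>
     (\<forall>(t :: nat \<Rightarrow> real) n. 0 \<le> t 0 \<and> mono t \<longrightarrow>
        prob_space.indep_vars M (\<lambda>_. borel) (\<lambda>i \<omega>. X (t (Suc i)) \<omega> - X (t i) \<omega>) {..<n}) \<and>
     (\<forall>s\<ge>0. \<forall>t\<ge>0. distr M borel (\<lambda>\<omega>. X (s + t) \<omega> - X s \<omega>) = distr M borel (\<lambda>\<omega>. X t \<omega> - X 0 \<omega>)) \<and>
     (\<forall>\<omega>\<in>space M. cadlag (\<lambda>t. X t \<omega>))"

definition jump :: "(real \<Rightarrow> real) \<Rightarrow> real \<Rightarrow> real" where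
  "jump x t = x t - Lim (at_left t) x"

text \<open>
  The Levy measure of a Borel set is the expected number of jumps in the time interval \<open>(0,1]\<close>
  whose (nonzero) size belongs to that set.
\<close>

definition levy_measure_density ::
    "'a measure \<Rightarrow> (real \<Rightarrow> 'a \<Rightarrow> real) \<Rightarrow> (real \<Rightarrow> real) \<Rightarrow> bool" where
  "levy_measure_density M X p \<longleftrightarrow>
     (\<forall>A\<in>sets borel.
        (\<integral>\<^sup>+\<omega>. emeasure (count_space UNIV) {t\<in>{0<..1}. jump (\<lambda>s. X s \<omega>) t \<in> A - {0}} \<partial>M)
        = (\<integral>\<^sup>+x\<in>A. ennreal (p x) \<partial>lborel))"

section \<open>Meromorphic Levy processes\<close>

definition mero_density ::
    "(nat \<Rightarrow> real) \<Rightarrow> (nat \<Rightarrow> real) \<Rightarrow> (nat \<Rightarrow> real) \<Rightarrow> (nat \<Rightarrow> real) \<Rightarrow> real \<Rightarrow> real" where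
  "mero_density a ah \<rho> \<rho>h x =
     (if x > 0 then \<Sum>n. a (Suc n) * \<rho> (Suc n) * exp (- \<rho> (Suc n) * x)
      else if x < 0 then \<Sum>n. ah (Suc n) * \<rho>h (Suc n) * exp (\<rho>h (Suc n) * x)
      else 0)"

definition mero_exponent ::
    "real \<Rightarrow> real \<Rightarrow> (nat \<Rightarrow> real) \<Rightarrow> (nat \<Rightarrow> real) \<Rightarrow> (nat \<Rightarrow> real) \<Rightarrow> (nat \<Rightarrow> real) \<Rightarrow> complex \<Rightarrow> complex"
  where
  "mero_exponent \<sigma> \<mu> a ah \<rho> \<rho>h z =
     of_real (\<sigma>\<^sup>2) * z\<^sup>2 / 2 + of_real \<mu> * z
     + z\<^sup>2 * (\<Sum>n. of_real (a (Suc n)) / (of_real (\<rho> (Suc n)) * (of_real (\<rho> (Suc n)) - z)))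
     + z\<^sup>2 * (\<Sum>n. of_real (ah (Suc n)) / (of_real (\<rho>h (Suc n)) * (of_real (\<rho>h (Suc n)) + z)))"

text \<open>
  At these points the value of \<^const>\<open>mero_exponent\<close> is an artefact of \<open>x / 0 = 0\<close>.
\<close>

definition mero_poles :: "(nat \<Rightarrow> real) \<Rightarrow> (nat \<Rightarrow> real) \<Rightarrow> complex set" where
  "mero_poles \<rho> \<rho>h = {of_real (\<rho> n) |n. n \<ge> 1} \<union> {of_real (- \<rho>h n) |n. n \<ge> 1}"

text \<open>
  The last condition is \<open>\<psi>(z) = ln E[exp (z X\<^sub>1)]\<close> in the strip around the imaginary
  axis, written in exponential form so that no branch of the complex logarithm has to be chosen.
  It is what fixes the meaning of \<open>\<sigma>\<close> and \<open>\<mu>\<close>.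
\<close>

definition meromorphic_levy_process ::
    "'a measure \<Rightarrow> (real \<Rightarrow> 'a \<Rightarrow> real) \<Rightarrow> real \<Rightarrow> real \<Rightarrow>
     (nat \<Rightarrow> real) \<Rightarrow> (nat \<Rightarrow> real) \<Rightarrow> (nat \<Rightarrow> real) \<Rightarrow> (nat \<Rightarrow> real) \<Rightarrow> bool" where
  "meromorphic_levy_process M X \<sigma> \<mu> a ah \<rho> \<rho>h \<longleftrightarrow>
     levy_process M X \<and>
     \<sigma> \<ge> 0 \<and>
     (\<forall>n\<ge>1. a n > 0 \<and> ah n > 0 \<and> \<rho> n > 0 \<and> \<rho>h n > 0) \<and>
     strict_mono_on {1..} \<rho> \<and> strict_mono_on {1..} \<rho>h \<and>
     \<not> bdd_above (\<rho> ` {1..}) \<and> \<not> bdd_above (\<rho>h ` {1..}) \<and>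
     summable (\<lambda>n. a (Suc n) / (\<rho> (Suc n))\<^sup>2 + ah (Suc n) / (\<rho>h (Suc n))\<^sup>2) \<and>
     levy_measure_density M X (mero_density a ah \<rho> \<rho>h) \<and>
     (\<forall>z::complex. - \<rho>h 1 < Re z \<and> Re z < \<rho> 1 \<longrightarrow>
        integrable M (\<lambda>\<omega>. exp (z * of_real (X 1 \<omega>))) \<and>
        (LINT \<omega>|M. exp (z * of_real (X 1 \<omega>))) = exp (mero_exponent \<sigma> \<mu> a ah \<rho> \<rho>h z))"

section \<open>The exponential functional\<close>

text \<open>
  \<^const>\<open>prob_space.indep_var\<close> needs both variables to have the same type, so independence of a
  real random variable from the whole process is stated for the generated sigma-algebras.
\<close>

definition indep_of_process ::
    "'a measure \<Rightarrow> ('a \<Rightarrow> real) \<Rightarrow> (real \<Rightarrow> 'a \<Rightarrow> real) \<Rightarrow> bool" where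
  "indep_of_process M T X \<longleftrightarrow>
     prob_space.indep_set M
       (sets (vimage_algebra (space M) T borel))
       (sets (vimage_algebra (space M) (\<lambda>\<omega>. \<lambda>t\<in>{0..}. X t \<omega>) (PiM {0..} (\<lambda>_. borel))))"

definition exp_functional :: "(real \<Rightarrow> 'a \<Rightarrow> real) \<Rightarrow> ('a \<Rightarrow> real) \<Rightarrow> 'a \<Rightarrow> real" where
  "exp_functional X T \<omega> = (LINT u:{0..T \<omega>}|lborel. exp (X u \<omega>))"

section \<open>Infinite products of independent beta variables\<close>

definition beta_density :: "real \<Rightarrow> real \<Rightarrow> real \<Rightarrow> real" where
  "beta_density a b x =
     (if 0 < x \<and> x < 1
      then Gamma (a + b) / (Gamma a * Gamma b) * x powr (a - 1) * (1 - x) powr (b - 1)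
      else 0)"

definition beta_distribution :: "real \<Rightarrow> real \<Rightarrow> real measure" where
  "beta_distribution a b = density lborel (\<lambda>x. ennreal (beta_density a b x))"

text \<open>
  The law of \<open>X(\<alpha>,\<beta>)\<close>, realised on the product space whose coordinates are the independent
  beta variables; coordinate \<open>n\<close> is the beta variable with index \<open>n + 1\<close>.
\<close>

definition beta_product_law :: "(nat \<Rightarrow> real) \<Rightarrow> (nat \<Rightarrow> real) \<Rightarrow> real measure" where
  "beta_product_law \<alpha> \<beta> =
     distr (PiM UNIV (\<lambda>n. beta_distribution (\<alpha> (Suc n)) (\<beta> (Suc n) - \<alpha> (Suc n)))) borel
       (\<lambda>b. \<Prod>n. b n * (\<beta> (Suc n) / \<alpha> (Suc n)))"

end

theory Submission imports Defs "HOL-Complex_Analysis.Complex_Analysis" "HOL-Real_Asymp.Real_Asymp" begin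

text \<open>
  Write \<open>I\<close> for the exponential functional and \<open>M(s) = E[I\<^sup>s\<^sup>-\<^sup>1]\<close>. Differentiating
  \<open>(\<integral>\<^sub>u\<^sup>t exp X)\<^sup>s\<close> in \<open>u\<close> and using stationarity and independence of the increments gives
  \<open>M(s+1) = s M(s) / (q - \<psi>(s))\<close> for real \<open>0 < s < \<zeta>\<^sub>1\<close>. Let \<open>f(s)\<close> be the Mellin transform of the quotient
  of beta products. It is a limit of products of gamma ratios, so by \<open>\<Gamma>(z+1) = z \<Gamma>(z)\<close> and the product formula for
  \<open>q - \<psi>\<close> it satisfies the same recursion. Hence \<open>M/f\<close> is holomorphic and periodic with period one in a strip wider
  than one. Now \<open>|M(s)| \<le> M(Re s)\<close>, and \<open>|f(s)| / f(Re s)\<close> decays no faster than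
  \<open>exp(- \<pi> |Im s|)\<close> up to a polynomial factor; a periodic function of growth below \<open>exp(2 \<pi> |Im s|)\<close> is
  constant, so \<open>M = f\<close>, and the values on the line \<open>Re s = 1\<close> determine the law.

  The product formula is proved as follows. The quotient of \<open>q - \<psi>\<close> by the product extends to an entire function
  without zeros. Both \<open>(\<psi>(z) - q) / z\<close> and the product divided by \<open>- z\<close> map the upper half-plane to the closed upper
  half-plane, so the quotient takes no negative real value and is constant by Picard's little theorem.
\<close>

section \<open>Mellin transforms and periodic functions on strips\<close>

text \<open>The recursion fixes the Mellin transform only up to a factor of period one, so the proof
  turns on comparing growth. The margin is \<open>exp (2 * pi * t)\<close> against
  \<open>exp (pi * t)\<close>: each of the two beta products, one for each half-line, decays at
  worst like \<open>exp (- pi / 2 * t)\<close>. That an infinite product of gamma ratios costs no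
  more than a single gamma function is due to interlacing, by which the loss in one factor is
  recovered in the next. The same telescoping gives all convergence statements. The recursion itself
  is an identity between integrals with values in \<open>[0, \<infinity>]\<close> and real
  exponents. Read from right to left it yields the moments of negative order, which widen the strip
  beyond length one; only afterwards is it continued to complex exponents. The path functional is
  reached through Riemann sums, since these depend on finitely many increments and so obey
  independence and stationarity directly. The constant \<open>C\<close> is the one for which the
  negative roots and poles, together with the shifted gamma arguments, telescope to exactly
  \<open>s\<close>.\<close>

lemma complex_of_real_powr:
  "y > 0 \<Longrightarrow> complex_of_real y powr s = exp (s * of_real (ln y))"
  by (simp add: powr_def Ln_of_real)

lemma borel_measurable_complex_powr [measurable]:
  assumes [measurable]: "Y \<in> borel_measurable N"
  shows "(\<lambda>\<omega>. complex_of_real (Y \<omega>) powr s) \<in> borel_measurable N"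
proof -
  \<comment> \<open>On the negative half-line the principal logarithm is
    \<open>ln \<bar>y\<bar> + \<i> * pi\<close>, so the power has a form by cases that is visibly
    measurable, although \<open>Ln\<close> jumps there.\<close>
  have "complex_of_real y powr s =
      (if y = 0 then 0 else exp (s * (of_real (ln \<bar>y\<bar>) + (if y < 0 then \<i> * pi else 0))))" for y
  proof (cases "y < 0")
    case True
    have "Ln (complex_of_real y) = ln (- complex_of_real (- y))" by simp
    also have "\<dots> = of_real (ln \<bar>y\<bar>) + \<i> * pi"
      using True by (subst Ln_minus) (auto simp: Ln_of_real simp del: of_real_minus)
    finally show ?thesis using True by (simp add: powr_def)
  qed (auto simp: complex_of_real_powr)
  then show ?thesis by simp
qed

lemma norm_complex_of_real_powr: "y > 0 \<Longrightarrow> norm (complex_of_real y powr s) = y powr Re s"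
  by (simp add: norm_powr_real_powr)

lemma integrable_complex_powr:
  fixes Y :: "'a \<Rightarrow> real"
  assumes [measurable]: "Y \<in> borel_measurable N" and pos: "AE \<omega> in N. Y \<omega> > 0"
    and "integrable N (\<lambda>\<omega>. Y \<omega> powr Re s)"
  shows "integrable N (\<lambda>\<omega>. complex_of_real (Y \<omega>) powr s)"
  by (rule Bochner_Integration.integrable_bound[OF assms(3)])
     (use pos in \<open>auto simp: norm_complex_of_real_powr\<close>)

text \<open>The right side is free of \<open>h\<close>, hence a dominating function for
  differentiation under an integral. Half of \<open>d\<close> pays for
  \<open>exp (h * L) - 1\<close>, the other half absorbs the factor \<open>\<bar>L\<bar>\<close>
  through \<open>x \<le> exp x\<close>.\<close>

lemma norm_complex_powr_quotient_le:
  assumes y: "y > 0" and d: "d > 0" and h: "norm h \<le> d / 2" "h \<noteq> 0"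
  shows "norm ((complex_of_real y powr (s + h) - complex_of_real y powr s) / h)
       \<le> (2 / d) * (y powr (Re s + d) + y powr (Re s - d))"
proof -
  define L where "L = ln y"
  have 1: "complex_of_real y powr (s + h) - complex_of_real y powr s
      = complex_of_real y powr s * (exp (h * L) - 1)"
    using y by (simp add: complex_of_real_powr L_def algebra_simps exp_add)
  have "norm (exp (h * L) - 1) \<le> exp \<bar>Re (h * L)\<bar> * norm (h * L)"
    using Taylor_exp[of "h * L" 0] by simp
  also have "\<bar>Re (h * L)\<bar> \<le> d / 2 * \<bar>L\<bar>"
  proof -
    have "\<bar>Re (h * L)\<bar> \<le> norm (h * L)" by (rule abs_Re_le_cmod)
    also have "\<dots> = norm h * \<bar>L\<bar>" by (simp add: norm_mult)
    also have "\<dots> \<le> d / 2 * \<bar>L\<bar>" using h by (intro mult_right_mono) auto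
    finally show ?thesis .
  qed
  finally have "norm (exp (h * L) - 1) \<le> exp (d / 2 * \<bar>L\<bar>) * (norm h * \<bar>L\<bar>)"
    by (simp add: norm_mult mult_right_mono)
  then have 2: "norm ((exp (h * L) - 1) / h) \<le> exp (d / 2 * \<bar>L\<bar>) * \<bar>L\<bar>"
    using h by (simp add: norm_divide divide_simps mult_ac)
  have "d / 2 * \<bar>L\<bar> \<le> exp (d / 2 * \<bar>L\<bar>)"
    using exp_ge_add_one_self[of "d / 2 * \<bar>L\<bar>"] by linarith
  then have "\<bar>L\<bar> \<le> 2 / d * exp (d / 2 * \<bar>L\<bar>)" using d by (simp add: field_simps)
  then have "exp (d / 2 * \<bar>L\<bar>) * \<bar>L\<bar> \<le> exp (d / 2 * \<bar>L\<bar>) * (2 / d * exp (d / 2 * \<bar>L\<bar>))"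
    by (intro mult_left_mono) auto
  also have "\<dots> = 2 / d * exp (d * \<bar>L\<bar>)" by (simp flip: exp_add add: mult_ac)
  also have "\<dots> \<le> 2 / d * (y powr d + y powr (- d))"
    using d y by (intro mult_left_mono) (auto simp: powr_def L_def abs_if)
  finally have 3: "norm ((exp (h * L) - 1) / h) \<le> 2 / d * (y powr d + y powr (- d))" using 2 by linarith
  have "norm ((complex_of_real y powr (s + h) - complex_of_real y powr s) / h)
      = y powr Re s * norm ((exp (h * L) - 1) / h)"
    using y by (simp add: 1 norm_mult norm_divide norm_complex_of_real_powr)
  also have "\<dots> \<le> y powr Re s * (2 / d * (y powr d + y powr (- d)))"
    by (intro mult_left_mono 3) auto
  also have "\<dots> = (2 / d) * (y powr (Re s + d) + y powr (Re s - d))"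
    using powr_add[of y "Re s" d] powr_add[of y "Re s" "- d"] by (simp add: algebra_simps)
  finally show ?thesis .
qed

lemma mellin_transform_holomorphic:
  fixes Y :: "'a \<Rightarrow> real"
  assumes Ym [measurable]: "Y \<in> borel_measurable N" and pos: "AE \<omega> in N. Y \<omega> > 0"
    and int: "\<And>r. a < r \<Longrightarrow> r < b \<Longrightarrow> integrable N (\<lambda>\<omega>. Y \<omega> powr r)"
  shows "(\<lambda>s. LINT \<omega>|N. complex_of_real (Y \<omega>) powr s) holomorphic_on {s. a < Re s \<and> Re s < b}"
proof (rule holomorphic_onI)
  fix s assume s: "s \<in> {s. a < Re s \<and> Re s < b}"
  define F where "F s = (LINT \<omega>|N. complex_of_real (Y \<omega>) powr s)" for s
  \<comment> \<open>Half the distance to the boundary, so that the two exponents of the dominating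
    function stay in the open strip.\<close>
  define d where "d = min (Re s - a) (b - Re s) / 2"
  have d: "d > 0" "a < Re s - d" "Re s + d < b" using s by (auto simp: d_def min_def field_simps)
  have inte: "integrable N (\<lambda>\<omega>. complex_of_real (Y \<omega>) powr z)" if "a < Re z" "Re z < b" for z
    using that by (intro integrable_complex_powr pos int) auto
  define D where "D = (LINT \<omega>|N. complex_of_real (Y \<omega>) powr s * of_real (ln (Y \<omega>)))"
  have "((\<lambda>h. (F (s + h) - F s) / h) \<longlongrightarrow> D) (at 0)"
    unfolding tendsto_at_iff_sequentially comp_def
  proof (intro allI impI)
    fix H :: "nat \<Rightarrow> complex"
    assume H: "\<forall>i. H i \<in> UNIV - {0}" "H \<longlonglongrightarrow> 0"
    have "eventually (\<lambda>n. norm (H n) < d / 2) sequentially"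
      using tendstoD[OF H(2), of "d / 2"] d(1) by (simp add: dist_norm)
    then obtain n0 where n0: "\<And>n. n \<ge> n0 \<Longrightarrow> norm (H n) < d / 2"
      by (auto simp: eventually_sequentially)
    have "(\<lambda>n. (F (s + H (n + n0)) - F s) / H (n + n0)) \<longlonglongrightarrow> D"
    proof -
      have eq: "(F (s + H (n + n0)) - F s) / H (n + n0) =
        (LINT \<omega>|N. (complex_of_real (Y \<omega>) powr (s + H (n + n0)) - complex_of_real (Y \<omega>) powr s) / H (n + n0))" for n
      proof -
        have "norm (H (n + n0)) < d / 2" by (rule n0) simp
        then have "\<bar>Re (H (n + n0))\<bar> < d" using abs_Re_le_cmod[of "H (n + n0)"] d by linarith
        then show ?thesis using s d unfolding F_def
          by (subst Bochner_Integration.integral_diff[symmetric]) (auto intro!: inte simp: abs_if split: if_splits)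
      qed
      show ?thesis unfolding eq D_def
      proof (rule integral_dominated_convergence[where
            w="\<lambda>\<omega>. (2 / d) * (Y \<omega> powr (Re s + d) + Y \<omega> powr (Re s - d))"])
        show "AE x in N. (\<lambda>i. (complex_of_real (Y x) powr (s + H (i + n0)) - complex_of_real (Y x) powr s) / H (i + n0))
          \<longlonglongrightarrow> complex_of_real (Y x) powr s * complex_of_real (ln (Y x))"
          using pos
        proof eventually_elim
          case (elim \<omega>)
          have "((\<lambda>z. exp (z * of_real (ln (Y \<omega>)))) has_field_derivative
                exp (s * of_real (ln (Y \<omega>))) * of_real (ln (Y \<omega>))) (at s)"
            by (auto intro!: derivative_eq_intros)
          then have "((\<lambda>h. (complex_of_real (Y \<omega>) powr (s + h) - complex_of_real (Y \<omega>) powr s) / h)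
             \<longlongrightarrow> complex_of_real (Y \<omega>) powr s * complex_of_real (ln (Y \<omega>))) (at 0)"
            using elim by (simp add: DERIV_def complex_of_real_powr)
          then have "(\<lambda>i. (complex_of_real (Y \<omega>) powr (s + H i) - complex_of_real (Y \<omega>) powr s) / H i)
             \<longlonglongrightarrow> complex_of_real (Y \<omega>) powr s * complex_of_real (ln (Y \<omega>))"
            using H unfolding tendsto_at_iff_sequentially comp_def by blast
          then show ?case by (rule LIMSEQ_ignore_initial_segment)
        qed
        show "AE x in N. cmod ((complex_of_real (Y x) powr (s + H (i + n0)) - complex_of_real (Y x) powr s) / H (i + n0))
          \<le> (2 / d) * (Y x powr (Re s + d) + Y x powr (Re s - d))" for i
          using pos
        proof eventually_elim
          case (elim \<omega>)
          then show ?case using norm_complex_powr_quotient_le[OF elim d(1), of "H (i + n0)" s] n0[of "i + n0"] H by force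
        qed
      qed (use d int s in \<open>auto intro!: Bochner_Integration.integrable_add\<close>)
    qed
    then show "(\<lambda>n. (F (s + H n) - F s) / H n) \<longlonglongrightarrow> D" by (rule LIMSEQ_offset)
  qed
  then have "(F has_field_derivative D) (at s)" by (simp add: DERIV_def)
  then have "F field_differentiable at s within {s. a < Re s \<and> Re s < b}"
    by (meson field_differentiable_at_within field_differentiable_def)
  then show "(\<lambda>s. LINT \<omega>|N. complex_of_real (Y \<omega>) powr s) field_differentiable at s within {s. a < Re s \<and> Re s < b}"
    unfolding F_def .
qed

lemma powr_le_sum_powr:
  assumes "(y::real) > 0" "a \<le> r" "r \<le> b"
  shows "y powr r \<le> y powr a + y powr b"
proof (cases "y \<ge> 1")
  case True
  then have "y powr r \<le> y powr b" using assms by (intro powr_mono) auto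
  then show ?thesis by (simp add: add_increasing)
next
  case False
  then have "y powr r \<le> y powr a" using assms by (intro powr_mono') auto
  then show ?thesis by (simp add: add_increasing2)
qed

lemma integrable_powr_between:
  fixes Y :: "'a \<Rightarrow> real"
  assumes [measurable]: "Y \<in> borel_measurable N" and pos: "AE \<omega> in N. Y \<omega> > 0"
    and "integrable N (\<lambda>\<omega>. Y \<omega> powr a)" "integrable N (\<lambda>\<omega>. Y \<omega> powr b)" "a \<le> r" "r \<le> b"
  shows "integrable N (\<lambda>\<omega>. Y \<omega> powr r)"
  by (rule Bochner_Integration.integrable_bound[OF Bochner_Integration.integrable_add[OF assms(3,4)]])
     (use pos in \<open>auto intro: powr_le_sum_powr assms elim!: eventually_mono\<close>)

lemma strip_shift_nat:
  assumes "\<And>s. a < Re s \<Longrightarrow> Re s + 1 < b \<Longrightarrow> N (s + 1) = N s"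
  shows "a < Re s \<Longrightarrow> Re s + real n < b \<Longrightarrow> N (s + of_nat n) = N s"
proof (induction n)
  case (Suc n)
  then have "N (s + of_nat n + 1) = N (s + of_nat n)" by (intro assms) auto
  then show ?case using Suc by (simp add: add_ac)
qed auto

text \<open>\<open>N\<close> factors through \<open>e s = exp (2 * pi * \<i> * s)\<close>, which
  maps a strip of width one onto the punctured plane. As
  \<open>norm (e s) = exp (- 2 * pi * Im s)\<close>, the growth condition makes the induced function
  \<open>o(1 / norm z)\<close> at 0 and \<open>o(norm z)\<close> at infinity: the singularity is
  removable and Liouville's theorem applies.\<close>

lemma periodic_in_strip_constant:
  fixes N :: "complex \<Rightarrow> complex" and B :: "real \<Rightarrow> real"
  assumes hol: "N holomorphic_on {s. a < Re s \<and> Re s < b}"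
    and per: "\<And>s. a < Re s \<Longrightarrow> Re s + 1 < b \<Longrightarrow> N (s + 1) = N s"
    and c: "a < c" "c + 1 < b"
    and bd: "\<And>s. c \<le> Re s \<Longrightarrow> Re s \<le> c + 1 \<Longrightarrow> norm (N s) \<le> B \<bar>Im s\<bar>"
    and B: "((\<lambda>t. B t * exp (- 2 * pi * t)) \<longlongrightarrow> 0) at_top"
    and s: "a < Re s" "Re s < b" "a < Re s'" "Re s' < b"
  shows "N s = N s'"
proof -
  define e where "e s = exp (2 * of_real pi * \<i> * s)" for s
  define S where "S = {s. a < Re s \<and> Re s < b}"
  have oS: "open S" unfolding S_def
    by (intro open_Collect_conj open_Collect_less continuous_intros)
  have wd: "N s = N s'" if "s \<in> S" "s' \<in> S" "e s = e s'" for s s'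
  proof -
    \<comment> \<open>Equal values of \<open>e\<close> mean an integer translation;
      \<open>strip_shift_nat\<close> only moves to the right, hence the order of the real
      parts.\<close>
    have *: "N s = N s'" if st: "s \<in> S" "s' \<in> S" "e s = e s'" "Re s \<le> Re s'" for s s'
    proof -
      obtain n :: int where "2 * of_real pi * \<i> * s' = 2 * of_real pi * \<i> * s + (of_int (2 * n) * pi) * \<i>"
        using st(3) unfolding e_def exp_eq by (metis exp_eq)
      then have "2 * of_real pi * \<i> * s' = 2 * of_real pi * \<i> * (s + of_int n)" by (simp add: algebra_simps)
      then have n: "s' = s + of_int n" by simp
      with st(4) have "n \<ge> 0" by simp
      then obtain k :: nat where k: "n = int k" using nonneg_int_cases by blast
      have "N (s + of_nat k) = N s" using st n k per by (intro strip_shift_nat[of a b]) (auto simp: S_def)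
      then show ?thesis using n k by simp
    qed
    show ?thesis using *[OF that] *[of s' s] that by (cases "Re s \<le> Re s'") auto
  qed
  have ex: "\<exists>s. c \<le> Re s \<and> Re s \<le> c + 1 \<and> e s = z" if "z \<noteq> 0" for z
  proof -
    define u where "u = Ln z / (2 * of_real pi * \<i>)"
    define k where "k = \<lfloor>Re u - c\<rfloor>"
    have "e (u - of_int k) = z"
    proof -
      have "e (u - of_int k) = exp (2 * of_real pi * \<i> * u) / exp (2 * of_int k * of_real pi * \<i>)"
        by (simp add: e_def exp_diff algebra_simps)
      also have "exp (2 * of_int k * of_real pi * \<i>) = 1"
        using exp_integer_2pi[of "of_int k"] by (simp add: mult_ac)
      also have "exp (2 * of_real pi * \<i> * u) = z" using that by (simp add: u_def)
      finally show ?thesis by simp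
    qed
    moreover have "c \<le> Re (u - of_int k)" "Re (u - of_int k) \<le> c + 1"
      unfolding k_def by (simp; linarith)+
    ultimately show ?thesis by blast
  qed
  \<comment> \<open>An arbitrary choice of preimages, in general discontinuous; by \<open>wd\<close>
    the value of \<open>N\<close> does not depend on it.\<close>
  define p where "p z = (SOME s. c \<le> Re s \<and> Re s \<le> c + 1 \<and> e s = z)" for z
  have p: "c \<le> Re (p z)" "Re (p z) \<le> c + 1" "e (p z) = z" if "z \<noteq> 0" for z
    using someI_ex[OF ex[OF that]] unfolding p_def by auto
  have pS: "p z \<in> S" if "z \<noteq> 0" for z using p[OF that] c by (auto simp: S_def)
  define G where "G z = N (p z)" for z
  have Ge: "G (e s) = N s" if "s \<in> S" for s
    unfolding G_def using that p(3) pS by (intro wd) (auto simp: e_def)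
  have holG: "G holomorphic_on -{0}"
  proof (rule holomorphic_onI)
    fix z0 :: complex assume "z0 \<in> -{0}"
    then have z0: "z0 \<noteq> 0" by simp
    \<comment> \<open>A holomorphic local inverse of \<open>e\<close> through \<open>p z0\<close>,
      defined where \<open>z / z0\<close> avoids the branch cut. Near \<open>z0\<close> the induced
      function is \<open>N\<close> composed with it.\<close>
    define l where "l z = p z0 + Ln (z / z0) / (2 * of_real pi * \<i>)" for z
    have A: "open (- {0} \<inter> (\<lambda>z. z / z0) -` (- \<real>\<^sub>\<le>\<^sub>0))"
      using z0 by (intro continuous_open_preimage continuous_intros open_Compl closed_nonpos_Reals_complex) auto
    have lhol: "l holomorphic_on (- {0} \<inter> (\<lambda>z. z / z0) -` (- \<real>\<^sub>\<le>\<^sub>0))"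
      unfolding l_def by (intro holomorphic_intros) (auto simp: z0)
    then have "open ((- {0} \<inter> (\<lambda>z. z / z0) -` (- \<real>\<^sub>\<le>\<^sub>0)) \<inter> l -` S)"
      by (intro continuous_open_preimage A oS holomorphic_on_imp_continuous_on)
    moreover define U where "U = ((- {0} \<inter> (\<lambda>z. z / z0) -` (- \<real>\<^sub>\<le>\<^sub>0)) \<inter> l -` S)"
    ultimately have oU: "open U" by simp
    have zU: "z0 \<in> U" using z0 pS[OF z0] by (auto simp: U_def l_def)
    have el: "e (l z) = z" if "z \<noteq> 0" for z
    proof -
      have "e (l z) = e (p z0) * exp (Ln (z / z0))"
        by (simp add: e_def l_def algebra_simps exp_add)
      then show ?thesis using that z0 p(3)[OF z0] by simp
    qed
    have "G z = N (l z)" if "z \<in> U" for z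
      using Ge[of "l z"] el[of z] that by (auto simp: U_def)
    moreover have "(\<lambda>z. N (l z)) holomorphic_on U"
      using holomorphic_on_compose_gen[OF holomorphic_on_subset[OF lhol] hol, of U]
      by (auto simp: comp_def U_def S_def)
    ultimately have "G holomorphic_on U" by (simp cong: holomorphic_cong)
    then show "G field_differentiable at z0 within - {0}"
      using oU zU holomorphic_on_imp_differentiable_at field_differentiable_at_within by blast
  qed
  have normz: "norm z = exp (- 2 * pi * Im (p z))" if "z \<noteq> 0" for z
    using arg_cong[OF p(3)[OF that], of norm] by (simp add: e_def)
  have small: "\<exists>T. \<forall>t\<ge>T. \<bar>B t * exp (- 2 * pi * t)\<bar> < \<epsilon>" if "\<epsilon> > 0" for \<epsilon>
    using B that by (auto simp: tendsto_iff eventually_at_top_linorder)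
  have lim0: "((\<lambda>z. (z - 0) * G z) \<longlongrightarrow> 0) (at 0)"
  proof (rule tendstoI)
    fix \<epsilon> :: real assume "\<epsilon> > 0"
    then obtain T where T: "\<And>t. t \<ge> T \<Longrightarrow> \<bar>B t * exp (- 2 * pi * t)\<bar> < \<epsilon>" using small by blast
    define d where "d = exp (- 2 * pi * max T 0)"
    show "\<forall>\<^sub>F z in at 0. dist ((z - 0) * G z) 0 < \<epsilon>"
      unfolding eventually_at
    proof (intro exI[of _ d] conjI ballI impI)
      fix z :: complex assume z: "z \<noteq> 0 \<and> dist z 0 < d"
      then have t: "Im (p z) > max T 0" using normz[of z] by (simp add: d_def)
      have "norm (z * G z) \<le> exp (- 2 * pi * Im (p z)) * B \<bar>Im (p z)\<bar>"
        using z p[of z] bd[of "p z"] normz[of z] by (auto simp: norm_mult G_def intro!: mult_left_mono)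
      also have "\<dots> = B (Im (p z)) * exp (- 2 * pi * Im (p z))" using t by (simp add: mult.commute)
      also have "\<dots> < \<epsilon>" using T[of "Im (p z)"] t by auto
      finally show "dist ((z - 0) * G z) 0 < \<epsilon>" by simp
    qed (simp add: d_def)
  qed
  obtain G' where G': "G' holomorphic_on UNIV" "\<And>z. z \<noteq> 0 \<Longrightarrow> G' z = G z"
    using holomorphic_on_extend_lim[of G UNIV 0] holG lim0 by (auto simp: Compl_eq_Diff_UNIV)
  \<comment> \<open>Linear growth is excluded by dividing by \<open>z\<close>: this quotient is
    entire and tends to 0 at infinity, hence vanishes.\<close>
  define Q where "Q z = (if z = 0 then deriv G' 0 else (G' z - G' 0) / (z - 0))" for z
  have Qh: "Q holomorphic_on UNIV" unfolding Q_def by (rule pole_lemma_open[OF G'(1)]) simp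
  have "(Q \<longlongrightarrow> 0) at_infinity"
    unfolding Lim_at_infinity
  proof (intro allI impI)
    fix \<epsilon> :: real assume e0: "\<epsilon> > 0"
    then obtain T where T: "\<And>t. t \<ge> T \<Longrightarrow> \<bar>B t * exp (- 2 * pi * t)\<bar> < \<epsilon> / 2" using small[of "\<epsilon>/2"] by auto
    define R where "R = max (exp (2 * pi * max T 1)) (2 * norm (G' 0) / \<epsilon> + 1)"
    show "\<exists>b. \<forall>x. b \<le> norm x \<longrightarrow> dist (Q x) 0 < \<epsilon>"
    proof (intro exI[of _ R] allI impI)
      fix z :: complex assume z: "R \<le> norm z"
      then have nz: "norm z > 0" unfolding R_def by (smt (verit) exp_gt_zero)
      then have z0: "z \<noteq> 0" by auto
      have "exp (2 * pi * max T 1) \<le> exp (- 2 * pi * Im (p z))" using z normz[OF z0] by (simp add: R_def)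
      then have "2 * pi * max T 1 \<le> 2 * pi * (- Im (p z))" by simp
      then have "max T 1 \<le> - Im (p z)" by (subst (asm) mult_le_cancel_left_pos) auto
      then have t: "\<bar>Im (p z)\<bar> \<ge> T" "\<bar>Im (p z)\<bar> = - Im (p z)" by auto
      have "norm (G' z / z) \<le> B \<bar>Im (p z)\<bar> / exp (- 2 * pi * Im (p z))"
        using z0 p[of z] bd[of "p z"] normz[of z] by (auto simp: norm_divide G_def G'(2) intro!: divide_right_mono)
      also have "\<dots> = B \<bar>Im (p z)\<bar> * exp (- 2 * pi * \<bar>Im (p z)\<bar>)" using t(2) by (simp add: exp_minus field_simps)
      also have "\<dots> < \<epsilon> / 2" using T[of "\<bar>Im (p z)\<bar>"] t by auto
      finally have 1: "norm (G' z / z) < \<epsilon> / 2" .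
      have "2 * norm (G' 0) / \<epsilon> < norm z" using z by (auto simp: R_def)
      then have 2: "norm (G' 0 / z) < \<epsilon> / 2" using e0 nz by (simp add: norm_divide field_simps)
      have "norm (Q z) \<le> norm (G' z / z) + norm (G' 0 / z)"
        using z0 by (simp add: Q_def diff_divide_distrib norm_triangle_ineq4)
      then show "dist (Q z) 0 < \<epsilon>" using 1 2 by simp
    qed
  qed
  then have "Q z = 0" for z using Liouville_weak_0[OF Qh] by blast
  then have "G' z = G' 0" for z by (cases "z = 0") (auto simp: Q_def split: if_splits, metis diff_0_right divide_eq_0_iff eq_iff_diff_eq_0)
  then have const: "G' z = G' z'" for z z' by metis
  have "N s = G' (e s)" if "s \<in> S" for s using Ge[OF that] G'(2) by (simp add: e_def)
  then show ?thesis using s const by (simp add: S_def)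
qed

section \<open>Maxima of products of independent variables\<close>

lemma (in prob_space) indep_var_nn_integral_mult:
  fixes f g :: "_ \<Rightarrow> ennreal"
  assumes ind: "indep_var S X T Y" and fg: "f \<in> borel_measurable S" "g \<in> borel_measurable T"
  shows "(\<integral>\<^sup>+\<omega>. f (X \<omega>) * g (Y \<omega>) \<partial>M) = (\<integral>\<^sup>+\<omega>. f (X \<omega>) \<partial>M) * (\<integral>\<^sup>+\<omega>. g (Y \<omega>) \<partial>M)"
proof -
  have "indep_var borel (f \<circ> X) borel (g \<circ> Y)" by (rule indep_var_compose[OF ind fg])
  then have "indep_vars (\<lambda>_. borel) (case_bool (f \<circ> X) (g \<circ> Y)) UNIV"
    unfolding indep_var_def by (rule back_subst[of "\<lambda>N. indep_vars N _ _"]) (auto split: bool.split)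
  from indep_vars_nn_integral[OF _ this] show ?thesis by (simp add: UNIV_bool comp_def mult.commute)
qed

lemma (in prob_space) indep_vars_nn_integral_split:
  fixes f g :: "('i \<Rightarrow> 'b) \<Rightarrow> ennreal"
  assumes ind: "indep_vars N \<xi> I" and AB: "A \<inter> B = {}" "A \<subseteq> I" "B \<subseteq> I"
    and fg: "f \<in> borel_measurable (PiM A N)" "g \<in> borel_measurable (PiM B N)"
  shows "(\<integral>\<^sup>+\<omega>. f (\<lambda>i\<in>A. \<xi> i \<omega>) * g (\<lambda>i\<in>B. \<xi> i \<omega>) \<partial>M)
    = (\<integral>\<^sup>+\<omega>. f (\<lambda>i\<in>A. \<xi> i \<omega>) \<partial>M) * (\<integral>\<^sup>+\<omega>. g (\<lambda>i\<in>B. \<xi> i \<omega>) \<partial>M)"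
  by (rule indep_var_nn_integral_mult[OF indep_var_restrict[OF ind AB] fg])

text \<open>Weighted arithmetic-geometric mean of \<open>r powr \<theta>\<close> and 1 with weights
  \<open>s / \<theta>\<close> and \<open>1 - s / \<theta>\<close>, scaled by
  \<open>\<theta> / (\<theta> - s)\<close> so that the constant term becomes 1. Equality holds at
  \<open>r = 1\<close>.\<close>

lemma powr_exponent_young:
  fixes r :: real
  assumes "r > 0" "0 < s" "s < \<theta>"
  shows "(1 + s / (\<theta> - s)) * r powr s \<le> 1 + s / (\<theta> - s) * r powr \<theta>"
proof -
  have "(r powr \<theta>) powr (s / \<theta>) * 1 powr (1 - s / \<theta>) \<le> s / \<theta> * r powr \<theta> + (1 - s / \<theta>) * 1"
    using assms by (intro Youngs_inequality_0) (auto simp: field_simps)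
  then have "r powr s \<le> s / \<theta> * r powr \<theta> + (1 - s / \<theta>)" using assms by (simp add: powr_powr)
  then have "\<theta> * r powr s \<le> \<theta> * (s / \<theta> * r powr \<theta> + (1 - s / \<theta>))"
    using assms by (intro mult_left_mono) auto
  also have "\<dots> = s * r powr \<theta> + (\<theta> - s)" using assms by (simp add: distrib_left right_diff_distrib)
  finally have "\<theta> * r powr s \<le> s * r powr \<theta> + (\<theta> - s)" .
  then have "\<theta> * r powr s / (\<theta> - s) \<le> (s * r powr \<theta> + (\<theta> - s)) / (\<theta> - s)"
    using assms by (intro divide_right_mono) auto
  moreover have "1 + s / (\<theta> - s) = \<theta> / (\<theta> - s)" using assms by (simp add: field_simps)
  ultimately show ?thesis using assms by (simp add: add_divide_distrib)
qed

text \<open>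
  A Burkholder function: \<open>E[B(max m x, x)]\<close> grows along products of independent factors at most by the
  \<open>\<theta>\<close>-th moments, which replaces a stopping-time proof of the maximal inequality.
\<close>

definition burkholder :: "real \<Rightarrow> real \<Rightarrow> real \<Rightarrow> real \<Rightarrow> real" where
  "burkholder s \<theta> m x = m powr s + s / (\<theta> - s) * x powr \<theta> * m powr (s - \<theta>)"

text \<open>If the product sets no new maximum this is an equality; otherwise it is Young's
  inequality for \<open>r = x * y / m\<close>. The right side is affine in
  \<open>y powr \<theta>\<close>, so averaging over an independent \<open>y\<close> brings in only
  its moment of order \<open>\<theta>\<close>.\<close>

lemma burkholder_step:
  assumes "m > 0" "x > 0" "y > 0" "0 < s" "s < \<theta>"
  shows "burkholder s \<theta> (max m (x * y)) (x * y)
    \<le> m powr s + s / (\<theta> - s) * x powr \<theta> * m powr (s - \<theta>) * y powr \<theta>"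
proof (cases "x * y \<le> m")
  case True
  then show ?thesis using assms by (simp add: burkholder_def powr_mult max_def mult_ac)
next
  case False
  define r where "r = x * y / m"
  have r: "r > 0" "x * y = r * m" using assms by (auto simp: r_def)
  have "burkholder s \<theta> (max m (x * y)) (x * y) = (1 + s / (\<theta> - s)) * (x * y) powr s"
    using False assms by (simp add: burkholder_def max_def algebra_simps flip: powr_add)
  also have "\<dots> = (1 + s / (\<theta> - s)) * r powr s * m powr s" using r assms by (simp add: powr_mult)
  also have "\<dots> \<le> (1 + s / (\<theta> - s) * r powr \<theta>) * m powr s"
    using powr_exponent_young r assms by (intro mult_right_mono) auto
  also have "\<dots> = m powr s + s / (\<theta> - s) * (x * y) powr \<theta> * m powr (s - \<theta>)"
    using r assms by (simp add: powr_mult algebra_simps flip: powr_add)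
  also have "\<dots> = m powr s + s / (\<theta> - s) * x powr \<theta> * m powr (s - \<theta>) * y powr \<theta>"
    using assms by (simp add: powr_mult)
  finally show ?thesis .
qed

text \<open>The empty product competes as well, which keeps the maximum at least 1.\<close>

definition max_prod :: "nat \<Rightarrow> (nat \<Rightarrow> real) \<Rightarrow> real" where
  "max_prod n x = Max ((\<lambda>k. \<Prod>j<k. x j) ` {..n})"

lemma max_prod_0 [simp]: "max_prod 0 x = 1"
  by (simp add: max_prod_def)

lemma max_prod_Suc: "max_prod (Suc n) x = max (max_prod n x) ((\<Prod>j<n. x j) * x n)"
  by (simp add: max_prod_def atMost_Suc max.commute)

lemma max_prod_ge: "k \<le> n \<Longrightarrow> (\<Prod>j<k. x j) \<le> max_prod n x"
  by (simp add: max_prod_def)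

lemma max_prod_ge_1: "1 \<le> max_prod n x"
  using max_prod_ge[of 0 n x] by simp

lemma max_prod_cong: "(\<And>j. j < n \<Longrightarrow> x j = y j) \<Longrightarrow> max_prod n x = max_prod n y"
  unfolding max_prod_def by (intro arg_cong[of _ _ Max] image_cong prod.cong) auto

lemma max_prod_mono: "m \<le> n \<Longrightarrow> max_prod m x \<le> max_prod n x"
  unfolding max_prod_def by (intro Max_mono) auto

lemma borel_measurable_max_prod [measurable]:
  "max_prod n \<in> borel_measurable (PiM {..<n} (\<lambda>_. borel))"
proof -
  have "(\<lambda>x. Max ((\<lambda>k. \<Prod>j<k. x j) ` {..n})) \<in> borel_measurable (PiM {..<n} (\<lambda>_. borel :: real measure))"
    by (intro borel_measurable_Max borel_measurable_prod measurable_component_singleton) auto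
  then show ?thesis unfolding max_prod_def .
qed

text \<open>Induction on the number of factors: by \<open>burkholder_step\<close> and independence,
  a new factor multiplies one summand of the expectation by its moment and leaves the other alone.
  The constant is the starting value \<open>burkholder s \<theta> 1 1\<close>.\<close>

lemma (in prob_space) burkholder_moment_le:
  fixes \<xi> :: "nat \<Rightarrow> 'a \<Rightarrow> real"
  assumes ind: "indep_vars (\<lambda>_. borel) \<xi> {..<n}" and pos: "\<And>k \<omega>. k < n \<Longrightarrow> \<xi> k \<omega> > 0"
    and s: "0 < s" "s < \<theta>"
  shows "(\<integral>\<^sup>+\<omega>. ennreal (burkholder s \<theta> (max_prod n (\<lambda>j. \<xi> j \<omega>)) (\<Prod>j<n. \<xi> j \<omega>)) \<partial>M)
    \<le> ennreal (1 + s / (\<theta> - s)) * (\<Prod>j<n. max 1 (\<integral>\<^sup>+\<omega>. ennreal (\<xi> j \<omega> powr \<theta>) \<partial>M))"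
  using ind pos
proof (induction n)
  case 0
  then show ?case by (simp add: burkholder_def emeasure_space_1)
next
  case (Suc n)
  have m [measurable]: "\<xi> k \<in> borel_measurable M" if "k < Suc n" for k
    using Suc.prems(1) that by (auto simp: indep_vars_def)
  have ind: "indep_vars (\<lambda>_. borel) \<xi> {..<n}" by (rule indep_vars_subset[OF Suc.prems(1)]) auto
  define E where "E = (\<integral>\<^sup>+\<omega>. ennreal (\<xi> n \<omega> powr \<theta>) \<partial>M)"
  define m where "m \<omega> = max_prod n (\<lambda>j. \<xi> j \<omega>)" for \<omega>
  define x where "x \<omega> = (\<Prod>j<n. \<xi> j \<omega>)" for \<omega>
  define g where "g \<omega> = s / (\<theta> - s) * x \<omega> powr \<theta> * m \<omega> powr (s - \<theta>)" for \<omega>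
  have m_eq: "m \<omega> = max_prod n (\<lambda>j\<in>{..<n}. \<xi> j \<omega>)" for \<omega>
    unfolding m_def by (rule max_prod_cong) auto
  have mm [measurable]: "m \<in> borel_measurable M"
    unfolding m_eq[abs_def] using Suc.prems(1)
    by (intro measurable_compose[OF _ borel_measurable_max_prod] measurable_restrict m) auto
  have xm [measurable]: "x \<in> borel_measurable M" unfolding x_def by (intro borel_measurable_prod m) auto
  have gm [measurable]: "g \<in> borel_measurable M" unfolding g_def by measurable
  have g0: "g \<omega> \<ge> 0" for \<omega> using s by (auto simp: g_def)
  have xpos: "x \<omega> > 0" for \<omega> unfolding x_def using Suc.prems(2) by (intro prod_pos) auto
  have mpos: "m \<omega> > 0" for \<omega> unfolding m_def using max_prod_ge_1[of n] by (smt (verit))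
  have "(\<integral>\<^sup>+\<omega>. ennreal (burkholder s \<theta> (max_prod (Suc n) (\<lambda>j. \<xi> j \<omega>)) (\<Prod>j<Suc n. \<xi> j \<omega>)) \<partial>M)
      \<le> (\<integral>\<^sup>+\<omega>. ennreal (m \<omega> powr s) + ennreal (g \<omega>) * ennreal (\<xi> n \<omega> powr \<theta>) \<partial>M)"
  proof (intro nn_integral_mono)
    fix \<omega>
    have "burkholder s \<theta> (max_prod (Suc n) (\<lambda>j. \<xi> j \<omega>)) (\<Prod>j<Suc n. \<xi> j \<omega>)
        \<le> m \<omega> powr s + g \<omega> * \<xi> n \<omega> powr \<theta>"
      using burkholder_step[OF mpos xpos Suc.prems(2) s, of n \<omega> \<omega> \<omega>]
      by (simp add: max_prod_Suc g_def m_def x_def)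
    then show "ennreal (burkholder s \<theta> (max_prod (Suc n) (\<lambda>j. \<xi> j \<omega>)) (\<Prod>j<Suc n. \<xi> j \<omega>))
        \<le> ennreal (m \<omega> powr s) + ennreal (g \<omega>) * ennreal (\<xi> n \<omega> powr \<theta>)"
      by (simp add: g0 flip: ennreal_mult ennreal_plus)
  qed
  also have "\<dots> = (\<integral>\<^sup>+\<omega>. ennreal (m \<omega> powr s) \<partial>M) + (\<integral>\<^sup>+\<omega>. ennreal (g \<omega>) * ennreal (\<xi> n \<omega> powr \<theta>) \<partial>M)"
    by (rule nn_integral_add) measurable
  also have "(\<integral>\<^sup>+\<omega>. ennreal (g \<omega>) * ennreal (\<xi> n \<omega> powr \<theta>) \<partial>M) = (\<integral>\<^sup>+\<omega>. ennreal (g \<omega>) \<partial>M) * E"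
  proof -
    define G where "G y = ennreal (s / (\<theta> - s) * (\<Prod>j<n. y j) powr \<theta> * max_prod n y powr (s - \<theta>))" for y
    have [measurable]: "(\<lambda>y. \<Prod>j<n. y j) \<in> borel_measurable (PiM {..<n} (\<lambda>_. borel :: real measure))"
      by (intro borel_measurable_prod measurable_component_singleton) auto
    have 1: "G \<in> borel_measurable (PiM {..<n} (\<lambda>_. borel))" unfolding G_def by measurable
    have 2: "(\<lambda>y. ennreal (y n powr \<theta>)) \<in> borel_measurable (PiM {n} (\<lambda>_. borel :: real measure))" by measurable
    have Gg: "G (\<lambda>j\<in>{..<n}. \<xi> j \<omega>) = ennreal (g \<omega>)" for \<omega>
      unfolding G_def g_def m_eq[symmetric] x_def by simp
    from indep_vars_nn_integral_split[OF Suc.prems(1) _ _ _ 1 2] show ?thesis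
      unfolding Gg E_def by auto
  qed
  \<comment> \<open>Only the second summand carries the moment. Passing to \<open>max 1 E\<close> in
    both lets it be factored out.\<close>
  also have "(\<integral>\<^sup>+\<omega>. ennreal (m \<omega> powr s) \<partial>M) + (\<integral>\<^sup>+\<omega>. ennreal (g \<omega>) \<partial>M) * E
     \<le> (\<integral>\<^sup>+\<omega>. ennreal (m \<omega> powr s) \<partial>M) * max 1 E + (\<integral>\<^sup>+\<omega>. ennreal (g \<omega>) \<partial>M) * max 1 E"
    using mult_left_mono[of 1 "max 1 E" "\<integral>\<^sup>+\<omega>. ennreal (m \<omega> powr s) \<partial>M"]
    by (intro add_mono mult_left_mono) auto
  also have "\<dots> = (\<integral>\<^sup>+\<omega>. ennreal (m \<omega> powr s) + ennreal (g \<omega>) \<partial>M) * max 1 E"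
    by (subst nn_integral_add) (auto simp: distrib_right)
  also have "(\<integral>\<^sup>+\<omega>. ennreal (m \<omega> powr s) + ennreal (g \<omega>) \<partial>M)
      = (\<integral>\<^sup>+\<omega>. ennreal (burkholder s \<theta> (max_prod n (\<lambda>j. \<xi> j \<omega>)) (\<Prod>j<n. \<xi> j \<omega>)) \<partial>M)"
    using g0 by (intro nn_integral_cong) (simp add: burkholder_def g_def m_def x_def flip: ennreal_plus)
  also have "\<dots> * max 1 E \<le> (ennreal (1 + s / (\<theta> - s)) * (\<Prod>j<n. max 1 (\<integral>\<^sup>+\<omega>. ennreal (\<xi> j \<omega> powr \<theta>) \<partial>M))) * max 1 E"
    using Suc.IH[OF ind] Suc.prems(2) by (intro mult_right_mono) auto
  finally show ?case by (simp add: E_def mult.assoc)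
qed

lemma (in prob_space) max_prod_moment_le:
  fixes \<xi> :: "nat \<Rightarrow> 'a \<Rightarrow> real"
  assumes ind: "indep_vars (\<lambda>_. borel) \<xi> {..<n}" and pos: "\<And>k \<omega>. k < n \<Longrightarrow> \<xi> k \<omega> > 0"
    and s: "0 < s" "s < \<theta>"
  shows "(\<integral>\<^sup>+\<omega>. ennreal (max_prod n (\<lambda>j. \<xi> j \<omega>) powr s) \<partial>M)
    \<le> ennreal (1 + s / (\<theta> - s)) * (\<Prod>j<n. max 1 (\<integral>\<^sup>+\<omega>. ennreal (\<xi> j \<omega> powr \<theta>) \<partial>M))"
  by (rule order_trans[OF nn_integral_mono burkholder_moment_le[OF assms]])
     (use s in \<open>auto intro!: ennreal_leI simp: burkholder_def\<close>)

section \<open>Ratios of gamma functions\<close>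

text \<open>The difference is the series of \<open>1 / (x + n) - 1 / (x + w + n)\<close>.
  Subtracting \<open>w * (1 / (x + n) - 1 / (x + n + 1))\<close>, whose sum is \<open>w / x\<close>,
  leaves terms \<open>w * (1 - w) / (c * (c + 1) * (c + w))\<close> with \<open>c = x + n\<close>.
  The hypothesis on \<open>\<kappa>\<close> bounds \<open>norm (c + w)\<close> below by
  \<open>\<kappa> * x\<close>, and \<open>1 / (c * (c + 1))\<close> telescopes again.\<close>

lemma Digamma_diff_bound:
  fixes w :: complex and x \<kappa> :: real
  assumes x: "x > 0" and \<kappa>: "0 < \<kappa>" "\<kappa> \<le> 1" "\<kappa> * x \<le> x + Re w"
  shows "norm (Digamma (of_real x + w) - Digamma (of_real x) - w / of_real x)
    \<le> norm w * norm (1 - w) / \<kappa> / x\<^sup>2"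
proof -
  define K where "K = norm w * norm (1 - w) / \<kappa>"
  have K: "K \<ge> 0" using \<kappa> by (simp add: K_def)
  define X where "X n = x + real n" for n
  have Xp: "X n > 0" "X n \<ge> x" for n using x by (auto simp: X_def)
  have Re_ge: "\<kappa> * X n \<le> X n + Re w" for n
  proof -
    have "\<kappa> * real n \<le> real n" using \<kappa> by (simp add: mult_left_le_one_le)
    then show ?thesis using \<kappa> by (simp add: X_def algebra_simps)
  qed
  have nz: "of_real (X n) + w \<noteq> 0" for n
  proof -
    have "Re (of_real (X n) + w) > 0" using Re_ge[of n] \<kappa> Xp[of n] by (smt (verit) mult_pos_pos Re_complex_of_real plus_complex.sel)
    then show ?thesis by (metis less_irrefl zero_complex.sel(1))
  qed
  have nx: "of_real x \<noteq> (0::complex)" "of_real x + w \<noteq> 0" using x nz[of 0] by (auto simp: X_def)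
  define D where "D m = (\<Sum>n<m. inverse (of_real x + of_nat n) - inverse (of_real x + w + of_nat n))
     - w * (1 / of_real x - 1 / of_real (X m))" for m
  have lim: "D \<longlonglongrightarrow> Digamma (of_real x + w) - Digamma (of_real x) - w * (1 / of_real x - 0)"
  proof -
    have 1: "(\<lambda>m. (of_real (ln (real m)) - (\<Sum>n<m. inverse (of_real x + w + of_nat n))) -
       (of_real (ln (real m)) - (\<Sum>n<m. inverse (of_real x + of_nat n))))
      \<longlonglongrightarrow> Digamma (of_real x + w) - Digamma (of_real x)"
      by (intro tendsto_diff Digamma_LIMSEQ nx)
    have "(\<lambda>m. 1 / X m) \<longlonglongrightarrow> 0"
      unfolding X_def by real_asymp
    then have 2: "(\<lambda>m. complex_of_real (1 / X m)) \<longlonglongrightarrow> of_real 0" by (intro tendsto_of_real)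
    have 3: "(\<lambda>m. 1 / complex_of_real (X m)) \<longlonglongrightarrow> 0" using 2 by simp
    have "(\<lambda>m. ((of_real (ln (real m)) - (\<Sum>n<m. inverse (of_real x + w + of_nat n))) -
       (of_real (ln (real m)) - (\<Sum>n<m. inverse (of_real x + of_nat n)))) - w * (1 / of_real x - 1 / complex_of_real (X m)))
      \<longlonglongrightarrow> Digamma (of_real x + w) - Digamma (of_real x) - w * (1 / of_real x - 0)"
      by (intro tendsto_intros 1 3)
    then show ?thesis by (simp add: D_def[abs_def] sum_subtractf)
  qed
  have bound: "norm (D m) \<le> K / x * (1 / x - 1 / X m)" for m
  proof (induction m)
    case 0 then show ?case by (simp add: D_def X_def)
  next
    case (Suc m)
    define c where "c = complex_of_real (X m)"
    have c1: "c + 1 = of_real (X m + 1)" by (simp add: c_def)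
    have nc1: "norm (c + 1) = X m + 1" unfolding c1 norm_of_real using Xp[of m] by simp
    have c: "c \<noteq> 0" "c + 1 \<noteq> 0" "c + w \<noteq> 0" 
    proof -
      show "c \<noteq> 0" "c + w \<noteq> 0" using Xp[of m] nz[of m] by (auto simp: c_def)
      show "c + 1 \<noteq> 0" using nc1 Xp[of m] by (metis norm_zero add_pos_pos less_irrefl zero_less_one)
    qed
    have XS: "complex_of_real (X (Suc m)) = c + 1" "X (Suc m) = X m + 1" by (auto simp: X_def c_def)
    have "D (Suc m) = D m + (inverse c - inverse (c + w) - w * (1 / c - 1 / (c + 1)))"
      unfolding D_def XS by (simp add: c_def X_def algebra_simps)
    also have "inverse c - inverse (c + w) - w * (1 / c - 1 / (c + 1)) = w * (1 - w) / (c * (c + 1) * (c + w))"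
      using c by (simp add: divide_simps) (simp add: algebra_simps)
    finally have "norm (D (Suc m)) \<le> norm (D m) + norm (w * (1 - w) / (c * (c + 1) * (c + w)))"
      by (simp add: norm_triangle_ineq)
    also have "norm (w * (1 - w) / (c * (c + 1) * (c + w)))
        = norm w * norm (1 - w) / (X m * (X m + 1) * norm (c + w))"
      using Xp[of m] by (simp add: norm_divide norm_mult nc1) (simp add: c_def)
    also have "\<dots> \<le> norm w * norm (1 - w) / (X m * (X m + 1) * (\<kappa> * x))"
    proof -
      have "\<kappa> * x \<le> \<kappa> * X m" using \<kappa> Xp[of m] by simp
      also have "\<dots> \<le> Re (c + w)" using Re_ge[of m] by (simp add: c_def)
      also have "\<dots> \<le> norm (c + w)" by (rule complex_Re_le_cmod)
      finally show ?thesis using Xp[of m] \<kappa> x c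
        by (intro divide_left_mono mult_left_mono) (auto intro!: mult_pos_pos)
    qed
    also have "\<dots> = K / x * (1 / X m - 1 / X (Suc m))"
      using Xp[of m] \<kappa> x by (simp add: K_def XS divide_simps)
    finally show ?case using Suc.IH by (simp add: algebra_simps)
  qed
  have "norm (D m) \<le> K / x\<^sup>2" for m
  proof -
    have "K / x * (1 / x - 1 / X m) \<le> K / x * (1 / x)" using K x Xp[of m] by (intro mult_left_mono) auto
    then show ?thesis using bound[of m] by (simp add: power2_eq_square)
  qed
  then have "norm (Digamma (of_real x + w) - Digamma (of_real x) - w * (1 / of_real x - 0)) \<le> K / x\<^sup>2"
    by (intro Lim_bounded[OF tendsto_norm[OF lim], of 0]) auto
  then show ?thesis by (simp add: K_def)
qed

text \<open>The moment of order \<open>w\<close> of a beta variable with parameters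
  \<open>\<alpha>\<close> and \<open>\<beta> - \<alpha>\<close>, rescaled by
  \<open>\<beta> / \<alpha>\<close>.\<close>

definition gamma_ratio :: "real \<Rightarrow> real \<Rightarrow> complex \<Rightarrow> complex" where
  "gamma_ratio \<alpha> \<beta> w = Gamma (of_real \<alpha> + w) * Gamma (of_real \<beta>)
     / (Gamma (of_real \<alpha>) * Gamma (of_real \<beta> + w)) * of_real (\<beta> / \<alpha>) powr w"

lemma not_nonpos_Reals_if_Re_pos: "Re z > 0 \<Longrightarrow> z \<notin> \<real>\<^sub>\<le>\<^sub>0"
  by (auto simp: complex_nonpos_Reals_iff)

lemma exp_ln_Gamma_complex: "Re z > 0 \<Longrightarrow> exp (ln_Gamma z) = Gamma z"
  by (subst Gamma_complex_altdef) (auto elim!: nonpos_Ints_cases)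

text \<open>The function \<open>h\<close> in the proof has derivative of size \<open>K / x^2\<close>
  by \<open>Digamma_diff_bound\<close>, and the ratio is
  \<open>exp (h \<alpha> - h \<beta>)\<close>. Producing the exponent itself avoids logarithms of
  complex products later, and a bound by a difference of inverses is what interlacing can
  sum.\<close>

lemma gamma_ratio_eq_exp:
  assumes \<alpha>: "0 < \<alpha>" "\<alpha> < \<beta>" and \<kappa>: "0 < \<kappa>" "\<kappa> \<le> 1" "\<kappa> * \<alpha> \<le> \<alpha> + Re w"
  obtains L where "gamma_ratio \<alpha> \<beta> w = exp L" "norm L \<le> norm w * norm (1 - w) / \<kappa> * (1 / \<alpha> - 1 / \<beta>)"
proof -
  define K where "K = norm w * norm (1 - w) / \<kappa>"
  define h where "h x = ln_Gamma (of_real x + w) - ln_Gamma (of_real x) - w * of_real (ln x)" for x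
  have Re_ge: "\<kappa> * x \<le> x + Re w" if "x \<ge> \<alpha>" for x
  proof -
    have "\<kappa> * (x - \<alpha>) \<le> x - \<alpha>" using \<kappa> that by (simp add: mult_left_le_one_le)
    then show ?thesis using \<kappa> by (simp add: algebra_simps)
  qed
  have Re_pos: "Re (of_real x + w) > 0" if "x \<ge> \<alpha>" for x
  proof -
    have "\<kappa> * x > 0" using that \<alpha> \<kappa> by simp
    then show ?thesis using Re_ge[OF that] by simp
  qed
  have dlg: "((\<lambda>x. ln_Gamma (complex_of_real x + v)) has_vector_derivative Digamma (of_real x + v)) (at x)"
    if "Re (of_real x + v) > 0" for x v
  proof -
    have "((\<lambda>z. ln_Gamma (z + v)) has_field_derivative Digamma (of_real x + v)) (at (complex_of_real x))"
      by (rule derivative_eq_intros not_nonpos_Reals_if_Re_pos that | simp)+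
    from field_vector_diff_chain_at[OF has_vector_derivative_of_real[OF DERIV_ident] this]
    show ?thesis by (simp add: comp_def)
  qed
  have dh: "(h has_vector_derivative (Digamma (of_real x + w) - Digamma (of_real x) - w / of_real x)) (at x)"
    if "x \<ge> \<alpha>" for x
  proof -
    have x0: "x > 0" using that \<alpha> by simp
    have "((\<lambda>x. complex_of_real (ln x)) has_vector_derivative of_real (1 / x)) (at x)"
      using x0 by (intro has_vector_derivative_of_real)
         (auto simp flip: has_real_derivative_iff_has_vector_derivative intro!: derivative_eq_intros)
    from has_vector_derivative_mult_right[OF this, of w]
    have "((\<lambda>x. w * complex_of_real (ln x)) has_vector_derivative w / of_real x) (at x)"
      by (simp add: divide_inverse)
    then show ?thesis unfolding h_def
      using dlg[of x w] dlg[of x 0] Re_pos[OF that] x0 by (intro has_vector_derivative_diff) auto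
  qed
  have "norm (h \<beta> - h \<alpha>) \<le> (- K / \<beta>) - (- K / \<alpha>)"
  proof (rule differentiable_bound_general[where \<phi>="\<lambda>x. - K / x" and \<phi>'="\<lambda>x. K / x\<^sup>2"])
    show "continuous_on {\<alpha>..\<beta>} h"
      using dh by (intro continuous_at_imp_continuous_on ballI has_vector_derivative_continuous) auto
    show "continuous_on {\<alpha>..\<beta>} (\<lambda>x. - K / x)"
      using \<alpha> by (intro continuous_intros) auto
    show "((\<lambda>x. - K / x) has_vector_derivative K / x\<^sup>2) (at x)" if "\<alpha> < x" "x < \<beta>" for x
      using that \<alpha> by (auto simp flip: has_real_derivative_iff_has_vector_derivative
          intro!: derivative_eq_intros simp: power2_eq_square)
    show "norm (Digamma (of_real x + w) - Digamma (of_real x) - w / of_real x) \<le> K / x\<^sup>2"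
      if "\<alpha> < x" "x < \<beta>" for x
      unfolding K_def using that \<alpha> \<kappa> Re_ge[of x] by (intro Digamma_diff_bound) auto
  qed (use \<alpha> dh in auto)
  then have 1: "norm (h \<alpha> - h \<beta>) \<le> K * (1 / \<alpha> - 1 / \<beta>)" by (simp add: norm_minus_commute algebra_simps)
  have "exp (h x) = Gamma (of_real x + w) / Gamma (of_real x) / of_real x powr w" if "x \<ge> \<alpha>" for x
    using that \<alpha> Re_pos[OF that] exp_ln_Gamma_complex[of "of_real x"] exp_ln_Gamma_complex[of "of_real x + w"]
    by (simp add: h_def exp_diff powr_def Ln_of_real)
  moreover have "complex_of_real (\<beta> / \<alpha>) powr w = of_real \<beta> powr w / of_real \<alpha> powr w"
  proof -
    have "Ln (complex_of_real (\<beta> / \<alpha>)) = of_real (ln \<beta>) - of_real (ln \<alpha>)"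
      using \<alpha> by (subst Ln_of_real) (auto simp: ln_div)
    then show ?thesis using \<alpha> by (simp add: powr_def Ln_of_real right_diff_distrib exp_diff)
  qed
  ultimately have "exp (h \<alpha> - h \<beta>) = gamma_ratio \<alpha> \<beta> w"
    using \<alpha> by (simp add: exp_diff gamma_ratio_def mult_ac)
  then show ?thesis using that[of "h \<alpha> - h \<beta>"] 1 by (simp add: K_def)
qed

lemma norm_gamma_ratio_le:
  assumes \<alpha>: "0 < \<alpha>" "\<alpha> < \<beta>" and \<kappa>: "0 < \<kappa>" "\<kappa> \<le> 1" "\<kappa> * \<alpha> \<le> \<alpha> + Re w"
  shows "max 1 (norm (gamma_ratio \<alpha> \<beta> w)) \<le> exp (norm w * norm (1 - w) / \<kappa> * (1 / \<alpha> - 1 / \<beta>))"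
proof -
  obtain L where L: "gamma_ratio \<alpha> \<beta> w = exp L" "norm L \<le> norm w * norm (1 - w) / \<kappa> * (1 / \<alpha> - 1 / \<beta>)"
    using gamma_ratio_eq_exp[OF assms] by blast
  have "norm (exp L) \<le> exp (norm L)" by (rule norm_exp)
  then have "norm (gamma_ratio \<alpha> \<beta> w) \<le> exp (norm w * norm (1 - w) / \<kappa> * (1 / \<alpha> - 1 / \<beta>))"
    using L by (metis exp_le_cancel_iff order_trans)
  moreover have "1 \<le> exp (norm w * norm (1 - w) / \<kappa> * (1 / \<alpha> - 1 / \<beta>))"
    using L(2) norm_ge_zero[of L] by (subst one_le_exp_iff) linarith
  ultimately show ?thesis by simp
qed

locale interlaced =
  fixes \<alpha> \<beta> :: "nat \<Rightarrow> real"
  assumes pos: "0 < \<alpha> 0" and less: "\<And>n. \<alpha> n < \<beta> n" "\<And>n. \<beta> n < \<alpha> (Suc n)"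
    and unbounded: "filterlim \<alpha> at_top sequentially"
begin

lemma \<alpha>_mono: "m \<le> n \<Longrightarrow> \<alpha> m \<le> \<alpha> n"
proof (rule lift_Suc_mono_le[of \<alpha>])
  show "\<alpha> n \<le> \<alpha> (Suc n)" for n using less[of n] by linarith
qed

lemma \<alpha>_pos: "0 < \<alpha> n" and \<beta>_pos: "0 < \<beta> n"
proof -
  show "0 < \<alpha> n" using \<alpha>_mono[of 0 n] pos by simp
  then show "0 < \<beta> n" using less(1)[of n] by linarith
qed

text \<open>Interlacing gives \<open>1 / \<beta> k \<ge> 1 / \<alpha> (Suc k)\<close>, so the sum is
  dominated by a telescoping one, whatever the growth of the sequences.\<close>

lemma sum_inverse_gap_le: "(\<Sum>k<n. 1 / \<alpha> (m + k) - 1 / \<beta> (m + k)) \<le> 1 / \<alpha> m"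
proof -
  have "(\<Sum>k<n. 1 / \<alpha> (m + k) - 1 / \<beta> (m + k)) \<le> 1 / \<alpha> m - 1 / \<alpha> (m + n)"
  proof (induction n)
    case (Suc n)
    have "1 / \<alpha> (m + Suc n) \<le> 1 / \<beta> (m + n)"
      using less(2)[of "m + n"] \<beta>_pos[of "m + n"] by (simp add: frac_le)
    then show ?case using Suc by simp
  qed simp
  then show ?thesis using \<alpha>_pos[of "m + n"] by (smt (verit) divide_pos_pos)
qed

lemma inverse_gap_nonneg: "0 \<le> 1 / \<alpha> k - 1 / \<beta> k"
  using less(1)[of k] \<alpha>_pos[of k] by (simp add: frac_le)

lemma summable_inverse_gap: "summable (\<lambda>k. 1 / \<alpha> k - 1 / \<beta> k)"
  using sum_inverse_gap_le[of 0] by (intro summableI_nonneg_bounded[of _ "1 / \<alpha> 0"] inverse_gap_nonneg) auto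

text \<open>The worst index is 0: a constant that works there works for all larger
  \<open>\<alpha> n\<close>, because \<open>\<kappa> \<le> 1\<close>.\<close>

lemma exists_ratio_bound:
  assumes "\<alpha> 0 + Re w > 0"
  obtains \<kappa> where "0 < \<kappa>" "\<kappa> \<le> 1" "\<And>n. \<kappa> * \<alpha> n \<le> \<alpha> n + Re w"
proof
  define \<kappa> where "\<kappa> = min 1 ((\<alpha> 0 + Re w) / \<alpha> 0)"
  show k: "0 < \<kappa>" "\<kappa> \<le> 1" using assms pos by (auto simp: \<kappa>_def)
  fix n
  have "\<kappa> \<le> (\<alpha> 0 + Re w) / \<alpha> 0" by (simp add: \<kappa>_def)
  then have "\<kappa> * \<alpha> 0 \<le> \<alpha> 0 + Re w" using pos by (simp add: field_simps)
  moreover have "\<kappa> * (\<alpha> n - \<alpha> 0) \<le> \<alpha> n - \<alpha> 0"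
    using k \<alpha>_mono[of 0 n] by (simp add: mult_left_le_one_le)
  ultimately show "\<kappa> * \<alpha> n \<le> \<alpha> n + Re w" by (simp add: algebra_simps)
qed

text \<open>The factors are exponentials of a summable sequence, so the limit is an exponential and
  cannot vanish.\<close>

lemma prod_gamma_ratio_limit:
  assumes "\<alpha> 0 + Re w > 0"
  obtains P where "P \<noteq> 0" "(\<lambda>n. \<Prod>k<n. gamma_ratio (\<alpha> k) (\<beta> k) w) \<longlonglongrightarrow> P"
proof -
  obtain \<kappa> where \<kappa>: "0 < \<kappa>" "\<kappa> \<le> 1" "\<And>n. \<kappa> * \<alpha> n \<le> \<alpha> n + Re w"
    using exists_ratio_bound[OF assms] by blast
  have "\<exists>L. gamma_ratio (\<alpha> k) (\<beta> k) w = exp L \<and> norm L \<le> norm w * norm (1 - w) / \<kappa> * (1 / \<alpha> k - 1 / \<beta> k)" for k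
    using gamma_ratio_eq_exp[OF \<alpha>_pos less(1) \<kappa>] by metis
  then obtain L where L: "\<And>k. gamma_ratio (\<alpha> k) (\<beta> k) w = exp (L k)"
    "\<And>k. norm (L k) \<le> norm w * norm (1 - w) / \<kappa> * (1 / \<alpha> k - 1 / \<beta> k)" by metis
  have "summable L"
    by (rule summable_comparison_test'[OF summable_mult[OF summable_inverse_gap] L(2)])
  then have "(\<lambda>n. exp (\<Sum>k<n. L k)) \<longlonglongrightarrow> exp (suminf L)"
    by (intro tendsto_exp summable_LIMSEQ)
  then have "(\<lambda>n. \<Prod>k<n. gamma_ratio (\<alpha> k) (\<beta> k) w) \<longlonglongrightarrow> exp (suminf L)" by (simp add: L exp_sum)
  then show ?thesis using that[of "exp (suminf L)"] by simp
qed

lemma prod_max_gamma_ratio_le: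
  assumes \<kappa>: "0 < \<kappa>" "\<kappa> \<le> 1" "\<kappa> * \<alpha> m \<le> \<alpha> m + Re w"
  shows "(\<Prod>k<n. max 1 (norm (gamma_ratio (\<alpha> (m + k)) (\<beta> (m + k)) w)))
    \<le> exp (norm w * norm (1 - w) / \<kappa> / \<alpha> m)"
proof -
  have k: "\<kappa> * \<alpha> (m + k) \<le> \<alpha> (m + k) + Re w" for k
  proof -
    have "\<kappa> * (\<alpha> (m + k) - \<alpha> m) \<le> \<alpha> (m + k) - \<alpha> m"
      using \<kappa> \<alpha>_mono[of m "m + k"] by (simp add: mult_left_le_one_le)
    then show ?thesis using \<kappa> by (simp add: algebra_simps)
  qed
  have "(\<Prod>k<n. max 1 (norm (gamma_ratio (\<alpha> (m + k)) (\<beta> (m + k)) w)))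
    \<le> (\<Prod>k<n. exp (norm w * norm (1 - w) / \<kappa> * (1 / \<alpha> (m + k) - 1 / \<beta> (m + k))))"
    using \<alpha>_pos less \<kappa> k by (intro prod_mono conjI norm_gamma_ratio_le) auto
  also have "\<dots> = exp (norm w * norm (1 - w) / \<kappa> * (\<Sum>k<n. 1 / \<alpha> (m + k) - 1 / \<beta> (m + k)))"
    by (simp add: exp_sum sum_distrib_left)
  also have "\<dots> \<le> exp (norm w * norm (1 - w) / \<kappa> * (1 / \<alpha> m))"
    using sum_inverse_gap_le \<kappa> by (subst exp_le_cancel_iff, intro mult_left_mono) auto
  finally show ?thesis by simp
qed

end

section \<open>Decay of the gamma function along vertical lines\<close>

definition gamma_decay :: "real \<Rightarrow> real \<Rightarrow> real" where
  "gamma_decay t x = norm (Gamma (of_real x + \<i> * of_real t)) / Gamma x"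

text \<open>In the Gamma series, numerator and denominator share the factors \<open>fact n\<close>
  and \<open>n powr x\<close>. The surviving factors are at most 1 and increase with
  \<open>x\<close>, from which monotonicity and the bound by 1 follow termwise.\<close>

lemma gamma_decay_limit:
  assumes "x > 0"
  shows "(\<lambda>n. \<Prod>k\<le>n. (x + real k) / norm (of_real (x + real k) + \<i> * of_real t)) \<longlonglongrightarrow> gamma_decay t x"
proof -
  have ne: "x + real k > 0" for k using assms by simp
  have "(\<lambda>n. norm (Gamma_series (of_real x + \<i> * of_real t) n) / Gamma_series x n)
     \<longlonglongrightarrow> gamma_decay t x"
    unfolding gamma_decay_def using Gamma_real_pos[OF assms]
    by (intro tendsto_divide tendsto_norm Gamma_series_LIMSEQ) linarith
  moreover have "norm (Gamma_series (complex_of_real x + \<i> * of_real t) n) / Gamma_series x n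
     = (\<Prod>k\<le>n. (x + real k) / norm (of_real (x + real k) + \<i> * of_real t))" for n
  proof -
    have 1: "norm (Gamma_series (complex_of_real x + \<i> * of_real t) n)
      = fact n * exp (x * ln (real n)) / (\<Prod>k\<le>n. norm (complex_of_real (x + real k) + \<i> * of_real t))"
      by (simp add: Gamma_series_def norm_divide norm_mult pochhammer_Suc_prod prod_norm[symmetric] atLeast0AtMost
          add_ac cong: prod.cong)
    have 2: "Gamma_series x n = fact n * exp (x * ln (real n)) / (\<Prod>k\<le>n. x + real k)"
      by (simp add: Gamma_series_def pochhammer_Suc_prod atLeast0AtMost)
    have "(\<Prod>k\<le>n. x + real k) > 0" using ne by (intro prod_pos) auto
    then show ?thesis unfolding 1 2 by (simp add: prod_dividef)
  qed
  ultimately show ?thesis by simp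
qed

lemma gamma_decay_factor:
  assumes "0 < (x::real)" "x \<le> y"
  shows "x / norm (of_real x + \<i> * complex_of_real t) \<le> y / norm (of_real y + \<i> * complex_of_real t)"
    "x / norm (of_real x + \<i> * complex_of_real t) \<le> 1"
proof -
  have nx: "norm (of_real x + \<i> * complex_of_real t) = sqrt (x\<^sup>2 + t\<^sup>2)" for x by (simp add: cmod_def)
  have e: "x / sqrt (x\<^sup>2 + t\<^sup>2) = 1 / sqrt (1 + (t / x)\<^sup>2)" if "x > 0" for x
  proof -
    have "x\<^sup>2 + t\<^sup>2 = x\<^sup>2 * (1 + (t / x)\<^sup>2)" using that by (simp add: field_simps)
    then have "sqrt (x\<^sup>2 + t\<^sup>2) = x * sqrt (1 + (t / x)\<^sup>2)" using that by (simp add: real_sqrt_mult)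
    then show ?thesis using that by simp
  qed
  have "(t / y)\<^sup>2 \<le> (t / x)\<^sup>2" using assms
    by (auto simp: power_divide intro!: divide_left_mono power_mono)
  then have "sqrt (1 + (t / y)\<^sup>2) \<le> sqrt (1 + (t / x)\<^sup>2)" by simp
  moreover have "sqrt (1 + (t / y)\<^sup>2) \<ge> 1" "sqrt (1 + (t / x)\<^sup>2) \<ge> 1" by auto
  moreover have "sqrt (1 + (t / y)\<^sup>2) > 0" "sqrt (1 + (t / x)\<^sup>2) > 0" by (auto simp: add_pos_nonneg)
  ultimately show "x / norm (of_real x + \<i> * complex_of_real t) \<le> y / norm (of_real y + \<i> * complex_of_real t)"
    "x / norm (of_real x + \<i> * complex_of_real t) \<le> 1"
    using assms by (auto simp: nx e divide_le_eq_1 intro!: divide_left_mono simp del: real_sqrt_gt_0_iff)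
qed

lemma gamma_decay_mono:
  assumes "0 < x" "x \<le> y" shows "gamma_decay t x \<le> gamma_decay t y"
proof (rule LIMSEQ_le[OF gamma_decay_limit gamma_decay_limit])
  show "\<exists>N. \<forall>n\<ge>N. (\<Prod>k\<le>n. (x + real k) / norm (of_real (x + real k) + \<i> * of_real t))
       \<le> (\<Prod>k\<le>n. (y + real k) / norm (of_real (y + real k) + \<i> * of_real t))"
    using assms gamma_decay_factor(1)[of "x + real k" "y + real k" t for k]
    by (intro exI allI impI prod_mono) auto
qed (use assms in auto)

lemma gamma_decay_le_1: assumes "0 < x" shows "gamma_decay t x \<le> 1"
proof (rule LIMSEQ_le_const2[OF gamma_decay_limit[OF assms]])
  show "\<exists>N. \<forall>n\<ge>N. (\<Prod>k\<le>n. (x + real k) / norm (of_real (x + real k) + \<i> * of_real t)) \<le> 1"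
    using assms gamma_decay_factor(2)[of "x + real k" "x + real k" t for k]
    by (intro exI allI impI prod_le_1) auto
qed

lemma gamma_decay_pos: "0 < x \<Longrightarrow> 0 < gamma_decay t x"
proof -
  assume x: "0 < x"
  have "Re (of_real x + \<i> * complex_of_real t) > 0" using x by simp
  then have "of_real x + \<i> * complex_of_real t \<notin> \<int>\<^sub>\<le>\<^sub>0" by (metis nonpos_Ints_cases complex_Re_of_int not_less of_int_le_0_iff)
  then show "0 < gamma_decay t x" using x by (simp add: gamma_decay_def Gamma_eq_zero_iff)
qed

text \<open>On this line \<open>1 - z\<close> is the conjugate of \<open>z\<close>, so the
  reflection formula gives the squared modulus of the gamma function as
  \<open>pi / cosh (pi * t)\<close>.\<close>

lemma gamma_decay_half: "gamma_decay t (1/2) \<ge> exp (- pi / 2 * \<bar>t\<bar>)"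
proof -
  define z where "z = complex_of_real (1/2) + \<i> * of_real t"
  have "Gamma z * Gamma (1 - z) = of_real pi / sin (of_real pi * z)" by (rule Gamma_reflection_complex)
  also have "1 - z = cnj z" by (simp add: z_def complex_eq_iff)
  also have "Gamma (cnj z) = cnj (Gamma z)" by (rule cnj_Gamma[symmetric])
  also have "sin (of_real pi * z) = cos (\<i> * of_real (pi * t))"
  proof -
    have "of_real pi * z = of_real pi / 2 + \<i> * of_real (pi * t)" by (simp add: z_def algebra_simps)
    then show ?thesis by (simp add: sin_add)
  qed
  also have "\<dots> = of_real (cosh (pi * t))" by (simp add: cosh_def cos_exp_eq exp_of_real scaleR_conv_of_real exp_minus flip: of_real_mult of_real_minus)
  finally have "of_real ((norm (Gamma z))\<^sup>2) = complex_of_real (pi / cosh (pi * t))"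
    by (simp add: complex_norm_square flip: of_real_power)
  then have "(norm (Gamma z))\<^sup>2 = pi / cosh (pi * t)" using of_real_eq_iff by blast
  then have "(gamma_decay t (1/2))\<^sup>2 = 1 / cosh (pi * t)"
    using z_def by (simp add: gamma_decay_def power_divide Gamma_one_half_real)
  moreover have "1 / cosh (pi * t) \<ge> 1 / exp (\<bar>pi * t\<bar>)"
  proof (intro divide_left_mono)
    have "cosh (pi * t) = cosh \<bar>pi * t\<bar>" by (simp add: cosh_real_abs)
    also have "\<dots> \<le> exp \<bar>pi * t\<bar>" by (simp add: cosh_def field_simps)
    finally show "cosh (pi * t) \<le> exp \<bar>pi * t\<bar>" .
  qed (auto simp: cosh_real_pos)
  moreover have "(exp (- pi / 2 * \<bar>t\<bar>))\<^sup>2 = 1 / exp (\<bar>pi * t\<bar>)"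
    by (simp add: abs_mult exp_minus inverse_eq_divide power_divide flip: exp_double)
  ultimately have "(exp (- pi / 2 * \<bar>t\<bar>))\<^sup>2 \<le> (gamma_decay t (1/2))\<^sup>2" by simp
  then show ?thesis by (rule power2_le_imp_le) (use gamma_decay_pos[of "1/2" t] in auto)
qed

text \<open>At \<open>x + 1\<close> monotonicity compares with the line through 1/2; the functional
  equation then returns to \<open>x\<close> at the price of the polynomial factor.\<close>

lemma gamma_decay_ge:
  assumes "x > 0" shows "gamma_decay t x \<ge> exp (- pi / 2 * \<bar>t\<bar>) * x / (x + \<bar>t\<bar>)"
proof -
  define z where "z = complex_of_real x + \<i> * of_real t"
  have z: "z \<notin> \<int>\<^sub>\<le>\<^sub>0" using assms by (auto simp: z_def elim!: nonpos_Ints_cases dest: arg_cong[of _ _ Re])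
  have "Re z \<noteq> 0" using assms by (simp add: z_def)
  then have z0: "z \<noteq> 0" by auto
  have "norm (Gamma (z + 1)) = norm z * norm (Gamma z)" using z by (simp add: Gamma_plus1 norm_mult)
  moreover have "Gamma (x + 1) = x * Gamma x" using assms by (intro Gamma_plus1) (auto elim!: nonpos_Ints_cases)
  ultimately have "gamma_decay t (x + 1) = gamma_decay t x * norm z / x"
    using assms by (simp add: gamma_decay_def z_def add_ac mult_ac)
  then have "gamma_decay t x = gamma_decay t (x + 1) * (x / norm z)" using z0 assms by simp
  moreover have "exp (- pi / 2 * \<bar>t\<bar>) \<le> gamma_decay t (x + 1)"
    using gamma_decay_half[of t] gamma_decay_mono[of "1/2" "x + 1" t] assms by linarith
  moreover have "norm z \<le> x + \<bar>t\<bar>" using norm_triangle_ineq[of "complex_of_real x" "\<i> * of_real t"] assms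
    by (simp add: z_def norm_mult)
  then have "x / (x + \<bar>t\<bar>) \<le> x / norm z" using assms z0 by (intro divide_left_mono) auto
  ultimately show ?thesis using assms mult_mono[of "exp (- pi / 2 * \<bar>t\<bar>)" "gamma_decay t (x + 1)" "x / (x + \<bar>t\<bar>)" "x / norm z"]
    by (simp add: gamma_decay_pos less_imp_le)
qed

lemma norm_gamma_ratio_decay:
  assumes "0 < \<alpha>" "\<alpha> < \<beta>" "0 < \<alpha> + Re w"
  shows "norm (gamma_ratio \<alpha> \<beta> w)
    = norm (gamma_ratio \<alpha> \<beta> (of_real (Re w))) * (gamma_decay (Im w) (\<alpha> + Re w) / gamma_decay (Im w) (\<beta> + Re w))"
proof -
  have e: "norm (Gamma (complex_of_real x + w)) = norm (Gamma (complex_of_real x + of_real (Re w))) * gamma_decay (Im w) (x + Re w)"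
    if "x + Re w > 0" for x
  proof -
    have 1: "complex_of_real x + w = of_real (x + Re w) + \<i> * of_real (Im w)" by (simp add: complex_eq_iff)
    have 2: "norm (Gamma (complex_of_real x + of_real (Re w))) = Gamma (x + Re w)"
      using Gamma_real_pos[OF that] by (simp add: Gamma_complex_of_real flip: of_real_add)
    show ?thesis using Gamma_real_pos[OF that] by (subst 1) (simp add: 2 gamma_decay_def)
  qed
  have "norm (complex_of_real (\<beta> / \<alpha>) powr w) = norm (complex_of_real (\<beta> / \<alpha>) powr of_real (Re w))"
    using assms by (subst (1 2) norm_powr_real_powr) (auto simp del: of_real_divide)
  then show ?thesis using assms unfolding gamma_ratio_def norm_mult norm_divide
    by (simp add: e[of \<alpha>] e[of \<beta>] mult_ac del: of_real_divide)
qed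

text \<open>Relative to the real point, factor \<open>k\<close> loses
  \<open>\<phi> (\<alpha> k) / \<phi> (\<beta> k)\<close>. As \<open>\<phi>\<close> is increasing
  and \<open>\<beta> k < \<alpha> (Suc k)\<close>, the product of these losses is at least
  \<open>\<phi> (\<alpha> 0) / \<phi> (\<alpha> n)\<close>, hence at least
  \<open>\<phi> (\<alpha> 0)\<close>: a bound uniform in the number of factors.\<close>

lemma (in interlaced) norm_prod_gamma_ratio_ge:
  assumes "\<alpha> 0 + Re w > 0"
  shows "norm (\<Prod>k<n. gamma_ratio (\<alpha> k) (\<beta> k) w)
    \<ge> gamma_decay (Im w) (\<alpha> 0 + Re w) * norm (\<Prod>k<n. gamma_ratio (\<alpha> k) (\<beta> k) (of_real (Re w)))"
proof -
  define \<phi> where "\<phi> x = gamma_decay (Im w) (x + Re w)" for x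
  have Re_pos: "\<alpha> k + Re w > 0" "\<beta> k + Re w > 0" for k
    using assms \<alpha>_mono[of 0 k] less(1)[of k] by auto
  have p: "\<phi> (\<alpha> k) > 0" "\<phi> (\<beta> k) > 0" "\<phi> (\<alpha> k) \<le> 1" "\<phi> (\<beta> k) \<le> \<phi> (\<alpha> (Suc k))" for k
    using Re_pos less(2)[of k] by (auto simp: \<phi>_def gamma_decay_pos gamma_decay_le_1 intro!: gamma_decay_mono)
  have "\<phi> (\<alpha> 0) / \<phi> (\<alpha> n) \<le> (\<Prod>k<n. \<phi> (\<alpha> k) / \<phi> (\<beta> k))"
  proof (induction n)
    case (Suc n)
    have "\<phi> (\<alpha> 0) / \<phi> (\<alpha> (Suc n)) \<le> \<phi> (\<alpha> 0) / \<phi> (\<beta> n)"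
      using p by (intro divide_left_mono) (auto intro: less_imp_le)
    also have "\<dots> = \<phi> (\<alpha> 0) / \<phi> (\<alpha> n) * (\<phi> (\<alpha> n) / \<phi> (\<beta> n))" using p(1)[of n] by simp
    also have "\<dots> \<le> (\<Prod>k<n. \<phi> (\<alpha> k) / \<phi> (\<beta> k)) * (\<phi> (\<alpha> n) / \<phi> (\<beta> n))"
      using p Suc by (intro mult_right_mono) (auto intro: less_imp_le divide_nonneg_pos)
    finally show ?case by simp
  qed (use p(1)[of 0] in simp)
  moreover have "\<phi> (\<alpha> 0) \<le> \<phi> (\<alpha> 0) / \<phi> (\<alpha> n)"
    using p(1)[of 0] p(1)[of n] p(3)[of n] by (simp add: field_simps)
  ultimately have "\<phi> (\<alpha> 0) \<le> (\<Prod>k<n. \<phi> (\<alpha> k) / \<phi> (\<beta> k))" by linarith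
  then have "\<phi> (\<alpha> 0) * (\<Prod>k<n. norm (gamma_ratio (\<alpha> k) (\<beta> k) (of_real (Re w))))
    \<le> (\<Prod>k<n. \<phi> (\<alpha> k) / \<phi> (\<beta> k)) * (\<Prod>k<n. norm (gamma_ratio (\<alpha> k) (\<beta> k) (of_real (Re w))))"
    by (intro mult_right_mono prod_nonneg) auto
  also have "\<dots> = (\<Prod>k<n. norm (gamma_ratio (\<alpha> k) (\<beta> k) w))"
    using Re_pos by (simp add: norm_gamma_ratio_decay[where w=w, OF \<alpha>_pos less(1)] \<phi>_def mult.commute flip: prod.distrib)
  finally show ?thesis by (simp add: prod_norm \<phi>_def)
qed

section \<open>Product formula for the Laplace exponent\<close>

lemma holomorphic_on_suminf:
  fixes f :: "nat \<Rightarrow> complex \<Rightarrow> complex"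
  assumes S: "open S" and hol: "\<And>n. f n holomorphic_on S"
    and M: "\<And>n z. z \<in> S \<Longrightarrow> norm (f n z) \<le> M n" "summable M"
  shows "(\<lambda>z. \<Sum>n. f n z) holomorphic_on S"
proof (rule holomorphic_uniform_sequence[OF S])
  show "(\<lambda>z. \<Sum>i<n. f i z) holomorphic_on S" for n by (intro holomorphic_intros hol)
  fix z assume "z \<in> S"
  then obtain d where d: "d > 0" "cball z d \<subseteq> S" using S open_contains_cball by blast
  then show "\<exists>d>0. cball z d \<subseteq> S \<and> uniform_limit (cball z d) (\<lambda>n z. \<Sum>i<n. f i z) (\<lambda>z. \<Sum>n. f n z) sequentially"
    using M by (intro exI[of _ d] conjI Weierstrass_m_test[where M=M]) auto
qed

text \<open>The derivative of \<open>Ln (1 - z)\<close> has modulus at most 2 on the closed disk of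
  radius 1/2.\<close>

lemma norm_Ln_diff_le:
  assumes "norm u \<le> 1/2" "norm v \<le> 1/2"
  shows "norm (Ln (1 - u) - Ln (1 - v)) \<le> 2 * norm (u - v)"
proof (rule field_differentiable_bound[where S="cball 0 (1/2)" and f'="\<lambda>z. - (1 / (1 - z))"])
  fix z :: complex assume z: "z \<in> cball 0 (1/2)"
  then have nz: "norm z \<le> 1/2" by simp
  then have "Re (1 - z) > 0" using abs_Re_le_cmod[of z] by simp
  then have "1 - z \<notin> \<real>\<^sub>\<le>\<^sub>0" by (rule not_nonpos_Reals_if_Re_pos)
  then show "((\<lambda>z. Ln (1 - z)) has_field_derivative - (1 / (1 - z))) (at z within cball 0 (1/2))"
    by (auto intro!: derivative_eq_intros simp: field_simps)
  have "norm (1 - z) \<ge> 1 / 2" using norm_triangle_ineq2[of 1 z] nz by simp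
  then show "norm (- (1 / (1 - z))) \<le> 2" by (simp add: norm_divide divide_le_eq)
qed (use assms in auto)

lemma abs_diff_ge_1: "2 * (\<bar>b\<bar> + 1) \<le> \<bar>a\<bar> \<Longrightarrow> 1 \<le> \<bar>a - b\<bar>" for a b :: real
  by (simp add: distrib_left)

text \<open>Poles \<open>r\<close> and zeros \<open>y\<close> of both half-lines are listed in one
  sequence each, with signs. The Herglotz condition concerns even partial products only, since in
  the intended alternating order these contain equally many pairs from either side.\<close>

locale interlaced_meromorphic =
  fixes r y A :: "nat \<Rightarrow> real" and \<sigma> \<mu> q :: real and \<psi> :: "complex \<Rightarrow> complex"
  assumes nz: "\<And>k. r k \<noteq> 0" "\<And>k. y k \<noteq> 0" and inj: "inj r" "inj y"
    and disj: "\<And>j k. y j \<noteq> r k" and A: "\<And>k. A k > 0" and q: "q > 0"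
    and infty: "filterlim (\<lambda>k. \<bar>r k\<bar>) at_top sequentially" "filterlim (\<lambda>k. \<bar>y k\<bar>) at_top sequentially"
    and sumA: "summable (\<lambda>k. A k / (r k)\<^sup>2)" and sumgap: "summable (\<lambda>k. \<bar>1 / y k - 1 / r k\<bar>)"
    and \<psi>_eq: "\<And>z. \<psi> z = of_real (\<sigma>\<^sup>2) * z\<^sup>2 / 2 + of_real \<mu> * z
       + z\<^sup>2 * (\<Sum>k. of_real (A k) / (of_real (r k) * (of_real (r k) - z)))"
    and roots: "\<And>z. z \<notin> range (\<lambda>k. of_real (r k)) \<Longrightarrow> \<psi> z = of_real q \<longleftrightarrow> z \<in> range (\<lambda>k. of_real (y k))"
    and herglotz: "\<And>z n. Im z > 0 \<Longrightarrow>
       Im (- (1 / z) * (\<Prod>k<2*n. (1 - z / of_real (y k)) / (1 - z / of_real (r k)))) \<ge> 0"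
begin

abbreviation "poles \<equiv> range (\<lambda>k. complex_of_real (r k))"
abbreviation "zeros \<equiv> range (\<lambda>k. complex_of_real (y k))"

definition polar :: "nat \<Rightarrow> complex \<Rightarrow> complex" where
  "polar k z = of_real (A k) / (of_real (r k) * (of_real (r k) - z))"

definition fac :: "nat \<Rightarrow> complex \<Rightarrow> complex" where
  "fac k z = (1 - z / of_real (y k)) / (1 - z / of_real (r k))"

definition Q :: "complex \<Rightarrow> complex" where
  "Q z = lim (\<lambda>n. \<Prod>k<n. fac k z)"

lemma escape: "\<exists>m. \<forall>k\<ge>m. 2 * R \<le> \<bar>r k\<bar> \<and> 2 * R \<le> \<bar>y k\<bar>"
  using eventually_conj[OF filterlim_at_top[THEN iffD1, OF infty(1), rule_format, of "2 * R"]
      filterlim_at_top[THEN iffD1, OF infty(2), rule_format, of "2 * R"]]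
  by (simp add: eventually_sequentially)

lemma norm_polar_le:
  assumes "norm z < R" "2 * R \<le> \<bar>r k\<bar>"
  shows "norm (polar k z) \<le> 2 * (A k / (r k)\<^sup>2)"
proof -
  have "\<bar>r k\<bar> / 2 \<le> norm (of_real (r k) - z)"
    using assms norm_triangle_ineq2[of "of_real (r k)" z] by simp
  then have "\<bar>r k\<bar> * (\<bar>r k\<bar> / 2) \<le> \<bar>r k\<bar> * norm (of_real (r k) - z)" by (intro mult_left_mono) auto
  moreover have "0 < \<bar>r k\<bar> * (\<bar>r k\<bar> / 2)" using nz[of k] by (intro mult_pos_pos) auto
  ultimately have "A k / (\<bar>r k\<bar> * norm (of_real (r k) - z)) \<le> A k / (\<bar>r k\<bar> * (\<bar>r k\<bar> / 2))"
    using A[of k] by (intro frac_le) auto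
  also have "\<bar>r k\<bar> * (\<bar>r k\<bar> / 2) = (r k)\<^sup>2 / 2" by (simp add: power2_eq_square)
  finally show ?thesis using A[of k] by (simp add: polar_def norm_divide norm_mult mult_ac)
qed

lemma summable_polar: "summable (\<lambda>k. polar k z)"
proof -
  obtain m where m: "\<forall>k\<ge>m. 2 * (norm z + 1) \<le> \<bar>r k\<bar>" using escape by blast
  show ?thesis
    by (rule summable_comparison_test'[OF summable_mult[OF sumA, of 2], of m])
      (use m norm_polar_le[of z "norm z + 1"] in auto)
qed

definition T :: "nat \<Rightarrow> complex \<Rightarrow> complex" where "T m z = (\<Sum>k. polar (k + m) z)"
definition E :: "nat \<Rightarrow> complex \<Rightarrow> complex" where
  "E m z = (\<Sum>k. Ln (1 - z / of_real (y (k + m))) - Ln (1 - z / of_real (r (k + m))))"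

definition D :: "nat \<Rightarrow> complex \<Rightarrow> complex" where "D m z = (\<Prod>k<m. 1 - z / of_real (r k))"
definition Z :: "nat \<Rightarrow> complex \<Rightarrow> complex" where "Z m z = (\<Prod>k<m. 1 - z / of_real (y k))"
text \<open>This is \<open>(q - \<psi>) * D m\<close>, the first \<open>m\<close> poles being
  cleared. The cleared pole terms are written with their own linear factor removed, so that the
  formula keeps its meaning at the poles.\<close>

definition H :: "nat \<Rightarrow> complex \<Rightarrow> complex" where
  "H m z = (of_real q - (of_real (\<sigma>\<^sup>2) * z\<^sup>2 / 2 + of_real \<mu> * z + z\<^sup>2 * T m z)) * D m z
     - z\<^sup>2 * (\<Sum>k<m. of_real (A k / (r k)\<^sup>2) * (\<Prod>j\<in>{..<m}-{k}. 1 - z / of_real (r j)))"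

section \<open>Representation on a disk of radius \<open>R\<close> beyond which, with room to spare,
  all later poles and zeros lie\<close>

context
  fixes R :: real and m :: nat
  assumes m: "\<And>k. k \<ge> m \<Longrightarrow> 2 * R \<le> \<bar>r k\<bar>" "\<And>k. k \<ge> m \<Longrightarrow> 2 * R \<le> \<bar>y k\<bar>"
begin

lemma log_bound:
  assumes "norm z < R"
  shows "norm (Ln (1 - z / of_real (y (k + m))) - Ln (1 - z / of_real (r (k + m))))
     \<le> 2 * R * \<bar>1 / y (k + m) - 1 / r (k + m)\<bar>"
    "Re (1 - z / of_real (y (k + m))) > 0" "Re (1 - z / of_real (r (k + m))) > 0"
proof -
  have n: "norm (z / of_real (y (k + m))) \<le> 1 / 2" "norm (z / of_real (r (k + m))) \<le> 1 / 2"
    using m[of "k + m"] assms nz[of "k + m"] by (auto simp: norm_divide divide_simps)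
  show "Re (1 - z / of_real (y (k + m))) > 0" "Re (1 - z / of_real (r (k + m))) > 0"
    using n complex_Re_le_cmod[of "z / of_real (y (k + m))"] complex_Re_le_cmod[of "z / of_real (r (k + m))"]
    unfolding minus_complex.sel one_complex.sel by linarith+
  have "z / of_real (y (k + m)) - z / of_real (r (k + m)) = z * of_real (1 / y (k + m) - 1 / r (k + m))"
    by (simp add: algebra_simps)
  then have "norm (z / of_real (y (k + m)) - z / of_real (r (k + m))) = norm z * \<bar>1 / y (k + m) - 1 / r (k + m)\<bar>"
    by (simp only: norm_mult norm_of_real)
  also have "\<dots> \<le> R * \<bar>1 / y (k + m) - 1 / r (k + m)\<bar>" using assms by (intro mult_right_mono) auto
  finally show "norm (Ln (1 - z / of_real (y (k + m))) - Ln (1 - z / of_real (r (k + m))))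
     \<le> 2 * R * \<bar>1 / y (k + m) - 1 / r (k + m)\<bar>"
    using norm_Ln_diff_le[OF n] by linarith
qed

lemma summable_gap_shift: "summable (\<lambda>k. 2 * R * \<bar>1 / y (k + m) - 1 / r (k + m)\<bar>)"
  by (intro summable_mult summable_ignore_initial_segment[OF sumgap])

lemma E_holomorphic: "E m holomorphic_on ball 0 R"
  unfolding E_def
proof (rule holomorphic_on_suminf[OF open_ball _ _ summable_gap_shift])
  show "(\<lambda>z. Ln (1 - z / of_real (y (n + m))) - Ln (1 - z / of_real (r (n + m)))) holomorphic_on ball 0 R" for n
    using log_bound[of _ n] nz by (intro holomorphic_intros not_nonpos_Reals_if_Re_pos) auto
qed (use log_bound in auto)

lemma T_holomorphic: "T m holomorphic_on ball 0 R"
  unfolding T_def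
proof (rule holomorphic_on_suminf[OF open_ball])
  show "summable (\<lambda>k. 2 * (A (k + m) / (r (k + m))\<^sup>2))"
    by (intro summable_mult summable_ignore_initial_segment[OF sumA])
  show "norm (polar (n + m) z) \<le> 2 * (A (n + m) / (r (n + m))\<^sup>2)" if "z \<in> ball 0 R" for n z
    using that m[of "n + m"] by (intro norm_polar_le) auto
  show "polar (n + m) holomorphic_on ball 0 R" for n
    unfolding polar_def using nz m[of "n + m"] by (intro holomorphic_intros) auto
qed

text \<open>The first \<open>m\<close> factors are split off; the remaining ones are exponentials of
  logarithms with a summable bound. At a pole both sides are 0 because of
  \<open>x / 0 = 0\<close>.\<close>

lemma Q_limit:
  assumes "norm z < R"
  shows "(\<lambda>n. \<Prod>k<n. fac k z) \<longlonglongrightarrow> Z m z / D m z * exp (E m z)"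
proof -
  have s: "summable (\<lambda>k. Ln (1 - z / of_real (y (k + m))) - Ln (1 - z / of_real (r (k + m))))"
    by (rule summable_comparison_test'[OF summable_gap_shift]) (use log_bound(1)[OF assms] in auto)
  have e: "fac (k + m) z = exp (Ln (1 - z / of_real (y (k + m))) - Ln (1 - z / of_real (r (k + m))))" for k
  proof -
    have "1 - z / of_real (y (k + m)) \<noteq> 0" "1 - z / of_real (r (k + m)) \<noteq> 0"
      using log_bound(2,3)[OF assms, of k] by (metis less_irrefl zero_complex.sel(1))+
    then show ?thesis by (simp add: fac_def exp_diff)
  qed
  have "(\<lambda>n. (\<Prod>k<m. fac k z) * exp (\<Sum>k<n. Ln (1 - z / of_real (y (k + m))) - Ln (1 - z / of_real (r (k + m)))))
     \<longlonglongrightarrow> (\<Prod>k<m. fac k z) * exp (E m z)"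
    unfolding E_def by (intro tendsto_intros summable_LIMSEQ s)
  also have "(\<lambda>n. (\<Prod>k<m. fac k z) * exp (\<Sum>k<n. Ln (1 - z / of_real (y (k + m))) - Ln (1 - z / of_real (r (k + m)))))
     = (\<lambda>n. \<Prod>k<n + m. fac k z)"
  proof
    fix n
    show "(\<Prod>k<m. fac k z) * exp (\<Sum>k<n. Ln (1 - z / of_real (y (k + m))) - Ln (1 - z / of_real (r (k + m))))
      = (\<Prod>k<n + m. fac k z)"
      by (induction n) (simp_all add: exp_add e mult_ac)
  qed
  finally have "(\<lambda>n. \<Prod>k<n. fac k z) \<longlonglongrightarrow> (\<Prod>k<m. fac k z) * exp (E m z)"
    by (rule LIMSEQ_offset)
  also have "(\<Prod>k<m. fac k z) = Z m z / D m z" by (simp add: fac_def Z_def D_def prod_dividef)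
  finally show ?thesis .
qed

lemma Q_eq: "norm z < R \<Longrightarrow> Q z = Z m z / D m z * exp (E m z)"
  unfolding Q_def using Q_limit by (rule limI)

lemma D_eq_0_iff: "D m z = 0 \<longleftrightarrow> (\<exists>k<m. z = of_real (r k))"
  using nz by (auto simp: D_def)

lemma Z_eq_0_iff: "Z m z = 0 \<longleftrightarrow> (\<exists>k<m. z = of_real (y k))"
  using nz by (auto simp: Z_def)

lemma pole_index: "norm z < R \<Longrightarrow> z = complex_of_real (r k) \<Longrightarrow> k < m"
  using m(1)[of k] by (cases "k < m") auto

lemma zero_index: "norm z < R \<Longrightarrow> z = complex_of_real (y k) \<Longrightarrow> k < m"
  using m(2)[of k] by (cases "k < m") auto

lemma \<psi>_split:
  "\<psi> z = of_real (\<sigma>\<^sup>2) * z\<^sup>2 / 2 + of_real \<mu> * z + z\<^sup>2 * T m z + z\<^sup>2 * (\<Sum>k<m. polar k z)"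
proof -
  have "(\<Sum>k. polar k z) = T m z + (\<Sum>k<m. polar k z)"
    unfolding T_def by (rule suminf_split_initial_segment[OF summable_polar])
  then show ?thesis unfolding \<psi>_eq polar_def[symmetric] by (simp add: algebra_simps)
qed

lemma H_eq:
  assumes "z \<notin> poles"
  shows "H m z = (of_real q - \<psi> z) * D m z"
proof -
  have "polar k z * D m z = of_real (A k / (r k)\<^sup>2) * (\<Prod>j\<in>{..<m}-{k}. 1 - z / of_real (r j))" if "k < m" for k
  proof -
    have ne: "complex_of_real (r k) - z \<noteq> 0" "complex_of_real (r k) \<noteq> 0" using assms nz by auto
    have "D m z = (1 - z / of_real (r k)) * (\<Prod>j\<in>{..<m}-{k}. 1 - z / of_real (r j))"
      unfolding D_def using that by (subst prod.remove[of _ k]) auto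
    moreover have "polar k z * (1 - z / of_real (r k)) = of_real (A k / (r k)\<^sup>2)"
      using ne by (simp add: polar_def divide_simps power2_eq_square)
    ultimately show ?thesis by (simp add: mult.assoc[symmetric])
  qed
  then have "(\<Sum>k<m. polar k z) * D m z = (\<Sum>k<m. of_real (A k / (r k)\<^sup>2) * (\<Prod>j\<in>{..<m}-{k}. 1 - z / of_real (r j)))"
    by (simp add: sum_distrib_right)
  then show ?thesis unfolding H_def \<psi>_split by (simp add: algebra_simps)
qed

text \<open>At \<open>r k\<close> the product \<open>D m\<close> and all residue terms except the
  one with index \<open>k\<close> vanish, and the coefficient of that one is positive. So no pole of
  \<open>\<psi>\<close> is cancelled.\<close>

lemma H_pole: assumes k: "k < m" shows "H m (of_real (r k)) \<noteq> 0"
proof -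
  let ?z = "complex_of_real (r k)"
  have D0: "D m ?z = 0" using k D_eq_0_iff by blast
  have z: "(\<Prod>j\<in>{..<m}-{i}. 1 - ?z / of_real (r j)) = 0" if "i \<noteq> k" for i
    using k that nz by (auto intro!: bexI[of _ k])
  have nz': "(\<Prod>j\<in>{..<m}-{k}. 1 - ?z / of_real (r j)) \<noteq> 0"
    using nz inj(1) by (auto simp: inj_def)
  have "(\<Sum>i<m. of_real (A i / (r i)\<^sup>2) * (\<Prod>j\<in>{..<m}-{i}. 1 - ?z / of_real (r j)))
     = (\<Sum>i<m. if i = k then of_real (A k / (r k)\<^sup>2) * (\<Prod>j\<in>{..<m}-{k}. 1 - ?z / of_real (r j)) else 0)"
    by (intro sum.cong refl) (auto simp: z)
  then show ?thesis unfolding H_def D0 using k nz nz' A[of k] by (simp del: prod_zero_iff)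
qed

lemma H_holomorphic: "H m holomorphic_on ball 0 R"
  unfolding H_def D_def using nz by (intro holomorphic_intros T_holomorphic) auto

lemma H_eq_0_imp: "norm z < R \<Longrightarrow> H m z = 0 \<Longrightarrow> z \<in> zeros"
  using H_pole pole_index[of z] H_eq[of z] D_eq_0_iff[of z] roots[of z]
  by (cases "z \<in> poles") auto

end

section \<open>Half-plane properties, simplicity of the zeros, and the quotient of the two
  sides\<close>

lemma \<psi>_0: "\<psi> 0 = 0" by (simp add: \<psi>_eq)

lemma Q_0: "Q 0 = 1"
  by (simp add: Q_def fac_def)

lemma \<psi>_sums: "(\<lambda>k. polar k z) sums (\<Sum>k. polar k z)"
  using summable_polar by (rule summable_sums)

lemma \<psi>_eq_polar: "\<psi> z = of_real (\<sigma>\<^sup>2) * z\<^sup>2 / 2 + of_real \<mu> * z + z\<^sup>2 * (\<Sum>k. polar k z)"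
  unfolding \<psi>_eq polar_def ..

lemma divide_\<psi>: "z \<noteq> 0 \<Longrightarrow> (\<psi> z - of_real q) / z
   = of_real (\<sigma>\<^sup>2) * z / 2 + of_real \<mu> - of_real q / z + z * (\<Sum>k. polar k z)"
  unfolding \<psi>_eq_polar by (simp add: field_simps power2_eq_square)

text \<open>The difference quotient of \<open>(\<psi> z - q) / z\<close> between \<open>x\<close>
  and \<open>\<zeta>\<close> is the sum of \<open>\<sigma>^2 / 2\<close>,
  \<open>q / (x * \<zeta>)\<close> and the series of
  \<open>A k / ((r k - x) * (r k - \<zeta>))\<close>. With no pole between two points of the same
  sign all of these are nonnegative. The bound is linear in the distance to the root, which makes
  the root simple.\<close>

lemma \<psi>_real_lower_bound:
  assumes x: "x \<noteq> \<zeta>" "x * \<zeta> > 0" and \<zeta>: "\<psi> (of_real \<zeta>) = of_real q"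
    and gap: "\<And>k. (r k - x) * (r k - \<zeta>) > 0"
  shows "norm (\<psi> (of_real x) - of_real q) \<ge> q / \<bar>\<zeta>\<bar> * \<bar>x - \<zeta>\<bar>"
proof -
  define X Y where "X = complex_of_real x" and "Y = complex_of_real \<zeta>"
  have ne: "X \<noteq> Y" "X \<noteq> 0" "Y \<noteq> 0" "x \<noteq> 0" "\<zeta> \<noteq> 0" using x by (auto simp: X_def Y_def)
  define B where "B = (X * (\<Sum>k. polar k X) - Y * (\<Sum>k. polar k Y)) / (X - Y)"
  have "(\<lambda>k. (X * polar k X - Y * polar k Y) / (X - Y)) sums B"
    unfolding B_def by (intro sums_divide sums_diff sums_mult \<psi>_sums)
  also have "(\<lambda>k. (X * polar k X - Y * polar k Y) / (X - Y)) = (\<lambda>k. of_real (A k / ((r k - x) * (r k - \<zeta>))))"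
  proof
    fix k
    have "complex_of_real (r k) \<noteq> 0" "of_real (r k) - X \<noteq> 0" "of_real (r k) - Y \<noteq> 0" "X - Y \<noteq> 0"
      using gap[of k] nz ne by (auto simp: X_def Y_def)
    moreover have "(X * (a / (\<rho> * (\<rho> - X))) - Y * (a / (\<rho> * (\<rho> - Y)))) / (X - Y) = a / ((\<rho> - X) * (\<rho> - Y))"
      if "\<rho> \<noteq> 0" "\<rho> - X \<noteq> 0" "\<rho> - Y \<noteq> 0" "X - Y \<noteq> 0" for \<rho> a :: complex
    proof -
      have e: "V * (a / (\<rho> * (\<rho> - V))) = a / (\<rho> - V) - a / \<rho>" if "\<rho> \<noteq> 0" "\<rho> - V \<noteq> 0" for V
        using that by (subst diff_frac_eq) (simp_all add: algebra_simps)
      have "a / (\<rho> - X) - a / (\<rho> - Y) = a * (X - Y) / ((\<rho> - X) * (\<rho> - Y))"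
        using that by (subst diff_frac_eq) (simp_all add: algebra_simps)
      then show ?thesis using that e[of X] e[of Y] by simp
    qed
    ultimately have "(X * polar k X - Y * polar k Y) / (X - Y) = of_real (A k) / ((of_real (r k) - X) * (of_real (r k) - Y))"
      unfolding polar_def by blast
    then show "(X * polar k X - Y * polar k Y) / (X - Y) = of_real (A k / ((r k - x) * (r k - \<zeta>)))"
      by (simp add: X_def Y_def)
  qed
  finally have 1: "(\<lambda>k. complex_of_real (A k / ((r k - x) * (r k - \<zeta>)))) sums B" .
  have 2: "(\<lambda>k. A k / ((r k - x) * (r k - \<zeta>))) sums Re B" using sums_Re[OF 1] by (simp only: Re_complex_of_real)
  have "0 \<le> A k / ((r k - x) * (r k - \<zeta>))" for k using gap[of k] A[of k] by (intro divide_nonneg_pos) auto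
  then have B: "Re B \<ge> 0" using sums_le[OF _ sums_zero 2] by blast
  have "((\<psi> X - of_real q) / X - (\<psi> Y - of_real q) / Y) / (X - Y) = of_real (\<sigma>\<^sup>2 / 2 + q / (x * \<zeta>)) + B"
  proof -
    define SX SY where "SX = (\<Sum>k. polar k X)" and "SY = (\<Sum>k. polar k Y)"
    have "of_real q / Y - of_real q / X = of_real q / (X * Y) * (X - Y)"
      using ne(2,3) by (subst diff_frac_eq) (simp_all add: algebra_simps)
    moreover have "(c * X / 2 + u - a + b) - (c * Y / 2 + u - a' + b') = (c / 2 + k) * (X - Y) + (b - b')"
      if "a' - a = k * (X - Y)" for a a' b b' c u k :: complex
      unfolding distrib_right that[symmetric] by (simp add: algebra_simps diff_divide_distrib)
    ultimately have "(\<psi> X - of_real q) / X - (\<psi> Y - of_real q) / Y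
       = (of_real (\<sigma>\<^sup>2) / 2 + of_real q / (X * Y)) * (X - Y) + (X * SX - Y * SY)"
      unfolding divide_\<psi>[OF ne(2)] divide_\<psi>[OF ne(3)] SX_def[symmetric] SY_def[symmetric] by blast
    then show ?thesis unfolding B_def SX_def[symmetric] SY_def[symmetric] using ne(1)
      by (simp add: add_divide_distrib X_def Y_def)
  qed
  then have "(\<psi> X - of_real q) / X / (X - Y) = of_real (\<sigma>\<^sup>2 / 2 + q / (x * \<zeta>)) + B"
    using \<zeta> by (simp add: Y_def)
  then have "Re ((\<psi> X - of_real q) / X / (X - Y)) \<ge> q / (x * \<zeta>)" using B by simp
  then have "norm ((\<psi> X - of_real q) / X / (X - Y)) \<ge> q / (x * \<zeta>)"
    using complex_Re_le_cmod order_trans by blast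
  moreover have "norm (X - Y) = \<bar>x - \<zeta>\<bar>" unfolding X_def Y_def of_real_diff[symmetric] norm_of_real ..
  ultimately have "norm (\<psi> X - of_real q) / \<bar>x\<bar> / \<bar>x - \<zeta>\<bar> \<ge> q / (x * \<zeta>)"
    by (simp only: norm_divide X_def norm_of_real)
  then have "q / (x * \<zeta>) * (\<bar>x\<bar> * \<bar>x - \<zeta>\<bar>) \<le> norm (\<psi> X - of_real q)"
    using x ne by (simp add: pos_le_divide_eq)
  moreover have "q / (x * \<zeta>) * (\<bar>x\<bar> * \<bar>x - \<zeta>\<bar>) = q / \<bar>\<zeta>\<bar> * \<bar>x - \<zeta>\<bar>"
  proof -
    have "x * \<zeta> = \<bar>x\<bar> * \<bar>\<zeta>\<bar>" using x by (simp flip: abs_mult)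
    then show ?thesis using ne by simp
  qed
  ultimately show ?thesis by (simp add: X_def)
qed

text \<open>Every pole term times \<open>z\<close> equals \<open>A k / (r k - z)\<close> minus a
  real constant and so has nonnegative imaginary part; strict positivity comes from
  \<open>- q / z\<close>.\<close>

lemma \<psi>_Im_pos:
  assumes "Im z > 0" shows "Im ((\<psi> z - of_real q) / z) > 0"
proof -
  have z0: "z \<noteq> 0" using assms by auto
  have Im_div: "Im (of_real a / w) = - a * Im w / (norm w)\<^sup>2" for a and w :: complex
    by (simp add: Im_divide cmod_power2)
  have 1: "(\<lambda>k. Im (z * polar k z)) sums Im (z * (\<Sum>k. polar k z))"
    by (rule sums_Im[OF sums_mult[OF \<psi>_sums]])
  have 2: "0 \<le> Im (z * polar k z)" for k
  proof -
    have "of_real (r k) - z \<noteq> 0" using assms by auto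
    then have "z * polar k z = of_real (A k) / (of_real (r k) - z) - of_real (A k) / of_real (r k)"
      unfolding polar_def using nz by (subst diff_frac_eq) (simp_all add: algebra_simps)
    then have "Im (z * polar k z) = A k * Im z / (norm (of_real (r k) - z))\<^sup>2"
      by (simp add: Im_div flip: of_real_divide)
    then show ?thesis using assms A[of k] by simp
  qed
  have "Im (z * (\<Sum>k. polar k z)) \<ge> 0" by (rule sums_le[OF 2 sums_zero 1])
  moreover have "Im (of_real q / z) < 0"
    unfolding Im_div using assms q z0 by simp
  moreover have "Im (of_real (\<sigma>\<^sup>2) * z / 2) \<ge> 0" using assms by simp
  ultimately show ?thesis unfolding divide_\<psi>[OF z0] by simp
qed

lemma Q_tendsto: "(\<lambda>n. \<Prod>k<n. fac k z) \<longlonglongrightarrow> Q z"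
proof -
  obtain m where "\<And>k. k \<ge> m \<Longrightarrow> 2 * (norm z + 1) \<le> \<bar>r k\<bar>" "\<And>k. k \<ge> m \<Longrightarrow> 2 * (norm z + 1) \<le> \<bar>y k\<bar>"
    using escape[of "norm z + 1"] by blast
  from Q_limit[OF this, where z=z] Q_eq[OF this, where z=z] show ?thesis by simp
qed

lemma Q_Im_nonneg:
  assumes "Im z > 0" shows "Im (- (1 / z) * Q z) \<ge> 0"
proof -
  have "(\<lambda>n. \<Prod>k<2*n. fac k z) \<longlonglongrightarrow> Q z"
    using LIMSEQ_subseq_LIMSEQ[OF Q_tendsto, of "\<lambda>n. 2 * n"] by (simp add: strict_mono_def comp_def)
  then have "(\<lambda>n. Im (- (1 / z) * (\<Prod>k<2*n. fac k z))) \<longlonglongrightarrow> Im (- (1 / z) * Q z)"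
    by (intro tendsto_intros)
  then show ?thesis
    by (rule LIMSEQ_le_const) (use herglotz[OF assms] in \<open>auto simp: fac_def\<close>)
qed

lemma \<psi>_cnj: "\<psi> (cnj z) = cnj (\<psi> z)"
proof -
  have "(\<lambda>k. cnj (polar k z)) sums cnj (\<Sum>k. polar k z)" using \<psi>_sums by (simp only: sums_cnj)
  then have "(\<lambda>k. polar k (cnj z)) sums cnj (\<Sum>k. polar k z)" by (simp add: polar_def)
  then show ?thesis by (simp add: \<psi>_eq_polar sums_iff)
qed

lemma Q_cnj: "Q (cnj z) = cnj (Q z)"
proof -
  have "(\<lambda>n. cnj (\<Prod>k<n. fac k z)) \<longlonglongrightarrow> cnj (Q z)" by (intro tendsto_cnj Q_tendsto)
  then have "(\<lambda>n. \<Prod>k<n. fac k (cnj z)) \<longlonglongrightarrow> cnj (Q z)" by (simp add: fac_def)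
  then show ?thesis using Q_tendsto LIMSEQ_unique by blast
qed

definition ratio :: "complex \<Rightarrow> complex" where
  "ratio z = (of_real q - \<psi> z) / (of_real q * Q z)"

lemma ratio_cnj: "ratio (cnj z) = cnj (ratio z)"
  by (simp add: ratio_def \<psi>_cnj Q_cnj)

text \<open>\<open>(\<psi> z - q) / z\<close> is \<open>ratio z\<close> times a positive multiple of
  \<open>- (1 / z) * Q z\<close>. In the upper half-plane the first has positive and the last
  nonnegative imaginary part, which a negative quotient would contradict; conjugation covers the
  lower half-plane.\<close>

lemma ratio_not_negative:
  assumes "Im z \<noteq> 0" "c > 0" shows "ratio z \<noteq> - of_real c"
proof
  assume eq: "ratio z = - of_real c"
  have *: False if "Im z > 0" "ratio z = - of_real c" for z
  proof (cases "Q z = 0")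
    \<comment> \<open>Here the quotient is 0 because of \<open>x / 0 = 0\<close>, and
      \<open>- of_real c\<close> is not 0.\<close>
    case True
    then show False using that assms by (simp add: ratio_def)
  next
    case False
    have z0: "z \<noteq> 0" using that by auto
    have "(\<psi> z - of_real q) / z = - (1 / z) * (of_real q * Q z) * ratio z"
      using False q z0 by (simp add: ratio_def field_simps)
    also have "\<dots> = of_real (- c * q) * (- (1 / z) * Q z)" using that by simp
    finally have "Im ((\<psi> z - of_real q) / z) = (- c * q) * Im (- (1 / z) * Q z)"
      by (simp only: Im_complex_of_real times_complex.sel Re_complex_of_real mult_zero_left add_0_right)
    moreover have "(- c * q) * Im (- (1 / z) * Q z) \<le> 0"
      using Q_Im_nonneg[OF that(1)] assms q by (intro mult_nonpos_nonneg) auto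
    ultimately show False using \<psi>_Im_pos[OF that(1)] by linarith
  qed
  show False
  proof (cases "Im z > 0")
    case True then show False using * eq by blast
  next
    case False
    then show False using *[of "cnj z"] assms eq by (simp add: ratio_cnj)
  qed
qed

text \<open>Only finitely many poles lie near a given zero, and none of them coincides with
  it.\<close>

lemma pole_gap: "\<exists>\<delta>>0. \<forall>j. \<delta> \<le> \<bar>r j - y k\<bar>"
proof -
  obtain m where m: "\<forall>j\<ge>m. 2 * (\<bar>y k\<bar> + 1) \<le> \<bar>r j\<bar>" using escape by blast
  obtain \<delta> where d: "\<delta> > 0" "\<forall>x\<in>r ` {..<m}. x \<noteq> y k \<longrightarrow> \<delta> \<le> dist (y k) x"
    using finite_set_avoid[of "r ` {..<m}" "y k"] by auto
  have "min \<delta> 1 \<le> \<bar>r j - y k\<bar>" for j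
  proof (cases "j < m")
    case True
    then have "\<delta> \<le> dist (y k) (r j)" using d(2) disj[of k j] by (metis imageI lessThan_iff)
    then show ?thesis by (auto simp: dist_real_def)
  next
    case False
    then have "2 * (\<bar>y k\<bar> + 1) \<le> \<bar>r j\<bar>" using m by auto
    then have "1 \<le> \<bar>r j - y k\<bar>" by (rule abs_diff_ge_1)
    then show ?thesis by simp
  qed
  then show ?thesis using d(1) by (intro exI[of _ "min \<delta> 1"]) auto
qed

lemma \<psi>_y: "\<psi> (of_real (y k)) = of_real q"
proof -
  have "complex_of_real (y k) \<notin> poles" using disj by auto
  then show ?thesis using roots by blast
qed

text \<open>A double zero would make \<open>H m (\<zeta> + h) / h\<close> tend to 0, against the
  linear lower bound on the real axis.\<close>

lemma deriv_H_nonzero: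
  assumes m: "\<And>k. k \<ge> m \<Longrightarrow> 2 * R \<le> \<bar>r k\<bar>" "\<And>k. k \<ge> m \<Longrightarrow> 2 * R \<le> \<bar>y k\<bar>" and k: "\<bar>y k\<bar> < R"
  shows "deriv (H m) (of_real (y k)) \<noteq> 0"
proof
  assume d0: "deriv (H m) (of_real (y k)) = 0"
  define \<zeta> where "\<zeta> = y k"
  have yp: "complex_of_real (y k) \<notin> poles" using disj by auto
  have H0: "H m (of_real \<zeta>) = 0" using H_eq[OF m yp] \<psi>_y by (simp add: \<zeta>_def)
  have "H m field_differentiable at (of_real \<zeta>)"
    using H_holomorphic[OF m] k by (intro holomorphic_on_imp_differentiable_at[of _ "ball 0 R"]) (auto simp: \<zeta>_def)
  then have "(H m has_field_derivative 0) (at (of_real \<zeta>))"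
    using d0 DERIV_deriv_iff_field_differentiable unfolding \<zeta>_def by metis
  then have lim: "((\<lambda>h. H m (of_real \<zeta> + h) / h) \<longlongrightarrow> 0) (at 0)"
    by (simp add: DERIV_def H0)
  have D0: "D m (of_real \<zeta>) \<noteq> 0" using D_eq_0_iff[OF m] yp by (auto simp: \<zeta>_def)
  have "isCont (D m) (of_real \<zeta>)" unfolding D_def using nz by (intro continuous_intros) auto
  then have "((\<lambda>h. D m (of_real \<zeta> + h)) \<longlongrightarrow> D m (of_real \<zeta>)) (at 0)"
    by (simp add: isCont_def LIM_offset_zero_iff)
  then have lim2: "((\<lambda>h. H m (of_real \<zeta> + h) / h / D m (of_real \<zeta> + h)) \<longlongrightarrow> 0 / D m (of_real \<zeta>)) (at 0)"
    by (intro tendsto_divide lim D0)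
  \<comment> \<open>Points approaching \<open>\<zeta>\<close> from the right, at distance at most
    half its modulus, so that \<open>\<zeta> + X n\<close> keeps the sign of
    \<open>\<zeta>\<close>.\<close>
  define X where "X n = (min 1 (\<bar>\<zeta>\<bar> / 2)) / real (Suc n)" for n
  obtain \<delta> where \<delta>: "\<delta> > 0" "\<And>j. \<delta> \<le> \<bar>r j - \<zeta>\<bar>" using pole_gap[of k] by (auto simp: \<zeta>_def)
  have z0: "\<zeta> \<noteq> 0" using nz by (simp add: \<zeta>_def)
  have X0: "X n > 0" "X n \<le> \<bar>\<zeta>\<bar> / 2" for n
  proof -
    show "X n > 0" using z0 by (simp add: X_def)
    have "X n \<le> min 1 (\<bar>\<zeta>\<bar> / 2) / 1" unfolding X_def by (intro divide_left_mono) auto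
    then show "X n \<le> \<bar>\<zeta>\<bar> / 2" by simp
  qed
  have Xlim: "X \<longlonglongrightarrow> 0" unfolding X_def by (rule lim_const_over_n[THEN LIMSEQ_Suc])
  then have "(\<lambda>n. complex_of_real (X n)) \<longlonglongrightarrow> of_real 0" by (rule tendsto_of_real)
  then have "filterlim (\<lambda>n. complex_of_real (X n)) (at 0) sequentially"
    using X0 by (auto simp: filterlim_at intro!: always_eventually less_imp_neq[symmetric])
  from filterlim_compose[OF lim2 this]
  have "(\<lambda>n. H m (of_real (\<zeta> + X n)) / of_real (X n) / D m (of_real (\<zeta> + X n))) \<longlonglongrightarrow> 0" by simp
  then have "\<forall>\<^sub>F n in sequentially. norm (H m (of_real (\<zeta> + X n)) / of_real (X n) / D m (of_real (\<zeta> + X n))) < q / \<bar>\<zeta>\<bar>"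
    using q z0 by (auto dest!: tendstoD[of _ _ _ "q / \<bar>\<zeta>\<bar>"])
  moreover have "\<forall>\<^sub>F n in sequentially. X n < \<delta>" using Xlim \<delta>(1) by (rule order_tendstoD)
  ultimately have "\<forall>\<^sub>F n in sequentially. norm (H m (of_real (\<zeta> + X n)) / of_real (X n) / D m (of_real (\<zeta> + X n))) < q / \<bar>\<zeta>\<bar> \<and> X n < \<delta>"
    by (rule eventually_conj)
  then obtain n where n: "norm (H m (of_real (\<zeta> + X n)) / of_real (X n) / D m (of_real (\<zeta> + X n))) < q / \<bar>\<zeta>\<bar>" "X n < \<delta>"
    by (auto simp: eventually_sequentially)
  define x where "x = \<zeta> + X n"
  have gap: "(r j - x) * (r j - \<zeta>) > 0" for j
    using \<delta>(2)[of j] n(2) X0(1)[of n] by (auto simp: x_def zero_less_mult_iff abs_if split: if_splits)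
  have xp: "complex_of_real x \<notin> poles"
  proof
    assume "complex_of_real x \<in> poles"
    then obtain j where "x = r j" by auto
    then show False using gap[of j] by simp
  qed
  have "q / \<bar>\<zeta>\<bar> * \<bar>x - \<zeta>\<bar> \<le> norm (\<psi> (of_real x) - of_real q)"
  proof (rule \<psi>_real_lower_bound[OF _ _ _ gap])
    show "x \<noteq> \<zeta>" using X0(1)[of n] by (simp add: x_def)
    show "x * \<zeta> > 0" using X0[of n] z0 by (auto simp: x_def zero_less_mult_iff abs_if split: if_splits)
    show "\<psi> (of_real \<zeta>) = of_real q" using \<psi>_y by (simp add: \<zeta>_def)
  qed
  then have *: "q / \<bar>\<zeta>\<bar> \<le> norm (\<psi> (of_real x) - of_real q) / X n" using X0[of n] by (simp add: x_def pos_le_divide_eq)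
  have "D m (of_real x) \<noteq> 0" using D_eq_0_iff[OF m] xp by auto
  then have "H m (of_real x) / of_real (X n) / D m (of_real x) = (of_real q - \<psi> (of_real x)) / of_real (X n)"
    using H_eq[OF m xp] by simp
  then have "norm (H m (of_real x) / of_real (X n) / D m (of_real x)) = norm (\<psi> (of_real x) - of_real q) / X n"
    using X0(1)[of n] by (simp add: norm_divide norm_minus_commute)
  then show False using n(1) * by (simp add: x_def)
qed

text \<open>Away from the zeros the factor \<open>D m\<close> cancels between \<open>H m\<close> and
  \<open>Q\<close>, which removes the poles. At a zero both \<open>H m\<close> and
  \<open>Z m\<close> vanish to first order, and the common linear factor is divided out. The
  resulting \<open>h\<close> is holomorphic and nonzero at \<open>z0\<close>.\<close>

lemma ratio_local:
  "\<exists>\<epsilon>>0. \<exists>h. h holomorphic_on ball z0 \<epsilon> \<and> h z0 \<noteq> 0 \<and>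
     (\<forall>z\<in>ball z0 \<epsilon>. (z \<noteq> z0 \<longrightarrow> z \<notin> poles \<union> zeros) \<and> (z \<notin> poles \<union> zeros \<longrightarrow> ratio z = h z))"
proof -
  define R where "R = norm z0 + 1"
  obtain m where m: "\<And>k. k \<ge> m \<Longrightarrow> 2 * R \<le> \<bar>r k\<bar>" "\<And>k. k \<ge> m \<Longrightarrow> 2 * R \<le> \<bar>y k\<bar>"
    using escape[of R] by blast
  define S where "S = (\<lambda>k. complex_of_real (r k)) ` {..<m} \<union> (\<lambda>k. complex_of_real (y k)) ` {..<m}"
  have "finite S" by (simp add: S_def)
  then obtain \<epsilon>0 where e0: "\<epsilon>0 > 0" "\<forall>x\<in>S. x \<noteq> z0 \<longrightarrow> \<epsilon>0 \<le> dist z0 x" using finite_set_avoid by blast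
  define \<epsilon> where "\<epsilon> = min \<epsilon>0 1"
  have e: "\<epsilon> > 0" using e0 by (simp add: \<epsilon>_def)
  have sub: "norm z < R" if "z \<in> ball z0 \<epsilon>" for z
    using that norm_triangle_ineq2[of z z0] by (auto simp: R_def \<epsilon>_def dist_norm norm_minus_commute)
  then have subB: "ball z0 \<epsilon> \<subseteq> ball 0 R" by auto
  have avoid: "z \<notin> poles \<union> zeros" if "z \<in> ball z0 \<epsilon>" "z \<noteq> z0" for z
  proof
    assume "z \<in> poles \<union> zeros"
    then have "z \<in> S" using pole_index[OF m sub[OF that(1)]] zero_index[OF m sub[OF that(1)]] by (auto simp: S_def)
    then show False using e0(2) that by (auto simp: \<epsilon>_def)
  qed
  have Eh: "E m holomorphic_on ball z0 \<epsilon>" using E_holomorphic[OF m] subB holomorphic_on_subset by blast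
  have Hh: "H m holomorphic_on ball z0 \<epsilon>" using H_holomorphic[OF m] subB holomorphic_on_subset by blast
  have ratio: "ratio z = H m z / (of_real q * (Z m z * exp (E m z)))" if "z \<in> ball z0 \<epsilon>" "z \<notin> poles \<union> zeros" for z
  proof -
    have "D m z \<noteq> 0" using D_eq_0_iff[OF m] that by auto
    moreover have "Q z = Z m z / D m z * exp (E m z)" by (rule Q_eq[OF m sub[OF that(1)]])
    moreover have "H m z = (of_real q - \<psi> z) * D m z" using that by (intro H_eq[OF m]) auto
    moreover have "a / (b * (c / d * e)) = a * d / (b * (c * e))" if "d \<noteq> 0" for a b c d e :: complex
      using that by simp
    ultimately show ?thesis by (simp only: ratio_def)
  qed
  show ?thesis
  proof (cases "z0 \<in> zeros")
    case False
    define h where "h z = H m z / (of_real q * (Z m z * exp (E m z)))" for z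
    have Z0: "Z m z \<noteq> 0" if "z \<in> ball z0 \<epsilon>" for z
      using Z_eq_0_iff[OF m] that False avoid[OF that] by (cases "z = z0") auto
    have "Z m holomorphic_on ball z0 \<epsilon>"
      unfolding Z_def[abs_def] using nz by (intro holomorphic_intros) auto
    then have "h holomorphic_on ball z0 \<epsilon>"
      unfolding h_def using q Z0 by (intro holomorphic_intros Eh Hh) auto
    moreover have "h z0 \<noteq> 0"
      using H_eq_0_imp[OF m, where z=z0] False sub[of z0] e q Z_eq_0_iff[OF m] by (auto simp: h_def)
    ultimately show ?thesis using e avoid ratio by (intro exI[of _ \<epsilon>] conjI exI[of _ h]) (auto simp: h_def)
  next
    case True
    then obtain k where k: "z0 = of_real (y k)" by auto
    have km: "k < m" using zero_index[OF m sub[of z0] k] e by simp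
    have z0p: "z0 \<notin> poles" using k disj by auto
    have H0: "H m z0 = 0" using H_eq[OF m z0p] \<psi>_y k by simp
    \<comment> \<open>The zero of \<open>H m\<close> divided out; its value at \<open>z0\<close> is
      the derivative, nonzero by \<open>deriv_H_nonzero\<close>.\<close>
    define H1 where "H1 z = (if z = z0 then deriv (H m) z0 else (H m z - H m z0) / (z - z0))" for z
    define Z1 where "Z1 z = - (1 / complex_of_real (y k)) * (\<Prod>j\<in>{..<m}-{k}. 1 - z / of_real (y j))" for z
    have H1h: "H1 holomorphic_on ball z0 \<epsilon>" unfolding H1_def by (rule pole_lemma_open[OF Hh]) simp
    have Z1h: "Z1 holomorphic_on ball z0 \<epsilon>" unfolding Z1_def using nz by (intro holomorphic_intros) auto
    have ZZ1: "Z m z = (z - z0) * Z1 z" for z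
    proof -
      have "Z m z = (1 - z / of_real (y k)) * (\<Prod>j\<in>{..<m}-{k}. 1 - z / of_real (y j))"
        unfolding Z_def using km by (intro prod.remove) auto
      also have "1 - z / of_real (y k) = (z - z0) * (- (1 / of_real (y k)))"
        using nz[of k] unfolding k by (simp add: left_diff_distrib diff_divide_distrib)
      finally show ?thesis by (simp only: Z1_def mult.assoc)
    qed
    have Z10: "Z1 z \<noteq> 0" if "z \<in> ball z0 \<epsilon>" for z
    proof (cases "z = z0")
      case True
      have "1 - z0 / of_real (y j) \<noteq> 0" if "j \<noteq> k" for j
      proof
        assume "1 - z0 / of_real (y j) = 0"
        then have "complex_of_real (y j) = of_real (y k)" using nz[of j] k by simp
        then show False using injD[OF inj(2), of j k] that by simp
      qed
      then have "(\<Prod>j\<in>{..<m}-{k}. 1 - z0 / of_real (y j)) \<noteq> 0" by (subst prod_zero_iff) auto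
      then show ?thesis using nz[of k] unfolding Z1_def True by simp
    next
      case False
      then show ?thesis using avoid[OF that False] ZZ1[of z] Z_eq_0_iff[OF m, where z=z] by auto
    qed
    define h where "h z = H1 z / (of_real q * (Z1 z * exp (E m z)))" for z
    have "h holomorphic_on ball z0 \<epsilon>"
      unfolding h_def using q Z10 by (intro holomorphic_intros H1h Z1h Eh) auto
    moreover have "h z0 \<noteq> 0"
      using deriv_H_nonzero[OF m, where k=k] sub[of z0] e q Z10[of z0] by (auto simp: h_def H1_def k)
    moreover have "ratio z = h z" if "z \<in> ball z0 \<epsilon>" "z \<notin> poles \<union> zeros" for z
    proof -
      have "z \<noteq> z0" using that True by auto
      then show ?thesis unfolding ratio[OF that] ZZ1 h_def H1_def H0 by simp
    qed
    ultimately show ?thesis using e avoid by (intro exI[of _ \<epsilon>] conjI exI[of _ h]) auto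
  qed
qed

lemma zero_regular: "0 \<notin> poles \<union> zeros" using nz by auto

theorem factorization:
  assumes "z \<notin> poles" "z \<notin> zeros"
  shows "of_real q - \<psi> z = of_real q * Q z" and "Q z \<noteq> 0"
proof -
  \<comment> \<open>At poles and zeros \<open>ratio\<close> has a default value produced by division
    by zero, so the limit is taken instead.\<close>
  define F where "F z = (if z \<in> poles \<union> zeros then Lim (at z) ratio else ratio z)" for z
  have loc: "\<exists>\<epsilon>>0. \<exists>h. h holomorphic_on ball z0 \<epsilon> \<and> h z0 \<noteq> 0 \<and> (\<forall>z\<in>ball z0 \<epsilon>. F z = h z)" for z0
  proof -
    obtain \<epsilon> h where h: "\<epsilon> > 0" "h holomorphic_on ball z0 \<epsilon>" "h z0 \<noteq> 0"
      "\<And>z. z \<in> ball z0 \<epsilon> \<Longrightarrow> z \<noteq> z0 \<Longrightarrow> z \<notin> poles \<union> zeros"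
      "\<And>z. z \<in> ball z0 \<epsilon> \<Longrightarrow> z \<notin> poles \<union> zeros \<Longrightarrow> ratio z = h z"
      using ratio_local[of z0] by blast
    have "isCont h z0" using h(1,2) by (intro continuous_on_interior[of "ball z0 \<epsilon>"] holomorphic_on_imp_continuous_on) auto
    then have "(h \<longlongrightarrow> h z0) (at z0)" by (simp add: isCont_def)
    moreover have "eventually (\<lambda>z. h z = ratio z) (at z0)"
      unfolding eventually_at using h by (intro exI[of _ \<epsilon>]) (auto simp: dist_commute)
    ultimately have "(ratio \<longlongrightarrow> h z0) (at z0)" by (rule Lim_transform_eventually)
    then have "Lim (at z0) ratio = h z0" by (intro tendsto_Lim) auto
    then have "F z = h z" if "z \<in> ball z0 \<epsilon>" for z
      using that h(4,5)[OF that] by (cases "z = z0") (auto simp: F_def)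
    then show ?thesis using h(1-3) by blast
  qed
  have Fh: "F holomorphic_on UNIV"
  proof (rule holomorphic_onI)
    fix z0
    obtain \<epsilon> h where h: "\<epsilon> > 0" "h holomorphic_on ball z0 \<epsilon>" "\<And>z. z \<in> ball z0 \<epsilon> \<Longrightarrow> F z = h z" using loc by blast
    then have "F holomorphic_on ball z0 \<epsilon>" using holomorphic_transform[OF h(2), of F] by simp
    then show "F field_differentiable at z0 within UNIV"
      using h(1) by (intro holomorphic_on_imp_differentiable_at[of _ "ball z0 \<epsilon>"]) auto
  qed
  have F0: "F z \<noteq> 0" for z using loc[of z] by (metis centre_in_ball)
  have F1: "F 0 = 1" using zero_regular q by (simp add: F_def ratio_def \<psi>_0 Q_0)
  have Foff: "F z = ratio z" if "Im z \<noteq> 0" for z using that by (auto simp: F_def)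
  have contF: "isCont F z" for z using Fh holomorphic_on_imp_continuous_on continuous_on_eq_continuous_at open_UNIV by blast
  \<comment> \<open>The approaches from above and from below have conjugate values and the same
    limit.\<close>
  have real: "Im (F (of_real x)) = 0" for x
  proof -
    have lim: "(\<lambda>n. of_real x + \<i> * of_real (c / real (Suc n))) \<longlonglongrightarrow> complex_of_real x" for c :: real
    proof -
      have "(\<lambda>n. of_real x + \<i> * of_real (c / real (Suc n))) \<longlonglongrightarrow> of_real x + \<i> * of_real 0"
        by (intro tendsto_intros lim_const_over_n[THEN LIMSEQ_Suc])
      then show ?thesis by simp
    qed
    have 1: "(\<lambda>n. F (of_real x + \<i> * of_real (1 / real (Suc n)))) \<longlonglongrightarrow> F (of_real x)"
      by (rule isCont_tendsto_compose[OF contF lim])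
    have 2: "(\<lambda>n. F (of_real x + \<i> * of_real ((-1) / real (Suc n)))) \<longlonglongrightarrow> F (of_real x)"
      by (rule isCont_tendsto_compose[OF contF lim])
    have "F (of_real x + \<i> * of_real ((-1) / real (Suc n))) = cnj (F (of_real x + \<i> * of_real (1 / real (Suc n))))" for n
    proof -
      define w where "w = of_real x + \<i> * of_real (1 / real (Suc n))"
      have "of_real x + \<i> * of_real ((-1) / real (Suc n)) = cnj w" by (simp add: complex_eq_iff w_def)
      moreover have "Im w \<noteq> 0" by (simp add: w_def)
      ultimately show ?thesis by (metis Foff ratio_cnj complex_cnj w_def cnj.simps(2) neg_equal_0_iff_equal)
    qed
    with 2 tendsto_cnj[OF 1] have "F (of_real x) = cnj (F (of_real x))"
      using LIMSEQ_unique by auto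
    then show ?thesis by (simp add: complex_eq_iff)
  qed
  define u where "u x = Re (F (of_real x))" for x
  have ucont: "continuous_on A u" for A unfolding u_def
    by (intro continuous_at_imp_continuous_on ballI continuous_intros isCont_o2[OF _ contF])
  have u0: "u x \<noteq> 0" for x using F0[of "of_real x"] real[of x] by (auto simp: u_def complex_eq_iff)
  \<comment> \<open>The real-valued restriction is continuous without zeros and equals 1 at 0; a
    sign change would contradict the intermediate value theorem.\<close>
  have upos: "u x > 0" for x
  proof (rule ccontr)
    assume "\<not> u x > 0"
    then have neg: "u x \<le> 0" by simp
    have one: "u 0 = 1" by (simp add: u_def F1)
    show False
    proof (cases "x \<ge> 0")
      case True
      then show False using IVT2'[of u x 0 0] neg one ucont u0 by auto
    next
      case False
      then show False using IVT'[of u x 0 0] neg one ucont u0 by auto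
    qed
  qed
  have neg: "F z \<noteq> - of_real c" if "c > 0" for z c
  proof (cases "Im z = 0")
    case True
    then have "z = of_real (Re z)" by (simp add: complex_eq_iff)
    then show ?thesis using upos[of "Re z"] that by (auto simp: u_def)
  next
    case False
    then show ?thesis using ratio_not_negative that Foff by simp
  qed
  \<comment> \<open>Any two negative reals would serve as the omitted values in Picard's
    theorem.\<close>
  have "F z \<notin> {-1, -2}" for z using neg[of 1 z] neg[of 2 z] by simp
  then have "range F \<inter> {-1, -2} = {}" by blast
  then obtain c where "F = (\<lambda>z. c)" using little_Picard[OF Fh, of "-1" "-2"] by auto
  then have "F z = 1" using F1 by metis
  then have "ratio z = 1" using assms by (simp add: F_def)
  then show "of_real q - \<psi> z = of_real q * Q z" "Q z \<noteq> 0" by (auto simp: ratio_def divide_eq_1_iff)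
qed

end

section \<open>Infinite products of beta variables\<close>

lemma borel_measurable_beta_density [measurable]: "beta_density a b \<in> borel_measurable borel"
  unfolding beta_density_def by measurable

lemma sets_beta_distribution [simp, measurable_cong]: "sets (beta_distribution a b) = sets borel"
  and space_beta_distribution [simp]: "space (beta_distribution a b) = UNIV"
  by (simp_all add: beta_distribution_def)

lemma AE_beta_distribution: "AE x in beta_distribution a b. 0 < x \<and> x < 1"
  unfolding beta_distribution_def by (subst AE_density) (auto simp: beta_density_def intro!: AE_I2)

lemma nn_integral_beta_powr:
  assumes ab: "a > 0" "b > 0" "a + r > 0"
  shows "(\<integral>\<^sup>+x. ennreal (x powr r) \<partial>beta_distribution a b)
    = ennreal (Gamma (a + r) * Gamma (a + b) / (Gamma a * Gamma (a + b + r)))"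
proof -
  define f where "f t = t powr (a + r - 1) * (1 - t) powr (b - 1)" for t :: real
  define c where "c = Gamma (a + b) / (Gamma a * Gamma b)"
  have G: "Gamma (a + b) > 0" "Gamma a > 0" "Gamma b > 0" using ab by (auto intro!: Gamma_real_pos)
  then have c: "c \<ge> 0" by (simp add: c_def)
  have fm [measurable]: "f \<in> borel_measurable borel" unfolding f_def by measurable
  have "(f has_integral Beta (a + r) b) {0..1}"
    unfolding f_def by (rule has_integral_Beta_real) (use ab in auto)
  moreover have "0 \<le> f x" for x by (simp add: f_def)
  ultimately have I: "(\<integral>\<^sup>+t. ennreal (f t) * indicator {0..1} t \<partial>lborel) = ennreal (Beta (a + r) b)"
    by (intro nn_integral_has_integral_lebesgue')
  have "(\<integral>\<^sup>+x. ennreal (x powr r) \<partial>beta_distribution a b)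
    = (\<integral>\<^sup>+x. ennreal (beta_density a b x) * ennreal (x powr r) \<partial>lborel)"
    unfolding beta_distribution_def by (subst nn_integral_density) auto
  also have "\<dots> = (\<integral>\<^sup>+x. ennreal c * (ennreal (f x) * indicator {0..1} x) \<partial>lborel)"
  proof (intro nn_integral_cong)
    fix x
    show "ennreal (beta_density a b x) * ennreal (x powr r) = ennreal c * (ennreal (f x) * indicator {0..1} x)"
    proof (cases "0 < x \<and> x < 1")
      case True
      have "x powr (a - 1) * x powr r = x powr (a + r - 1)"
        unfolding powr_add[symmetric] by (rule arg_cong) simp
      then have "beta_density a b x * x powr r = c * f x" using True
        by (simp add: beta_density_def c_def f_def mult_ac)
      moreover have "beta_density a b x \<ge> 0" using True G by (simp add: beta_density_def)
      ultimately show ?thesis using True c by (simp add: f_def flip: ennreal_mult)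
    next
      case False
      then show ?thesis by (cases "x = 0"; cases "x = 1") (auto simp: beta_density_def f_def)
    qed
  qed
  also have "\<dots> = ennreal c * ennreal (Beta (a + r) b)" by (subst nn_integral_cmult) (auto simp: I)
  also have "\<dots> = ennreal (c * Beta (a + r) b)" using c by (intro ennreal_mult'[symmetric]) auto
  also have "c * Beta (a + r) b = Gamma (a + r) * Gamma (a + b) / (Gamma a * Gamma (a + b + r))"
    using G by (simp add: c_def Beta_def add_ac)
  finally show ?thesis .
qed

lemma prob_space_beta_distribution: "a > 0 \<Longrightarrow> b > 0 \<Longrightarrow> prob_space (beta_distribution a b)"
proof
  assume ab: "a > 0" "b > 0"
  have "emeasure (beta_distribution a b) (space (beta_distribution a b)) = (\<integral>\<^sup>+x. 1 \<partial>beta_distribution a b)" by simp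
  also have "\<dots> = (\<integral>\<^sup>+x. ennreal (x powr 0) \<partial>beta_distribution a b)"
  proof (rule nn_integral_cong_AE)
    show "AE x in beta_distribution a b. 1 = ennreal (x powr 0)"
      using AE_beta_distribution[of a b] by eventually_elim auto
  qed
  also have "\<dots> = ennreal 1"
  proof -
    have "Gamma a > 0" "Gamma (a + b) > 0" using ab by (auto intro: Gamma_real_pos)
    then have "Gamma a \<noteq> 0" "Gamma (a + b) \<noteq> 0" by linarith+
    then have "Gamma (a + 0) * Gamma (a + b) / (Gamma a * Gamma (a + b + 0)) = 1" by simp
    then show ?thesis using ab by (subst nn_integral_beta_powr) auto
  qed
  finally show "emeasure (beta_distribution a b) (space (beta_distribution a b)) = 1" by simp
qed

text \<open>The identity theorem in the shape used below: identities are first shown for real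
  exponents in an interval and then continued to the strip.\<close>

lemma holomorphic_eq_on_strip:
  assumes "f holomorphic_on {s. a < Re s \<and> Re s < b}" "g holomorphic_on {s. a < Re s \<and> Re s < b}"
    and cd: "a \<le> c" "c < d" "d \<le> b" and eq: "\<And>x. c < x \<Longrightarrow> x < d \<Longrightarrow> f (of_real x) = g (of_real x)"
    and s: "a < Re s" "Re s < b"
  shows "f s = g s"
proof -
  let ?S = "{s. a < Re s \<and> Re s < b}"
  have S: "?S = {s. a < Re s} \<inter> {s. Re s < b}" by auto
  have "f s - g s = 0"
  proof (rule analytic_continuation[where S="?S" and U="of_real ` {c<..<d}" and \<xi>="of_real ((c + d) / 2)" and f="\<lambda>s. f s - g s"])
    show "(\<lambda>s. f s - g s) holomorphic_on ?S" using assms by (intro holomorphic_intros)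
    show "open ?S" unfolding S by (intro open_Int open_halfspace_Re_gt open_halfspace_Re_lt)
    show "connected ?S" unfolding S
      by (intro convex_connected convex_Int convex_halfspace_Re_gt convex_halfspace_Re_lt)
    show "of_real ((c + d) / 2) islimpt (complex_of_real ` {c<..<d})"
    proof (rule islimpt_sequential[THEN iffD2], intro exI conjI allI)
      let ?x = "\<lambda>n. complex_of_real ((c + d) / 2 + ((d - c) / 4) / real (Suc n))"
      fix n
      have "(d - c) / 4 / real (Suc n) \<le> (d - c) / 4 / 1" using cd by (intro divide_left_mono) auto
      moreover have p: "(d - c) / 4 / real (Suc n) > 0" using cd by simp
      ultimately have "(c + d) / 2 + ((d - c) / 4) / real (Suc n) \<in> {c<..<d}" using cd by (auto simp: field_simps)
      then have "?x n \<in> complex_of_real ` {c<..<d}" by (rule imageI)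
      moreover have "?x n \<noteq> of_real ((c + d) / 2)" unfolding of_real_eq_iff using p by linarith
      ultimately show "?x n \<in> complex_of_real ` {c<..<d} - {of_real ((c + d) / 2)}" by blast
    next
      let ?x = "\<lambda>n. complex_of_real ((c + d) / 2 + ((d - c) / 4) / real (Suc n))"
      have "(\<lambda>n. (c + d) / 2 + ((d - c) / 4) / real (Suc n)) \<longlonglongrightarrow> (c + d) / 2 + 0"
        by (intro tendsto_intros lim_const_over_n[THEN LIMSEQ_Suc])
      then show "?x \<longlonglongrightarrow> of_real ((c + d) / 2)" by (intro tendsto_of_real) simp
    qed
  qed (use cd eq s in auto)
  then show ?thesis by simp
qed

lemma gamma_ratio_of_real:
  assumes "0 < \<alpha>" "\<alpha> < \<beta>" "0 < \<alpha> + r"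
  shows "gamma_ratio \<alpha> \<beta> (of_real r)
    = of_real (Gamma (\<alpha> + r) * Gamma \<beta> / (Gamma \<alpha> * Gamma (\<beta> + r)) * (\<beta> / \<alpha>) powr r)" (is "_ = of_real ?x")
    and "0 < Gamma (\<alpha> + r) * Gamma \<beta> / (Gamma \<alpha> * Gamma (\<beta> + r)) * (\<beta> / \<alpha>) powr r"
proof -
  have "complex_of_real (\<beta> / \<alpha>) powr of_real r = of_real ((\<beta> / \<alpha>) powr r)"
    using assms by (intro powr_of_real) auto
  then show "gamma_ratio \<alpha> \<beta> (of_real r) = of_real ?x"
    unfolding gamma_ratio_def of_real_add[symmetric] Gamma_complex_of_real by simp
  show "0 < ?x" using assms
    by (intro mult_pos_pos divide_pos_pos Gamma_real_pos) auto
qed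

lemma convergent_prod_iff_limits:
  fixes f :: "nat \<Rightarrow> real"
  shows "convergent_prod f \<longleftrightarrow> (\<exists>m. Cauchy (\<lambda>n. \<Prod>i\<le>n. f (i + m)) \<and> lim (\<lambda>n. \<Prod>i\<le>n. f (i + m)) \<noteq> 0)"
  unfolding convergent_prod_def raw_has_prod_def
  by (auto simp: Cauchy_convergent_iff convergent_LIMSEQ_iff dest: limI intro: convergentI)

text \<open>Where the product does not converge, \<open>prodinf\<close> is the fixed value
  \<open>THE p. False\<close>. Elsewhere it is a limit, and convergence is a countable combination
  of Cauchy conditions by \<open>convergent_prod_iff_limits\<close>.\<close>

lemma borel_measurable_prodinf [measurable]:
  fixes f :: "nat \<Rightarrow> 'a \<Rightarrow> real"
  assumes [measurable]: "\<And>n. f n \<in> borel_measurable M"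
  shows "(\<lambda>x. \<Prod>n. f n x) \<in> borel_measurable M"
proof -
  have "(\<Prod>n. f n x) = (if convergent_prod (\<lambda>n. f n x) then lim (\<lambda>n. \<Prod>i\<le>n. f i x) else (THE p. False))" for x
  proof (cases "convergent_prod (\<lambda>n. f n x)")
    case True
    then show ?thesis using convergent_prod_LIMSEQ[OF True] by (simp add: limI)
  next
    case False
    then have "\<not> (\<lambda>n. f n x) has_prod p" for p using has_prod_iff by blast
    then show ?thesis using False by (simp add: prodinf_def)
  qed
  moreover have "(\<lambda>x. if convergent_prod (\<lambda>n. f n x) then lim (\<lambda>n. \<Prod>i\<le>n. f i x) else (THE p. False)) \<in> borel_measurable M"
    unfolding convergent_prod_iff_limits by measurable
  ultimately show ?thesis by simp
qed

section \<open>The independent rescaled beta factors and their moments\<close>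

context interlaced
begin

abbreviation "beta_space \<equiv> PiM UNIV (\<lambda>n. beta_distribution (\<alpha> n) (\<beta> n - \<alpha> n))"

text \<open>A coordinate is positive only almost surely; the default 1 makes the factor positive
  everywhere, so that powers and logarithms need no exceptional set.\<close>

definition W :: "nat \<Rightarrow> (nat \<Rightarrow> real) \<Rightarrow> real" where
  "W n \<omega> = (if 0 < \<omega> n then \<omega> n * (\<beta> n / \<alpha> n) else 1)"

lemma prob_space_beta: "prob_space (beta_distribution (\<alpha> n) (\<beta> n - \<alpha> n))"
  using \<alpha>_pos[of n] less(1)[of n] by (intro prob_space_beta_distribution) auto

lemma product_prob_space_beta: "product_prob_space (\<lambda>n. beta_distribution (\<alpha> n) (\<beta> n - \<alpha> n))"
  by (intro product_prob_spaceI prob_space_beta)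

lemma prob_space_beta_space: "prob_space beta_space"
  by (intro prob_space_PiM prob_space_beta)

lemma measurable_coordinate [measurable]: "(\<lambda>\<omega>. \<omega> n) \<in> borel_measurable beta_space"
  using measurable_component_singleton[of n UNIV "\<lambda>n. beta_distribution (\<alpha> n) (\<beta> n - \<alpha> n)"]
  by (simp cong: measurable_cong_sets)

lemma W_measurable [measurable]: "W n \<in> borel_measurable beta_space"
  unfolding W_def by measurable

lemma W_pos: "W n \<omega> > 0"
  using \<alpha>_pos[of n] \<beta>_pos[of n] by (simp add: W_def)

lemma distr_coordinate: "distr beta_space borel (\<lambda>\<omega>. \<omega> n) = beta_distribution (\<alpha> n) (\<beta> n - \<alpha> n)"
proof -
  interpret product_prob_space "\<lambda>n. beta_distribution (\<alpha> n) (\<beta> n - \<alpha> n)" UNIV by (rule product_prob_space_beta)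
  have "distr beta_space borel (\<lambda>\<omega>. \<omega> n) = distr beta_space (beta_distribution (\<alpha> n) (\<beta> n - \<alpha> n)) (\<lambda>\<omega>. \<omega> n)"
    by (intro distr_cong) auto
  then show ?thesis using PiM_component[of n] by simp
qed

lemma AE_coordinates: "AE \<omega> in beta_space. \<forall>n. 0 < \<omega> n \<and> \<omega> n < 1"
proof -
  have "AE \<omega> in beta_space. 0 < \<omega> n \<and> \<omega> n < 1" for n
    by (rule AE_distrD[of "\<lambda>\<omega>. \<omega> n" _ borel], measurable)
       (unfold distr_coordinate, rule AE_beta_distribution)
  then show ?thesis by (subst AE_all_countable) auto
qed

lemma indep_coordinates: "prob_space.indep_vars beta_space (\<lambda>_. borel) (\<lambda>n \<omega>. \<omega> n) UNIV"
proof -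
  interpret prob_space beta_space by (rule prob_space_beta_space)
  have "distr beta_space (PiM UNIV (\<lambda>_. borel)) (\<lambda>\<omega>. \<lambda>i\<in>UNIV. \<omega> i) = distr beta_space beta_space (\<lambda>\<omega>. \<omega>)"
    by (intro distr_cong) (auto intro!: sets_PiM_cong)
  also have "\<dots> = beta_space" by (rule distr_id)
  finally have "distr beta_space (PiM UNIV (\<lambda>_. borel)) (\<lambda>\<omega>. \<lambda>i\<in>UNIV. \<omega> i) = PiM UNIV (\<lambda>i. distr beta_space borel (\<lambda>\<omega>. \<omega> i))"
    by (simp only: distr_coordinate)
  then show ?thesis by (subst indep_vars_iff_distr_eq_PiM) auto
qed

lemma indep_W:
  assumes [measurable]: "\<And>n. h n \<in> borel_measurable (borel :: real measure)"
  shows "prob_space.indep_vars beta_space (\<lambda>_. borel) (\<lambda>n \<omega>. h n (W n \<omega>)) J"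
proof -
  interpret prob_space beta_space by (rule prob_space_beta_space)
  have "indep_vars (\<lambda>_. borel) (\<lambda>n \<omega>. (\<lambda>x. h n (if 0 < x then x * (\<beta> n / \<alpha> n) else 1)) (\<omega> n)) UNIV"
    by (rule indep_vars_compose2[OF indep_coordinates]) measurable
  then show ?thesis unfolding W_def by (rule indep_vars_subset) auto
qed

lemma nn_integral_W_powr:
  assumes "\<alpha> n + r > 0"
  shows "(\<integral>\<^sup>+\<omega>. ennreal (W n \<omega> powr r) \<partial>beta_space) = ennreal (norm (gamma_ratio (\<alpha> n) (\<beta> n) (of_real r)))"
proof -
  have "(\<integral>\<^sup>+\<omega>. ennreal (W n \<omega> powr r) \<partial>beta_space)
    = (\<integral>\<^sup>+\<omega>. ennreal ((\<beta> n / \<alpha> n) powr r) * ennreal (\<omega> n powr r) \<partial>beta_space)"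
    using AE_coordinates \<alpha>_pos[of n] \<beta>_pos[of n]
    by (intro nn_integral_cong_AE) (auto elim!: eventually_mono simp: W_def powr_mult mult_ac powr_divide simp flip: ennreal_mult)
  also have "\<dots> = ennreal ((\<beta> n / \<alpha> n) powr r) * (\<integral>\<^sup>+\<omega>. ennreal (\<omega> n powr r) \<partial>beta_space)"
    by (intro nn_integral_cmult) measurable
  also have "(\<integral>\<^sup>+\<omega>. ennreal (\<omega> n powr r) \<partial>beta_space) = (\<integral>\<^sup>+x. ennreal (x powr r) \<partial>distr beta_space borel (\<lambda>\<omega>. \<omega> n))"
    by (subst nn_integral_distr) auto
  also have "\<dots> = ennreal (Gamma (\<alpha> n + r) * Gamma (\<beta> n) / (Gamma (\<alpha> n) * Gamma (\<beta> n + r)))"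
    unfolding distr_coordinate using assms \<alpha>_pos[of n] less(1)[of n] by (subst nn_integral_beta_powr) auto
  also have "ennreal ((\<beta> n / \<alpha> n) powr r) * \<dots>
     = ennreal (norm (gamma_ratio (\<alpha> n) (\<beta> n) (of_real r)))"
    unfolding gamma_ratio_of_real(1)[OF \<alpha>_pos less(1) assms] norm_of_real
      abs_of_pos[OF gamma_ratio_of_real(2)[OF \<alpha>_pos less(1) assms]]
    by (subst ennreal_mult'[symmetric]) (auto simp: mult_ac)
  finally show ?thesis .
qed

lemma integrable_W_powr:
  assumes "\<alpha> n + r > 0" shows "integrable beta_space (\<lambda>\<omega>. W n \<omega> powr r)"
  by (rule integrableI_nn_integral_finite[OF _ _ nn_integral_W_powr[OF assms]]) auto

text \<open>Both sides are holomorphic on a common strip and agree for positive real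
  exponents.\<close>

lemma integral_W_complex_powr:
  assumes w: "\<alpha> n + Re w > 0"
  shows "integrable beta_space (\<lambda>\<omega>. complex_of_real (W n \<omega>) powr w)"
    and "(LINT \<omega>|beta_space. complex_of_real (W n \<omega>) powr w) = gamma_ratio (\<alpha> n) (\<beta> n) w"
proof -
  show "integrable beta_space (\<lambda>\<omega>. complex_of_real (W n \<omega>) powr w)"
    using w W_pos by (intro integrable_complex_powr integrable_W_powr) auto
  define b where "b = \<bar>Re w\<bar> + 1"
  show "(LINT \<omega>|beta_space. complex_of_real (W n \<omega>) powr w) = gamma_ratio (\<alpha> n) (\<beta> n) w"
  proof (rule holomorphic_eq_on_strip[where a="- \<alpha> n" and b=b and c=0 and d=b
        and f="\<lambda>w. LINT \<omega>|beta_space. complex_of_real (W n \<omega>) powr w" and g="gamma_ratio (\<alpha> n) (\<beta> n)"])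
    show "(\<lambda>w. LINT \<omega>|beta_space. complex_of_real (W n \<omega>) powr w) holomorphic_on {s. - \<alpha> n < Re s \<and> Re s < b}"
      using W_pos by (intro mellin_transform_holomorphic integrable_W_powr) auto
    have "complex_of_real \<beta>' + s \<notin> \<int>\<^sub>\<le>\<^sub>0" if "\<beta>' \<ge> \<alpha> n" "- \<alpha> n < Re s" for \<beta>' s
      using that not_nonpos_Reals_if_Re_pos[of "of_real \<beta>' + s"] nonpos_Ints_subset_nonpos_Reals by auto
    then show "gamma_ratio (\<alpha> n) (\<beta> n) holomorphic_on {s. - \<alpha> n < Re s \<and> Re s < b}"
      unfolding gamma_ratio_def using \<alpha>_pos[of n] \<beta>_pos[of n] less(1)[of n]
      by (intro holomorphic_intros) (auto simp: Gamma_eq_zero_iff)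
    show "(LINT \<omega>|beta_space. complex_of_real (W n \<omega>) powr of_real x) = gamma_ratio (\<alpha> n) (\<beta> n) (of_real x)"
      if "0 < x" "x < b" for x
    proof -
      have x: "\<alpha> n + x > 0" using that \<alpha>_pos[of n] by simp
      have "(LINT \<omega>|beta_space. complex_of_real (W n \<omega>) powr of_real x) = (LINT \<omega>|beta_space. complex_of_real (W n \<omega> powr x))"
        using W_pos by (intro Bochner_Integration.integral_cong) (auto simp: powr_of_real less_imp_le)
      also have "\<dots> = of_real (LINT \<omega>|beta_space. W n \<omega> powr x)" by simp
      also have "(LINT \<omega>|beta_space. W n \<omega> powr x) = norm (gamma_ratio (\<alpha> n) (\<beta> n) (of_real x))"
      proof -
        have "(LINT \<omega>|beta_space. W n \<omega> powr x) = enn2real (\<integral>\<^sup>+\<omega>. ennreal (W n \<omega> powr x) \<partial>beta_space)"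
          by (intro integral_eq_nn_integral) auto
        then show ?thesis by (simp add: nn_integral_W_powr[OF x])
      qed
      also have "complex_of_real \<dots> = gamma_ratio (\<alpha> n) (\<beta> n) (of_real x)"
        unfolding gamma_ratio_of_real(1)[OF \<alpha>_pos less(1) x] norm_of_real
          abs_of_pos[OF gamma_ratio_of_real(2)[OF \<alpha>_pos less(1) x]] ..
      finally show ?thesis .
    qed
  qed (use w \<alpha>_pos[of n] in \<open>auto simp: b_def\<close>)
qed

section \<open>Maximal bounds and almost sure convergence of the partial products\<close>

definition partial :: "nat \<Rightarrow> (nat \<Rightarrow> real) \<Rightarrow> real" where
  "partial n \<omega> = (\<Prod>k<n. W k \<omega>)"

text \<open>The running maximum of \<open>(partial k / partial m) powr c\<close> for
  \<open>k \<ge> m\<close>: the first \<open>m\<close> factors are replaced by 1. The choice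
  \<open>c = 1\<close> controls upward and \<open>c = -1\<close> downward fluctuations.\<close>

definition tail_max :: "real \<Rightarrow> nat \<Rightarrow> nat \<Rightarrow> (nat \<Rightarrow> real) \<Rightarrow> real" where
  "tail_max c m n \<omega> = max_prod n (\<lambda>j. if j < m then 1 else W j \<omega> powr c)"

lemma partial_pos: "partial n \<omega> > 0"
  unfolding partial_def using W_pos by (intro prod_pos) auto

lemma partial_measurable [measurable]: "partial n \<in> borel_measurable beta_space"
  unfolding partial_def by measurable

lemma tail_max_measurable [measurable]: "tail_max c m n \<in> borel_measurable beta_space"
proof -
  have "tail_max c m n = (\<lambda>\<omega>. max_prod n (\<lambda>j\<in>{..<n}. if j < m then 1 else W j \<omega> powr c))"
    unfolding tail_max_def by (intro ext max_prod_cong) auto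
  moreover have "(\<lambda>\<omega>. max_prod n (\<lambda>j\<in>{..<n}. if j < m then 1 else W j \<omega> powr c)) \<in> borel_measurable beta_space"
    by (intro measurable_compose[OF _ borel_measurable_max_prod] measurable_restrict) auto
  ultimately show ?thesis by simp
qed

lemma partial_ratio_le_tail_max:
  assumes "m \<le> k" "k \<le> n" shows "(partial k \<omega> / partial m \<omega>) powr c \<le> tail_max c m n \<omega>"
proof -
  have "(\<Prod>j<k. if j < m then 1 else W j \<omega> powr c) = (partial k \<omega> / partial m \<omega>) powr c"
    using assms(1)
  proof (induction k rule: dec_induct)
    case base
    have "(\<Prod>j<m. if j < m then 1 else W j \<omega> powr c) = (\<Prod>j<m. 1)" by (intro prod.cong) auto
    then show ?case using partial_pos[of m \<omega>] by simp
  next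
    case (step k)
    have "partial (Suc k) \<omega> = partial k \<omega> * W k \<omega>" by (simp add: partial_def)
    then show ?case using step partial_pos[of k \<omega>] partial_pos[of m \<omega>] W_pos[of k \<omega>]
      by (simp add: powr_mult powr_divide)
  qed
  then show ?thesis unfolding tail_max_def using max_prod_ge[OF assms(2), of "\<lambda>j. if j < m then 1 else W j \<omega> powr c"] by simp
qed

lemma tail_max_ge_1: "1 \<le> tail_max c m n \<omega>"
  unfolding tail_max_def by (rule max_prod_ge_1)

lemma tail_max_mono: "n \<le> n' \<Longrightarrow> tail_max c m n \<omega> \<le> tail_max c m n' \<omega>"
  unfolding tail_max_def by (rule max_prod_mono)

lemma tail_max_moment_le:
  assumes s: "0 < s" "s < \<theta>" and \<kappa>: "0 < \<kappa>" "\<kappa> \<le> 1" "\<kappa> * \<alpha> m \<le> \<alpha> m + c * \<theta>"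
  shows "(\<integral>\<^sup>+\<omega>. ennreal (tail_max c m n \<omega> powr s) \<partial>beta_space)
    \<le> ennreal ((1 + s / (\<theta> - s)) * exp (\<bar>c * \<theta>\<bar> * \<bar>1 - c * \<theta>\<bar> / \<kappa> / \<alpha> m))"
proof -
  interpret prob_space beta_space by (rule prob_space_beta_space)
  define \<xi> where "\<xi> j \<omega> = (if j < m then 1 else W j \<omega> powr c)" for j \<omega>
  define w where "w = complex_of_real (c * \<theta>)"
  define g where "g j = (if j < m then 1 else max 1 (norm (gamma_ratio (\<alpha> j) (\<beta> j) w)))" for j
  have ind: "indep_vars (\<lambda>_. borel) \<xi> {..<n}"
    using indep_W[of "\<lambda>j x. if j < m then 1 else x powr c" "{..<n}"] by (simp add: \<xi>_def[abs_def])
  have pos: "\<xi> j \<omega> > 0" for j \<omega> using W_pos[of j \<omega>] by (simp add: \<xi>_def)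
  have mom: "max 1 (\<integral>\<^sup>+\<omega>. ennreal (\<xi> j \<omega> powr \<theta>) \<partial>beta_space) = ennreal (g j)" for j
  proof (cases "j < m")
    case True
    then show ?thesis by (simp add: \<xi>_def g_def emeasure_space_1)
  next
    case False
    have "\<kappa> * (\<alpha> j - \<alpha> m) \<le> \<alpha> j - \<alpha> m" using \<kappa> \<alpha>_mono[of m j] False by (simp add: mult_left_le_one_le)
    then have "\<kappa> * \<alpha> j \<le> \<alpha> j + c * \<theta>" using \<kappa> by (simp add: right_diff_distrib)
    then have "\<alpha> j + c * \<theta> > 0" using \<kappa>(1) \<alpha>_pos[of j] by (smt (verit) mult_pos_pos)
    from nn_integral_W_powr[OF this] show ?thesis using False
      by (simp add: \<xi>_def g_def w_def powr_powr max_def flip: ennreal_1)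
  qed
  have "(\<Prod>j<m + k. g j) = (\<Prod>j<k. max 1 (norm (gamma_ratio (\<alpha> (m + j)) (\<beta> (m + j)) w)))" for k
  proof (induction k)
    case 0
    then show ?case by (auto simp: g_def intro!: prod.neutral)
  qed (simp add: g_def)
  moreover have "(\<Prod>j<k. max 1 (norm (gamma_ratio (\<alpha> (m + j)) (\<beta> (m + j)) w))) \<le> exp (norm w * norm (1 - w) / \<kappa> / \<alpha> m)" for k
    using \<kappa> by (intro prod_max_gamma_ratio_le) (auto simp: w_def)
  moreover have nw: "norm w = \<bar>c * \<theta>\<bar>" "norm (1 - w) = \<bar>1 - c * \<theta>\<bar>"
  proof -
    have "1 - w = of_real (1 - c * \<theta>)" by (simp add: w_def)
    then show "norm w = \<bar>c * \<theta>\<bar>" "norm (1 - w) = \<bar>1 - c * \<theta>\<bar>" by (simp_all only: w_def norm_of_real)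
  qed
  ultimately have le: "(\<Prod>j<m + k. g j) \<le> exp (\<bar>c * \<theta>\<bar> * \<bar>1 - c * \<theta>\<bar> / \<kappa> / \<alpha> m)" for k by metis
  have "(\<Prod>j<n. g j) \<le> (\<Prod>j<m + n. g j)"
    by (intro prod_mono2) (auto simp: g_def)
  then have le: "(\<Prod>j<n. g j) \<le> exp (\<bar>c * \<theta>\<bar> * \<bar>1 - c * \<theta>\<bar> / \<kappa> / \<alpha> m)" using le[of n] by linarith
  have "(\<integral>\<^sup>+\<omega>. ennreal (tail_max c m n \<omega> powr s) \<partial>beta_space)
     \<le> ennreal (1 + s / (\<theta> - s)) * (\<Prod>j<n. ennreal (g j))"
  proof -
    have "tail_max c m n \<omega> = max_prod n (\<lambda>j. \<xi> j \<omega>)" for \<omega> by (simp add: tail_max_def \<xi>_def)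
    then show ?thesis using max_prod_moment_le[OF ind pos s] by (simp only: mom)
  qed
  also have "(\<Prod>j<n. ennreal (g j)) = ennreal (\<Prod>j<n. g j)" by (intro prod_ennreal) (simp add: g_def max.coboundedI1)
  also have "ennreal (1 + s / (\<theta> - s)) * \<dots> = ennreal ((1 + s / (\<theta> - s)) * (\<Prod>j<n. g j))"
    using s by (intro ennreal_mult'[symmetric]) auto
  also have "\<dots> \<le> ennreal ((1 + s / (\<theta> - s)) * exp (\<bar>c * \<theta>\<bar> * \<bar>1 - c * \<theta>\<bar> / \<kappa> / \<alpha> m))"
    using s le by (intro ennreal_leI mult_left_mono) auto
  finally show ?thesis .
qed

text \<open>The maximum is at least 1 while its mean exceeds 1 by at most a small
  \<open>\<delta>\<close>, so Markov's inequality applies to the excess. The mean bound is a product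
  of \<open>1 + 1 / (\<theta> - 1)\<close>, near 1 for large \<open>\<theta>\<close>, and
  \<open>exp (K / \<alpha> m)\<close>, near 1 for large \<open>m\<close>.\<close>

lemma tail_max_exceeds_small:
  assumes c: "\<bar>c\<bar> = 1" and \<epsilon>: "\<epsilon> > 0" and \<eta>: "\<eta> > 0"
  shows "\<forall>\<^sub>F m in sequentially. emeasure beta_space {\<omega>\<in>space beta_space. \<exists>n. tail_max c m n \<omega> \<ge> 1 + \<epsilon>} \<le> ennreal \<eta>"
proof -
  interpret prob_space beta_space by (rule prob_space_beta_space)
  \<comment> \<open>Markov's inequality yields the probability bound
    \<open>\<delta> / \<epsilon>\<close>, which is to be \<open>\<eta>\<close>.\<close>
  define \<delta> where "\<delta> = \<epsilon> * \<eta>"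
  define \<theta> where "\<theta> = 1 + 3 / \<delta>"
  have \<delta>: "\<delta> > 0" using \<epsilon> \<eta> by (simp add: \<delta>_def)
  have \<theta>: "\<theta> > 1" "1 / (\<theta> - 1) = \<delta> / 3" using \<delta> by (auto simp: \<theta>_def)
  define K where "K = \<bar>c * \<theta>\<bar> * \<bar>1 - c * \<theta>\<bar> / (1/2)"
  have "filterlim (\<lambda>m. \<alpha> m) at_infinity sequentially" using unbounded by (rule filterlim_at_top_imp_at_infinity)
  then have "(\<lambda>m. K / \<alpha> m) \<longlonglongrightarrow> 0" by (intro tendsto_divide_0[OF tendsto_const])
  then have "(\<lambda>m. (1 + \<delta> / 3) * exp (K / \<alpha> m)) \<longlonglongrightarrow> (1 + \<delta> / 3) * exp 0" by (intro tendsto_intros)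
  then have "\<forall>\<^sub>F m in sequentially. (1 + \<delta> / 3) * exp (K / \<alpha> m) < 1 + \<delta>"
    using \<delta> by (elim order_tendstoD(2)) simp
  \<comment> \<open>This makes \<open>\<kappa> = 1/2\<close> admissible for both signs of
    \<open>c\<close>, since \<open>c * \<theta> \<ge> - \<theta>\<close>.\<close>
  moreover have "\<forall>\<^sub>F m in sequentially. 2 * \<theta> \<le> \<alpha> m" using unbounded by (simp add: filterlim_at_top)
  ultimately show ?thesis
  proof eventually_elim
    case (elim m)
    define B where "B n = {\<omega>\<in>space beta_space. tail_max c m n \<omega> \<ge> 1 + \<epsilon>}" for n
    have [measurable]: "B n \<in> sets beta_space" for n unfolding B_def by measurable
    have le: "emeasure beta_space (B n) \<le> ennreal \<eta>" for n
    proof -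
      have "\<bar>c * \<theta>\<bar> = \<theta>" using c \<theta> by (simp add: abs_mult)
      then have "1/2 * \<alpha> m \<le> \<alpha> m + c * \<theta>" using elim(2) by linarith
      from tail_max_moment_le[OF _ \<theta>(1) _ _ this, of n]
      have 1: "(\<integral>\<^sup>+\<omega>. ennreal (tail_max c m n \<omega>) \<partial>beta_space) \<le> ennreal ((1 + \<delta> / 3) * exp (K / \<alpha> m))"
        using tail_max_ge_1[of c m n] by (simp add: \<theta> K_def powr_one_gt_zero_iff order.trans[OF zero_le_one])
      have "ennreal (1 + \<epsilon> * measure beta_space (B n)) = ennreal 1 + ennreal \<epsilon> * emeasure beta_space (B n)"
        using \<epsilon> by (simp add: emeasure_eq_measure ennreal_mult)
      also have "\<dots> = (\<integral>\<^sup>+\<omega>. 1 + ennreal \<epsilon> * indicator (B n) \<omega> \<partial>beta_space)"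
        by (subst nn_integral_add) (auto simp: emeasure_space_1 nn_integral_cmult_indicator)
      also have "\<dots> \<le> (\<integral>\<^sup>+\<omega>. ennreal (tail_max c m n \<omega>) \<partial>beta_space)"
      proof (rule nn_integral_mono)
        fix \<omega>
        have "ennreal 1 \<le> ennreal (tail_max c m n \<omega>)" using tail_max_ge_1 by (intro ennreal_leI)
        moreover have "ennreal 1 + ennreal \<epsilon> \<le> ennreal (tail_max c m n \<omega>)" if "\<omega> \<in> B n"
        proof -
          have "ennreal 1 + ennreal \<epsilon> = ennreal (1 + \<epsilon>)" using \<epsilon> by (intro ennreal_plus[symmetric]) auto
          also have "\<dots> \<le> ennreal (tail_max c m n \<omega>)" using that by (intro ennreal_leI) (auto simp: B_def)
          finally show ?thesis .
        qed
        ultimately show "1 + ennreal \<epsilon> * indicator (B n) \<omega> \<le> ennreal (tail_max c m n \<omega>)"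
          by (auto split: split_indicator)
      qed
      also have "\<dots> \<le> ennreal (1 + \<delta>)" using 1 elim(1) by (meson ennreal_leI less_imp_le order_trans)
      finally have "1 + \<epsilon> * measure beta_space (B n) \<le> 1 + \<delta>" using \<delta> by (subst (asm) ennreal_le_iff) auto
      then have "measure beta_space (B n) \<le> \<eta>" using \<epsilon> by (simp add: \<delta>_def)
      then show ?thesis using \<eta> by (simp add: emeasure_eq_measure ennreal_leI)
    qed
    have "{\<omega>\<in>space beta_space. \<exists>n. tail_max c m n \<omega> \<ge> 1 + \<epsilon>} = (\<Union>n. B n)" by (auto simp: B_def)
    moreover have "incseq B" unfolding incseq_def B_def using tail_max_mono by (auto intro: order.trans)
    then have "emeasure beta_space (\<Union>n. B n) = (SUP n. emeasure beta_space (B n))"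
      by (subst SUP_emeasure_incseq) auto
    ultimately show ?case using le by (simp add: SUP_le_iff)
  qed
qed

lemma AE_tail_max_small:
  assumes \<epsilon>: "\<epsilon> > 0"
  shows "AE \<omega> in beta_space. \<exists>m. \<forall>n. tail_max 1 m n \<omega> < 1 + \<epsilon> \<and> tail_max (-1) m n \<omega> < 1 + \<epsilon>"
proof -
  interpret prob_space beta_space by (rule prob_space_beta_space)
  define B where "B c m = {\<omega>\<in>space beta_space. \<exists>n. tail_max c m n \<omega> \<ge> 1 + \<epsilon>}" for c m
  have [measurable]: "B c m \<in> sets beta_space" for c m unfolding B_def by measurable
  define N where "N = (\<Inter>m. B 1 m \<union> B (-1) m)"
  have [measurable]: "N \<in> sets beta_space" unfolding N_def by measurable
  have "measure beta_space N \<le> 0"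
  proof (rule field_le_epsilon)
    fix \<eta> :: real assume \<eta>: "\<eta> > 0"
    have "\<forall>\<^sub>F m in sequentially. emeasure beta_space (B 1 m) \<le> ennreal (\<eta> / 2) \<and> emeasure beta_space (B (-1) m) \<le> ennreal (\<eta> / 2)"
      unfolding B_def using \<epsilon> \<eta> by (intro eventually_conj tail_max_exceeds_small) auto
    then obtain m where "emeasure beta_space (B 1 m) \<le> ennreal (\<eta> / 2)" "emeasure beta_space (B (-1) m) \<le> ennreal (\<eta> / 2)"
      by (auto simp: eventually_sequentially)
    then have "measure beta_space (B 1 m) \<le> \<eta> / 2" "measure beta_space (B (-1) m) \<le> \<eta> / 2"
      using \<eta> by (auto simp: emeasure_eq_measure)
    moreover have "measure beta_space N \<le> measure beta_space (B 1 m \<union> B (-1) m)"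
      by (intro finite_measure_mono) (auto simp: N_def)
    moreover have "measure beta_space (B 1 m \<union> B (-1) m) \<le> measure beta_space (B 1 m) + measure beta_space (B (-1) m)"
      by (intro measure_subadditive) (auto simp: emeasure_eq_measure)
    ultimately show "measure beta_space N \<le> 0 + \<eta>" by simp
  qed
  then have "emeasure beta_space N = 0" by (simp add: emeasure_eq_measure measure_le_0_iff)
  then have "AE \<omega> in beta_space. \<omega> \<notin> N" by (intro AE_not_in) (auto simp: null_sets_def)
  with AE_space show ?thesis
    by eventually_elim (auto simp: N_def B_def not_le)
qed

text \<open>Small running maxima for \<open>c = 1\<close> and \<open>c = -1\<close> bound the
  fluctuation of the logarithm after \<open>m\<close> on both sides, so the logarithms are Cauchy
  and the limit is positive.\<close>

lemma AE_partial_converges: "AE \<omega> in beta_space. \<exists>L>0. (\<lambda>n. partial n \<omega>) \<longlonglongrightarrow> L"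
proof -
  have "AE \<omega> in beta_space. \<forall>j. \<exists>m. \<forall>n. tail_max 1 m n \<omega> < 1 + 1 / real (Suc j) \<and> tail_max (-1) m n \<omega> < 1 + 1 / real (Suc j)"
    by (subst AE_all_countable) (auto intro!: AE_tail_max_small)
  then show ?thesis
  proof eventually_elim
    case (elim \<omega>)
    have "Cauchy (\<lambda>n. ln (partial n \<omega>))"
    proof (rule metric_CauchyI)
      fix e :: real assume e: "e > 0"
      then obtain j where j: "1 / real (Suc j) < e / 2" using nat_approx_posE[of "e / 2"] by auto
      obtain m where m: "\<And>n. tail_max 1 m n \<omega> < 1 + 1 / real (Suc j)" "\<And>n. tail_max (-1) m n \<omega> < 1 + 1 / real (Suc j)"
        using elim by blast
      have *: "dist (ln (partial k \<omega>)) (ln (partial m \<omega>)) < e / 2" if "k \<ge> m" for k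
      proof -
        note p = partial_pos[of k \<omega>] partial_pos[of m \<omega>]
        have "partial k \<omega> / partial m \<omega> < 1 + 1 / real (Suc j)"
          using partial_ratio_le_tail_max[OF that order.refl, where c=1 and \<omega>=\<omega>] m(1)[of k] p by simp
        then have "ln (partial k \<omega> / partial m \<omega>) < ln (1 + 1 / real (Suc j))"
          using p by (intro ln_less_cancel_iff[THEN iffD2] divide_pos_pos add_pos_pos) auto
        moreover have "partial m \<omega> / partial k \<omega> < 1 + 1 / real (Suc j)"
          using partial_ratio_le_tail_max[OF that order.refl, where c="-1" and \<omega>=\<omega>] m(2)[of k] p
          by (simp add: powr_minus_divide powr_divide)
        then have "ln (partial m \<omega> / partial k \<omega>) < ln (1 + 1 / real (Suc j))"
          using p by (intro ln_less_cancel_iff[THEN iffD2] divide_pos_pos add_pos_pos) auto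
        moreover have "ln (1 + 1 / real (Suc j)) \<le> 1 / real (Suc j)" by (rule ln_add_one_self_le_self) simp
        moreover have "ln (partial k \<omega> / partial m \<omega>) = ln (partial k \<omega>) - ln (partial m \<omega>)"
          "ln (partial m \<omega> / partial k \<omega>) = ln (partial m \<omega>) - ln (partial k \<omega>)"
          using p by (simp_all add: ln_div)
        ultimately show ?thesis using j unfolding dist_real_def abs_less_iff by linarith
      qed
      show "\<exists>M. \<forall>k\<ge>M. \<forall>n\<ge>M. dist (ln (partial k \<omega>)) (ln (partial n \<omega>)) < e"
        using * dist_triangle_half_l by (metis dist_commute)
    qed
    then obtain l where "(\<lambda>n. ln (partial n \<omega>)) \<longlonglongrightarrow> l" by (auto simp: Cauchy_convergent_iff convergent_def)
    then have "(\<lambda>n. exp (ln (partial n \<omega>))) \<longlonglongrightarrow> exp l" by (rule tendsto_exp)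
    then show ?case using partial_pos by (intro exI[of _ "exp l"]) simp
  qed
qed

definition inf_prod :: "(nat \<Rightarrow> real) \<Rightarrow> real" where
  "inf_prod \<omega> = (\<Prod>n. \<omega> n * (\<beta> n / \<alpha> n))"

lemma inf_prod_measurable [measurable]: "inf_prod \<in> borel_measurable beta_space"
  unfolding inf_prod_def by measurable

lemma AE_inf_prod: "AE \<omega> in beta_space. inf_prod \<omega> > 0 \<and> (\<lambda>n. partial n \<omega>) \<longlonglongrightarrow> inf_prod \<omega>"
  using AE_coordinates AE_partial_converges
proof eventually_elim
  case (elim \<omega>)
  then obtain L where L: "L > 0" "(\<lambda>n. partial n \<omega>) \<longlonglongrightarrow> L" by blast
  have "partial n \<omega> = (\<Prod>k<n. \<omega> k * (\<beta> k / \<alpha> k))" for n using elim(1) by (simp add: partial_def W_def)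
  then have "(\<lambda>n. \<Prod>k<n. \<omega> k * (\<beta> k / \<alpha> k)) \<longlonglongrightarrow> L" using L(2) by simp
  then have "(\<lambda>n. \<Prod>k\<le>n. \<omega> k * (\<beta> k / \<alpha> k)) \<longlonglongrightarrow> L" using LIMSEQ_lessThan_iff_atMost by blast
  then have "(\<lambda>n. \<omega> n * (\<beta> n / \<alpha> n)) has_prod L" using L(1) by (simp add: has_prod_def raw_has_prod_def)
  then have "inf_prod \<omega> = L" unfolding inf_prod_def using has_prod_unique by metis
  then show ?case using L by simp
qed

text \<open>The supremum over \<open>n\<close> of the running maximum from index 0, raised to
  \<open>\<bar>r\<bar>\<close>, is integrable by the maximal moment bound and dominates all partial
  products.\<close>

lemma exists_dominating:
  assumes r: "\<alpha> 0 + r > 0"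
  obtains g where "integrable beta_space g" "AE \<omega> in beta_space. \<forall>n. partial n \<omega> powr r \<le> g \<omega>"
proof (cases "r = 0")
  case True
  interpret prob_space beta_space by (rule prob_space_beta_space)
  show thesis by (rule that[of "\<lambda>_. 1"]) (use True partial_pos in auto)
next
  case False
  define c s where "c = sgn r" and "s = \<bar>r\<bar>"
  \<comment> \<open>The exponent has to exceed \<open>\<bar>r\<bar>\<close>; for negative
    \<open>r\<close> it must also stay below \<open>\<alpha> 0\<close>, and the midpoint of the two
    is taken.\<close>
  define \<theta> where "\<theta> = (if r > 0 then r + 1 else (\<alpha> 0 - r) / 2)"
  have s: "0 < s" "s < \<theta>" "c * s = r" using False r by (auto simp: s_def \<theta>_def c_def sgn_if)
  have "\<alpha> 0 + Re (of_real (c * \<theta>)) > 0" using r False pos by (auto simp: c_def \<theta>_def sgn_if field_simps)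
  then obtain \<kappa> where \<kappa>: "0 < \<kappa>" "\<kappa> \<le> 1" "\<And>n. \<kappa> * \<alpha> n \<le> \<alpha> n + c * \<theta>"
    using exists_ratio_bound[of "of_real (c * \<theta>)"] by auto
  define C where "C = (1 + s / (\<theta> - s)) * exp (\<bar>c * \<theta>\<bar> * \<bar>1 - c * \<theta>\<bar> / \<kappa> / \<alpha> 0)"
  define G where "G \<omega> = (SUP n. ennreal (tail_max c 0 n \<omega> powr s))" for \<omega>
  have [measurable]: "G \<in> borel_measurable beta_space" unfolding G_def by measurable
  have t0: "0 \<le> tail_max c 0 n \<omega>" for n \<omega> using tail_max_ge_1[of c 0 n \<omega>] by linarith
  have "(\<integral>\<^sup>+\<omega>. G \<omega> \<partial>beta_space) = (SUP n. \<integral>\<^sup>+\<omega>. ennreal (tail_max c 0 n \<omega> powr s) \<partial>beta_space)"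
    unfolding G_def using t0 s
    by (intro nn_integral_monotone_convergence_SUP) (auto simp: incseq_def le_fun_def intro!: ennreal_leI powr_mono2 tail_max_mono)
  also have "\<dots> \<le> ennreal C" unfolding C_def by (intro SUP_least tail_max_moment_le s \<kappa>)
  finally have fin: "(\<integral>\<^sup>+\<omega>. G \<omega> \<partial>beta_space) < \<infinity>" by (simp add: le_less_trans)
  then have AEfin: "AE \<omega> in beta_space. G \<omega> \<noteq> \<infinity>" by (intro nn_integral_PInf_AE) auto
  show thesis
  proof (rule that[of "\<lambda>\<omega>. enn2real (G \<omega>)"])
    show "integrable beta_space (\<lambda>\<omega>. enn2real (G \<omega>))"
    proof (rule integrableI_bounded)
      have "(\<integral>\<^sup>+\<omega>. ennreal (norm (enn2real (G \<omega>))) \<partial>beta_space) \<le> (\<integral>\<^sup>+\<omega>. G \<omega> \<partial>beta_space)"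
        by (intro nn_integral_mono) (simp add: ennreal_enn2real_if)
      then show "(\<integral>\<^sup>+\<omega>. ennreal (norm (enn2real (G \<omega>))) \<partial>beta_space) < \<infinity>" using fin by simp
    qed measurable
    show "AE \<omega> in beta_space. \<forall>n. partial n \<omega> powr r \<le> enn2real (G \<omega>)"
      using AEfin
    proof eventually_elim
      case (elim \<omega>)
      show ?case
      proof
        fix n
        have "partial 0 \<omega> = 1" by (simp add: partial_def)
        then have "partial n \<omega> powr c \<le> tail_max c 0 n \<omega>"
          using partial_ratio_le_tail_max[of 0 n n \<omega> c] by simp
        then have "partial n \<omega> powr r \<le> tail_max c 0 n \<omega> powr s"
          using powr_mono2[of s "partial n \<omega> powr c" "tail_max c 0 n \<omega>"] s by (simp add: powr_powr)
        then have "ennreal (partial n \<omega> powr r) \<le> G \<omega>"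
          unfolding G_def by (intro SUP_upper2[of n]) (auto intro: ennreal_leI)
        then show "partial n \<omega> powr r \<le> enn2real (G \<omega>)"
          using elim by (metis enn2real_ennreal enn2real_mono infinity_ennreal_def less_top powr_ge_zero)
      qed
    qed
  qed
qed

lemma partial_complex_powr: "complex_of_real (partial n \<omega>) powr w = (\<Prod>k<n. complex_of_real (W k \<omega>) powr w)"
proof (induction n)
  case (Suc n)
  have "complex_of_real (partial (Suc n) \<omega>) powr w = complex_of_real (partial n \<omega>) powr w * complex_of_real (W n \<omega>) powr w"
  proof -
    have e: "partial (Suc n) \<omega> = partial n \<omega> * W n \<omega>" by (simp add: partial_def)
    have "complex_of_real (x * y) powr w = complex_of_real x powr w * complex_of_real y powr w"
      if "x > 0" "y > 0" for x y
    proof -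
      have "complex_of_real (x * y) powr w = exp (w * of_real (ln (x * y)))"
        using that by (intro complex_of_real_powr) simp
      then show ?thesis using that by (simp add: complex_of_real_powr ln_mult distrib_left exp_add)
    qed
    then show ?thesis unfolding e using W_pos partial_pos by blast
  qed
  then show ?case using Suc by simp
qed (simp add: partial_def)

text \<open>Dominated convergence applied to the partial products, whose expectation factors by
  independence.\<close>

lemma mellin_inf_prod:
  assumes w: "\<alpha> 0 + Re w > 0"
  shows "integrable beta_space (\<lambda>\<omega>. complex_of_real (inf_prod \<omega>) powr w)"
    and "(\<lambda>n. \<Prod>k<n. gamma_ratio (\<alpha> k) (\<beta> k) w) \<longlonglongrightarrow> (LINT \<omega>|beta_space. complex_of_real (inf_prod \<omega>) powr w)"
proof -
  interpret prob_space beta_space by (rule prob_space_beta_space)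
  obtain g where g: "integrable beta_space g" "AE \<omega> in beta_space. \<forall>n. partial n \<omega> powr Re w \<le> g \<omega>"
    using exists_dominating[OF w] by blast
  have conv: "AE \<omega> in beta_space. (\<lambda>n. complex_of_real (partial n \<omega>) powr w) \<longlonglongrightarrow> complex_of_real (inf_prod \<omega>) powr w"
    using AE_inf_prod
  proof eventually_elim
    case (elim \<omega>)
    then have "(\<lambda>n. exp (w * of_real (ln (partial n \<omega>)))) \<longlonglongrightarrow> exp (w * of_real (ln (inf_prod \<omega>)))"
      by (intro tendsto_intros) auto
    then show ?case using elim partial_pos by (simp add: complex_of_real_powr)
  qed
  have dom: "AE \<omega> in beta_space. norm (complex_of_real (partial n \<omega>) powr w) \<le> g \<omega>" for n
    using g(2) by eventually_elim (use partial_pos in \<open>auto simp: norm_complex_of_real_powr\<close>)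
  note D = conv g(1) dom
  show "integrable beta_space (\<lambda>\<omega>. complex_of_real (inf_prod \<omega>) powr w)"
    by (rule integrable_dominated_convergence[OF _ _ g(1) conv dom]) measurable
  have lim: "(\<lambda>n. LINT \<omega>|beta_space. complex_of_real (partial n \<omega>) powr w)
     \<longlonglongrightarrow> (LINT \<omega>|beta_space. complex_of_real (inf_prod \<omega>) powr w)"
    by (rule integral_dominated_convergence[OF _ _ g(1) conv dom]) measurable
  have "(LINT \<omega>|beta_space. complex_of_real (partial n \<omega>) powr w) = (\<Prod>k<n. gamma_ratio (\<alpha> k) (\<beta> k) w)" for n
  proof -
    have wk: "\<alpha> k + Re w > 0" for k using w \<alpha>_mono[of 0 k] by simp
    have "indep_vars (\<lambda>_. borel) (\<lambda>k \<omega>. (\<lambda>x. complex_of_real x powr w) (W k \<omega>)) {..<n}"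
      by (rule indep_vars_compose2[OF indep_W[of "\<lambda>_ x. x"]]) measurable
    then have "(LINT \<omega>|beta_space. (\<Prod>k<n. complex_of_real (W k \<omega>) powr w))
       = (\<Prod>k<n. LINT \<omega>|beta_space. complex_of_real (W k \<omega>) powr w)"
      using integral_W_complex_powr(1)[OF wk] by (intro indep_vars_lebesgue_integral) auto
    then show ?thesis by (simp add: partial_complex_powr integral_W_complex_powr(2)[OF wk])
  qed
  with lim show "(\<lambda>n. \<Prod>k<n. gamma_ratio (\<alpha> k) (\<beta> k) w) \<longlonglongrightarrow> (LINT \<omega>|beta_space. complex_of_real (inf_prod \<omega>) powr w)" by simp
qed

end

section \<open>The exponential functional of a Levy process\<close>

lemma cadlag_right: "cadlag x \<Longrightarrow> t \<ge> 0 \<Longrightarrow> (x \<longlongrightarrow> x t) (at_right t)"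
  by (simp add: cadlag_def continuous_within)

text \<open>One-sided limits give local boundedness, which Bolzano's bisection principle makes
  uniform. The guard \<open>0 \<le> u\<close> inside the bisected property is there because
  neighbourhoods of 0 reach to its left.\<close>

lemma cadlag_bounded:
  assumes x: "cadlag x" and t: "0 \<le> t"
  obtains B where "\<And>u. 0 \<le> u \<Longrightarrow> u \<le> t \<Longrightarrow> \<bar>x u\<bar> \<le> B"
proof -
  have "\<exists>B. \<forall>u\<in>{0..t}. 0 \<le> u \<longrightarrow> \<bar>x u\<bar> \<le> B"
  proof (rule Bolzano[where P="\<lambda>a b. \<exists>B. \<forall>u\<in>{a..b}. 0 \<le> u \<longrightarrow> \<bar>x u\<bar> \<le> B" and a=0 and b=t])
    fix a b c :: real
    assume "\<exists>B. \<forall>u\<in>{a..b}. 0 \<le> u \<longrightarrow> \<bar>x u\<bar> \<le> B" "\<exists>B. \<forall>u\<in>{b..c}. 0 \<le> u \<longrightarrow> \<bar>x u\<bar> \<le> B"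
    then obtain B B' where BB: "\<And>u. a \<le> u \<Longrightarrow> u \<le> b \<Longrightarrow> 0 \<le> u \<Longrightarrow> \<bar>x u\<bar> \<le> B" "\<And>u. b \<le> u \<Longrightarrow> u \<le> c \<Longrightarrow> 0 \<le> u \<Longrightarrow> \<bar>x u\<bar> \<le> B'"
      by (auto simp: Ball_def)
    have "\<bar>x u\<bar> \<le> max B B'" if "u \<in> {a..c}" "0 \<le> u" for u
      using BB(1)[of u] BB(2)[of u] that by (cases "u \<le> b") auto
    then show "\<exists>B. \<forall>u\<in>{a..c}. 0 \<le> u \<longrightarrow> \<bar>x u\<bar> \<le> B" by blast
  next
    fix c :: real assume c: "0 \<le> c"
    have "\<forall>\<^sub>F u in at_right c. dist (x u) (x c) < 1" using cadlag_right[OF x c] by (rule tendstoD) simp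
    then obtain b where b: "b > c" "\<And>u. c < u \<Longrightarrow> u < b \<Longrightarrow> dist (x u) (x c) < 1"
      unfolding eventually_at_right_field by blast
    obtain a l where a: "a < c" "\<And>u. a < u \<Longrightarrow> u < c \<Longrightarrow> 0 \<le> u \<Longrightarrow> dist (x u) l < 1"
    proof (cases "c = 0")
      case True
      then show ?thesis using that[of "-1" 0] by auto
    next
      case False
      then have "c > 0" using c by simp
      then obtain l where "(x \<longlongrightarrow> l) (at_left c)" using x unfolding cadlag_def by blast
      then have "\<forall>\<^sub>F u in at_left c. dist (x u) l < 1" by (rule tendstoD) simp
      then show ?thesis unfolding eventually_at_left_field using that by blast
    qed
    define B where "B = max (\<bar>x c\<bar> + 1) (\<bar>l\<bar> + 1)"
    have B: "\<bar>x u\<bar> \<le> B" if "a < u" "u < b" "0 \<le> u" for u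
    proof (cases u c rule: linorder_cases)
      case less
      then show ?thesis using a(2)[of u] that by (auto simp: B_def dist_real_def)
    next
      case greater
      then show ?thesis using b(2)[of u] that by (auto simp: B_def dist_real_def)
    qed (auto simp: B_def)
    show "\<exists>d>0. \<forall>a b. a \<le> c \<and> c \<le> b \<and> b - a < d \<longrightarrow> (\<exists>B. \<forall>u\<in>{a..b}. 0 \<le> u \<longrightarrow> \<bar>x u\<bar> \<le> B)"
    proof (rule exI[of _ "min (c - a) (b - c)"], intro conjI allI impI)
      fix a' b'
      assume "a' \<le> c \<and> c \<le> b' \<and> b' - a' < min (c - a) (b - c)"
      then have "\<bar>x u\<bar> \<le> B" if "u \<in> {a'..b'}" "0 \<le> u" for u using that by (intro B) auto
      then show "\<exists>B. \<forall>u\<in>{a'..b'}. 0 \<le> u \<longrightarrow> \<bar>x u\<bar> \<le> B" by blast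
    qed (use a b in auto)
  qed (use t in auto)
  then obtain B where "\<forall>u\<in>{0..t}. 0 \<le> u \<longrightarrow> \<bar>x u\<bar> \<le> B" by blast
  then have "\<bar>x u\<bar> \<le> B" if "0 \<le> u" "u \<le> t" for u using that by simp
  then show ?thesis using that by blast
qed

text \<open>The least multiple of \<open>v / (n + 1)\<close> strictly greater than \<open>w\<close>.
  It approaches \<open>w\<close> from the right, so right-continuity is enough to pass to the
  limit.\<close>

definition grid :: "real \<Rightarrow> nat \<Rightarrow> real \<Rightarrow> real" where
  "grid v n w = real (nat \<lfloor>real (Suc n) * w / v\<rfloor> + 1) * v / real (Suc n)"

lemma grid_bounds:
  assumes v: "v > 0" and w: "w \<ge> 0"
  shows "w < grid v n w" "grid v n w \<le> w + v / real (Suc n)"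
proof -
  define N where "N = real (Suc n)"
  have N: "N > 0" by (simp add: N_def)
  have k: "real (nat \<lfloor>N * w / v\<rfloor>) = of_int \<lfloor>N * w / v\<rfloor>" using v w N by simp
  have g: "grid v n w = (of_int \<lfloor>N * w / v\<rfloor> + 1) * v / N"
    unfolding grid_def N_def[symmetric] of_nat_add k by simp
  have "N * w / v < of_int \<lfloor>N * w / v\<rfloor> + 1" "of_int \<lfloor>N * w / v\<rfloor> \<le> N * w / v" by linarith+
  then have "N * w / v * (v / N) < (of_int \<lfloor>N * w / v\<rfloor> + 1) * (v / N)"
    "of_int \<lfloor>N * w / v\<rfloor> * (v / N) \<le> N * w / v * (v / N)"
    using v N by (auto intro!: mult_strict_right_mono mult_right_mono simp del: times_divide_eq_right times_divide_eq_left)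
  moreover have e: "N * w / v * (v / N) = w" using v N by simp
  ultimately have *: "w < (of_int \<lfloor>N * w / v\<rfloor> + 1) * (v / N)" "of_int \<lfloor>N * w / v\<rfloor> * (v / N) \<le> w"
    unfolding e by auto
  have g': "grid v n w = (of_int \<lfloor>N * w / v\<rfloor> + 1) * (v / N)" by (simp add: g)
  show "w < grid v n w" unfolding g' by (rule *)
  show "grid v n w \<le> w + v / real (Suc n)" using *(2) unfolding g' N_def[symmetric] distrib_right by simp
qed

lemma grid_tendsto:
  assumes v: "v > 0" and w: "w \<ge> 0" shows "filterlim (\<lambda>n. grid v n w) (at_right w) sequentially"
proof -
  have "(\<lambda>n. w + v / real (Suc n)) \<longlonglongrightarrow> w + 0" by (intro tendsto_intros lim_const_over_n[THEN LIMSEQ_Suc])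
  then have "(\<lambda>n. w + v / real (Suc n)) \<longlonglongrightarrow> w" by simp
  then have "(\<lambda>n. grid v n w) \<longlonglongrightarrow> w"
    by (rule tendsto_sandwich[OF _ _ tendsto_const, rotated 2])
      (use grid_bounds[OF assms] in \<open>auto intro!: always_eventually less_imp_le\<close>)
  then show ?thesis using grid_bounds(1)[OF assms] by (auto simp: filterlim_at intro!: always_eventually less_imp_neq[symmetric])
qed

text \<open>Rounding time up to the grid leaves countably many time points, where joint
  measurability is clear; right-continuity gives the limit. Negative times, at which the process is
  arbitrary, are sent to 0.\<close>

lemma borel_measurable_process:
  fixes X :: "real \<Rightarrow> 'a \<Rightarrow> real"
  assumes X: "\<And>t. 0 \<le> t \<Longrightarrow> X t \<in> borel_measurable N" and c: "\<And>\<omega>. \<omega> \<in> space N \<Longrightarrow> cadlag (\<lambda>t. X t \<omega>)"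
  shows "(\<lambda>(u, \<omega>). if 0 \<le> u then X u \<omega> else 0) \<in> borel_measurable ((borel :: real measure) \<Otimes>\<^sub>M N)"
proof (rule borel_measurable_LIMSEQ_real[where u="\<lambda>n (u, \<omega>). if 0 \<le> u then X (grid 1 n u) \<omega> else 0"])
  fix z assume "z \<in> space ((borel :: real measure) \<Otimes>\<^sub>M N)"
  then obtain u \<omega> where z: "z = (u, \<omega>)" "\<omega> \<in> space N" by (auto simp: space_pair_measure)
  have "(\<lambda>n. X (grid 1 n u) \<omega>) \<longlonglongrightarrow> X u \<omega>" if "u \<ge> 0"
    by (rule filterlim_compose[OF cadlag_right[OF c[OF z(2)] that] grid_tendsto]) (use that in auto)
  then show "(\<lambda>n. (\<lambda>(u, \<omega>). if 0 \<le> u then X (grid 1 n u) \<omega> else 0) z) \<longlonglongrightarrow> (\<lambda>(u, \<omega>). if 0 \<le> u then X u \<omega> else 0) z"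
    using z by auto
next
  fix n
  have [measurable]: "(\<lambda>z. X (real (i + 1) * 1 / real (Suc n)) (snd z)) \<in> borel_measurable ((borel :: real measure) \<Otimes>\<^sub>M N)" for i
    by (rule measurable_compose[OF measurable_snd X]) simp
  have "(\<lambda>z. X (real (nat \<lfloor>real (Suc n) * fst z / 1\<rfloor> + 1) * 1 / real (Suc n)) (snd z)) \<in> borel_measurable ((borel :: real measure) \<Otimes>\<^sub>M N)"
    by (rule measurable_compose_countable[where f="\<lambda>i z. X (real (i + 1) * 1 / real (Suc n)) (snd z)"]) measurable
  then show "(\<lambda>(u, \<omega>). if 0 \<le> u then X (grid 1 n u) \<omega> else 0) \<in> borel_measurable ((borel :: real measure) \<Otimes>\<^sub>M N)"
    unfolding grid_def case_prod_beta by measurable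
qed

lemma cadlag_measurable:
  assumes "cadlag p" shows "(\<lambda>u. if 0 \<le> u then p u else 0) \<in> borel_measurable borel"
proof -
  have "(\<lambda>(u, \<omega>::unit). if 0 \<le> u then p u else 0) \<in> borel_measurable (borel \<Otimes>\<^sub>M count_space UNIV)"
    by (rule borel_measurable_process[where X="\<lambda>u _. p u"]) (use assms in auto)
  then have "(\<lambda>u. (\<lambda>(u, \<omega>::unit). if 0 \<le> u then p u else 0) (u, ())) \<in> borel_measurable borel"
    by (rule measurable_compose[rotated]) simp
  then show ?thesis by simp
qed

text \<open>The sum is the integral of a step function whose value at \<open>w\<close> is
  \<open>g (grid v n w)\<close>, so right limits and boundedness suffice for dominated
  convergence.\<close>

lemma riemann_sums_right:
  fixes g :: "real \<Rightarrow> real"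
  assumes v: "v > 0" and bound: "\<And>u. 0 \<le> u \<Longrightarrow> u \<le> v \<Longrightarrow> \<bar>g u\<bar> \<le> B"
    and right: "\<And>u. 0 \<le> u \<Longrightarrow> u < v \<Longrightarrow> (g \<longlongrightarrow> g u) (at_right u)"
  shows "(\<lambda>n. v / real (Suc n) * (\<Sum>k<Suc n. g (real (k + 1) * v / real (Suc n)))) \<longlonglongrightarrow> (LINT u:{0..v}|lborel. g u)"
proof -
  define s where "s n w = (\<Sum>k<Suc n. indicator {real k * v / real (Suc n)..<real (k + 1) * v / real (Suc n)} w * g (real (k + 1) * v / real (Suc n)))"
    for n and w :: real
  have s_eq: "s n w = indicator {0..<v} w * g (grid v n w)" for n w
  proof -
    define N where "N = real (Suc n)"
    have N: "N > 0" by (simp add: N_def)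
    have iff: "w \<in> {real k * v / N..<real (k + 1) * v / N} \<longleftrightarrow> \<lfloor>N * w / v\<rfloor> = int k" for k
      using v N by (simp add: floor_eq_iff field_simps)
    show ?thesis
    proof (cases "0 \<le> w \<and> w < v")
      case True
      define k0 where "k0 = nat \<lfloor>N * w / v\<rfloor>"
      have k0: "\<lfloor>N * w / v\<rfloor> = int k0" using True v N by (simp add: k0_def)
      have "N * w / v < N" using True v N by (simp add: field_simps)
      then have "of_int \<lfloor>N * w / v\<rfloor> < N" by linarith
      then have k0N: "k0 < Suc n" unfolding k0 by (simp add: N_def)
      have "s n w = (\<Sum>k<Suc n. if k = k0 then g (real (k0 + 1) * v / N) else 0)"
        unfolding s_def N_def[symmetric]
      proof (intro sum.cong refl)
        fix k
        have "indicator {real k * v / N..<real (k + 1) * v / N} w = (if k = k0 then 1 else (0::real))"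
          unfolding indicator_def iff k0 by auto
        then show "indicator {real k * v / N..<real (k + 1) * v / N} w * g (real (k + 1) * v / N)
          = (if k = k0 then g (real (k0 + 1) * v / N) else 0)" by simp
      qed
      also have "\<dots> = g (real (k0 + 1) * v / N)" using k0N by simp
      finally show ?thesis using True by (simp add: grid_def k0_def N_def)
    next
      case False
      have "indicator {real k * v / N..<real (k + 1) * v / N} w = (0::real)" if "k < Suc n" for k
      proof -
        have "w \<notin> {real k * v / N..<real (k + 1) * v / N}"
        proof
          assume w: "w \<in> {real k * v / N..<real (k + 1) * v / N}"
          have "real (k + 1) * v / N \<le> N * v / N" using that v N
            by (intro divide_right_mono mult_right_mono) (auto simp: N_def)
          moreover have "0 \<le> real k * v / N" using v N by simp
          ultimately show False using w False N by auto
        qed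
        then show ?thesis by simp
      qed
      then show ?thesis using False unfolding s_def N_def[symmetric] by simp
    qed
  qed
  have s_meas [measurable]: "s n \<in> borel_measurable borel" for n unfolding s_def by measurable
  have lim: "(\<lambda>n. s n w) \<longlonglongrightarrow> indicator {0..<v} w * g w" for w
  proof (cases "0 \<le> w \<and> w < v")
    case True
    then have "(\<lambda>n. g (grid v n w)) \<longlonglongrightarrow> g w" using v by (intro filterlim_compose[OF right grid_tendsto]) auto
    then show ?thesis using True by (simp add: s_eq)
  qed (auto simp: s_eq indicator_def)
  have f_meas: "(\<lambda>w. indicator {0..<v} w * g w) \<in> borel_measurable borel"
    by (rule borel_measurable_LIMSEQ_real[OF lim s_meas])
  have gv: "grid v n w \<le> v" if "0 \<le> w" "w < v" for n w
  proof -
    define N where "N = real (Suc n)"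
    have N: "N > 0" by (simp add: N_def)
    have "N * w / v < N" using that v N by (simp add: field_simps)
    then have "\<lfloor>N * w / v\<rfloor> < int (Suc n)" unfolding floor_less_iff by (simp add: N_def)
    moreover have "0 \<le> N * w / v" using that v N by simp
    ultimately have "nat \<lfloor>N * w / v\<rfloor> + 1 \<le> Suc n" by linarith
    then have "real (nat \<lfloor>N * w / v\<rfloor> + 1) \<le> N" unfolding N_def of_nat_le_iff .
    then have "real (nat \<lfloor>N * w / v\<rfloor> + 1) * v / N \<le> N * v / N" using v N by (intro divide_right_mono mult_right_mono) auto
    then show ?thesis using N by (simp add: grid_def N_def)
  qed
  have "(\<lambda>n. LINT w|lborel. s n w) \<longlonglongrightarrow> (LINT w|lborel. indicator {0..<v} w * g w)"
  proof (rule integral_dominated_convergence[where w="\<lambda>w. indicator {0..<v} w * B"])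
    show "integrable lborel (\<lambda>w. indicator {0..<v} w * B)"
      using v by (intro integrable_mult_left integrable_real_indicator) auto
    have "norm (s n w) \<le> indicator {0..<v} w * B" for n w
      using bound[of "grid v n w"] gv[of w n] grid_bounds(1)[OF v, of w n] by (auto simp: s_eq indicator_def)
    then show "AE w in lborel. norm (s n w) \<le> indicator {0..<v} w * B" for n by simp
  qed (use lim f_meas in auto)
  moreover have "(LINT w|lborel. s n w) = v / real (Suc n) * (\<Sum>k<Suc n. g (real (k + 1) * v / real (Suc n)))" for n
  proof -
    have le: "real k * v / real (Suc n) \<le> real (k + 1) * v / real (Suc n)" for k
      using v by (intro divide_right_mono mult_right_mono) auto
    have d: "real (k + 1) * v / real (Suc n) - real k * v / real (Suc n) = v / real (Suc n)" for k
      by (simp add: diff_divide_distrib[symmetric] algebra_simps)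
    have "(LINT w|lborel. s n w) = (\<Sum>k<Suc n. LINT w|lborel. indicator {real k * v / real (Suc n)..<real (k + 1) * v / real (Suc n)} w * g (real (k + 1) * v / real (Suc n)))"
      unfolding s_def using le by (intro Bochner_Integration.integral_sum integrable_mult_left integrable_real_indicator) (auto simp: emeasure_lborel_Ico)
    also have "\<dots> = (\<Sum>k<Suc n. v / real (Suc n) * g (real (k + 1) * v / real (Suc n)))"
      by (intro sum.cong refl) (simp only: Bochner_Integration.integral_mult_left_zero Bochner_Integration.integral_indicator space_lborel space_borel Int_UNIV_right measure_lborel_Ico[OF le] d)
    finally show ?thesis by (simp only: sum_distrib_left)
  qed
  \<comment> \<open>The step functions live on the half-open interval; the end point
    \<open>v\<close> is a null set.\<close>
  moreover have "(LINT w|lborel. indicator {0..<v} w * g w) = (LINT u:{0..v}|lborel. g u)"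
  proof -
    have "(\<lambda>u. indicator {0..v} u *\<^sub>R g u) = (\<lambda>u. if u = v then g v else indicator {0..<v} u * g u)"
      using v by (auto simp: indicator_def fun_eq_iff)
    then have m: "(\<lambda>u. indicator {0..v} u *\<^sub>R g u) \<in> borel_measurable borel" using f_meas by simp
    show ?thesis unfolding set_lebesgue_integral_def
      by (intro integral_cong_AE) (use m f_meas AE_lborel_singleton[of v] in \<open>auto elim!: eventually_mono simp: indicator_def\<close>)
  qed
  ultimately show ?thesis by simp
qed

text \<open>The probability integral transform: without atoms,
  \<open>u \<mapsto> measure M {u<..}\<close> carries \<open>M\<close> to Lebesgue measure on the
  interval from 0 to the total mass. It serves as the change of variables from time to remaining
  area.\<close>

lemma (in finite_borel_measure) nn_integral_tail_transform:
  assumes atom: "\<And>x. measure M {x} = 0" and h [measurable]: "h \<in> borel_measurable borel"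
  shows "(\<integral>\<^sup>+u. h (measure M {u<..}) \<partial>M) = (\<integral>\<^sup>+y. h y * indicator {0..measure M UNIV} y \<partial>lborel)"
proof -
  define a where "a = measure M UNIV"
  define F where "F u = measure M {u<..}" for u
  have sets [simp]: "sets M = sets borel" by (rule M_is_borel)
  have sp: "space M = UNIV" using sets_eq_imp_space_eq[OF sets] by simp
  have F_cdf: "F u = a - cdf M u" for u
  proof -
    have "{u<..} = UNIV - {..u}" by auto
    then have "measure M {u<..} = measure M UNIV - measure M {..u}"
      using finite_measure_compl[of "{..u}"] sp by simp
    then show ?thesis by (simp add: F_def a_def cdf_def)
  qed
  have cont: "isCont (cdf M) x" for x using atom by (simp add: isCont_cdf)
  have Fm [measurable]: "F \<in> borel_measurable borel"
    unfolding F_cdf[abs_def] using cont by (intro borel_measurable_continuous_onI continuous_at_imp_continuous_on) (auto intro!: continuous_intros)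
  \<comment> \<open>Without atoms the distribution function is continuous and takes every value
    strictly between 0 and the total mass \<open>a\<close>. The value \<open>a\<close> itself may
    not be attained, hence the separate case.\<close>
  have level: "measure M {u. cdf M u < c} = c" if c: "0 < c" "c \<le> a" for c
  proof (rule antisym)
    have reach: "\<exists>u. cdf M u = c'" if "0 < c'" "c' < a" for c'
    proof -
      have "\<forall>\<^sub>F u in at_bot. cdf M u < c'" using cdf_lim_at_bot that(1) by (rule order_tendstoD)
      then obtain l where l: "\<And>u. u \<le> l \<Longrightarrow> cdf M u < c'" by (auto simp: eventually_at_bot_linorder)
      have "(cdf M \<longlongrightarrow> a) at_top" using cdf_lim_at_top sp by (simp add: a_def)
      then have "\<forall>\<^sub>F u in at_top. cdf M u > c'" using that(2) by (rule order_tendstoD)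
      then obtain r where r: "\<And>u. u \<ge> r \<Longrightarrow> cdf M u > c'" by (auto simp: eventually_at_top_linorder)
      have "\<exists>x\<ge>l. x \<le> max l r \<and> cdf M x = c'"
        using l[of l] r[of "max l r"] cont by (intro IVT) (auto intro: less_imp_le)
      then show ?thesis by blast
    qed
    have meas: "{u. cdf M u < c} \<in> sets borel"
    proof -
      have [measurable]: "cdf M \<in> borel_measurable borel"
        using cont by (intro borel_measurable_continuous_onI continuous_at_imp_continuous_on) auto
      show ?thesis by measurable
    qed
    show "measure M {u. cdf M u < c} \<le> c"
    proof (cases "c = a")
      case True
      have "measure M {u. cdf M u < c} \<le> measure M UNIV" by (intro finite_measure_mono) auto
      then show ?thesis by (simp add: True a_def)
    next
      case False
      then obtain u0 where u0: "cdf M u0 = c" using reach[of c] c by auto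
      have "{u. cdf M u < c} \<subseteq> {..u0}"
        using cdf_nondecreasing[of u0] u0 by (auto simp: not_le[symmetric]) (meson linear not_le)
      then have "measure M {u. cdf M u < c} \<le> cdf M u0" unfolding cdf_def by (intro finite_measure_mono) auto
      then show ?thesis using u0 by simp
    qed
    show "c \<le> measure M {u. cdf M u < c}"
    proof (rule dense_le_bounded[of 0])
      fix c' assume c': "0 < c'" "c' < c"
      then obtain u0 where u0: "cdf M u0 = c'" using reach[of c'] c by auto
      have "{..u0} \<subseteq> {u. cdf M u < c}" using cdf_nondecreasing[of _ u0] u0 c' by (auto intro: le_less_trans)
      then have "cdf M u0 \<le> measure M {u. cdf M u < c}" unfolding cdf_def using meas by (intro finite_measure_mono) (auto simp: cdf_def)
      then show "c' \<le> measure M {u. cdf M u < c}" using u0 by simp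
    qed (use c in auto)
  qed
  have a0: "a \<ge> 0" by (simp add: a_def)
  have "distr M borel F = density lborel (indicator {0..a})"
  proof (rule measure_eqI_lessThan)
    fix y
    have 1: "emeasure (distr M borel F) {y<..} = ennreal (measure M {u. F u > y})"
      by (subst emeasure_distr) (auto simp: sp emeasure_eq_measure vimage_def measurable_cong_sets[OF sets refl])
    have 2: "emeasure (density lborel (indicator {0..a})) {y<..} = emeasure lborel ({0..a} \<inter> {y<..})"
      by (subst emeasure_density) (auto simp flip: indicator_inter_arith)
    show "emeasure (distr M borel F) {y<..} < \<infinity>" by (simp add: 1)
    show "emeasure (distr M borel F) {y<..} = emeasure (density lborel (indicator {0..a})) {y<..}"
    proof (cases "y < 0")
      case True
      have "{u. F u > y} = UNIV" using True by (auto simp: F_def intro: less_le_trans)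
      moreover have "{0..a} \<inter> {y<..} = {0..a}" using True by auto
      ultimately show ?thesis unfolding 1 2 using a0 by (simp add: a_def)
    next
      case False
      show ?thesis
      proof (cases "y < a")
        case True
        have "{u. F u > y} = {u. cdf M u < a - y}" by (auto simp: F_cdf)
        then have "measure M {u. F u > y} = a - y" using level[of "a - y"] True False by simp
        moreover have "{0..a} \<inter> {y<..} = {y<..a}" using False by auto
        ultimately show ?thesis unfolding 1 2 using True by simp
      next
        case ge: False
        have "F u \<le> a" for u unfolding F_cdf using cdf_nonneg by simp
        then have "{u. F u > y} = {}" using ge by (auto simp: not_less intro: order.trans)
        moreover have "{0..a} \<inter> {y<..} = {}" using ge by auto
        ultimately show ?thesis unfolding 1 2 by simp
      qed
    qed
  qed auto
  then have "(\<integral>\<^sup>+y. h y \<partial>distr M borel F) = (\<integral>\<^sup>+y. h y \<partial>density lborel (indicator {0..a}))" by simp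
  also have "(\<integral>\<^sup>+y. h y \<partial>distr M borel F) = (\<integral>\<^sup>+u. h (F u) \<partial>M)"
    by (rule nn_integral_distr) (auto simp: measurable_cong_sets[OF sets refl])
  also have "(\<integral>\<^sup>+y. h y \<partial>density lborel (indicator {0..a})) = (\<integral>\<^sup>+y. indicator {0..a} y * h y \<partial>lborel)"
    by (rule nn_integral_density) auto
  finally show ?thesis by (simp add: F_def a_def mult.commute)
qed

definition area :: "(real \<Rightarrow> real) \<Rightarrow> real \<Rightarrow> real \<Rightarrow> real" where
  "area p a b = (LINT u:{a..b}|lborel. exp (p u))"

lemma area_set_integrable:
  assumes p: "cadlag p" and a: "0 \<le> a"
  shows "set_integrable lborel {a..b} (\<lambda>u. exp (p u))"
proof (cases "a \<le> b")
  case True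
  obtain B where B: "\<And>u. 0 \<le> u \<Longrightarrow> u \<le> b \<Longrightarrow> \<bar>p u\<bar> \<le> B" using cadlag_bounded[OF p, of b] a True by auto
  have eq: "indicator {a..b} u *\<^sub>R exp (p u) = indicator {a..b} u * exp (if 0 \<le> u then p u else 0)" for u
    using a by (auto simp: indicator_def)
  note [measurable] = cadlag_measurable[OF p]
  show ?thesis unfolding set_integrable_def eq
  proof (rule Bochner_Integration.integrable_bound[where f="\<lambda>u. indicator {a..b} u * exp B"])
    show "AE u in lborel. norm (indicator {a..b} u * exp (if 0 \<le> u then p u else 0)) \<le> norm (indicator {a..b} u * exp B)"
    proof (rule AE_I2)
      fix u
      show "norm (indicator {a..b} u * exp (if 0 \<le> u then p u else 0)) \<le> norm (indicator {a..b} u * exp B)"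
        using B[of u] a by (cases "u \<in> {a..b}") auto
    qed
    show "integrable lborel (\<lambda>u. indicator {a..b} u * exp B)"
      using True by (intro integrable_mult_left integrable_real_indicator) auto
  qed measurable
qed (simp add: set_integrable_def)

lemma ennreal_area:
  assumes p: "cadlag p" and a: "0 \<le> a"
  shows "ennreal (area p a b) = (\<integral>\<^sup>+u. ennreal (exp (p u)) * indicator {a..b} u \<partial>lborel)"
proof -
  have "ennreal (area p a b) = (\<integral>\<^sup>+u. ennreal (indicator {a..b} u *\<^sub>R exp (p u)) \<partial>lborel)"
    unfolding area_def set_lebesgue_integral_def
    by (intro nn_integral_eq_integral[symmetric] area_set_integrable[OF p a, unfolded set_integrable_def]) auto
  also have "\<dots> = (\<integral>\<^sup>+u. ennreal (exp (p u)) * indicator {a..b} u \<partial>lborel)"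
    by (intro nn_integral_cong) (auto simp: indicator_def)
  finally show ?thesis .
qed

lemma area_nonneg: "0 \<le> area p a b"
  unfolding area_def set_lebesgue_integral_def by (intro Bochner_Integration.integral_nonneg) auto

lemma area_pos:
  assumes p: "cadlag p" and a: "0 \<le> a" "a < b" shows "0 < area p a b"
proof (rule ccontr)
  assume "\<not> 0 < area p a b"
  then have "area p a b = 0" using area_nonneg[of p a b] by simp
  then have "AE u in lborel. indicator {a..b} u *\<^sub>R exp (p u) = 0"
    unfolding area_def set_lebesgue_integral_def
    using integral_nonneg_eq_0_iff_AE[OF area_set_integrable[OF p a(1), unfolded set_integrable_def]] by auto
  then have "AE u in lborel. u \<notin> {a..b}" by eventually_elim (auto simp: indicator_def split: if_splits)
  moreover have "(AE u in lborel. u \<notin> {a..b}) \<longleftrightarrow> emeasure lborel {a..b} = 0"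
    by (rule AE_iff_measurable) auto
  ultimately have "emeasure lborel {a..b} = 0" by blast
  then show False using a by simp
qed

text \<open>For the measure with density \<open>exp p\<close> on \<open>{0..t}\<close> the tail mass
  beyond \<open>u\<close> is \<open>area p u t\<close>, so the tail transform turns the integral of
  \<open>s * y powr (s - 1)\<close> over the range of the area into one over time. The end point
  \<open>t\<close>, where the area vanishes, is left out.\<close>

lemma area_powr_eq:
  assumes p: "cadlag p" and t: "0 \<le> t" and s: "0 < s"
  shows "ennreal (area p 0 t powr s)
    = (\<integral>\<^sup>+u. ennreal (s * area p u t powr (s - 1) * exp (p u)) * indicator {0..<t} u \<partial>lborel)"
proof -
  define p' where "p' u = (if 0 \<le> u then p u else 0)" for u
  have [measurable]: "p' \<in> borel_measurable borel" unfolding p'_def by (rule cadlag_measurable[OF p])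
  define \<nu> where "\<nu> = density lborel (\<lambda>u. ennreal (exp (p' u)) * indicator {0..t} u)"
  have em: "emeasure \<nu> S = (\<integral>\<^sup>+u. ennreal (exp (p' u)) * indicator {0..t} u * indicator S u \<partial>lborel)"
    if "S \<in> sets borel" for S
    unfolding \<nu>_def using that by (subst emeasure_density) auto
  have tot: "emeasure \<nu> UNIV = ennreal (area p 0 t)"
    by (subst em) (auto simp: ennreal_area[OF p] p'_def intro!: nn_integral_cong split: split_indicator)
  have fin: "finite_borel_measure \<nu>"
    unfolding finite_borel_measure_def finite_borel_measure_axioms_def
    by (intro conjI finite_measureI) (auto simp: tot \<nu>_def[THEN arg_cong[of _ _ space]] \<nu>_def[THEN arg_cong[of _ _ sets]])
  interpret finite_borel_measure \<nu> by (rule fin)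
  have atom: "measure \<nu> {x} = 0" for x
  proof -
    have "emeasure \<nu> {x} = 0"
      by (subst em) (auto intro!: nn_integral_null_set)
    then show ?thesis by (simp add: measure_def)
  qed
  have tail: "measure \<nu> {u<..} = area p u t" if "0 \<le> u" for u
  proof -
    have "emeasure \<nu> {u<..} = (\<integral>\<^sup>+v. ennreal (exp (p v)) * indicator {u..t} v \<partial>lborel)"
      unfolding em[OF greaterThan_borel] using AE_lborel_singleton[of u] that
      by (intro nn_integral_cong_AE) (auto elim!: eventually_mono simp: p'_def split: split_indicator)
    also have "\<dots> = ennreal (area p u t)" by (rule ennreal_area[OF p that, symmetric])
    finally show ?thesis by (simp add: measure_def area_nonneg)
  qed
  define h where "h y = ennreal (s * y powr (s - 1))" for y :: real
  have [measurable]: "h \<in> borel_measurable borel" unfolding h_def by measurable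
  have "((\<lambda>y. y powr (s - 1)) has_integral (area p 0 t powr (s - 1 + 1) / (s - 1 + 1))) {0..area p 0 t}"
    using s by (intro has_integral_powr_from_0 area_nonneg) auto
  then have "((\<lambda>y. s * y powr (s - 1)) has_integral (s * (area p 0 t powr s / s))) {0..area p 0 t}"
    by (intro has_integral_mult_right) simp
  then have "(\<integral>\<^sup>+y. h y * indicator {0..area p 0 t} y \<partial>lborel) = ennreal (s * (area p 0 t powr s / s))"
    unfolding h_def using s by (intro nn_integral_has_integral_lebesgue') auto
  moreover have "measure \<nu> UNIV = area p 0 t" using tot by (simp add: measure_def area_nonneg)
  ultimately have "ennreal (area p 0 t powr s) = (\<integral>\<^sup>+u. h (measure \<nu> {u<..}) \<partial>\<nu>)"
    using nn_integral_tail_transform[OF atom, of h] s by simp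
  also have "\<dots> = (\<integral>\<^sup>+u. ennreal (exp (p' u)) * indicator {0..t} u * h (measure \<nu> {u<..}) \<partial>lborel)"
  proof -
    have "(\<lambda>u. measure \<nu> {u<..}) = (\<lambda>u. measure \<nu> UNIV - cdf \<nu> u)"
    proof
      fix u :: real
      have "{u<..} = UNIV - {..u}" by auto
      then show "measure \<nu> {u<..} = measure \<nu> UNIV - cdf \<nu> u"
        using finite_measure_compl[of "{..u}"] by (simp add: \<nu>_def cdf_def)
    qed
    moreover have "(\<lambda>u. measure \<nu> UNIV - cdf \<nu> u) \<in> borel_measurable borel"
      using borel_measurable_mono[of "cdf \<nu>"] cdf_nondecreasing by (auto simp: mono_def)
    ultimately have [measurable]: "(\<lambda>u. measure \<nu> {u<..}) \<in> borel_measurable borel" by simp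
    show ?thesis unfolding \<nu>_def[THEN arg_cong[of _ _ "nn_integral"], THEN fun_cong]
      by (subst nn_integral_density) auto
  qed
  also have "\<dots> = (\<integral>\<^sup>+u. ennreal (s * area p u t powr (s - 1) * exp (p u)) * indicator {0..<t} u \<partial>lborel)"
    using AE_lborel_singleton[of t] s
    by (intro nn_integral_cong_AE)
      (auto elim!: eventually_mono simp: tail p'_def h_def mult_ac area_nonneg simp flip: ennreal_mult split: split_indicator)
  finally show ?thesis .
qed

section \<open>The functional of a restarted path and its moments\<close>

locale levy = prob_space M for M :: "'a measure" +
  fixes X :: "real \<Rightarrow> 'a \<Rightarrow> real"
  assumes levy: "levy_process M X"
begin

lemma X_measurable [measurable]: "0 \<le> t \<Longrightarrow> X t \<in> borel_measurable M"
  and X_0: "AE \<omega> in M. X 0 \<omega> = 0"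
  and X_increments: "0 \<le> \<tau> 0 \<Longrightarrow> mono \<tau> \<Longrightarrow>
     indep_vars (\<lambda>_. borel) (\<lambda>i \<omega>. X (\<tau> (Suc i)) \<omega> - X (\<tau> i) \<omega>) {..<n}"
  and X_stationary: "0 \<le> s \<Longrightarrow> 0 \<le> t \<Longrightarrow>
     distr M borel (\<lambda>\<omega>. X (s + t) \<omega> - X s \<omega>) = distr M borel (\<lambda>\<omega>. X t \<omega> - X 0 \<omega>)"
  and X_cadlag: "\<omega> \<in> space M \<Longrightarrow> cadlag (\<lambda>t. X t \<omega>)"
  using levy unfolding levy_process_def by auto

lemma X_joint_measurable: "(\<lambda>(u, \<omega>). if 0 \<le> u then X u \<omega> else 0) \<in> borel_measurable (borel \<Otimes>\<^sub>M M)"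
  by (rule borel_measurable_process[OF X_measurable X_cadlag])

definition shift_area :: "real \<Rightarrow> real \<Rightarrow> 'a \<Rightarrow> real" where
  "shift_area u v \<omega> = area (\<lambda>w. X (u + w) \<omega> - X u \<omega>) 0 v"

text \<open>A function of finitely many increments after time \<open>u\<close>; through it,
  independence and stationarity reach \<open>shift_area\<close>.\<close>

definition riemann :: "real \<Rightarrow> real \<Rightarrow> nat \<Rightarrow> 'a \<Rightarrow> real" where
  "riemann u v n \<omega> = v / real (Suc n) * (\<Sum>k<Suc n. exp (X (u + real (k + 1) * v / real (Suc n)) \<omega> - X u \<omega>))"

lemma riemann_measurable [measurable]: "0 \<le> u \<Longrightarrow> 0 < v \<Longrightarrow> riemann u v n \<in> borel_measurable M"
  unfolding riemann_def by measurable

lemma cadlag_shift: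
  assumes "\<omega> \<in> space M" "0 \<le> u" shows "cadlag (\<lambda>w. X (u + w) \<omega> - X u \<omega>)"
  unfolding cadlag_def continuous_within
proof (intro conjI allI impI)
  fix t :: real assume t: "0 \<le> t"
  have "((\<lambda>w. X w \<omega>) \<longlongrightarrow> X (u + t) \<omega>) (at_right (u + t))"
    using cadlag_right[OF X_cadlag[OF assms(1)], of "u + t"] assms t by simp
  moreover have "at_right (u + t) = filtermap (\<lambda>w. w + u) (at_right t)" using filtermap_at_right_shift[of "- u" t] by (simp add: add.commute)
  ultimately have "((\<lambda>w. X (w + u) \<omega>) \<longlongrightarrow> X (u + t) \<omega>) (at_right t)"
    by (simp add: filterlim_filtermap)
  then show "((\<lambda>w. X (u + w) \<omega> - X u \<omega>) \<longlongrightarrow> X (u + t) \<omega> - X u \<omega>) (at_right t)"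
    by (intro tendsto_intros) (simp add: add.commute)
next
  fix t :: real assume t: "0 < t"
  then obtain l where "((\<lambda>w. X w \<omega>) \<longlongrightarrow> l) (at_left (u + t))"
    using X_cadlag[OF assms(1)] assms(2) unfolding cadlag_def by (metis add_nonneg_pos)
  moreover have "at_left (u + t) = filtermap (\<lambda>w. w + u) (at_left t)" using filtermap_at_left_shift[of "- u" t] by (simp add: add.commute)
  ultimately have "((\<lambda>w. X (w + u) \<omega>) \<longlongrightarrow> l) (at_left t)" by (simp add: filterlim_filtermap)
  then have "((\<lambda>w. X (u + w) \<omega> - X u \<omega>) \<longlongrightarrow> l - X u \<omega>) (at_left t)"
    by (intro tendsto_intros) (simp add: add.commute)
  then show "\<exists>l. ((\<lambda>w. X (u + w) \<omega> - X u \<omega>) \<longlongrightarrow> l) (at_left t)" by blast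
qed

lemma riemann_tendsto:
  assumes "\<omega> \<in> space M" "0 \<le> u" "0 < v"
  shows "(\<lambda>n. riemann u v n \<omega>) \<longlonglongrightarrow> shift_area u v \<omega>"
proof -
  let ?p = "\<lambda>w. X (u + w) \<omega> - X u \<omega>"
  note c = cadlag_shift[OF assms(1,2)]
  obtain B where B: "\<And>w. 0 \<le> w \<Longrightarrow> w \<le> v \<Longrightarrow> \<bar>?p w\<bar> \<le> B" using cadlag_bounded[OF c, of v] assms(3) by auto
  have "(\<lambda>n. v / real (Suc n) * (\<Sum>k<Suc n. exp (?p (real (k + 1) * v / real (Suc n))))) \<longlonglongrightarrow> (LINT u:{0..v}|lborel. exp (?p u))"
  proof (rule riemann_sums_right[OF assms(3)])
    show "\<bar>exp (?p w)\<bar> \<le> exp B" if "0 \<le> w" "w \<le> v" for w using B[OF that] by auto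
    show "((\<lambda>w. exp (?p w)) \<longlongrightarrow> exp (?p w)) (at_right w)" if "0 \<le> w" "w < v" for w
      using cadlag_right[OF c that(1)] by (rule tendsto_exp)
  qed
  then show ?thesis unfolding riemann_def shift_area_def area_def .
qed

lemma shift_area_measurable [measurable]:
  assumes "0 \<le> u" "0 < v" shows "shift_area u v \<in> borel_measurable M"
  by (rule borel_measurable_LIMSEQ_real[OF riemann_tendsto riemann_measurable]) (use assms in auto)

lemma shift_area_pos: "\<omega> \<in> space M \<Longrightarrow> 0 \<le> u \<Longrightarrow> 0 < v \<Longrightarrow> 0 < shift_area u v \<omega>"
  unfolding shift_area_def by (intro area_pos cadlag_shift) auto

text \<open>The time 0 is put in front of the grid starting at \<open>u\<close>. Thus increment 0 is
  the past \<open>X u - X 0\<close>, and the increments 1 to \<open>n + 1\<close> are those that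
  enter \<open>riemann u v n\<close>.\<close>

definition times :: "real \<Rightarrow> real \<Rightarrow> nat \<Rightarrow> nat \<Rightarrow> real" where
  "times u v n k = (case k of 0 \<Rightarrow> 0 | Suc j \<Rightarrow> u + real j * v / real (Suc n))"

definition incr :: "real \<Rightarrow> real \<Rightarrow> nat \<Rightarrow> nat \<Rightarrow> 'a \<Rightarrow> real" where
  "incr u v n k \<omega> = X (times u v n (Suc k)) \<omega> - X (times u v n k) \<omega>"

lemma times_nonneg: "0 \<le> u \<Longrightarrow> 0 \<le> v \<Longrightarrow> 0 \<le> times u v n k"
  by (auto simp: times_def split: nat.split)

lemma incr_indep:
  assumes "0 \<le> u" "0 \<le> v"
  shows "indep_vars (\<lambda>_. borel) (incr u v n) {..<N}"
  unfolding incr_def[abs_def]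
proof (rule X_increments)
  show "mono (times u v n)"
    unfolding mono_iff_le_Suc using assms
    by (auto simp: times_def divide_right_mono mult_right_mono split: nat.split)
qed (simp add: times_def)

lemma incr_measurable [measurable]: "0 \<le> u \<Longrightarrow> 0 \<le> v \<Longrightarrow> incr u v n k \<in> borel_measurable M"
  unfolding incr_def by (intro borel_measurable_diff X_measurable times_nonneg) auto

lemma incr_0: "incr u v n 0 \<omega> = X u \<omega> - X 0 \<omega>"
  by (simp add: incr_def times_def)

lemma distr_incr_Suc:
  assumes "0 \<le> u" "0 \<le> v"
  shows "distr M borel (incr u v n (Suc k)) = distr M borel (\<lambda>\<omega>. X (v / real (Suc n)) \<omega> - X 0 \<omega>)"
proof -
  have "u + real (Suc k) * v / real (Suc n) = (u + real k * v / real (Suc n)) + v / real (Suc n)"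
    by (simp add: add_divide_distrib distrib_right)
  then have "incr u v n (Suc k) = (\<lambda>\<omega>. X ((u + real k * v / real (Suc n)) + v / real (Suc n)) \<omega> - X (u + real k * v / real (Suc n)) \<omega>)"
    by (auto simp: incr_def times_def fun_eq_iff add.assoc)
  then show ?thesis using assms X_stationary[of "u + real k * v / real (Suc n)" "v / real (Suc n)"] by simp
qed

lemma sum_incr: "(\<Sum>j<k. incr u v n (Suc j) \<omega>) = X (u + real k * v / real (Suc n)) \<omega> - X u \<omega>"
  by (induction k) (auto simp: incr_def times_def)

definition rsum :: "real \<Rightarrow> nat \<Rightarrow> (nat \<Rightarrow> real) \<Rightarrow> real" where
  "rsum v n y = v / real (Suc n) * (\<Sum>k<Suc n. exp (\<Sum>j<k + 1. y (Suc j)))"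

lemma riemann_eq_rsum: "riemann u v n \<omega> = rsum v n (\<lambda>i\<in>{1..<n + 2}. incr u v n i \<omega>)"
proof -
  have "(\<Sum>j<k + 1. (\<lambda>i\<in>{1..<n + 2}. incr u v n i \<omega>) (Suc j)) = (\<Sum>j<k + 1. incr u v n (Suc j) \<omega>)" if "k < Suc n" for k
    using that by (intro sum.cong) auto
  then show ?thesis unfolding riemann_def rsum_def sum_incr[symmetric] by (intro arg_cong2[of _ _ _ _ "(*)"] sum.cong refl) simp
qed

lemma rsum_measurable: "rsum v n \<in> borel_measurable (PiM {1..<n + 2} (\<lambda>_. borel))"
proof -
  have "(\<lambda>y. exp (\<Sum>j<k + 1. y (Suc j))) \<in> borel_measurable (PiM {1..<n + 2} (\<lambda>_. borel :: real measure))" if "k < Suc n" for k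
  proof -
    have "(\<lambda>y. \<Sum>j<k + 1. y (Suc j)) \<in> borel_measurable (PiM {1..<n + 2} (\<lambda>_. borel :: real measure))"
      using that by (intro borel_measurable_sum measurable_component_singleton) auto
    then show ?thesis by measurable
  qed
  then show ?thesis unfolding rsum_def
    by (intro borel_measurable_times borel_measurable_const borel_measurable_sum) auto
qed

lemma incr_joint_distr:
  assumes "0 \<le> u" "0 \<le> v"
  shows "distr M (PiM {1..<n + 2} (\<lambda>_. borel)) (\<lambda>\<omega>. \<lambda>i\<in>{1..<n + 2}. incr u v n i \<omega>)
    = PiM {1..<n + 2} (\<lambda>_. distr M borel (\<lambda>\<omega>. X (v / real (Suc n)) \<omega> - X 0 \<omega>))"
proof -
  have "indep_vars (\<lambda>_. borel) (incr u v n) {1..<n + 2}"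
    by (rule indep_vars_subset[OF incr_indep[OF assms, of n "n + 2"]]) auto
  then have "distr M (PiM {1..<n + 2} (\<lambda>_. borel)) (\<lambda>\<omega>. \<lambda>i\<in>{1..<n + 2}. incr u v n i \<omega>)
    = PiM {1..<n + 2} (\<lambda>i. distr M borel (incr u v n i))"
    using assms by (subst indep_vars_iff_distr_eq_PiM'[symmetric]) auto
  also have "\<dots> = PiM {1..<n + 2} (\<lambda>_. distr M borel (\<lambda>\<omega>. X (v / real (Suc n)) \<omega> - X 0 \<omega>))"
  proof (rule PiM_cong)
    fix i assume "i \<in> {1..<n + 2}"
    then obtain k where "i = Suc k" by (cases i) auto
    then show "distr M borel (incr u v n i) = distr M borel (\<lambda>\<omega>. X (v / real (Suc n)) \<omega> - X 0 \<omega>)"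
      using distr_incr_Suc[OF assms] by simp
  qed simp
  finally show ?thesis .
qed

text \<open>By stationarity and independence the increments after \<open>u\<close> have a joint law
  that does not involve \<open>u\<close>.\<close>

lemma nn_integral_riemann_shift:
  assumes u: "0 \<le> u" and v: "0 < v" and [measurable]: "h \<in> borel_measurable borel"
  shows "(\<integral>\<^sup>+\<omega>. h (riemann u v n \<omega>) \<partial>M) = (\<integral>\<^sup>+\<omega>. h (riemann 0 v n \<omega>) \<partial>M)"
proof -
  have "(\<integral>\<^sup>+\<omega>. h (riemann u v n \<omega>) \<partial>M)
     = (\<integral>\<^sup>+y. h (rsum v n y) \<partial>PiM {1..<n + 2} (\<lambda>_. distr M borel (\<lambda>\<omega>. X (v / real (Suc n)) \<omega> - X 0 \<omega>)))" if "0 \<le> u" for u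
    unfolding incr_joint_distr[OF that less_imp_le[OF v], symmetric] riemann_eq_rsum
  proof (rule nn_integral_distr[symmetric])
    show "(\<lambda>\<omega>. \<lambda>i\<in>{1..<n + 2}. incr u v n i \<omega>) \<in> M \<rightarrow>\<^sub>M PiM {1..<n + 2} (\<lambda>_. borel)"
      using that v by (intro measurable_restrict) auto
    have "(\<lambda>y. h (rsum v n y)) \<in> borel_measurable (PiM {1..<n + 2} (\<lambda>_. borel))"
      by (rule measurable_compose[OF rsum_measurable]) measurable
    then show "(\<lambda>y. h (rsum v n y)) \<in> borel_measurable
        (distr M (PiM {1..<n + 2} (\<lambda>_. borel)) (\<lambda>\<omega>. \<lambda>i\<in>{1..<n + 2}. incr u v n i \<omega>))"
      by (simp only: measurable_distr_eq1)
  qed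
  from this[OF u] this[of 0] show ?thesis by simp
qed

lemma nn_integral_riemann_indep:
  assumes u: "0 \<le> u" and v: "0 < v" and [measurable]: "h \<in> borel_measurable borel" "g \<in> borel_measurable borel"
  shows "(\<integral>\<^sup>+\<omega>. g (X u \<omega> - X 0 \<omega>) * h (riemann u v n \<omega>) \<partial>M)
    = (\<integral>\<^sup>+\<omega>. g (X u \<omega> - X 0 \<omega>) \<partial>M) * (\<integral>\<^sup>+\<omega>. h (riemann 0 v n \<omega>) \<partial>M)"
proof -
  have 1: "(\<lambda>y. g (y 0)) \<in> borel_measurable (PiM {0::nat} (\<lambda>_. borel))" by measurable
  have 2: "(\<lambda>y. h (rsum v n y)) \<in> borel_measurable (PiM {1..<n + 2} (\<lambda>_. borel))"
    by (rule measurable_compose[OF rsum_measurable]) measurable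
  have "(\<integral>\<^sup>+\<omega>. g ((\<lambda>i\<in>{0}. incr u v n i \<omega>) 0) * h (rsum v n (\<lambda>i\<in>{1..<n + 2}. incr u v n i \<omega>)) \<partial>M)
    = (\<integral>\<^sup>+\<omega>. g ((\<lambda>i\<in>{0}. incr u v n i \<omega>) 0) \<partial>M) * (\<integral>\<^sup>+\<omega>. h (rsum v n (\<lambda>i\<in>{1..<n + 2}. incr u v n i \<omega>)) \<partial>M)"
    using u v by (intro indep_vars_nn_integral_split[OF incr_indep[of u v n "n + 2"] _ _ _ 1 2]) auto
  then show ?thesis
    unfolding riemann_eq_rsum[symmetric] nn_integral_riemann_shift[OF u v assms(3)] by (simp add: incr_0)
qed

text \<open>The Markov property at the fixed time \<open>u\<close>, in the form needed for the
  recursion: exact for Riemann sums, then carried to the limit. The exponent \<open>r\<close> may be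
  negative.\<close>

lemma shift_area_moment:
  assumes u: "0 \<le> u" and v: "0 < v" and fin: "(\<integral>\<^sup>+\<omega>. ennreal (exp (z * (X u \<omega> - X 0 \<omega>))) \<partial>M) = ennreal c"
  shows "(\<integral>\<^sup>+\<omega>. ennreal (exp (z * (X u \<omega> - X 0 \<omega>))) * ennreal (shift_area u v \<omega> powr r) \<partial>M)
    = ennreal c * (\<integral>\<^sup>+\<omega>. ennreal (shift_area 0 v \<omega> powr r) \<partial>M)"
proof -
  define g where "g x = ennreal (exp (z * x))" for x :: real
  have [measurable]: "g \<in> borel_measurable borel" unfolding g_def by measurable
  \<comment> \<open>Truncation at \<open>K\<close> supplies a bound for dominated convergence in
    \<open>n\<close>; monotone convergence in \<open>K\<close> removes it afterwards.\<close>
  define h where "h K x = ennreal (min (real K) (x powr r))" for K :: nat and x :: real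
  have [measurable]: "h K \<in> borel_measurable borel" for K unfolding h_def by measurable
  have hlim: "(\<lambda>n. h K (riemann u v n \<omega>)) \<longlonglongrightarrow> h K (shift_area u v \<omega>)" if "\<omega> \<in> space M" "0 \<le> u" for K \<omega> u
    unfolding h_def using shift_area_pos[OF that v]
    by (intro tendsto_ennrealI tendsto_min tendsto_const tendsto_powr riemann_tendsto that v) auto
  have hK: "h K x \<le> ennreal (real K)" for K x unfolding h_def by (intro ennreal_leI) auto
  have gfin: "(\<integral>\<^sup>+\<omega>. g (X u \<omega> - X 0 \<omega>) \<partial>M) = ennreal c" using fin by (simp add: g_def)
  have K: "(\<integral>\<^sup>+\<omega>. g (X u \<omega> - X 0 \<omega>) * h K (shift_area u v \<omega>) \<partial>M)
     = ennreal c * (\<integral>\<^sup>+\<omega>. h K (shift_area 0 v \<omega>) \<partial>M)" for K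
  proof (rule LIMSEQ_unique)
    show "(\<lambda>n. \<integral>\<^sup>+\<omega>. g (X u \<omega> - X 0 \<omega>) * h K (riemann u v n \<omega>) \<partial>M)
      \<longlonglongrightarrow> (\<integral>\<^sup>+\<omega>. g (X u \<omega> - X 0 \<omega>) * h K (shift_area u v \<omega>) \<partial>M)"
    proof (rule nn_integral_dominated_convergence[where w="\<lambda>\<omega>. g (X u \<omega> - X 0 \<omega>) * ennreal (real K)"])
      show "(\<integral>\<^sup>+\<omega>. g (X u \<omega> - X 0 \<omega>) * ennreal (real K) \<partial>M) < \<infinity>"
        using u by (subst nn_integral_multc) (auto simp: gfin ennreal_mult_less_top)
      show "AE \<omega> in M. (\<lambda>n. g (X u \<omega> - X 0 \<omega>) * h K (riemann u v n \<omega>)) \<longlonglongrightarrow> g (X u \<omega> - X 0 \<omega>) * h K (shift_area u v \<omega>)"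
        using u by (intro AE_I2 ennreal_tendsto_cmult hlim) (auto simp: g_def)
    qed (use u v hK in \<open>auto intro!: AE_I2 mult_left_mono\<close>)
    have "(\<lambda>n. \<integral>\<^sup>+\<omega>. h K (riemann 0 v n \<omega>) \<partial>M) \<longlonglongrightarrow> (\<integral>\<^sup>+\<omega>. h K (shift_area 0 v \<omega>) \<partial>M)"
    proof (rule nn_integral_dominated_convergence[where w="\<lambda>\<omega>. ennreal (real K)"])
      show "AE \<omega> in M. (\<lambda>n. h K (riemann 0 v n \<omega>)) \<longlonglongrightarrow> h K (shift_area 0 v \<omega>)"
        by (intro AE_I2 hlim) auto
    qed (use v hK in \<open>auto simp: emeasure_space_1 ennreal_mult_less_top\<close>)
    then show "(\<lambda>n. \<integral>\<^sup>+\<omega>. g (X u \<omega> - X 0 \<omega>) * h K (riemann u v n \<omega>) \<partial>M)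
      \<longlonglongrightarrow> ennreal c * (\<integral>\<^sup>+\<omega>. h K (shift_area 0 v \<omega>) \<partial>M)"
      using u v by (simp add: nn_integral_riemann_indep gfin ennreal_tendsto_cmult)
  qed
  have hsup: "(SUP K. h K x) = ennreal (x powr r)" for x
  proof (rule antisym)
    show "(SUP K. h K x) \<le> ennreal (x powr r)" by (intro SUP_least) (auto simp: h_def intro!: ennreal_leI)
    obtain K :: nat where "x powr r \<le> real K" using real_arch_simple by blast
    then have "h K x = ennreal (x powr r)" by (simp add: h_def min_def)
    then show "ennreal (x powr r) \<le> (SUP K. h K x)" by (metis SUP_upper UNIV_I)
  qed
  have hinc: "incseq (\<lambda>K. h K x)" for x
    by (auto simp: incseq_def h_def intro!: ennreal_leI min.mono)
  have sup: "(\<integral>\<^sup>+\<omega>. G \<omega> * ennreal (shift_area u v \<omega> powr r) \<partial>M) = (SUP K. \<integral>\<^sup>+\<omega>. G \<omega> * h K (shift_area u v \<omega>) \<partial>M)"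
    if "0 \<le> u" and [measurable]: "G \<in> borel_measurable M" for u and G :: "'a \<Rightarrow> ennreal"
  proof -
    have "(\<integral>\<^sup>+\<omega>. G \<omega> * ennreal (shift_area u v \<omega> powr r) \<partial>M) = (\<integral>\<^sup>+\<omega>. (SUP K. G \<omega> * h K (shift_area u v \<omega>)) \<partial>M)"
      by (simp add: SUP_mult_left_ennreal[symmetric] hsup)
    also have "\<dots> = (SUP K. \<integral>\<^sup>+\<omega>. G \<omega> * h K (shift_area u v \<omega>) \<partial>M)"
      using that v hinc by (intro nn_integral_monotone_convergence_SUP) (auto simp: incseq_def le_fun_def intro!: mult_left_mono)
    finally show ?thesis .
  qed
  have "(\<integral>\<^sup>+\<omega>. g (X u \<omega> - X 0 \<omega>) * ennreal (shift_area u v \<omega> powr r) \<partial>M)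
     = (SUP K. ennreal c * (\<integral>\<^sup>+\<omega>. h K (shift_area 0 v \<omega>) \<partial>M))"
    using u by (subst sup) (auto simp: K)
  also have "\<dots> = ennreal c * (SUP K. \<integral>\<^sup>+\<omega>. h K (shift_area 0 v \<omega>) \<partial>M)" by (rule SUP_mult_left_ennreal[symmetric])
  also have "(SUP K. \<integral>\<^sup>+\<omega>. h K (shift_area 0 v \<omega>) \<partial>M) = (\<integral>\<^sup>+\<omega>. ennreal (shift_area 0 v \<omega> powr r) \<partial>M)"
    using sup[of 0 "\<lambda>_. 1"] by simp
  finally show ?thesis unfolding g_def .
qed

text \<open>A Riemann sum is at most \<open>v\<close> times the largest partial product of
  exponentiated increments, so the maximal moment bound applies. Each of the \<open>n + 1\<close>
  factors contributes at most \<open>exp (\<kappa> * v / (n + 1))\<close>, a bound uniform in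
  \<open>n\<close>, and Fatou's lemma concludes.\<close>

lemma shift_area_moment_le:
  assumes v: "0 < v" and r: "0 < r" "r < \<theta>" and \<kappa>: "0 \<le> \<kappa>"
    and mgf: "\<And>t. 0 \<le> t \<Longrightarrow> (\<integral>\<^sup>+\<omega>. ennreal (exp (\<theta> * (X t \<omega> - X 0 \<omega>))) \<partial>M) \<le> ennreal (exp (\<kappa> * t))"
  shows "(\<integral>\<^sup>+\<omega>. ennreal (shift_area 0 v \<omega> powr r) \<partial>M) \<le> ennreal (v powr r * (1 + r / (\<theta> - r)) * exp (\<kappa> * v))"
proof -
  have bd: "(\<integral>\<^sup>+\<omega>. ennreal (riemann 0 v n \<omega> powr r) \<partial>M) \<le> ennreal (v powr r * (1 + r / (\<theta> - r)) * exp (\<kappa> * v))" for n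
  proof -
    define \<xi> where "\<xi> j \<omega> = exp (incr 0 v n (Suc j) \<omega>)" for j \<omega>
    have pr: "(\<Prod>j<k. \<xi> j \<omega>) = exp (X (real k * v / real (Suc n)) \<omega> - X 0 \<omega>)" for k \<omega>
      unfolding \<xi>_def exp_sum[symmetric, OF finite_lessThan] sum_incr by simp
    have ind: "indep_vars (\<lambda>_. borel) \<xi> {..<Suc n}"
    proof -
      have "indep_vars (\<lambda>_. borel) (\<lambda>j \<omega>. exp (X (real (Suc j) * v / real (Suc n)) \<omega> - X (real j * v / real (Suc n)) \<omega>)) {..<Suc n}"
        using v by (intro indep_vars_compose2[where Y="\<lambda>_. exp" and M'="\<lambda>_. borel"] X_increments[where \<tau>="\<lambda>j. real j * v / real (Suc n)"])
          (auto simp: mono_def intro!: divide_right_mono mult_right_mono)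
      moreover have "\<xi> = (\<lambda>j \<omega>. exp (X (real (Suc j) * v / real (Suc n)) \<omega> - X (real j * v / real (Suc n)) \<omega>))"
        by (simp add: fun_eq_iff \<xi>_def incr_def times_def)
      ultimately show ?thesis by simp
    qed
    have le: "riemann 0 v n \<omega> powr r \<le> v powr r * max_prod (Suc n) (\<lambda>j. \<xi> j \<omega>) powr r" for \<omega>
    proof -
      have "riemann 0 v n \<omega> = v / real (Suc n) * (\<Sum>k<Suc n. \<Prod>j<k + 1. \<xi> j \<omega>)"
        unfolding riemann_def pr by simp
      also have "\<dots> \<le> v / real (Suc n) * (\<Sum>k<Suc n. max_prod (Suc n) (\<lambda>j. \<xi> j \<omega>))"
        using v by (intro mult_left_mono sum_mono max_prod_ge) auto
      also have "\<dots> = v * max_prod (Suc n) (\<lambda>j. \<xi> j \<omega>)" by simp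
      finally have "riemann 0 v n \<omega> \<le> v * max_prod (Suc n) (\<lambda>j. \<xi> j \<omega>)" .
      moreover have "0 \<le> riemann 0 v n \<omega>" unfolding riemann_def using v by (intro mult_nonneg_nonneg sum_nonneg) auto
      ultimately have "riemann 0 v n \<omega> powr r \<le> (v * max_prod (Suc n) (\<lambda>j. \<xi> j \<omega>)) powr r" using r by (intro powr_mono2) auto
      also have "\<dots> = v powr r * max_prod (Suc n) (\<lambda>j. \<xi> j \<omega>) powr r"
        by (rule powr_mult)
      finally show ?thesis .
    qed
    have mom: "max 1 (\<integral>\<^sup>+\<omega>. ennreal (\<xi> j \<omega> powr \<theta>) \<partial>M) \<le> ennreal (exp (\<kappa> * v / real (Suc n)))" for j
    proof -
      have "(\<integral>\<^sup>+\<omega>. ennreal (\<xi> j \<omega> powr \<theta>) \<partial>M) = (\<integral>\<^sup>+x. ennreal (exp (\<theta> * x)) \<partial>distr M borel (incr 0 v n (Suc j)))"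
        using v by (subst nn_integral_distr) (auto simp: \<xi>_def powr_def)
      also have "\<dots> = (\<integral>\<^sup>+\<omega>. ennreal (exp (\<theta> * (X (v / real (Suc n)) \<omega> - X 0 \<omega>))) \<partial>M)"
        using v by (subst distr_incr_Suc, simp, simp, subst nn_integral_distr) auto
      also have "\<dots> \<le> ennreal (exp (\<kappa> * (v / real (Suc n))))" using v by (intro mgf) auto
      finally show ?thesis using \<kappa> v by (simp add: ennreal_1[symmetric] del: ennreal_1)
    qed
    have [measurable]: "(\<lambda>\<omega>. max_prod (Suc n) (\<lambda>j. \<xi> j \<omega>)) \<in> borel_measurable M"
    proof -
      have "(\<lambda>\<omega>. max_prod (Suc n) (\<lambda>j. \<xi> j \<omega>)) = (\<lambda>\<omega>. max_prod (Suc n) (\<lambda>j\<in>{..<Suc n}. \<xi> j \<omega>))"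
        by (intro ext max_prod_cong) auto
      moreover have "(\<lambda>\<omega>. max_prod (Suc n) (\<lambda>j\<in>{..<Suc n}. \<xi> j \<omega>)) \<in> borel_measurable M"
        using ind by (intro measurable_compose[OF _ borel_measurable_max_prod] measurable_restrict) (auto simp: indep_vars_def)
      ultimately show ?thesis by simp
    qed
    have "(\<integral>\<^sup>+\<omega>. ennreal (riemann 0 v n \<omega> powr r) \<partial>M)
       \<le> (\<integral>\<^sup>+\<omega>. ennreal (v powr r) * ennreal (max_prod (Suc n) (\<lambda>j. \<xi> j \<omega>) powr r) \<partial>M)"
      using le by (intro nn_integral_mono) (auto simp flip: ennreal_mult intro!: ennreal_leI)
    also have "\<dots> = ennreal (v powr r) * (\<integral>\<^sup>+\<omega>. ennreal (max_prod (Suc n) (\<lambda>j. \<xi> j \<omega>) powr r) \<partial>M)"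
      by (rule nn_integral_cmult) measurable
    also have "\<dots> \<le> ennreal (v powr r) * (ennreal (1 + r / (\<theta> - r)) * (\<Prod>j<Suc n. max 1 (\<integral>\<^sup>+\<omega>. ennreal (\<xi> j \<omega> powr \<theta>) \<partial>M)))"
      by (intro mult_left_mono max_prod_moment_le[OF ind _ r]) (auto simp: \<xi>_def)
    also have "\<dots> \<le> ennreal (v powr r) * (ennreal (1 + r / (\<theta> - r)) * (\<Prod>j<Suc n. ennreal (exp (\<kappa> * v / real (Suc n)))))"
    proof -
      have "(\<Prod>j<N. max 1 (\<integral>\<^sup>+\<omega>. ennreal (\<xi> j \<omega> powr \<theta>) \<partial>M)) \<le> (\<Prod>j<N. ennreal (exp (\<kappa> * v / real (Suc n))))" for N
      proof (induction N)
        case (Suc N)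
        then show ?case unfolding prod.lessThan_Suc by (rule mult_mono[OF _ mom]) auto
      qed simp
      then show ?thesis by (intro mult_left_mono) (auto simp del: prod_constant prod.lessThan_Suc)
    qed
    also have "(\<Prod>j<Suc n. ennreal (exp (\<kappa> * v / real (Suc n)))) = ennreal (exp (\<kappa> * v))"
    proof -
      have "(\<Prod>j<Suc n. ennreal (exp (\<kappa> * v / real (Suc n)))) = ennreal (exp (\<kappa> * v / real (Suc n)) ^ Suc n)"
        by (simp only: prod_constant card_lessThan ennreal_power exp_ge_zero)
      also have "exp (\<kappa> * v / real (Suc n)) ^ Suc n = exp (real (Suc n) * (\<kappa> * v / real (Suc n)))" by (rule exp_of_nat_mult[symmetric])
      also have "real (Suc n) * (\<kappa> * v / real (Suc n)) = \<kappa> * v" by simp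
      finally show ?thesis .
    qed
    also have "ennreal (v powr r) * (ennreal (1 + r / (\<theta> - r)) * ennreal (exp (\<kappa> * v))) = ennreal (v powr r * (1 + r / (\<theta> - r)) * exp (\<kappa> * v))"
      using r by (simp add: ennreal_mult' mult.assoc)
    finally show ?thesis .
  qed
  have "(\<integral>\<^sup>+\<omega>. ennreal (shift_area 0 v \<omega> powr r) \<partial>M) = (\<integral>\<^sup>+\<omega>. liminf (\<lambda>n. ennreal (riemann 0 v n \<omega> powr r)) \<partial>M)"
  proof (intro nn_integral_cong)
    fix \<omega> assume w: "\<omega> \<in> space M"
    have "(\<lambda>n. ennreal (riemann 0 v n \<omega> powr r)) \<longlonglongrightarrow> ennreal (shift_area 0 v \<omega> powr r)"
      using shift_area_pos[OF w _ v, of 0] by (intro tendsto_ennrealI tendsto_powr tendsto_const riemann_tendsto w v) auto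
    from lim_imp_Liminf[OF _ this] show "ennreal (shift_area 0 v \<omega> powr r) = liminf (\<lambda>n. ennreal (riemann 0 v n \<omega> powr r))" by simp
  qed
  also have "\<dots> \<le> liminf (\<lambda>n. \<integral>\<^sup>+\<omega>. ennreal (riemann 0 v n \<omega> powr r) \<partial>M)"
    using v by (intro nn_integral_liminf) auto
  also have "\<dots> \<le> ennreal (v powr r * (1 + r / (\<theta> - r)) * exp (\<kappa> * v))"
    using bd by (intro Liminf_le) auto
  finally show ?thesis .
qed

abbreviation path :: "'a \<Rightarrow> real \<Rightarrow> real" where "path \<omega> \<equiv> (\<lambda>u. X u \<omega>)"

lemma area_shift:
  assumes w: "\<omega> \<in> space M" and u: "0 \<le> u"
  shows "area (path \<omega>) u t = exp (X u \<omega>) * shift_area u (t - u) \<omega>"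
proof -
  have "area (path \<omega>) u t = (LINT w|lborel. indicator {u..t} (u + 1 * w) *\<^sub>R exp (X (u + 1 * w) \<omega>))"
    unfolding area_def set_lebesgue_integral_def by (subst lborel_integral_real_affine[where c=1 and t=u]) auto
  also have "\<dots> = (LINT w|lborel. exp (X u \<omega>) * (indicator {0..t - u} w *\<^sub>R exp (X (u + w) \<omega> - X u \<omega>)))"
    by (intro Bochner_Integration.integral_cong) (auto simp: indicator_def exp_diff)
  finally show ?thesis by (simp add: shift_area_def area_def set_lebesgue_integral_def)
qed

lemma area_eq_shift_area: "\<omega> \<in> space M \<Longrightarrow> X 0 \<omega> = 0 \<Longrightarrow> area (path \<omega>) 0 t = shift_area 0 t \<omega>"
  using area_shift[of \<omega> 0 t] by simp

text \<open>The sigma-algebra \<open>N\<close> on the sample space is a parameter: besides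
  \<open>M\<close> itself it is instantiated by the one generated by the process, on which
  independence of the killing time rests.\<close>

lemma area_joint_measurable:
  assumes X: "\<And>t. 0 \<le> t \<Longrightarrow> X t \<in> borel_measurable N" and N: "space N = space M"
    and [measurable]: "f \<in> borel_measurable Q" "g \<in> borel_measurable Q" "k \<in> Q \<rightarrow>\<^sub>M N"
    and f0: "\<And>z. z \<in> space Q \<Longrightarrow> 0 \<le> f z"
  shows "(\<lambda>z. area (path (k z)) (f z) (g z)) \<in> borel_measurable Q"
proof -
  have J: "(\<lambda>(u, \<omega>). if 0 \<le> u then X u \<omega> else 0) \<in> borel_measurable (borel \<Otimes>\<^sub>M N)"
    by (rule borel_measurable_process[OF X]) (use X_cadlag N in auto)
  have K: "(\<lambda>p. (snd p, k (fst p))) \<in> Q \<Otimes>\<^sub>M lborel \<rightarrow>\<^sub>M borel \<Otimes>\<^sub>M N" by measurable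
  have [measurable]: "(\<lambda>p. if 0 \<le> snd p then X (snd p) (k (fst p)) else 0) \<in> borel_measurable (Q \<Otimes>\<^sub>M lborel)"
    using measurable_compose[OF K J] by simp
  have "(\<lambda>p. if f (fst p) \<le> snd p \<and> snd p \<le> g (fst p)
       then exp (if 0 \<le> snd p then X (snd p) (k (fst p)) else 0) else 0) \<in> borel_measurable (Q \<Otimes>\<^sub>M lborel)"
    by measurable
  then have "(\<lambda>(z, w). if f z \<le> w \<and> w \<le> g z then exp (if 0 \<le> w then X w (k z) else 0) else 0) \<in> borel_measurable (Q \<Otimes>\<^sub>M lborel)"
    by (simp add: case_prod_beta)
  from lborel.borel_measurable_lebesgue_integral[OF this]
  have *: "(\<lambda>z. LINT w|lborel. (if f z \<le> w \<and> w \<le> g z then exp (if 0 \<le> w then X w (k z) else 0) else 0)) \<in> borel_measurable Q" .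
  have "(LINT w|lborel. (if f z \<le> w \<and> w \<le> g z then exp (if 0 \<le> w then X w (k z) else 0) else 0)) = area (path (k z)) (f z) (g z)"
    if "z \<in> space Q" for z
    unfolding area_def set_lebesgue_integral_def using f0[OF that]
    by (intro Bochner_Integration.integral_cong) (auto simp: indicator_def)
  from iffD1[OF measurable_cong[OF this] *] show ?thesis .
qed

section \<open>Exponential moments of the process\<close>

definition mgf :: "real \<Rightarrow> real \<Rightarrow> ennreal" where
  "mgf z t = (\<integral>\<^sup>+\<omega>. ennreal (exp (z * (X t \<omega> - X 0 \<omega>))) \<partial>M)"

lemma mgf_0: "mgf z 0 = 1"
  by (simp add: mgf_def emeasure_space_1)

lemma mgf_add:
  assumes "0 \<le> s" "0 \<le> t" shows "mgf z (s + t) = mgf z s * mgf z t"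
proof -
  have m: "(\<lambda>y. ennreal (exp (z * y i))) \<in> borel_measurable (PiM {i} (\<lambda>_. borel :: real measure))" for i :: nat by measurable
  have "mgf z (s + t) = (\<integral>\<^sup>+\<omega>. ennreal (exp (z * incr s t 0 0 \<omega>)) * ennreal (exp (z * incr s t 0 1 \<omega>)) \<partial>M)"
    unfolding mgf_def by (intro nn_integral_cong)
      (simp add: incr_def times_def flip: ennreal_mult exp_add distrib_left)
  also have "\<dots> = (\<integral>\<^sup>+\<omega>. ennreal (exp (z * incr s t 0 0 \<omega>)) \<partial>M) * (\<integral>\<^sup>+\<omega>. ennreal (exp (z * incr s t 0 1 \<omega>)) \<partial>M)"
    using indep_vars_nn_integral_split[OF incr_indep[OF assms, of 0 2] _ _ _ m[of 0] m[of 1]] by auto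
  also have "(\<integral>\<^sup>+\<omega>. ennreal (exp (z * incr s t 0 1 \<omega>)) \<partial>M) = (\<integral>\<^sup>+x. ennreal (exp (z * x)) \<partial>distr M borel (incr s t 0 (Suc 0)))"
    using assms by (subst nn_integral_distr) auto
  also have "\<dots> = mgf z t"
    unfolding distr_incr_Suc[OF assms] mgf_def using assms by (subst nn_integral_distr) auto
  finally show ?thesis by (simp add: incr_0 mgf_def)
qed

lemma mgf_nat_mult: "0 \<le> h \<Longrightarrow> mgf z (real n * h) = mgf z h ^ n"
proof (induction n)
  case (Suc n)
  have "real (Suc n) * h = h + real n * h" by (simp add: distrib_right)
  then show ?case using Suc mgf_add[of h "real n * h" z] by simp
qed (simp add: mgf_0)

text \<open>Multiplicativity gives the formula at rational times. Right-continuity and Fatou's lemma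
  extend it to all times only as an upper bound; equality follows by splitting an integer time
  \<open>m\<close> into \<open>t\<close> and \<open>m - t\<close>, where both upper bounds have to
  be attained.\<close>

lemma mgf_eq_exp:
  assumes 1: "mgf z 1 = ennreal (exp \<kappa>)" and t: "0 \<le> t"
  shows "mgf z t = ennreal (exp (\<kappa> * t))"
proof -
  have inv: "mgf z (1 / real (Suc n)) = ennreal (exp (\<kappa> / real (Suc n)))" for n
  proof -
    define x where "x = mgf z (1 / real (Suc n))"
    have pow: "x ^ Suc n = ennreal (exp \<kappa>)"
      using mgf_nat_mult[of "1 / real (Suc n)" z "Suc n"] 1 by (simp add: x_def del: power_Suc)
    have "x \<noteq> \<top>"
    proof
      assume "x = \<top>"
      then have "x ^ Suc n = \<top>" by (simp add: ennreal_top_eq_mult_iff power_eq_top_ennreal_iff del: power_Suc)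
      then show False using pow by simp
    qed
    then obtain y where y: "x = ennreal y" "y \<ge> 0" by (cases x) auto
    then have "y ^ Suc n = exp \<kappa>" using pow by (simp add: ennreal_power del: power_Suc)
    moreover have "exp (\<kappa> / real (Suc n)) ^ Suc n = exp (real (Suc n) * (\<kappa> / real (Suc n)))" by (rule exp_of_nat_mult[symmetric])
    then have "exp (\<kappa> / real (Suc n)) ^ Suc n = exp \<kappa>" by (simp del: power_Suc)
    ultimately have "y ^ Suc n = exp (\<kappa> / real (Suc n)) ^ Suc n" by simp
    then have "y = exp (\<kappa> / real (Suc n))" using y(2) by (subst (asm) power_eq_iff_eq_base) auto
    then show ?thesis using y by (simp add: x_def)
  qed
  have rat: "mgf z (real k * 1 / real (Suc n)) = ennreal (exp (\<kappa> * (real k * 1 / real (Suc n))))" for k n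
  proof -
    have "mgf z (real k * (1 / real (Suc n))) = ennreal (exp (\<kappa> / real (Suc n)) ^ k)"
    proof -
      have "mgf z (real k * (1 / real (Suc n))) = mgf z (1 / real (Suc n)) ^ k" by (rule mgf_nat_mult) simp
      then show ?thesis unfolding inv by (simp only: ennreal_power exp_ge_zero)
    qed
    also have "exp (\<kappa> / real (Suc n)) ^ k = exp (real k * (\<kappa> / real (Suc n)))" by (rule exp_of_nat_mult[symmetric])
    finally show ?thesis by (simp add: mult_ac)
  qed
  have le: "mgf z t \<le> ennreal (exp (\<kappa> * t))" if t: "0 \<le> t" for t
  proof -
    have gr: "mgf z (grid 1 n t) = ennreal (exp (\<kappa> * grid 1 n t))" for n unfolding grid_def by (rule rat)
    have g0: "0 \<le> grid 1 n t" for n using grid_bounds(1)[of 1 t n] t by simp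
    have "mgf z t = (\<integral>\<^sup>+\<omega>. liminf (\<lambda>n. ennreal (exp (z * (X (grid 1 n t) \<omega> - X 0 \<omega>)))) \<partial>M)"
      unfolding mgf_def
    proof (intro nn_integral_cong)
      fix \<omega> assume w: "\<omega> \<in> space M"
      have "(\<lambda>n. X (grid 1 n t) \<omega>) \<longlonglongrightarrow> X t \<omega>"
        using t by (intro filterlim_compose[OF cadlag_right[OF X_cadlag[OF w]] grid_tendsto]) auto
      then have "(\<lambda>n. ennreal (exp (z * (X (grid 1 n t) \<omega> - X 0 \<omega>)))) \<longlonglongrightarrow> ennreal (exp (z * (X t \<omega> - X 0 \<omega>)))"
        by (intro tendsto_ennrealI tendsto_intros)
      from lim_imp_Liminf[OF _ this] show "ennreal (exp (z * (X t \<omega> - X 0 \<omega>))) = liminf (\<lambda>n. ennreal (exp (z * (X (grid 1 n t) \<omega> - X 0 \<omega>))))" by simp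
    qed
    also have "\<dots> \<le> liminf (\<lambda>n. mgf z (grid 1 n t))"
      unfolding mgf_def using g0 by (intro nn_integral_liminf) auto
    also have "\<dots> = ennreal (exp (\<kappa> * t))"
    proof -
      have "(\<lambda>n. grid 1 n t) \<longlonglongrightarrow> t" using grid_tendsto[of 1 t] t by (simp add: filterlim_at)
      then have "(\<lambda>n. ennreal (exp (\<kappa> * grid 1 n t))) \<longlonglongrightarrow> ennreal (exp (\<kappa> * t))" by (intro tendsto_ennrealI tendsto_intros)
      from lim_imp_Liminf[OF _ this] show ?thesis by (simp add: gr)
    qed
    finally show ?thesis .
  qed
  \<comment> \<open>Any integer beyond \<open>t\<close> will do, as the value at integers is known
    exactly.\<close>
  define m where "m = nat \<lceil>t\<rceil>"
  have m: "t \<le> real m" using t by (simp add: m_def)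
  have "mgf z t * mgf z (real m - t) = ennreal (exp (\<kappa> * real m))"
    using mgf_add[of t "real m - t" z] mgf_nat_mult[of 1 z m] t m 1 by (simp add: ennreal_power mult.commute flip: exp_of_nat_mult)
  moreover obtain a where a: "mgf z t = ennreal a" "a \<ge> 0" "a \<le> exp (\<kappa> * t)"
    using le[OF t] by (cases "mgf z t") (auto simp: top_unique)
  moreover obtain b where b: "mgf z (real m - t) = ennreal b" "b \<ge> 0" "b \<le> exp (\<kappa> * (real m - t))"
    using le[of "real m - t"] m by (cases "mgf z (real m - t)") (auto simp: top_unique)
  ultimately have "a * b = exp (\<kappa> * real m)" by (simp flip: ennreal_mult)
  also have "\<dots> = exp (\<kappa> * t) * exp (\<kappa> * (real m - t))" by (simp flip: exp_add add: algebra_simps)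
  finally have "exp (\<kappa> * t) * exp (\<kappa> * (real m - t)) = a * b" by simp
  also have "\<dots> \<le> a * exp (\<kappa> * (real m - t))" using a b by (intro mult_left_mono) auto
  finally have "exp (\<kappa> * t) \<le> a" by simp
  then show ?thesis using a by simp
qed

section \<open>Moments of the functional at fixed and at exponential times\<close>

definition moment :: "real \<Rightarrow> real \<Rightarrow> ennreal" where
  "moment r t = (\<integral>\<^sup>+\<omega>. ennreal (area (path \<omega>) 0 t powr r) \<partial>M)"

lemma area_measurable [measurable]: "0 \<le> u \<Longrightarrow> (\<lambda>\<omega>. area (path \<omega>) u t) \<in> borel_measurable M"
  by (rule area_joint_measurable[where N=M]) auto

lemma moment_measurable [measurable]: "moment r \<in> borel_measurable borel"
proof -
  have [measurable]: "(\<lambda>z. area (path (snd z)) 0 (fst z)) \<in> borel_measurable (borel \<Otimes>\<^sub>M M)"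
    by (rule area_joint_measurable[where N=M]) auto
  have "(\<lambda>(t, \<omega>). ennreal (area (path \<omega>) 0 t powr r)) \<in> borel_measurable (borel \<Otimes>\<^sub>M M)"
    unfolding case_prod_beta by measurable
  then show ?thesis unfolding moment_def by (rule borel_measurable_nn_integral)
qed

lemma moment_eq_shift: "moment r t = (\<integral>\<^sup>+\<omega>. ennreal (shift_area 0 t \<omega> powr r) \<partial>M)"
  unfolding moment_def
proof (rule nn_integral_cong_AE)
  show "AE \<omega> in M. ennreal (area (path \<omega>) 0 t powr r) = ennreal (shift_area 0 t \<omega> powr r)"
    using X_0 AE_space by eventually_elim (simp add: area_eq_shift_area)
qed

text \<open>Since \<open>area u t = exp (X u) * shift_area u (t - u)\<close>, the integrand of
  \<open>area_powr_eq\<close> contains \<open>exp (X u)\<close> to the power \<open>s - 1\<close>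
  times \<open>exp (X u)\<close>, that is \<open>exp (s * X u)\<close>, times a function of the
  later increments. The expectation factors by \<open>shift_area_moment\<close>.\<close>

lemma moment_recursion:
  assumes t: "0 \<le> t" and s: "0 < s" and mgf1: "mgf s 1 = ennreal (exp \<kappa>)"
  shows "moment s t = (\<integral>\<^sup>+u. ennreal (s * exp (\<kappa> * u)) * moment (s - 1) (t - u) * indicator {0..<t} u \<partial>lborel)"
proof -
  interpret pair_sigma_finite lborel M ..
  \<comment> \<open>The guards extend the integrand to negative \<open>u\<close>, where the process
    is unconstrained, without spoiling joint measurability.\<close>
  define f where "f u \<omega> = (if 0 \<le> u \<and> u < t then ennreal (s * area (path \<omega>) (max u 0) t powr (s - 1) * exp (if 0 \<le> u then X u \<omega> else 0)) else 0)" for u \<omega>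
  have [measurable]: "(\<lambda>z. area (path (snd z)) (max (fst z) 0) t) \<in> borel_measurable (lborel \<Otimes>\<^sub>M M)"
    by (rule area_joint_measurable[where N=M]) auto
  have [measurable]: "(\<lambda>z. if 0 \<le> fst z then X (fst z) (snd z) else 0) \<in> borel_measurable (lborel \<Otimes>\<^sub>M M)"
  proof -
    have "(\<lambda>z. (fst z, snd z)) \<in> lborel \<Otimes>\<^sub>M M \<rightarrow>\<^sub>M borel \<Otimes>\<^sub>M M" by measurable
    from measurable_compose[OF this X_joint_measurable] show ?thesis by simp
  qed
  have fm: "(\<lambda>(u, \<omega>). f u \<omega>) \<in> borel_measurable (lborel \<Otimes>\<^sub>M M)"
    unfolding f_def case_prod_beta by measurable
  have "moment s t = (\<integral>\<^sup>+\<omega>. \<integral>\<^sup>+u. f u \<omega> \<partial>lborel \<partial>M)"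
    unfolding moment_def
  proof (intro nn_integral_cong)
    fix \<omega> assume "\<omega> \<in> space M"
    then show "ennreal (area (path \<omega>) 0 t powr s) = (\<integral>\<^sup>+u. f u \<omega> \<partial>lborel)"
      by (subst area_powr_eq[OF X_cadlag t s]) (auto simp: f_def intro!: nn_integral_cong split: split_indicator)
  qed
  also have "\<dots> = (\<integral>\<^sup>+u. \<integral>\<^sup>+\<omega>. f u \<omega> \<partial>M \<partial>lborel)"
    using Fubini'[OF fm] by simp
  also have "\<dots> = (\<integral>\<^sup>+u. ennreal (s * exp (\<kappa> * u)) * moment (s - 1) (t - u) * indicator {0..<t} u \<partial>lborel)"
  proof (intro nn_integral_cong)
    fix u
    show "(\<integral>\<^sup>+\<omega>. f u \<omega> \<partial>M) = ennreal (s * exp (\<kappa> * u)) * moment (s - 1) (t - u) * indicator {0..<t} u"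
    proof (cases "0 \<le> u \<and> u < t")
      case True
      have "(\<integral>\<^sup>+\<omega>. f u \<omega> \<partial>M) = (\<integral>\<^sup>+\<omega>. ennreal s * (ennreal (exp (s * (X u \<omega> - X 0 \<omega>))) * ennreal (shift_area u (t - u) \<omega> powr (s - 1))) \<partial>M)"
      proof (rule nn_integral_cong_AE)
        show "AE \<omega> in M. f u \<omega> = ennreal s * (ennreal (exp (s * (X u \<omega> - X 0 \<omega>))) * ennreal (shift_area u (t - u) \<omega> powr (s - 1)))"
          using X_0 AE_space
        proof eventually_elim
          case (elim \<omega>)
          have p: "shift_area u (t - u) \<omega> > 0" using True elim by (intro shift_area_pos) auto
          have "area (path \<omega>) u t powr (s - 1) * exp (X u \<omega>) = exp (X u \<omega>) powr (s - 1) * exp (X u \<omega>) * shift_area u (t - u) \<omega> powr (s - 1)"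
            using p True elim by (simp add: area_shift powr_mult)
          also have "exp (X u \<omega>) powr (s - 1) * exp (X u \<omega>) = exp (s * X u \<omega>)"
            by (simp add: powr_def algebra_simps flip: exp_add)
          finally have eq: "s * area (path \<omega>) u t powr (s - 1) * exp (X u \<omega>) = s * (exp (s * X u \<omega>) * shift_area u (t - u) \<omega> powr (s - 1))"
            by (simp add: mult.assoc)
          have "f u \<omega> = ennreal (s * area (path \<omega>) u t powr (s - 1) * exp (X u \<omega>))"
            using True by (simp add: f_def)
          then have "f u \<omega> = ennreal (s * (exp (s * X u \<omega>) * shift_area u (t - u) \<omega> powr (s - 1)))"
            unfolding eq .
          then show ?case using elim s by (simp add: ennreal_mult)
        qed
      qed
      also have "\<dots> = ennreal s * (\<integral>\<^sup>+\<omega>. ennreal (exp (s * (X u \<omega> - X 0 \<omega>))) * ennreal (shift_area u (t - u) \<omega> powr (s - 1)) \<partial>M)"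
        using True by (intro nn_integral_cmult) auto
      also have "(\<integral>\<^sup>+\<omega>. ennreal (exp (s * (X u \<omega> - X 0 \<omega>))) * ennreal (shift_area u (t - u) \<omega> powr (s - 1)) \<partial>M)
         = ennreal (exp (\<kappa> * u)) * moment (s - 1) (t - u)"
        unfolding moment_eq_shift using True mgf_eq_exp[OF mgf1, of u] by (intro shift_area_moment) (auto simp: mgf_def)
      finally show ?thesis using True s by (simp add: ennreal_mult' mult.assoc)
    qed (auto simp: f_def)
  qed
  finally show ?thesis .
qed

definition killed_moment :: "real \<Rightarrow> real \<Rightarrow> ennreal" where
  "killed_moment q r = (\<integral>\<^sup>+t. ennreal (exponential_density q t) * moment r t \<partial>lborel)"

lemma nn_integral_exp_tail: "l > 0 \<Longrightarrow> (\<integral>\<^sup>+u. ennreal (exp (- l * u)) * indicator {0..} u \<partial>lborel) = ennreal (1 / l)" for l :: real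
proof -
  assume l: "l > 0"
  interpret E: prob_space "density lborel (exponential_density l)" by (rule prob_space_exponential_density[OF l])
  have "1 = (\<integral>\<^sup>+u. ennreal (exponential_density l u) \<partial>lborel)"
    using E.emeasure_space_1 by (simp add: emeasure_density)
  also have "\<dots> = (\<integral>\<^sup>+u. ennreal l * (ennreal (exp (- l * u)) * indicator {0..} u) \<partial>lborel)"
    using l by (intro nn_integral_cong) (auto simp: exponential_density_def mult_ac simp flip: ennreal_mult split: split_indicator)
  also have "\<dots> = ennreal l * (\<integral>\<^sup>+u. ennreal (exp (- l * u)) * indicator {0..} u \<partial>lborel)" by (intro nn_integral_cmult) measurable
  finally have "ennreal (1 / l) * 1 = ennreal (1 / l) * (ennreal l * (\<integral>\<^sup>+u. ennreal (exp (- l * u)) * indicator {0..} u \<partial>lborel))" by simp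
  then show ?thesis using l by (simp add: mult.assoc[symmetric] flip: ennreal_mult)
qed

text \<open>Inserting \<open>moment_recursion\<close> and exchanging the integrals, the lack of
  memory of the exponential law splits off the integral of
  \<open>exp (- (q - \<kappa>) * u)\<close>. As an identity in \<open>[0, \<infinity>]\<close> with
  positive factor it also carries finiteness from order \<open>s\<close> down to
  \<open>s - 1\<close>.\<close>

lemma killed_moment_recursion:
  assumes s: "0 < s" and q: "q > 0" and mgf1: "mgf s 1 = ennreal (exp \<kappa>)" and \<kappa>: "\<kappa> < q"
  shows "killed_moment q s = ennreal (s / (q - \<kappa>)) * killed_moment q (s - 1)"
proof -
  define F where "F u t = ennreal q * ennreal (exp (- q * t)) * (ennreal (s * exp (\<kappa> * u)) * moment (s - 1) (t - u)) * indicator {0..} u * indicator {u<..} t" for u t :: real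
  have [measurable]: "(\<lambda>z. moment (s - 1) (snd z - fst z)) \<in> borel_measurable (lborel \<Otimes>\<^sub>M lborel)"
    by (rule measurable_compose[OF _ moment_measurable]) measurable
  have Fm: "(\<lambda>(u, t). F u t) \<in> borel_measurable (lborel \<Otimes>\<^sub>M lborel)"
  proof -
    have "(\<lambda>z. if 0 \<le> fst z \<and> fst z < snd z then ennreal q * ennreal (exp (- q * snd z)) * (ennreal (s * exp (\<kappa> * fst z)) * moment (s - 1) (snd z - fst z)) else 0) \<in> borel_measurable (lborel \<Otimes>\<^sub>M lborel)"
      by measurable
    moreover have "(\<lambda>(u, t). F u t) = (\<lambda>z. if 0 \<le> fst z \<and> fst z < snd z then ennreal q * ennreal (exp (- q * snd z)) * (ennreal (s * exp (\<kappa> * fst z)) * moment (s - 1) (snd z - fst z)) else 0)"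
      by (auto simp: F_def fun_eq_iff split: split_indicator)
    ultimately show ?thesis by simp
  qed
  have "killed_moment q s = (\<integral>\<^sup>+t. \<integral>\<^sup>+u. F u t \<partial>lborel \<partial>lborel)"
    unfolding killed_moment_def
  proof (intro nn_integral_cong)
    fix t
    show "ennreal (exponential_density q t) * moment s t = (\<integral>\<^sup>+u. F u t \<partial>lborel)"
    proof (cases "0 \<le> t")
      case True
      have "ennreal (exponential_density q t) * moment s t
        = (\<integral>\<^sup>+u. ennreal (exponential_density q t) * (ennreal (s * exp (\<kappa> * u)) * moment (s - 1) (t - u) * indicator {0..<t} u) \<partial>lborel)"
        unfolding moment_recursion[OF True s mgf1] by (intro nn_integral_cmult[symmetric]) measurable
      also have "\<dots> = (\<integral>\<^sup>+u. F u t \<partial>lborel)"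
        using True q by (intro nn_integral_cong) (auto simp: F_def exponential_density_def ennreal_mult' mult_ac split: split_indicator)
      finally show ?thesis .
    next
      case False
      then have "F u t = 0" for u by (auto simp: F_def split: split_indicator)
      then show ?thesis using False by (simp add: exponential_density_def)
    qed
  qed
  also have "\<dots> = (\<integral>\<^sup>+u. \<integral>\<^sup>+t. F u t \<partial>lborel \<partial>lborel)"
    using lborel_pair.Fubini'[OF Fm] by simp
  also have "\<dots> = (\<integral>\<^sup>+u. ennreal s * (ennreal (exp (- (q - \<kappa>) * u)) * indicator {0..} u) * killed_moment q (s - 1) \<partial>lborel)"
  proof (intro nn_integral_cong)
    fix u
    have [measurable]: "F u \<in> borel_measurable borel"
    proof -
      have "(\<lambda>t. (u, t)) \<in> borel \<rightarrow>\<^sub>M lborel \<Otimes>\<^sub>M lborel" by measurable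
      from measurable_compose[OF this Fm] show ?thesis by simp
    qed
    \<comment> \<open>The substitution \<open>t = u + v\<close>, with \<open>v\<close> the time
      remaining after \<open>u\<close>.\<close>
    have "(\<integral>\<^sup>+t. F u t \<partial>lborel) = (\<integral>\<^sup>+v. F u (u + 1 * v) \<partial>lborel)"
      using nn_integral_real_affine[of "F u" 1 u] by simp
    also have "\<dots> = (\<integral>\<^sup>+v. (ennreal s * (ennreal (exp (- (q - \<kappa>) * u)) * indicator {0..} u)) * (ennreal (exponential_density q v) * moment (s - 1) v) \<partial>lborel)"
    proof (rule nn_integral_cong_AE)
      show "AE v in lborel. F u (u + 1 * v) = (ennreal s * (ennreal (exp (- (q - \<kappa>) * u)) * indicator {0..} u)) * (ennreal (exponential_density q v) * moment (s - 1) v)"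
        using AE_lborel_singleton[of 0]
      proof eventually_elim
        case (elim v)
        show ?case
        proof (cases "0 \<le> u \<and> 0 < v")
          case True
          have e: "exp (- q * (u + v)) * exp (\<kappa> * u) = exp (- (q - \<kappa>) * u) * exp (- v * q)"
            unfolding exp_add[symmetric] by (simp add: algebra_simps)
          have "q * exp (- q * (u + v)) * (s * exp (\<kappa> * u)) = q * s * (exp (- q * (u + v)) * exp (\<kappa> * u))" by (simp only: mult_ac)
          also have "\<dots> = s * exp (- (q - \<kappa>) * u) * (q * exp (- v * q))" unfolding e by (simp only: mult_ac)
          finally have "q * exp (- q * (u + v)) * (s * exp (\<kappa> * u)) = s * exp (- (q - \<kappa>) * u) * (q * exp (- v * q))" .
          then have "ennreal q * ennreal (exp (- q * (u + v))) * ennreal (s * exp (\<kappa> * u)) = ennreal s * ennreal (exp (- (q - \<kappa>) * u)) * ennreal (q * exp (- v * q))"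
            using s q by (simp flip: ennreal_mult)
          then show ?thesis using True by (simp add: F_def exponential_density_def mult.assoc[symmetric])
        next
          case False
          then show ?thesis using elim by (auto simp: F_def exponential_density_def split: split_indicator)
        qed
      qed
    qed
    also have "\<dots> = (ennreal s * (ennreal (exp (- (q - \<kappa>) * u)) * indicator {0..} u)) * killed_moment q (s - 1)"
      unfolding killed_moment_def by (intro nn_integral_cmult) measurable
    finally show "(\<integral>\<^sup>+t. F u t \<partial>lborel) = ennreal s * (ennreal (exp (- (q - \<kappa>) * u)) * indicator {0..} u) * killed_moment q (s - 1)" .
  qed
  also have "\<dots> = ennreal s * (\<integral>\<^sup>+u. ennreal (exp (- (q - \<kappa>) * u)) * indicator {0..} u \<partial>lborel) * killed_moment q (s - 1)"
    by (subst nn_integral_multc, measurable, subst nn_integral_cmult, measurable)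
  also have "(\<integral>\<^sup>+u. ennreal (exp (- (q - \<kappa>) * u)) * indicator {0..} u \<partial>lborel) = ennreal (1 / (q - \<kappa>))"
    using \<kappa> by (intro nn_integral_exp_tail) simp
  also have "ennreal s * ennreal (1 / (q - \<kappa>)) = ennreal (s / (q - \<kappa>))" using s \<kappa> by (simp flip: ennreal_mult)
  finally show ?thesis .
qed

text \<open>The moment at time \<open>t\<close> grows at most like
  \<open>t powr r * exp (k * t)\<close> with \<open>k < q\<close>, which the exponential density
  outweighs.\<close>

lemma killed_moment_finite:
  assumes r: "0 < r" "r < \<theta>" and q: "q > 0" and mgf1: "mgf \<theta> 1 = ennreal (exp \<kappa>)" and \<kappa>: "\<kappa> < q"
  shows "killed_moment q r < \<infinity>"
proof -
  \<comment> \<open>The maximal bound requires a nonnegative rate. Of the gap \<open>q - k\<close>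
    one half, called \<open>d\<close>, absorbs \<open>t powr r\<close> and the other half keeps the
    integral finite.\<close>
  define k where "k = max \<kappa> 0"
  define d where "d = (q - k) / 2"
  have k: "0 \<le> k" "k < q" "\<kappa> \<le> k" using \<kappa> q by (auto simp: k_def)
  have d: "d > 0" using k by (simp add: d_def)
  define c where "c = 1 + r / (\<theta> - r)"
  have c: "c \<ge> 0" using r by (simp add: c_def)
  have m: "moment r t \<le> ennreal (t powr r * c * exp (k * t))" if "0 < t" for t
    unfolding moment_eq_shift c_def
  proof (rule shift_area_moment_le[OF that r k(1)])
    fix t :: real assume t: "0 \<le> t"
    then show "(\<integral>\<^sup>+\<omega>. ennreal (exp (\<theta> * (X t \<omega> - X 0 \<omega>))) \<partial>M) \<le> ennreal (exp (k * t))"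
      using mgf_eq_exp[OF mgf1 t] k(3) by (simp add: mgf_def ennreal_leI mult_right_mono)
  qed
  have pb: "t powr r \<le> (r / d) powr r * exp (d * t)" if "0 < t" for t
  proof -
    have "d * t / r \<le> exp (d * t / r)" using exp_ge_add_one_self[of "d * t / r"] by linarith
    then have "t \<le> (r / d) * exp (d * t / r)" using d r by (simp add: field_simps)
    then have "t powr r \<le> ((r / d) * exp (d * t / r)) powr r" using that r by (intro powr_mono2) auto
    also have "\<dots> = (r / d) powr r * exp (d * t)" unfolding powr_mult using r by (simp add: powr_def)
    finally show ?thesis .
  qed
  have "killed_moment q r \<le> (\<integral>\<^sup>+t. ennreal (q * c * (r / d) powr r) * (ennreal (exp (- d * t)) * indicator {0..} t) \<partial>lborel)"
    unfolding killed_moment_def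
  proof (rule nn_integral_mono_AE)
    show "AE t in lborel. ennreal (exponential_density q t) * moment r t \<le> ennreal (q * c * (r / d) powr r) * (ennreal (exp (- d * t)) * indicator {0..} t)"
      using AE_lborel_singleton[of 0]
    proof eventually_elim
      case (elim t)
      show ?case
      proof (cases "0 < t")
        case True
        have "ennreal (exponential_density q t) * moment r t \<le> ennreal (q * exp (- t * q)) * ennreal (t powr r * c * exp (k * t))"
          using True m[OF True] by (intro mult_mono) (auto simp: exponential_density_def)
        also have "\<dots> = ennreal (q * exp (- t * q) * (t powr r * c * exp (k * t)))"
          using q c by (intro ennreal_mult[symmetric]) auto
        also have "\<dots> \<le> ennreal (q * exp (- t * q) * ((r / d) powr r * exp (d * t) * c * exp (k * t)))"
          using pb[OF True] q c by (intro ennreal_leI mult_left_mono mult_right_mono) auto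
        also have "q * exp (- t * q) * ((r / d) powr r * exp (d * t) * c * exp (k * t)) = q * c * (r / d) powr r * exp (- d * t)"
        proof -
          have "- t * q + d * t + k * t = - d * t" by (simp add: d_def field_simps)
          then have "exp (- t * q) * exp (d * t) * exp (k * t) = exp (- d * t)" unfolding exp_add[symmetric] by simp
          moreover have "q * a * (b * x * c * y) = q * c * b * (a * x * y)" for a b x y by (simp only: mult_ac)
          ultimately show ?thesis by simp
        qed
        finally show ?thesis using True q c by (simp add: ennreal_mult'')
      qed (use elim in \<open>auto simp: exponential_density_def\<close>)
    qed
  qed
  also have "\<dots> = ennreal (q * c * (r / d) powr r) * ennreal (1 / d)"
    unfolding nn_integral_exp_tail[OF d, symmetric] by (rule nn_integral_cmult) measurable
  also have "\<dots> < \<infinity>" by (simp add: ennreal_mult_less_top)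
  finally show ?thesis .
qed

section \<open>The independent killing time\<close>

definition path_algebra :: "'a measure" where
  "path_algebra = vimage_algebra (space M) (\<lambda>\<omega>. \<lambda>t\<in>{0..}. X t \<omega>) (PiM {0..} (\<lambda>_. borel))"

lemma path_algebra_measurable: "0 \<le> t \<Longrightarrow> X t \<in> borel_measurable path_algebra"
proof -
  assume t: "0 \<le> t"
  have 1: "(\<lambda>\<omega>. \<lambda>t\<in>{0..}. X t \<omega>) \<in> path_algebra \<rightarrow>\<^sub>M PiM {0..} (\<lambda>_. borel)"
    unfolding path_algebra_def by (rule measurable_vimage_algebra1) (auto simp: space_PiM)
  have "(\<lambda>x. x t) \<in> PiM {0..} (\<lambda>_. borel :: real measure) \<rightarrow>\<^sub>M borel" using t by (intro measurable_component_singleton) simp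
  from measurable_compose[OF 1 this] t show ?thesis by simp
qed

lemma id_path_algebra: "(\<lambda>\<omega>. \<omega>) \<in> M \<rightarrow>\<^sub>M path_algebra"
  unfolding path_algebra_def by (rule measurable_vimage_algebra2) (auto intro!: measurable_restrict)

text \<open>Independence says that \<open>(T, \<omega>)\<close> has a product law on
  \<open>borel\<close> times the algebra of the process, with the second component the identity of
  the sample space. The integrand must therefore be measurable for that algebra and not merely for
  \<open>M\<close>.\<close>

lemma nn_integral_independent_time:
  assumes T: "distributed M lborel T (exponential_density q)" and ind: "indep_of_process M T X"
    and [measurable]: "(\<lambda>(t, \<omega>). f t \<omega>) \<in> borel_measurable (borel \<Otimes>\<^sub>M path_algebra)"
  shows "(\<integral>\<^sup>+\<omega>. f (T \<omega>) \<omega> \<partial>M) = (\<integral>\<^sup>+t. ennreal (exponential_density q t) * (\<integral>\<^sup>+\<omega>. f t \<omega> \<partial>M) \<partial>lborel)"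
proof -
  have Tm [measurable]: "T \<in> borel_measurable M" using distributed_measurable[OF T] by simp
  note idm [measurable] = id_path_algebra
  define P1 where "P1 = distr M borel T"
  define P2 where "P2 = distr M path_algebra (\<lambda>\<omega>. \<omega>)"
  interpret P1: prob_space P1 unfolding P1_def by (rule prob_space_distr) measurable
  interpret P2: prob_space P2 unfolding P2_def by (rule prob_space_distr) measurable
  have J: "P1 \<Otimes>\<^sub>M P2 = distr M (borel \<Otimes>\<^sub>M path_algebra) (\<lambda>\<omega>. (T \<omega>, \<omega>))"
  proof (rule pair_measure_eqI)
    show "sigma_finite_measure P1" "sigma_finite_measure P2" by unfold_locales
    show "sets (P1 \<Otimes>\<^sub>M P2) = sets (distr M (borel \<Otimes>\<^sub>M path_algebra) (\<lambda>\<omega>. (T \<omega>, \<omega>)))"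
      unfolding P1_def P2_def by (simp cong: sets_pair_measure_cong)
    fix A B assume A: "A \<in> sets P1" and B: "B \<in> sets P2"
    then have [measurable]: "A \<in> sets borel" and Bp [measurable]: "B \<in> sets path_algebra" by (auto simp: P1_def P2_def)
    have "(\<lambda>\<omega>. \<omega>) -` B \<inter> space M \<in> sets M" by (rule measurable_sets[OF id_path_algebra]) measurable
    moreover have "B \<subseteq> space M"
      using sets.sets_into_space[OF Bp] by (simp add: path_algebra_def)
    ultimately have BM: "B \<in> sets M" by (simp add: Int_absorb2)
    have "prob ((T -` A \<inter> space M) \<inter> B) = prob (T -` A \<inter> space M) * prob B"
    proof (rule indep_setD)
      show "indep_set (sets (vimage_algebra (space M) T borel)) (sets path_algebra)"
        using ind unfolding indep_of_process_def path_algebra_def .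
    qed (auto intro: in_vimage_algebra)
    moreover have "emeasure P1 A = ennreal (prob (T -` A \<inter> space M))"
      unfolding P1_def by (simp add: emeasure_distr emeasure_eq_measure)
    moreover have "B \<subseteq> space M" using BM sets.sets_into_space by blast
    then have "emeasure P2 B = ennreal (prob B)"
      unfolding P2_def by (simp add: emeasure_distr emeasure_eq_measure Int_absorb2)
    moreover have "emeasure (distr M (borel \<Otimes>\<^sub>M path_algebra) (\<lambda>\<omega>. (T \<omega>, \<omega>))) (A \<times> B) = ennreal (prob ((T -` A \<inter> space M) \<inter> B))"
    proof -
      have "(\<lambda>\<omega>. (T \<omega>, \<omega>)) -` (A \<times> B) \<inter> space M = (T -` A \<inter> space M) \<inter> B" using \<open>B \<subseteq> space M\<close> by auto
      then show ?thesis by (subst emeasure_distr) (auto simp: emeasure_eq_measure)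
    qed
    ultimately show "emeasure P1 A * emeasure P2 B = emeasure (distr M (borel \<Otimes>\<^sub>M path_algebra) (\<lambda>\<omega>. (T \<omega>, \<omega>))) (A \<times> B)"
      by (simp add: ennreal_mult)
  qed
  have sets12: "sets (P1 \<Otimes>\<^sub>M P2) = sets (borel \<Otimes>\<^sub>M path_algebra)" unfolding J by simp
  have fm: "(\<lambda>(t, \<omega>). f t \<omega>) \<in> borel_measurable (P1 \<Otimes>\<^sub>M P2)"
    by (subst measurable_cong_sets[OF sets12 refl]) measurable
  have "(\<integral>\<^sup>+\<omega>. f (T \<omega>) \<omega> \<partial>M) = (\<integral>\<^sup>+z. (case z of (t, \<omega>) \<Rightarrow> f t \<omega>) \<partial>(P1 \<Otimes>\<^sub>M P2))"
    unfolding J by (subst nn_integral_distr) auto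
  also have "\<dots> = (\<integral>\<^sup>+t. \<integral>\<^sup>+\<omega>. f t \<omega> \<partial>P2 \<partial>P1)"
    using P2.nn_integral_fst[OF fm] by simp
  also have "\<dots> = (\<integral>\<^sup>+t. \<integral>\<^sup>+\<omega>. f t \<omega> \<partial>M \<partial>P1)"
  proof (intro nn_integral_cong)
    fix t :: real
    have "(\<lambda>\<omega>. (t, \<omega>)) \<in> path_algebra \<rightarrow>\<^sub>M borel \<Otimes>\<^sub>M path_algebra" by measurable
    from measurable_compose[OF this assms(3)] have [measurable]: "f t \<in> borel_measurable path_algebra" by simp
    show "(\<integral>\<^sup>+\<omega>. f t \<omega> \<partial>P2) = (\<integral>\<^sup>+\<omega>. f t \<omega> \<partial>M)"
      unfolding P2_def by (subst nn_integral_distr) auto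
  qed
  also have "\<dots> = (\<integral>\<^sup>+t. ennreal (exponential_density q t) * (\<integral>\<^sup>+\<omega>. f t \<omega> \<partial>M) \<partial>lborel)"
  proof -
    have P1eq: "P1 = density lborel (\<lambda>t. ennreal (exponential_density q t))"
      using distributed_distr_eq_density[OF T] by (simp add: P1_def cong: distr_cong)
    have "(\<lambda>z. f (fst z) (snd z)) \<in> borel_measurable (borel \<Otimes>\<^sub>M path_algebra)" using assms(3) by (simp add: case_prod_beta)
    have gm: "(\<lambda>(t, \<omega>). f t \<omega>) \<in> borel_measurable (lborel \<Otimes>\<^sub>M M)"
    proof -
      have "(\<lambda>z. (fst z, snd z)) \<in> lborel \<Otimes>\<^sub>M M \<rightarrow>\<^sub>M borel \<Otimes>\<^sub>M path_algebra" by measurable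
      from measurable_compose[OF this assms(3)] show ?thesis by (simp add: case_prod_beta)
    qed
    have "(\<lambda>t. \<integral>\<^sup>+\<omega>. f t \<omega> \<partial>M) \<in> borel_measurable lborel" by (rule borel_measurable_nn_integral[OF gm])
    then show ?thesis unfolding P1eq by (subst nn_integral_density) auto
  qed
  finally show ?thesis .
qed

end

section \<open>Mellin transform of one beta product: zeros, decay, recursion\<close>

context interlaced
begin

lemma \<alpha>_less: "m < n \<Longrightarrow> \<alpha> m < \<alpha> n"
  using less(1)[of m] less(2)[of m] \<alpha>_mono[of "Suc m" n] by simp

lemma \<beta>_less: "m < n \<Longrightarrow> \<beta> m < \<beta> n"
  using less(2)[of m] \<alpha>_mono[of "Suc m" n] less(1)[of n] by simp

lemma \<alpha>_neq_\<beta>: "\<alpha> m \<noteq> \<beta> n"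
proof (cases "m \<le> n")
  case True
  then show ?thesis using \<alpha>_mono[of m n] less(1)[of n] by simp
next
  case False
  then show ?thesis using \<alpha>_mono[of "Suc n" m] less(2)[of n] by simp
qed

lemma \<beta>_unbounded: "filterlim \<beta> at_top sequentially"
  by (rule filterlim_at_top_mono[OF unbounded]) (rule always_eventually, rule allI, rule less_imp_le, rule less(1))

lemma inj_\<alpha>: "inj \<alpha>"
  by (rule linorder_injI) (rule less_imp_neq, rule \<alpha>_less)

lemma inj_\<beta>: "inj \<beta>"
  by (rule linorder_injI) (rule less_imp_neq, rule \<beta>_less)

definition mellin :: "complex \<Rightarrow> complex" where
  "mellin w = (LINT \<omega>|beta_space. complex_of_real (inf_prod \<omega>) powr w)"

lemma mellin_limit: "\<alpha> 0 + Re w > 0 \<Longrightarrow> (\<lambda>n. \<Prod>k<n. gamma_ratio (\<alpha> k) (\<beta> k) w) \<longlonglongrightarrow> mellin w"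
  unfolding mellin_def by (rule mellin_inf_prod)

text \<open>The integral is the limit of the gamma products, which was seen to be an
  exponential.\<close>

lemma mellin_nonzero: "\<alpha> 0 + Re w > 0 \<Longrightarrow> mellin w \<noteq> 0"
  using prod_gamma_ratio_limit mellin_limit LIMSEQ_unique by metis

lemma mellin_0: "mellin 0 = 1"
proof -
  interpret prob_space beta_space by (rule prob_space_beta_space)
  have "mellin 0 = (LINT \<omega>|beta_space. 1)"
    unfolding mellin_def using AE_inf_prod by (intro integral_cong_AE) (auto elim!: eventually_mono)
  then show ?thesis by (simp add: prob_space)
qed

lemma norm_mellin_ge:
  assumes "\<alpha> 0 + Re w > 0"
  shows "norm (mellin w) \<ge> gamma_decay (Im w) (\<alpha> 0 + Re w) * norm (mellin (of_real (Re w)))"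
proof (rule LIMSEQ_le)
  show "(\<lambda>n. norm (\<Prod>k<n. gamma_ratio (\<alpha> k) (\<beta> k) w)) \<longlonglongrightarrow> norm (mellin w)"
    using assms by (intro tendsto_norm mellin_limit)
  show "(\<lambda>n. gamma_decay (Im w) (\<alpha> 0 + Re w) * norm (\<Prod>k<n. gamma_ratio (\<alpha> k) (\<beta> k) (of_real (Re w))))
    \<longlonglongrightarrow> gamma_decay (Im w) (\<alpha> 0 + Re w) * norm (mellin (of_real (Re w)))"
    using assms by (intro tendsto_intros mellin_limit) simp
  show "\<exists>N. \<forall>n\<ge>N. gamma_decay (Im w) (\<alpha> 0 + Re w) * norm (\<Prod>k<n. gamma_ratio (\<alpha> k) (\<beta> k) (of_real (Re w)))
    \<le> norm (\<Prod>k<n. gamma_ratio (\<alpha> k) (\<beta> k) w)"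
    using norm_prod_gamma_ratio_ge[OF assms] by blast
qed

end

lemma gamma_ratio_step:
  assumes "0 < \<alpha>" "\<alpha> < \<beta>" "0 < \<alpha> + Re w"
  shows "gamma_ratio \<alpha> \<beta> (w + 1) = gamma_ratio \<alpha> \<beta> w * ((of_real \<alpha> + w) / (of_real \<beta> + w) * of_real (\<beta> / \<alpha>))"
proof -
  have np: "of_real x + w \<notin> \<int>\<^sub>\<le>\<^sub>0" if "x \<ge> \<alpha>" for x
    using not_nonpos_Reals_if_Re_pos[of "of_real x + w"] nonpos_Ints_subset_nonpos_Reals that assms by auto
  have G: "Gamma (of_real x + (w + 1)) = (of_real x + w) * Gamma (of_real x + w)" if "x \<ge> \<alpha>" for x
    using Gamma_plus1[OF np[OF that]] by (simp add: add.assoc)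
  have "of_real (\<beta> / \<alpha>) \<noteq> (0::complex)" using assms by simp
  then have "complex_of_real (\<beta> / \<alpha>) powr (w + 1) = complex_of_real (\<beta> / \<alpha>) powr w * of_real (\<beta> / \<alpha>)"
    by (simp add: powr_add del: of_real_divide)
  then show ?thesis unfolding gamma_ratio_def using assms by (simp add: G mult_ac del: of_real_divide)
qed

text \<open>The functional equation of the gamma function reduces the quotient of consecutive
  transforms to a product of linear fractions, the form in which \<open>q - \<psi>\<close> is
  factored.\<close>

lemma (in interlaced) mellin_step:
  assumes "\<alpha> 0 + Re w > 0"
  shows "(\<lambda>n. \<Prod>k<n. (of_real (\<alpha> k) + w) / (of_real (\<beta> k) + w) * of_real (\<beta> k / \<alpha> k)) \<longlonglongrightarrow> mellin (w + 1) / mellin w"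
proof -
  have wk: "\<alpha> k + Re w > 0" for k using assms \<alpha>_mono[of 0 k] by simp
  have "(\<lambda>n. (\<Prod>k<n. gamma_ratio (\<alpha> k) (\<beta> k) (w + 1)) / (\<Prod>k<n. gamma_ratio (\<alpha> k) (\<beta> k) w)) \<longlonglongrightarrow> mellin (w + 1) / mellin w"
    using assms by (intro tendsto_divide mellin_limit mellin_nonzero) auto
  moreover have "gamma_ratio (\<alpha> k) (\<beta> k) w \<noteq> 0" for k
  proof -
    obtain \<kappa> where \<kappa>: "0 < \<kappa>" "\<kappa> \<le> 1" "\<And>n. \<kappa> * \<alpha> n \<le> \<alpha> n + Re w"
      using exists_ratio_bound[OF assms] by blast
    obtain L where "gamma_ratio (\<alpha> k) (\<beta> k) w = exp L"
      by (rule gamma_ratio_eq_exp[OF \<alpha>_pos less(1) \<kappa>])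
    then show ?thesis by simp
  qed
  then have "gamma_ratio (\<alpha> k) (\<beta> k) (w + 1) / gamma_ratio (\<alpha> k) (\<beta> k) w
     = (of_real (\<alpha> k) + w) / (of_real (\<beta> k) + w) * of_real (\<beta> k / \<alpha> k)" for k
    by (subst gamma_ratio_step[OF \<alpha>_pos less(1) wk]) (simp del: of_real_divide)
  ultimately show ?thesis by (simp only: prod_dividef[symmetric])
qed

section \<open>Interlacing zeros and poles on both half-lines\<close>

text \<open>Seen from a base point moving to the right, a point above the real axis is seen under a
  growing angle. Analytically, the sine of the difference of the angles has the sign of
  \<open>Im (u * cnj v) = Im z * (x - x')\<close>.\<close>

lemma Arg_shift_mono:
  assumes "Im z > 0" "x \<le> x'"
  shows "Arg (z - of_real x) \<le> Arg (z - of_real x')"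
proof (rule ccontr)
  define u v where "u = z - of_real x" and "v = z - of_real x'"
  define a b where "a = Arg u" and "b = Arg v"
  assume "\<not> ?thesis"
  then have ab: "b < a" by (simp add: a_def b_def u_def v_def)
  have im: "Im u > 0" "Im v > 0" using assms by (auto simp: u_def v_def)
  then have nz: "u \<noteq> 0" "v \<noteq> 0" by auto
  have r: "0 < a" "a < pi" "0 < b" "b < pi"
    using im Arg_lt_pi[of u] Arg_lt_pi[of v] by (auto simp: a_def b_def)
  have e: "u = of_real (norm u) * exp (\<i> * of_real a)" "v = of_real (norm v) * exp (\<i> * of_real b)"
    unfolding a_def b_def by (rule Arg_eq[OF nz(1)], rule Arg_eq[OF nz(2)])
  have "cnj v = of_real (norm v) * exp (- (\<i> * of_real b))"
    using arg_cong[OF e(2), of cnj] by (simp add: exp_cnj)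
  then have "u * cnj v = (of_real (norm u) * exp (\<i> * of_real a)) * (of_real (norm v) * exp (- (\<i> * of_real b)))"
    using e(1) by metis
  also have "\<dots> = of_real (norm u * norm v) * exp (\<i> * of_real (a - b))"
    by (simp add: right_diff_distrib exp_diff exp_minus divide_inverse)
  finally have "Im (u * cnj v) = norm u * norm v * sin (a - b)"
    by (simp add: Im_exp)
  moreover have "Im (u * cnj v) = Im z * (x - x')"
    by (simp add: u_def v_def algebra_simps)
  moreover have "norm u * norm v * sin (a - b) > 0" using ab r nz by (intro mult_pos_pos sin_gt_zero) auto
  ultimately have "0 < Im z * (x - x')" by simp
  then show False using assms by (simp add: zero_less_mult_iff)
qed

text \<open>The argument of the product is a sum of angle differences. By interlacing the part from
  the positive half-line lies between \<open>\<theta> 0 - \<theta> (a n)\<close> and 0, the part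
  from the negative one between 0 and \<open>\<theta> 0 - \<theta> (- c n)\<close>. Adding the
  argument \<open>pi - \<theta> 0\<close> of \<open>- (1 / z)\<close> leaves an angle in
  \<open>{0..pi}\<close>.\<close>

lemma herglotz_partial_product:
  assumes P: "interlaced a b" and N: "interlaced c d" and z: "Im z > 0"
  shows "Im (- (1 / z) * (\<Prod>j<n. (1 - z / of_real (a j)) / (1 - z / of_real (b j)) *
      ((1 - z / of_real (- c j)) / (1 - z / of_real (- d j))))) \<ge> 0"
proof -
  interpret P: interlaced a b by (rule P)
  interpret N: interlaced c d by (rule N)
  define \<theta> where "\<theta> x = Arg (z - of_real x)" for x
  have \<theta>: "0 < \<theta> x" "\<theta> x < pi" for x
    using z Arg_lt_pi[of "z - of_real x"] by (auto simp: \<theta>_def)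
  have mono: "x \<le> x' \<Longrightarrow> \<theta> x \<le> \<theta> x'" for x x' unfolding \<theta>_def by (rule Arg_shift_mono[OF z])
  have nz: "z - of_real x \<noteq> 0" for x using z by auto
  have e: "z - of_real x = of_real (norm (z - of_real x)) * exp (\<i> * of_real (\<theta> x))" for x
    unfolding \<theta>_def using nz by (rule Arg_eq)
  have quotient: "\<exists>p>0. (1 - z / of_real x) / (1 - z / of_real x') = of_real p * exp (\<i> * of_real (\<theta> x - \<theta> x'))"
    if "x / x' > 0" for x x'
  proof -
    have x: "x \<noteq> 0" "x' \<noteq> 0" using that by auto
    have l: "1 - z / of_real x = - (1 / of_real x) * (z - of_real x)" if "x \<noteq> 0" for x
      using that by (simp add: right_diff_distrib diff_divide_distrib)
    define p where "p = (x' / x) * (norm (z - of_real x) / norm (z - of_real x'))"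
    have "x' / x > 0" using that by (auto simp: zero_less_divide_iff)
    moreover have "norm (z - of_real x) / norm (z - of_real x') > 0" using nz[of x] nz[of x'] by simp
    ultimately have p: "p > 0" unfolding p_def by (rule mult_pos_pos)
    have "(1 - z / of_real x) / (1 - z / of_real x') = of_real (x' / x) * ((z - of_real x) / (z - of_real x'))"
      unfolding l[OF x(1)] l[OF x(2)] using x nz[of x'] by simp
    also have "(z - of_real x) / (z - of_real x') = of_real (norm (z - of_real x) / norm (z - of_real x')) * exp (\<i> * of_real (\<theta> x - \<theta> x'))"
      by (subst e[of x], subst e[of x']) (simp add: right_diff_distrib exp_diff)
    finally have "(1 - z / of_real x) / (1 - z / of_real x') = of_real p * exp (\<i> * of_real (\<theta> x - \<theta> x'))"
      by (simp add: p_def mult.assoc)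
    with p show ?thesis by blast
  qed
  define S where "S n = (\<Sum>j<n. \<theta> (a j) - \<theta> (b j))" for n
  define S' where "S' n = (\<Sum>j<n. \<theta> (- c j) - \<theta> (- d j))" for n
  have "\<exists>p>0. (\<Prod>j<n. (1 - z / of_real (a j)) / (1 - z / of_real (b j)) *
      ((1 - z / of_real (- c j)) / (1 - z / of_real (- d j)))) = of_real p * exp (\<i> * of_real (S n + S' n))"
  proof (induction n)
    case 0
    then show ?case by (intro exI[of _ 1]) (simp add: S_def S'_def)
  next
    case (Suc n)
    then obtain p where p: "p > 0" "(\<Prod>j<n. (1 - z / of_real (a j)) / (1 - z / of_real (b j)) *
      ((1 - z / of_real (- c j)) / (1 - z / of_real (- d j)))) = of_real p * exp (\<i> * of_real (S n + S' n))" by blast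
    obtain p1 where p1: "p1 > 0" "(1 - z / of_real (a n)) / (1 - z / of_real (b n)) = of_real p1 * exp (\<i> * of_real (\<theta> (a n) - \<theta> (b n)))"
      using quotient[of "a n" "b n"] P.\<alpha>_pos[of n] P.\<beta>_pos[of n] by auto
    obtain p2 where p2: "p2 > 0" "(1 - z / of_real (- c n)) / (1 - z / of_real (- d n)) = of_real p2 * exp (\<i> * of_real (\<theta> (- c n) - \<theta> (- d n)))"
      using quotient[of "- c n" "- d n"] N.\<alpha>_pos[of n] N.\<beta>_pos[of n] by auto
    have S: "\<i> * complex_of_real (S (Suc n) + S' (Suc n)) = \<i> * of_real (S n + S' n) + (\<i> * of_real (\<theta> (a n) - \<theta> (b n)) + \<i> * of_real (\<theta> (- c n) - \<theta> (- d n)))"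
      by (simp add: S_def S'_def algebra_simps)
    show ?case
      using p(1) p1(1) p2(1)
      by (intro exI[of _ "p * (p1 * p2)"] conjI)
        (simp, simp only: prod.lessThan_Suc p(2) p1(2) p2(2) S exp_add of_real_mult mult_ac)
  qed
  then obtain p where p: "p > 0" "(\<Prod>j<n. (1 - z / of_real (a j)) / (1 - z / of_real (b j)) *
      ((1 - z / of_real (- c j)) / (1 - z / of_real (- d j)))) = of_real p * exp (\<i> * of_real (S n + S' n))" by blast
  have "S n \<le> 0" unfolding S_def using mono P.less(1) by (intro sum_nonpos) (simp add: less_imp_le)
  moreover have "S' n \<ge> 0" unfolding S'_def using mono N.less(1) by (intro sum_nonneg) (simp add: less_imp_le)
  moreover have "S n \<ge> \<theta> 0 - \<theta> (a n)"
  proof (induction n)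
    case 0
    then show ?case using mono[of 0 "a 0"] P.pos by (simp add: S_def)
  next
    case (Suc n)
    then show ?case using mono[of "b n" "a (Suc n)"] P.less(2)[of n] by (simp add: S_def)
  qed
  moreover have "S' n \<le> \<theta> 0 - \<theta> (- c n)"
  proof (induction n)
    case 0
    then show ?case using mono[of "- c 0" 0] N.pos by (simp add: S'_def)
  next
    case (Suc n)
    then show ?case using mono[of "- c (Suc n)" "- d n"] N.less(2)[of n] by (simp add: S'_def)
  qed
  ultimately have range: "0 \<le> pi - \<theta> 0 + (S n + S' n)" "pi - \<theta> 0 + (S n + S' n) \<le> pi"
    using \<theta>(2)[of "a n"] \<theta>(1)[of "- c n"] by linarith+
  have "z = of_real (norm z) * exp (\<i> * of_real (\<theta> 0))" using e[of 0] by simp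
  then have "- (1 / z) = - (1 / (of_real (norm z) * exp (\<i> * of_real (\<theta> 0))))" by metis
  also have "\<dots> = of_real (1 / norm z) * exp (\<i> * of_real (pi - \<theta> 0))"
    by (simp add: right_diff_distrib exp_diff mult.commute[of \<i> "of_real pi"])
  finally have "- (1 / z) * (of_real p * exp (\<i> * of_real (S n + S' n)))
     = of_real (p / norm z) * exp (\<i> * of_real (pi - \<theta> 0 + (S n + S' n)))"
    by (simp add: distrib_left exp_add)
  then have "Im (- (1 / z) * (of_real p * exp (\<i> * of_real (S n + S' n)))) = p / norm z * sin (pi - \<theta> 0 + (S n + S' n))"
    by (simp only: Im_complex_of_real times_complex.sel Re_complex_of_real Im_exp) simp
  moreover have "sin (pi - \<theta> 0 + (S n + S' n)) \<ge> 0" using range by (intro sin_ge_zero) auto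
  ultimately show ?thesis unfolding p(2) using p(1) by simp
qed

text \<open>Alternation puts equally many entries of both sequences into each initial segment of
  even length, as the half-plane property of the partial products requires.\<close>

definition interleave :: "(nat \<Rightarrow> 'a) \<Rightarrow> (nat \<Rightarrow> 'a) \<Rightarrow> nat \<Rightarrow> 'a" where
  "interleave f g k = (if even k then f (k div 2) else g (k div 2))"

lemma interleave_even [simp]: "interleave f g (2 * n) = f n"
  and interleave_odd [simp]: "interleave f g (Suc (2 * n)) = g n"
  by (simp_all add: interleave_def)

lemma range_interleave: "range (interleave f g) = range f \<union> range g"
proof
  show "range (interleave f g) \<subseteq> range f \<union> range g" by (auto simp: interleave_def)
  show "range f \<union> range g \<subseteq> range (interleave f g)"
    by (metis Un_least image_subsetI interleave_even interleave_odd rangeI)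
qed

lemma interleave_sums:
  fixes f g :: "nat \<Rightarrow> 'b::real_normed_vector"
  assumes "f sums x" "g sums y" shows "interleave f g sums (x + y)"
proof -
  have "(\<lambda>k. \<Sum>i<2 * k. interleave f g i) = (\<lambda>k. (\<Sum>i<k. f i) + (\<Sum>i<k. g i))"
  proof
    fix k show "(\<Sum>i<2 * k. interleave f g i) = (\<Sum>i<k. f i) + (\<Sum>i<k. g i)"
      by (induction k) (auto simp: interleave_def)
  qed
  then have ev: "(\<lambda>k. \<Sum>i<2 * k. interleave f g i) \<longlonglongrightarrow> x + y" using assms unfolding sums_def by (simp add: tendsto_add)
  have "f \<longlonglongrightarrow> 0" using assms(1) by (intro summable_LIMSEQ_zero) (auto simp: summable_def)
  then have "(\<lambda>k. (\<Sum>i<2 * k. interleave f g i) + f k) \<longlonglongrightarrow> x + y + 0" by (intro tendsto_add ev)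
  then have od: "(\<lambda>k. \<Sum>i<2 * k + 1. interleave f g i) \<longlonglongrightarrow> x + y" by (simp add: interleave_def)
  show ?thesis unfolding sums_def using ev od by (rule limseq_even_odd)
qed

lemma filterlim_interleave:
  fixes f g :: "nat \<Rightarrow> real"
  assumes "filterlim f at_top sequentially" "filterlim g at_top sequentially"
  shows "filterlim (interleave f g) at_top sequentially"
  unfolding filterlim_at_top
proof
  fix Z
  have "\<forall>\<^sub>F n in sequentially. Z \<le> f n \<and> Z \<le> g n" using assms by (auto simp: filterlim_at_top eventually_conj_iff)
  then obtain N where "\<And>n. n \<ge> N \<Longrightarrow> Z \<le> f n \<and> Z \<le> g n" by (auto simp: eventually_sequentially)
  then have "Z \<le> interleave f g k" if "k \<ge> 2 * N" for k using that by (auto simp: interleave_def)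
  then show "\<forall>\<^sub>F k in sequentially. Z \<le> interleave f g k" by (auto simp: eventually_sequentially)
qed

lemma inj_interleave:
  assumes "inj f" "inj g" "\<And>m n. f m \<noteq> g n" shows "inj (interleave f g)"
proof (rule injI)
  fix k l assume eq: "interleave f g k = interleave f g l"
  obtain i where i: "k = 2 * i \<or> k = Suc (2 * i)" by (metis evenE oddE Suc_eq_plus1)
  obtain j where j: "l = 2 * j \<or> l = Suc (2 * j)" by (metis evenE oddE Suc_eq_plus1)
  have ff: "f i = f j \<Longrightarrow> i = j" and gg: "g i = g j \<Longrightarrow> i = j" using assms(1,2) by (auto dest: injD)
  show "k = l" using i j eq ff gg assms(3)[of i j] assms(3)[of j i] by (elim disjE) (simp_all add: eq_commute[of "g i" "f j"])
qed

lemma prod_interleave: "(\<Prod>k<2 * n. interleave f g k) = (\<Prod>j<n. f j * g j)" for f g :: "nat \<Rightarrow> 'b::comm_monoid_mult"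
  by (induction n) (auto simp: interleave_def mult_ac)

section \<open>Quotients of two beta products\<close>

text \<open>On the imaginary axis the Mellin transform of \<open>Y\<close> is the characteristic
  function of \<open>ln Y\<close>, and Levy's uniqueness theorem applies.\<close>

lemma distr_eq_if_mellin_eq:
  fixes Y1 :: "'a \<Rightarrow> real" and Y2 :: "'b \<Rightarrow> real"
  assumes "prob_space P1" "prob_space P2"
    and Ym [measurable]: "Y1 \<in> borel_measurable P1" "Y2 \<in> borel_measurable P2"
    and pos: "AE \<omega> in P1. Y1 \<omega> > 0" "AE \<omega> in P2. Y2 \<omega> > 0"
    and eq: "\<And>t::real. (LINT \<omega>|P1. complex_of_real (Y1 \<omega>) powr (\<i> * of_real t)) = (LINT \<omega>|P2. complex_of_real (Y2 \<omega>) powr (\<i> * of_real t))"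
  shows "distr P1 borel Y1 = distr P2 borel Y2"
proof -
  have ch1: "char (distr P1 borel (\<lambda>\<omega>. ln (Y1 \<omega>))) = char (distr P2 borel (\<lambda>\<omega>. ln (Y2 \<omega>)))"
  proof
    fix t
    have "char (distr P1 borel (\<lambda>\<omega>. ln (Y1 \<omega>))) t = (LINT \<omega>|P1. complex_of_real (Y1 \<omega>) powr (\<i> * of_real t))"
      unfolding char_def
    proof (subst integral_distr)
      show "(LINT \<omega>|P1. iexp (t * ln (Y1 \<omega>))) = (LINT \<omega>|P1. complex_of_real (Y1 \<omega>) powr (\<i> * of_real t))"
        using pos(1) by (intro integral_cong_AE) (auto elim!: eventually_mono simp: complex_of_real_powr mult.assoc)
    qed auto
    also have "\<dots> = char (distr P2 borel (\<lambda>\<omega>. ln (Y2 \<omega>))) t"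
      unfolding eq char_def
    proof (subst integral_distr)
      show "(LINT \<omega>|P2. complex_of_real (Y2 \<omega>) powr (\<i> * of_real t)) = (LINT \<omega>|P2. iexp (t * ln (Y2 \<omega>)))"
        using pos(2) by (intro integral_cong_AE) (auto elim!: eventually_mono simp: complex_of_real_powr mult.assoc)
    qed auto
    finally show "char (distr P1 borel (\<lambda>\<omega>. ln (Y1 \<omega>))) t = char (distr P2 borel (\<lambda>\<omega>. ln (Y2 \<omega>))) t" .
  qed
  have r1: "real_distribution (distr P1 borel (\<lambda>\<omega>. ln (Y1 \<omega>)))" by (rule prob_space.real_distribution_distr[OF assms(1)]) measurable
  have r2: "real_distribution (distr P2 borel (\<lambda>\<omega>. ln (Y2 \<omega>)))" by (rule prob_space.real_distribution_distr[OF assms(2)]) measurable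
  have lneq: "distr P1 borel (\<lambda>\<omega>. ln (Y1 \<omega>)) = distr P2 borel (\<lambda>\<omega>. ln (Y2 \<omega>))" by (rule Levy_uniqueness[OF r1 r2 ch1])
  have "distr P1 borel Y1 = distr P1 borel (\<lambda>\<omega>. exp (ln (Y1 \<omega>)))" using pos(1) by (intro distr_cong_AE) (auto elim!: eventually_mono)
  also have "\<dots> = distr (distr P1 borel (\<lambda>\<omega>. ln (Y1 \<omega>))) borel exp" by (subst distr_distr) (auto simp: comp_def)
  also have "\<dots> = distr P2 borel (\<lambda>\<omega>. exp (ln (Y2 \<omega>)))" unfolding lneq by (subst distr_distr) (auto simp: comp_def)
  also have "\<dots> = distr P2 borel Y2" using pos(2) by (intro distr_cong_AE) (auto elim!: eventually_mono)
  finally show ?thesis .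
qed

locale beta_quotient = U: interlaced a b + V: interlaced c d for a b c d +
  fixes C :: real
  assumes C: "C > 0"
begin

abbreviation "law \<equiv> distr U.beta_space borel U.inf_prod \<Otimes>\<^sub>M distr V.beta_space borel V.inf_prod"

definition quotient :: "real \<times> real \<Rightarrow> real" where
  "quotient = (\<lambda>(x, y). C * (x / y))"

lemma quotient_measurable [measurable]: "quotient \<in> borel_measurable law"
  unfolding quotient_def case_prod_beta by measurable

lemma prob_space_U: "prob_space (distr U.beta_space borel U.inf_prod)"
  by (intro prob_space.prob_space_distr U.prob_space_beta_space) measurable

lemma prob_space_V: "prob_space (distr V.beta_space borel V.inf_prod)"
  by (intro prob_space.prob_space_distr V.prob_space_beta_space) measurable

sublocale PU: prob_space "distr U.beta_space borel U.inf_prod" by (rule prob_space_U)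

sublocale PV: prob_space "distr V.beta_space borel V.inf_prod" by (rule prob_space_V)

sublocale PUV: pair_prob_space "distr U.beta_space borel U.inf_prod" "distr V.beta_space borel V.inf_prod" ..

lemma prob_space_law: "prob_space law"
  by (rule PUV.prob_space_axioms)

lemma AE_U_pos: "AE x in distr U.beta_space borel U.inf_prod. x > 0"
  using U.AE_inf_prod by (subst AE_distr_iff) (auto elim!: eventually_mono)

lemma AE_V_pos: "AE x in distr V.beta_space borel V.inf_prod. x > 0"
  using V.AE_inf_prod by (subst AE_distr_iff) (auto elim!: eventually_mono)

lemma AE_law_pos: "AE z in law. fst z > 0 \<and> snd z > 0"
proof -
  have "AE z in law. case z of (x, y) \<Rightarrow> x > 0 \<and> y > 0"
  proof (rule PUV.AE_pair_measure)
    show "{z \<in> space law. case z of (x, y) \<Rightarrow> x > 0 \<and> y > 0} \<in> sets law" unfolding case_prod_beta by measurable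
    show "AE x in distr U.beta_space borel U.inf_prod. AE y in distr V.beta_space borel V.inf_prod. case (x, y) of (x, y) \<Rightarrow> x > 0 \<and> y > 0"
      using AE_U_pos by eventually_elim (use AE_V_pos in simp)
  qed
  then show ?thesis by (simp add: case_prod_beta)
qed

lemma quotient_pos: "AE z in law. quotient z > 0"
  using AE_law_pos by eventually_elim (auto simp: quotient_def case_prod_beta C)

text \<open>Fubini's theorem for the product law; the numerator contributes the order
  \<open>w\<close>, the denominator the order \<open>- w\<close>, whence the two-sided condition on
  \<open>Re w\<close>.\<close>

lemma quotient_mellin:
  assumes w: "a 0 + Re w > 0" "c 0 - Re w > 0"
  shows "integrable law (\<lambda>z. complex_of_real (quotient z) powr w)"
    and "(LINT z|law. complex_of_real (quotient z) powr w) = of_real C powr w * U.mellin w * V.mellin (- w)"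
proof -
  let ?P = "distr U.beta_space borel U.inf_prod" and ?Q = "distr V.beta_space borel V.inf_prod"
  have iU: "integrable ?P (\<lambda>x. complex_of_real x powr w)" "(LINT x|?P. complex_of_real x powr w) = U.mellin w"
    using U.mellin_inf_prod(1)[OF w(1)] by (simp_all add: integrable_distr_eq integral_distr U.mellin_def)
  have iV: "integrable ?Q (\<lambda>y. complex_of_real y powr (- w))" "(LINT y|?Q. complex_of_real y powr (- w)) = V.mellin (- w)"
    using V.mellin_inf_prod(1)[of "- w"] w(2) by (simp_all add: integrable_distr_eq integral_distr V.mellin_def)
  define g where "g = (\<lambda>(x, y). complex_of_real C powr w * complex_of_real x powr w * complex_of_real y powr (- w))"
  have gm [measurable]: "g \<in> borel_measurable law" unfolding g_def case_prod_beta by measurable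
  have gi: "integrable law g"
  proof (rule PUV.Fubini_integrable[OF gm])
    have "(\<lambda>x. LINT y|?Q. norm (g (x, y))) = (\<lambda>x. norm (complex_of_real x powr w) * (norm (complex_of_real C powr w) * (LINT y|?Q. norm (complex_of_real y powr (- w)))))"
      by (simp add: g_def norm_mult mult_ac)
    then show "integrable ?P (\<lambda>x. LINT y|?Q. norm (g (x, y)))" using iU(1) by simp
    show "AE x in ?P. integrable ?Q (\<lambda>y. g (x, y))" using iV(1) by (auto simp: g_def)
  qed
  have "(LINT z|law. g z) = (LINT x|?P. LINT y|?Q. g (x, y))" by (rule PUV.integral_fst'[OF gi, symmetric])
  also have "\<dots> = of_real C powr w * U.mellin w * V.mellin (- w)"
    using iU iV by (simp add: g_def)
  finally have gI: "(LINT z|law. g z) = of_real C powr w * U.mellin w * V.mellin (- w)" .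
  have eq: "AE z in law. complex_of_real (quotient z) powr w = g z"
    using AE_law_pos
  proof eventually_elim
    case (elim z)
    then obtain x y where z: "z = (x, y)" "x > 0" "y > 0" by (cases z) auto
    have "w * complex_of_real (ln (C * (x / y))) = w * of_real (ln C) + w * of_real (ln x) + - w * of_real (ln y)"
      using z C by (simp add: ln_mult ln_div distrib_left right_diff_distrib)
    moreover have "complex_of_real (C * (x / y)) powr w = exp (w * of_real (ln (C * (x / y))))"
      using z C by (intro complex_of_real_powr) simp
    ultimately have "complex_of_real (C * (x / y)) powr w = complex_of_real C powr w * complex_of_real x powr w * complex_of_real y powr (- w)"
      by (simp only: exp_add complex_of_real_powr[OF C] complex_of_real_powr[OF z(2)] complex_of_real_powr[OF z(3)])
    then show ?case by (simp add: z quotient_def g_def)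
  qed
  have m: "(\<lambda>z. complex_of_real (quotient z) powr w) \<in> borel_measurable law" by measurable
  show "integrable law (\<lambda>z. complex_of_real (quotient z) powr w)"
    using gi integrable_cong_AE[OF m gm eq] by blast
  show "(LINT z|law. complex_of_real (quotient z) powr w) = of_real C powr w * U.mellin w * V.mellin (- w)"
    using gI integral_cong_AE[OF m gm eq] by (rule trans[rotated])
qed

lemma quotient_integrable:
  assumes "- a 0 < r" "r < c 0" shows "integrable law (\<lambda>z. quotient z powr r)"
proof -
  have i: "integrable law (\<lambda>z. norm (complex_of_real (quotient z) powr (of_real r)))"
    using assms by (intro integrable_norm quotient_mellin) auto
  have eq: "AE z in law. norm (complex_of_real (quotient z) powr (of_real r)) = quotient z powr r"
    using quotient_pos by eventually_elim (simp add: norm_complex_of_real_powr)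
  show ?thesis by (rule integrable_cong_AE_imp[OF i _ eq]) measurable
qed

end

section \<open>Meromorphic processes at an exponential time\<close>

lemma summable_polar_series:
  fixes c r :: "nat \<Rightarrow> real"
  assumes c: "\<And>n. c n > 0" and r: "\<And>n. r n \<noteq> 0" "filterlim (\<lambda>n. \<bar>r n\<bar>) at_top sequentially"
    and s: "summable (\<lambda>n. c n / (r n)\<^sup>2)"
  shows "summable (\<lambda>n. complex_of_real (c n) / (of_real (r n) * (of_real (r n) - z)))"
proof -
  have "\<forall>\<^sub>F n in sequentially. 2 * norm z \<le> \<bar>r n\<bar>" using r(2) by (simp add: filterlim_at_top)
  then have "\<forall>\<^sub>F n in sequentially. norm (complex_of_real (c n) / (of_real (r n) * (of_real (r n) - z))) \<le> 2 * (c n / (r n)\<^sup>2)"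
  proof eventually_elim
    case (elim n)
    have "\<bar>r n\<bar> / 2 \<le> norm (of_real (r n) - z)"
      using elim norm_triangle_ineq2[of "of_real (r n)" z] by simp
    then have "\<bar>r n\<bar> * (\<bar>r n\<bar> / 2) \<le> \<bar>r n\<bar> * norm (of_real (r n) - z)" by (intro mult_left_mono) auto
    moreover have "0 < \<bar>r n\<bar> * (\<bar>r n\<bar> / 2)" using r(1)[of n] by (intro mult_pos_pos) auto
    ultimately have "c n / (\<bar>r n\<bar> * norm (of_real (r n) - z)) \<le> c n / (\<bar>r n\<bar> * (\<bar>r n\<bar> / 2))"
      using c[of n] by (intro frac_le) auto
    also have "\<bar>r n\<bar> * (\<bar>r n\<bar> / 2) = (r n)\<^sup>2 / 2" by (simp add: power2_eq_square)
    finally show ?case using c[of n] by (simp add: norm_divide norm_mult mult_ac)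
  qed
  then show ?thesis by (rule summable_comparison_test_ev[OF _ summable_mult[OF s]])
qed

lemma filterlim_if_strict_mono_unbounded:
  fixes \<rho> \<zeta> :: "nat \<Rightarrow> real"
  assumes "strict_mono_on {1..} \<rho>" "\<not> bdd_above (\<rho> ` {1..})" "\<And>n. n \<ge> 1 \<Longrightarrow> \<rho> n < \<zeta> (Suc n)"
  shows "filterlim (\<lambda>n. \<zeta> (Suc n)) at_top sequentially"
  unfolding filterlim_at_top
proof
  fix Z
  obtain n where n: "n \<ge> 1" "\<rho> n > Z" using assms(2) by (auto simp: bdd_above_def not_le)
  have "Z \<le> \<zeta> (Suc m)" if "m \<ge> n" for m
  proof -
    have "\<rho> n \<le> \<rho> m" using strict_mono_on_leD[OF assms(1)] n that by auto
    then show ?thesis using assms(3)[of m] n that by simp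
  qed
  then show "\<forall>\<^sub>F n in sequentially. Z \<le> \<zeta> (Suc n)" by (auto simp: eventually_sequentially)
qed

lemma prodinf_eq_limit:
  fixes f :: "nat \<Rightarrow> 'b::real_normed_field"
  assumes "(\<lambda>n. \<Prod>k<n. f k) \<longlonglongrightarrow> L" "L \<noteq> 0" shows "prodinf f = L"
proof -
  have "raw_has_prod f 0 L" unfolding raw_has_prod_def
    using LIMSEQ_Suc[OF assms(1)] assms(2) by (simp add: lessThan_Suc_atMost)
  then have "f has_prod L" by (simp add: has_prod_def)
  then show ?thesis by (rule has_prod_unique[symmetric])
qed

text \<open>The logarithms of the factors are bounded by the summable gaps
  \<open>1 / \<alpha> k - 1 / \<beta> k\<close>. Positivity of the limit is what allows
  \<open>prodinf\<close> to be read as the limit of partial products.\<close>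

lemma (in interlaced) ratio_product_positive:
  "\<exists>L>0. (\<lambda>n. \<Prod>k<n. (1 + 1 / \<beta> k) / (1 + 1 / \<alpha> k)) \<longlonglongrightarrow> L"
proof -
  define l where "l k = ln ((1 + 1 / \<alpha> k) / (1 + 1 / \<beta> k))" for k
  have p: "1 + 1 / \<alpha> k > 0" "1 + 1 / \<beta> k > 0" for k
    using \<alpha>_pos[of k] \<beta>_pos[of k] by (auto intro: add_pos_pos)
  have inv: "1 / \<beta> k \<le> 1 / \<alpha> k" for k using \<alpha>_pos[of k] less(1)[of k] by (intro divide_left_mono) auto
  have bound: "norm (l k) \<le> 1 / \<alpha> k - 1 / \<beta> k" for k
  proof -
    have e: "(1 + 1 / \<alpha> k) / (1 + 1 / \<beta> k) = 1 + (1 / \<alpha> k - 1 / \<beta> k) / (1 + 1 / \<beta> k)"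
      using p[of k] by (simp add: field_simps)
    have "(1 / \<alpha> k - 1 / \<beta> k) / (1 + 1 / \<beta> k) \<le> (1 / \<alpha> k - 1 / \<beta> k) / 1"
      using inv[of k] \<beta>_pos[of k] p(2)[of k] by (intro divide_left_mono) auto
    moreover have "(1 / \<alpha> k - 1 / \<beta> k) / (1 + 1 / \<beta> k) \<ge> 0" using inv[of k] p[of k] by simp
    ultimately show ?thesis unfolding l_def e
      using ln_add_one_self_le_self[of "(1 / \<alpha> k - 1 / \<beta> k) / (1 + 1 / \<beta> k)"] by simp
  qed
  have "summable l" by (rule summable_comparison_test'[OF summable_inverse_gap bound])
  then have "(\<lambda>n. exp (- (\<Sum>k<n. l k))) \<longlonglongrightarrow> exp (- suminf l)"
    by (intro tendsto_intros summable_LIMSEQ)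
  moreover have "exp (- (\<Sum>k<n. l k)) = (\<Prod>k<n. (1 + 1 / \<beta> k) / (1 + 1 / \<alpha> k))" for n
  proof -
    have "exp (- l k) = (1 + 1 / \<beta> k) / (1 + 1 / \<alpha> k)" for k
      unfolding l_def exp_minus using p[of k] by (subst exp_ln) auto
    then show ?thesis by (simp add: sum_negf[symmetric] exp_sum)
  qed
  ultimately show ?thesis by (intro exI[of _ "exp (- suminf l)"]) simp
qed

locale meromorphic_killed =
  fixes M :: "'a measure" and X :: "real \<Rightarrow> 'a \<Rightarrow> real" and T :: "'a \<Rightarrow> real"
    and \<sigma> \<mu> q C :: real and a ah \<rho> \<rho>h \<zeta> \<zeta>h :: "nat \<Rightarrow> real"
  assumes process: "meromorphic_levy_process M X \<sigma> \<mu> a ah \<rho> \<rho>h"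
    and q: "q > 0"
    and exponent_roots: "{z. z \<notin> mero_poles \<rho> \<rho>h \<and> mero_exponent \<sigma> \<mu> a ah \<rho> \<rho>h z = of_real q}
                = {of_real (\<zeta> n) |n. n \<ge> 1} \<union> {of_real (- \<zeta>h n) |n. n \<ge> 1}"
    and interlacing_pos: "0 < \<zeta> 1" "\<And>n. n \<ge> 1 \<Longrightarrow> \<zeta> n < \<rho> n \<and> \<rho> n < \<zeta> (Suc n)"
    and interlacing_neg: "0 < \<zeta>h 1" "\<And>n. n \<ge> 1 \<Longrightarrow> \<zeta>h n < \<rho>h n \<and> \<rho>h n < \<zeta>h (Suc n)"
    and T: "distributed M lborel T (exponential_density q)"
    and indep: "indep_of_process M T X"
    and rho0: "\<rho>h 0 = 0"
    and C_eq: "C = inverse q * (\<Prod>n. (1 + 1 / \<rho>h (Suc n)) / (1 + 1 / \<zeta>h (Suc n)))"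
begin

sublocale levy M X
proof -
  have "levy_process M X" using process by (simp add: meromorphic_levy_process_def)
  moreover from this have "prob_space M" by (simp add: levy_process_def)
  ultimately show "levy M X" by (intro levy.intro levy_axioms.intro)
qed

lemma weights_pos: "n \<ge> 1 \<Longrightarrow> a n > 0" "n \<ge> 1 \<Longrightarrow> ah n > 0" "n \<ge> 1 \<Longrightarrow> \<rho> n > 0" "n \<ge> 1 \<Longrightarrow> \<rho>h n > 0"
  and \<rho>_mono: "strict_mono_on {1..} \<rho>" "strict_mono_on {1..} \<rho>h"
  and \<rho>_unbounded: "\<not> bdd_above (\<rho> ` {1..})" "\<not> bdd_above (\<rho>h ` {1..})"
  and weights_summable: "summable (\<lambda>n. a (Suc n) / (\<rho> (Suc n))\<^sup>2 + ah (Suc n) / (\<rho>h (Suc n))\<^sup>2)"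
  and exponent_at_1: "\<And>z. - \<rho>h 1 < Re z \<Longrightarrow> Re z < \<rho> 1 \<Longrightarrow> integrable M (\<lambda>\<omega>. exp (z * of_real (X 1 \<omega>)))"
    "\<And>z. - \<rho>h 1 < Re z \<Longrightarrow> Re z < \<rho> 1 \<Longrightarrow> (LINT \<omega>|M. exp (z * of_real (X 1 \<omega>))) = exp (mero_exponent \<sigma> \<mu> a ah \<rho> \<rho>h z)"
  using process unfolding meromorphic_levy_process_def by auto

sublocale P: interlaced "\<lambda>n. \<zeta> (Suc n)" "\<lambda>n. \<rho> (Suc n)"
  using interlacing_pos filterlim_if_strict_mono_unbounded[OF \<rho>_mono(1) \<rho>_unbounded(1), of \<zeta>]
  by unfold_locales auto

sublocale N: interlaced "\<lambda>n. \<zeta>h (Suc n)" "\<lambda>n. \<rho>h (Suc n)"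
  using interlacing_neg filterlim_if_strict_mono_unbounded[OF \<rho>_mono(2) \<rho>_unbounded(2), of \<zeta>h]
  by unfold_locales auto

text \<open>Compared with \<open>N\<close>, roots and poles exchange their roles: the convention
  \<open>\<rho>h 0 = 0\<close> puts a pole in front, and adding 1 makes the sequence
  positive.\<close>

sublocale U: interlaced "\<lambda>n. 1 + \<rho>h n" "\<lambda>n. 1 + \<zeta>h (Suc n)"
proof
  show "0 < 1 + \<rho>h 0" by (simp add: rho0)
  show "1 + \<rho>h n < 1 + \<zeta>h (Suc n)" for n using interlacing_neg by (cases n) (auto simp: rho0)
  show "1 + \<zeta>h (Suc n) < 1 + \<rho>h (Suc n)" for n using N.less(1) by simp
  have "filterlim (\<lambda>n. 1 + \<rho>h (Suc n)) at_top sequentially"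
    using N.\<beta>_unbounded by (rule filterlim_at_top_mono) simp
  then show "filterlim (\<lambda>n. 1 + \<rho>h n) at_top sequentially" by (rule filterlim_sequentially_Suc[THEN iffD1])
qed

abbreviation "\<psi> \<equiv> mero_exponent \<sigma> \<mu> a ah \<rho> \<rho>h"
definition "poles_merged = interleave (\<lambda>n. \<rho> (Suc n)) (\<lambda>n. - \<rho>h (Suc n))"
definition "zeros_merged = interleave (\<lambda>n. \<zeta> (Suc n)) (\<lambda>n. - \<zeta>h (Suc n))"
definition "weights_merged = interleave (\<lambda>n. a (Suc n)) (\<lambda>n. ah (Suc n))"

lemmas merged_defs = poles_merged_def zeros_merged_def weights_merged_def

lemma summable_a: "summable (\<lambda>n. a (Suc n) / (\<rho> (Suc n))\<^sup>2)"
  and summable_ah: "summable (\<lambda>n. ah (Suc n) / (\<rho>h (Suc n))\<^sup>2)"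
  using weights_pos(1,2)[of "Suc _"]
  by (auto intro!: summable_comparison_test'[OF weights_summable] simp: less_imp_le)

lemma exponent_series:
  "\<psi> z = of_real (\<sigma>\<^sup>2) * z\<^sup>2 / 2 + of_real \<mu> * z
     + z\<^sup>2 * (\<Sum>k. of_real (weights_merged k) / (of_real (poles_merged k) * (of_real (poles_merged k) - z)))"
proof -
  define f where "f n = complex_of_real (a (Suc n)) / (of_real (\<rho> (Suc n)) * (of_real (\<rho> (Suc n)) - z))" for n
  define g where "g n = complex_of_real (ah (Suc n)) / (of_real (\<rho>h (Suc n)) * (of_real (\<rho>h (Suc n)) + z))" for n
  have "summable (\<lambda>n. complex_of_real (ah (Suc n)) / (of_real (\<rho>h (Suc n)) * (of_real (\<rho>h (Suc n)) - (- z))))"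
    by (rule summable_polar_series[OF weights_pos(2) _ _ summable_ah])
       (use N.\<beta>_pos N.\<beta>_unbounded in \<open>auto simp: less_imp_neq[THEN not_sym] abs_of_pos\<close>)
  then have g: "g sums suminf g" unfolding g_def by (simp add: summable_sums)
  have "summable (\<lambda>n. complex_of_real (a (Suc n)) / (of_real (\<rho> (Suc n)) * (of_real (\<rho> (Suc n)) - z)))"
    by (rule summable_polar_series[OF weights_pos(1) _ _ summable_a])
       (use P.\<beta>_pos P.\<beta>_unbounded in \<open>auto simp: less_imp_neq[THEN not_sym] abs_of_pos\<close>)
  then have f: "f sums suminf f" unfolding f_def by (simp add: summable_sums)
  \<comment> \<open>With the signed pole \<open>- x\<close> the term for negative jumps takes the
    same shape as the one for positive jumps, so both series merge into one.\<close>
  have neg: "complex_of_real (- x) * (of_real (- x) - z) = of_real x * (of_real x + z)" for x by (simp add: algebra_simps)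
  have "(\<lambda>k. of_real (weights_merged k) / (of_real (poles_merged k) * (of_real (poles_merged k) - z))) = interleave f g"
    by (rule ext) (simp add: merged_defs interleave_def f_def g_def neg del: of_real_minus)
  then have "(\<Sum>k. of_real (weights_merged k) / (of_real (poles_merged k) * (of_real (poles_merged k) - z))) = suminf f + suminf g"
    using interleave_sums[OF f g] by (simp add: sums_iff)
  moreover have "\<psi> z = of_real (\<sigma>\<^sup>2) * z\<^sup>2 / 2 + of_real \<mu> * z + z\<^sup>2 * suminf f + z\<^sup>2 * suminf g"
    unfolding mero_exponent_def f_def g_def ..
  ultimately show ?thesis by (simp only: distrib_left add.assoc)
qed

lemma mero_poles_eq: "mero_poles \<rho> \<rho>h = range (\<lambda>k. complex_of_real (poles_merged k))"
proof -
  have "range (\<lambda>k. complex_of_real (poles_merged k)) = of_real ` range poles_merged" by auto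
  also have "\<dots> = of_real ` (range (\<lambda>n. \<rho> (Suc n)) \<union> range (\<lambda>n. - \<rho>h (Suc n)))" by (simp add: poles_merged_def range_interleave)
  finally show ?thesis unfolding mero_poles_def by (auto simp: image_iff) (metis Suc_le_D Suc_le_mono One_nat_def le0)+
qed

lemma mero_zeros_eq: "{of_real (\<zeta> n) |n. n \<ge> 1} \<union> {of_real (- \<zeta>h n) |n. n \<ge> 1} = range (\<lambda>k. complex_of_real (zeros_merged k))"
proof -
  have "range (\<lambda>k. complex_of_real (zeros_merged k)) = of_real ` range zeros_merged" by auto
  also have "\<dots> = of_real ` (range (\<lambda>n. \<zeta> (Suc n)) \<union> range (\<lambda>n. - \<zeta>h (Suc n)))" by (simp add: zeros_merged_def range_interleave)
  finally show ?thesis by (auto simp: image_iff) (metis Suc_le_D Suc_le_mono One_nat_def le0)+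
qed

lemma neq_signs: "x > 0 \<Longrightarrow> y > 0 \<Longrightarrow> x \<noteq> - y" "x > 0 \<Longrightarrow> y > 0 \<Longrightarrow> - y \<noteq> x" for x y :: real by auto

sublocale I: interlaced_meromorphic poles_merged zeros_merged weights_merged \<sigma> \<mu> q \<psi>
proof
  show "poles_merged k \<noteq> 0" "zeros_merged k \<noteq> 0" for k
    using P.\<beta>_pos[of "k div 2"] N.\<beta>_pos[of "k div 2"] P.\<alpha>_pos[of "k div 2"] N.\<alpha>_pos[of "k div 2"]
    by (auto simp: merged_defs interleave_def)
  show "inj poles_merged" unfolding poles_merged_def
    by (intro inj_interleave P.inj_\<beta> neq_signs P.\<beta>_pos N.\<beta>_pos) (use N.inj_\<beta> in \<open>simp add: inj_def\<close>)
  show "inj zeros_merged" unfolding zeros_merged_def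
    by (intro inj_interleave P.inj_\<alpha> neq_signs P.\<alpha>_pos N.\<alpha>_pos) (use N.inj_\<alpha> in \<open>simp add: inj_def\<close>)
  show "zeros_merged j \<noteq> poles_merged k" for j k
    unfolding merged_defs interleave_def
    using P.\<alpha>_neq_\<beta>[of "j div 2" "k div 2"] N.\<alpha>_neq_\<beta>[of "j div 2" "k div 2"]
      neq_signs(1)[OF P.\<alpha>_pos N.\<beta>_pos] neq_signs(2)[OF P.\<beta>_pos N.\<alpha>_pos] by simp
  show "weights_merged k > 0" for k using weights_pos(1,2) by (simp add: merged_defs interleave_def)
  show "q > 0" by (rule q)
  have "(\<lambda>k. \<bar>poles_merged k\<bar>) = interleave (\<lambda>n. \<rho> (Suc n)) (\<lambda>n. \<rho>h (Suc n))"
    using P.\<beta>_pos N.\<beta>_pos by (intro ext) (simp add: merged_defs interleave_def abs_of_pos)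
  then show "filterlim (\<lambda>k. \<bar>poles_merged k\<bar>) at_top sequentially"
    by (simp only:) (rule filterlim_interleave[OF P.\<beta>_unbounded N.\<beta>_unbounded])
  have "(\<lambda>k. \<bar>zeros_merged k\<bar>) = interleave (\<lambda>n. \<zeta> (Suc n)) (\<lambda>n. \<zeta>h (Suc n))"
    using P.\<alpha>_pos N.\<alpha>_pos by (intro ext) (simp add: merged_defs interleave_def abs_of_pos)
  then show "filterlim (\<lambda>k. \<bar>zeros_merged k\<bar>) at_top sequentially"
    by (simp only:) (rule filterlim_interleave[OF P.unbounded N.unbounded])
  have "(\<lambda>k. weights_merged k / (poles_merged k)\<^sup>2) = interleave (\<lambda>n. a (Suc n) / (\<rho> (Suc n))\<^sup>2) (\<lambda>n. ah (Suc n) / (\<rho>h (Suc n))\<^sup>2)"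
    by (intro ext) (simp add: merged_defs interleave_def)
  then show "summable (\<lambda>k. weights_merged k / (poles_merged k)\<^sup>2)"
    by (simp only:) (rule sums_summable[OF interleave_sums[OF summable_sums[OF summable_a] summable_sums[OF summable_ah]]])
  have abs: "\<bar>1 / x - 1 / y\<bar> = 1 / x - 1 / y" "\<bar>1 / (- x) - 1 / (- y)\<bar> = 1 / x - 1 / y" if "0 < x" "x < y" for x y :: real
    using that frac_less2[of 1 1 x y] by auto
  have "(\<lambda>k. \<bar>1 / zeros_merged k - 1 / poles_merged k\<bar>)
     = interleave (\<lambda>n. 1 / \<zeta> (Suc n) - 1 / \<rho> (Suc n)) (\<lambda>n. 1 / \<zeta>h (Suc n) - 1 / \<rho>h (Suc n))"
    unfolding merged_defs interleave_def
    by (intro ext) (simp only: if_split abs(1)[OF P.\<alpha>_pos P.less(1)] abs(2)[OF N.\<alpha>_pos N.less(1)] split: if_split, simp)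
  then show "summable (\<lambda>k. \<bar>1 / zeros_merged k - 1 / poles_merged k\<bar>)"
    by (simp only:) (rule sums_summable[OF interleave_sums[OF summable_sums[OF P.summable_inverse_gap] summable_sums[OF N.summable_inverse_gap]]])
  show "\<psi> z = of_real (\<sigma>\<^sup>2) * z\<^sup>2 / 2 + of_real \<mu> * z
     + z\<^sup>2 * (\<Sum>k. of_real (weights_merged k) / (of_real (poles_merged k) * (of_real (poles_merged k) - z)))" for z
    by (rule exponent_series)
  show "\<psi> z = of_real q \<longleftrightarrow> z \<in> range (\<lambda>k. of_real (zeros_merged k))" if "z \<notin> range (\<lambda>k. of_real (poles_merged k))" for z
    using that exponent_roots unfolding mero_zeros_eq mero_poles_eq by blast
  show "Im (- (1 / z) * (\<Prod>k<2*n. (1 - z / of_real (zeros_merged k)) / (1 - z / of_real (poles_merged k)))) \<ge> 0"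
    if "Im z > 0" for z n
  proof -
    have "(\<lambda>k. (1 - z / complex_of_real (zeros_merged k)) / (1 - z / of_real (poles_merged k)))
      = interleave (\<lambda>j. (1 - z / of_real (\<zeta> (Suc j))) / (1 - z / of_real (\<rho> (Suc j))))
          (\<lambda>j. (1 - z / of_real (- \<zeta>h (Suc j))) / (1 - z / of_real (- \<rho>h (Suc j))))"
      by (intro ext) (simp add: merged_defs interleave_def)
    then show ?thesis
      using herglotz_partial_product[OF P.interlaced_axioms N.interlaced_axioms that, of n] by (simp only: prod_interleave)
  qed
qed

section \<open>The exponent on the real line and the real moments of the functional\<close>

definition \<kappa> :: "real \<Rightarrow> real" where
  "\<kappa> s = Re (\<psi> (of_real s))"

lemma \<psi>_of_real: "\<psi> (of_real s) = of_real (\<kappa> s)"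
proof -
  have "cnj (\<psi> (of_real s)) = \<psi> (of_real s)" using I.\<psi>_cnj[of "of_real s"] by simp
  then have "\<psi> (of_real s) \<in> \<real>" by (simp add: Reals_cnj_iff)
  then show ?thesis by (simp add: \<kappa>_def)
qed

definition pos_factor :: "nat \<Rightarrow> real \<Rightarrow> real" where
  "pos_factor n s = (\<Prod>k<n. (1 - s / \<zeta> (Suc k)) / (1 - s / \<rho> (Suc k)))"

definition neg_factor :: "nat \<Rightarrow> real \<Rightarrow> real" where
  "neg_factor n s = (\<Prod>k<n. (1 + s / \<zeta>h (Suc k)) / (1 + s / \<rho>h (Suc k)))"

lemma less_\<zeta>: "s < \<zeta> 1 \<Longrightarrow> s < \<zeta> (Suc k)" and less_\<rho>: "s < \<zeta> 1 \<Longrightarrow> s < \<rho> (Suc k)"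
  using P.\<alpha>_mono[of 0 k] P.less(1)[of k] by auto

text \<open>Even partial products of the merged sequences regroup by half-line. For \<open>s\<close>
  below the first root all factors are nonnegative, so \<open>q - \<kappa> s\<close> is nonnegative
  as a limit, and nonzero since \<open>s\<close> is neither root nor pole.\<close>

lemma exponent_factorization:
  assumes s: "0 < s" "s < \<zeta> 1"
  shows "(\<lambda>n. q * (pos_factor n s * neg_factor n s)) \<longlonglongrightarrow> q - \<kappa> s" and "\<kappa> s < q"
proof -
  have "poles_merged k \<noteq> s" "zeros_merged k \<noteq> s" for k
    using less_\<rho>[OF s(2), of "k div 2"] less_\<zeta>[OF s(2), of "k div 2"] N.\<beta>_pos[of "k div 2"] N.\<alpha>_pos[of "k div 2"] s(1)
    by (auto simp: merged_defs interleave_def)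
  then have "of_real s \<notin> I.poles" "of_real s \<notin> I.zeros" by (auto simp: eq_commute[of s])
  then have fac: "of_real q - \<psi> (of_real s) = of_real q * I.Q (of_real s)" "I.Q (of_real s) \<noteq> 0"
    by (rule I.factorization)+
  have "(\<lambda>k. I.fac k (of_real s))
      = interleave (\<lambda>j. (1 - of_real s / of_real (\<zeta> (Suc j))) / (1 - of_real s / of_real (\<rho> (Suc j))))
          (\<lambda>j. (1 + of_real s / of_real (\<zeta>h (Suc j))) / (1 + of_real s / of_real (\<rho>h (Suc j))))"
    unfolding I.fac_def by (intro ext) (simp add: merged_defs interleave_def)
  then have "(\<Prod>k<2 * n. I.fac k (of_real s)) = of_real (pos_factor n s * neg_factor n s)" for n
    by (simp only: prod_interleave prod.distrib) (simp add: pos_factor_def neg_factor_def)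
  moreover have "(\<lambda>n. \<Prod>k<2 * n. I.fac k (of_real s)) \<longlonglongrightarrow> I.Q (of_real s)"
    using LIMSEQ_subseq_LIMSEQ[OF I.Q_tendsto, of "\<lambda>n. 2 * n"] by (simp add: strict_mono_def comp_def)
  ultimately have "(\<lambda>n. complex_of_real q * of_real (pos_factor n s * neg_factor n s)) \<longlonglongrightarrow> of_real q * I.Q (of_real s)"
    by (intro tendsto_intros) simp
  then have "(\<lambda>n. complex_of_real (q * (pos_factor n s * neg_factor n s))) \<longlonglongrightarrow> of_real (q - \<kappa> s)"
    using fac(1) by (simp add: \<psi>_of_real)
  then show lim: "(\<lambda>n. q * (pos_factor n s * neg_factor n s)) \<longlonglongrightarrow> q - \<kappa> s" by (rule tendsto_of_real_iff[THEN iffD1])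
  have "pos_factor n s \<ge> 0" for n unfolding pos_factor_def
    using less_\<zeta>[OF s(2)] less_\<rho>[OF s(2)] s(1) P.\<alpha>_pos P.\<beta>_pos by (intro prod_nonneg) (simp add: less_imp_le)
  moreover have "neg_factor n s \<ge> 0" for n unfolding neg_factor_def
    using s(1) N.\<alpha>_pos N.\<beta>_pos by (intro prod_nonneg ballI divide_nonneg_nonneg add_nonneg_nonneg) (auto simp: less_imp_le)
  ultimately have "0 \<le> q - \<kappa> s" using q by (intro LIMSEQ_le_const[OF lim]) auto
  moreover have "q - \<kappa> s \<noteq> 0" using fac q by (auto simp: \<psi>_of_real)
  ultimately show "\<kappa> s < q" by simp
qed

lemma mgf_1:
  assumes s: "0 < s" "s < \<rho> 1" shows "mgf s 1 = ennreal (exp (\<kappa> s))"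
proof -
  have i: "integrable M (\<lambda>\<omega>. exp (complex_of_real s * of_real (X 1 \<omega>)))"
    and e: "(LINT \<omega>|M. exp (complex_of_real s * of_real (X 1 \<omega>))) = exp (\<psi> (of_real s))"
    using exponent_at_1[of "of_real s"] s N.\<beta>_pos[of 0] by auto
  have eq: "exp (complex_of_real s * of_real (X 1 \<omega>)) = of_real (exp (s * X 1 \<omega>))" for \<omega>
    using exp_of_real[of "s * X 1 \<omega>", where 'a=complex] by simp
  have i': "integrable M (\<lambda>\<omega>. exp (s * X 1 \<omega>))" using i unfolding eq by (simp add: complex_of_real_integrable_eq)
  have "complex_of_real (LINT \<omega>|M. exp (s * X 1 \<omega>)) = of_real (exp (\<kappa> s))"
    using e unfolding eq \<psi>_of_real integral_complex_of_real by (simp add: exp_of_real)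
  then have e': "(LINT \<omega>|M. exp (s * X 1 \<omega>)) = exp (\<kappa> s)" by (simp only: of_real_eq_iff)
  have "mgf s 1 = (\<integral>\<^sup>+\<omega>. ennreal (exp (s * X 1 \<omega>)) \<partial>M)"
    unfolding mgf_def using X_0 by (intro nn_integral_cong_AE) (auto elim!: eventually_mono)
  also have "\<dots> = ennreal (exp (\<kappa> s))" using nn_integral_eq_integral[OF i'] e' by simp
  finally show ?thesis .
qed

abbreviation "Y \<equiv> exp_functional X T"

lemma Y_eq: "Y \<omega> = area (path \<omega>) 0 (T \<omega>)"
  by (simp add: exp_functional_def area_def)

lemma T_measurable [measurable]: "T \<in> borel_measurable M"
  using distributed_measurable[OF T] by simp

lemma Y_measurable [measurable]: "Y \<in> borel_measurable M"
proof -
  have "(\<lambda>\<omega>. area (path \<omega>) 0 (T \<omega>)) \<in> borel_measurable M"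
    by (rule area_joint_measurable[where N=M and k="\<lambda>\<omega>. \<omega>" and f="\<lambda>_. 0" and g=T]) auto
  moreover have "Y = (\<lambda>\<omega>. area (path \<omega>) 0 (T \<omega>))" by (rule ext) (rule Y_eq)
  ultimately show ?thesis by (simp only:)
qed

lemma AE_T_pos: "AE \<omega> in M. T \<omega> > 0"
proof -
  have m: "(\<lambda>x. ennreal (exponential_density q x)) \<in> borel_measurable lborel" by simp
  have "AE t in density lborel (\<lambda>x. ennreal (exponential_density q x)). t > 0"
    unfolding AE_density[OF m]
  proof -
    have "AE t in lborel. t \<noteq> (0::real)" by (rule AE_lborel_singleton)
    then show "AE t in lborel. 0 < ennreal (exponential_density q t) \<longrightarrow> 0 < t"
      by eventually_elim (auto simp: exponential_density_def)
  qed
  then have "AE t in distr M lborel T. t > 0" unfolding distributed_distr_eq_density[OF T] .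
  then show ?thesis by (rule AE_distrD[rotated]) simp
qed

lemma AE_Y_pos: "AE \<omega> in M. Y \<omega> > 0"
  using AE_T_pos AE_space by eventually_elim (auto simp: Y_eq intro!: area_pos X_cadlag)

text \<open>The area is measurable for the algebra of the process, so conditioning on the
  independent time is an integration against its density.\<close>

lemma nn_integral_Y: "(\<integral>\<^sup>+\<omega>. ennreal (Y \<omega> powr r) \<partial>M) = killed_moment q r"
proof -
  have "(\<lambda>z. area (path (snd z)) 0 (fst z)) \<in> borel_measurable (borel \<Otimes>\<^sub>M path_algebra)"
    by (rule area_joint_measurable[where N=path_algebra, OF path_algebra_measurable])
       (simp_all add: path_algebra_def)
  then have "(\<lambda>(t, \<omega>). ennreal (area (path \<omega>) 0 t powr r)) \<in> borel_measurable (borel \<Otimes>\<^sub>M path_algebra)"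
    unfolding case_prod_beta by measurable
  from nn_integral_independent_time[OF T indep this] show ?thesis
    by (simp add: Y_eq killed_moment_def moment_def)
qed

lemma integrable_Y_iff: "integrable M (\<lambda>\<omega>. Y \<omega> powr r) \<longleftrightarrow> killed_moment q r < \<infinity>"
  by (simp add: integrable_iff_bounded nn_integral_Y)

lemma killed_moment_Y_finite: "0 < r \<Longrightarrow> r < \<zeta> 1 \<Longrightarrow> killed_moment q r < \<infinity>"
proof -
  assume r: "0 < r" "r < \<zeta> 1"
  define \<theta> where "\<theta> = (r + \<zeta> 1) / 2"
  have \<theta>: "r < \<theta>" "0 < \<theta>" "\<theta> < \<zeta> 1" using r by (auto simp: \<theta>_def field_simps)
  show ?thesis
    using r \<theta> less_\<rho>[OF \<theta>(3), of 0] by (intro killed_moment_finite[OF _ _ q mgf_1 exponent_factorization(2)]) auto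
qed

lemma Y_recursion_nn:
  "0 < s \<Longrightarrow> s < \<zeta> 1 \<Longrightarrow> killed_moment q s = ennreal (s / (q - \<kappa> s)) * killed_moment q (s - 1)"
  using less_\<rho>[of s 0] by (intro killed_moment_recursion[OF _ q mgf_1 exponent_factorization(2)]) auto

text \<open>Positive orders come from the maximal bound. A negative order is reached from the
  recursion: \<open>killed_moment q s\<close> is finite and the factor positive, so
  \<open>killed_moment q (s - 1)\<close> is finite too.\<close>

lemma Y_integrable:
  assumes "- 1 < r" "r < \<zeta> 1" shows "integrable M (\<lambda>\<omega>. Y \<omega> powr r)"
proof (cases "0 < r")
  case True
  then show ?thesis using assms killed_moment_Y_finite[of r] by (simp add: integrable_Y_iff)
next
  case False
  \<comment> \<open>Small enough that \<open>s - 1 \<le> r\<close> and still below the first root;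
    the order \<open>r\<close> then lies between two finite ones.\<close>
  define s where "s = min (r + 1) (\<zeta> 1 / 2)"
  have s: "0 < s" "s < \<zeta> 1" "s - 1 \<le> r" using assms interlacing_pos(1) by (auto simp: s_def min_def)
  have p: "0 < s / (q - \<kappa> s)" using s(1) exponent_factorization(2)[OF s(1,2)] by simp
  have "killed_moment q (s - 1) \<noteq> \<infinity>"
  proof
    assume "killed_moment q (s - 1) = \<infinity>"
    moreover have "ennreal (s / (q - \<kappa> s)) \<noteq> 0" unfolding ennreal_eq_0_iff not_le by (rule p)
    ultimately have "killed_moment q s = \<infinity>"
      by (simp only: Y_recursion_nn[OF s(1,2)] infinity_ennreal_def ennreal_mult_top if_False)
    then show False using killed_moment_Y_finite[OF s(1,2)] by (simp only: less_irrefl)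
  qed
  then have "killed_moment q (s - 1) < \<infinity>" by (simp only: infinity_ennreal_def less_top)
  then have "integrable M (\<lambda>\<omega>. Y \<omega> powr (s - 1))" by (simp add: integrable_Y_iff)
  moreover have "integrable M (\<lambda>\<omega>. Y \<omega> powr (\<zeta> 1 / 2))"
    using interlacing_pos(1) killed_moment_Y_finite[of "\<zeta> 1 / 2"] by (simp add: integrable_Y_iff)
  ultimately show ?thesis 
    by (rule integrable_powr_between[where a="s - 1" and b="\<zeta> 1 / 2", OF Y_measurable AE_Y_pos])
      (use s(3) False interlacing_pos(1) in linarith)+
qed

section \<open>Complex moments of the functional\<close>

definition moment_Y :: "complex \<Rightarrow> complex" where
  "moment_Y s = (LINT \<omega>|M. complex_of_real (Y \<omega>) powr (s - 1))"

lemma moment_Y_of_real: "moment_Y (of_real s) = of_real (LINT \<omega>|M. Y \<omega> powr (s - 1))"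
proof -
  have "AE \<omega> in M. complex_of_real (Y \<omega>) powr (of_real s - 1) = of_real (Y \<omega> powr (s - 1))"
    using AE_Y_pos
  proof eventually_elim
    case (elim \<omega>)
    then show ?case using powr_of_real[of "Y \<omega>" "s - 1"] by (simp only: of_real_diff of_real_1 less_imp_le)
  qed
  then have "moment_Y (of_real s) = (LINT \<omega>|M. complex_of_real (Y \<omega> powr (s - 1)))"
    unfolding moment_Y_def by (rule integral_cong_AE[rotated 2]) measurable
  then show ?thesis by (simp only: integral_complex_of_real)
qed

lemma moment_Y_recursion:
  assumes s: "0 < s" "s < \<zeta> 1"
  shows "moment_Y (of_real s + 1) = of_real (s / (q - \<kappa> s)) * moment_Y (of_real s)"
proof -
  have p: "0 < s / (q - \<kappa> s)" using s(1) exponent_factorization(2)[OF s] by simp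
  have L: "(LINT \<omega>|M. Y \<omega> powr r) = enn2real (killed_moment q r)" for r
    using integral_eq_nn_integral[of "\<lambda>\<omega>. Y \<omega> powr r" M] by (simp only: nn_integral_Y) simp
  have "(LINT \<omega>|M. Y \<omega> powr s) = enn2real (ennreal (s / (q - \<kappa> s)) * killed_moment q (s - 1))"
    by (simp only: L Y_recursion_nn[OF s])
  also have "\<dots> = s / (q - \<kappa> s) * (LINT \<omega>|M. Y \<omega> powr (s - 1))"
    by (simp only: L enn2real_mult enn2real_ennreal[OF less_imp_le[OF p]])
  finally have "complex_of_real (LINT \<omega>|M. Y \<omega> powr s) = of_real (s / (q - \<kappa> s)) * of_real (LINT \<omega>|M. Y \<omega> powr (s - 1))"
    by (simp only: of_real_mult)
  moreover have "moment_Y (of_real s + 1) = of_real (LINT \<omega>|M. Y \<omega> powr s)"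
    using moment_Y_of_real[of "s + 1"] by (simp only: of_real_add of_real_1 add_diff_cancel_right')
  ultimately show ?thesis by (simp only: moment_Y_of_real)
qed

lemma moment_Y_holomorphic: "moment_Y holomorphic_on {s. 0 < Re s \<and> Re s < 1 + \<zeta> 1}"
proof -
  have "(\<lambda>s. LINT \<omega>|M. complex_of_real (Y \<omega>) powr s) holomorphic_on {s. - 1 < Re s \<and> Re s < \<zeta> 1}"
    by (rule mellin_transform_holomorphic[OF Y_measurable AE_Y_pos Y_integrable])
  then have "((\<lambda>s. LINT \<omega>|M. complex_of_real (Y \<omega>) powr s) \<circ> (\<lambda>s. s - 1)) holomorphic_on {s. 0 < Re s \<and> Re s < 1 + \<zeta> 1}"
    by (rule holomorphic_on_compose_gen[rotated]) (auto intro!: holomorphic_intros)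
  then show ?thesis by (simp add: moment_Y_def[abs_def] comp_def)
qed

lemma Y_integrable_complex:
  assumes "0 < Re s" "Re s < 1 + \<zeta> 1"
  shows "integrable M (\<lambda>\<omega>. complex_of_real (Y \<omega>) powr (s - 1))"
  using assms by (intro integrable_complex_powr AE_Y_pos Y_integrable Y_measurable) auto

lemma norm_moment_Y_le:
  assumes "0 < Re s" "Re s < 1 + \<zeta> 1"
  shows "norm (moment_Y s) \<le> norm (moment_Y (of_real (Re s)))"
proof -
  have "norm (moment_Y s) \<le> (LINT \<omega>|M. norm (complex_of_real (Y \<omega>) powr (s - 1)))"
    unfolding moment_Y_def by (rule integral_norm_bound)
  also have "\<dots> = (LINT \<omega>|M. Y \<omega> powr (Re s - 1))"
    using AE_Y_pos by (intro integral_cong_AE) (auto elim!: eventually_mono simp: norm_complex_of_real_powr)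
  also have "\<dots> \<le> norm (moment_Y (of_real (Re s)))" unfolding moment_Y_of_real norm_of_real by (rule abs_ge_self)
  finally show ?thesis .
qed

section \<open>The Mellin transform of the quotient of beta products\<close>

lemma C_tendsto: "(\<lambda>n. \<Prod>k<n. (1 + 1 / \<rho>h (Suc k)) / (1 + 1 / \<zeta>h (Suc k))) \<longlonglongrightarrow> q * C"
  and C_pos: "C > 0"
proof -
  obtain L where L: "L > 0" "(\<lambda>n. \<Prod>k<n. (1 + 1 / \<rho>h (Suc k)) / (1 + 1 / \<zeta>h (Suc k))) \<longlonglongrightarrow> L"
    using N.ratio_product_positive by blast
  have "C = inverse q * L" using prodinf_eq_limit[OF L(2)] L(1) by (simp add: C_eq)
  then have e: "L = q * C" using q by simp
  show "(\<lambda>n. \<Prod>k<n. (1 + 1 / \<rho>h (Suc k)) / (1 + 1 / \<zeta>h (Suc k))) \<longlonglongrightarrow> q * C"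
    using L(2) unfolding e .
  show "C > 0" using L(1) q unfolding e by (simp add: zero_less_mult_iff)
qed

sublocale BQ: beta_quotient "\<lambda>n. 1 + \<rho>h n" "\<lambda>n. 1 + \<zeta>h (Suc n)" "\<lambda>n. \<zeta> (Suc n)" "\<lambda>n. \<rho> (Suc n)" C
  by unfold_locales (rule C_pos)

definition mellin_quotient :: "complex \<Rightarrow> complex" where
  "mellin_quotient s = of_real C powr (s - 1) * U.mellin (s - 1) * P.mellin (1 - s)"

text \<open>
  The gamma factors cancel against the negative roots and poles only after shifting the index of \<open>\<rho>h\<close> by one;
  what remains is the boundary factor, which tends to \<open>s\<close>.
\<close>

lemma telescoping_product:
  assumes s: "0 < s"
  shows "(\<Prod>k<n. (1 + 1 / \<rho>h (Suc k)) / (1 + 1 / \<zeta>h (Suc k)))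
      * (\<Prod>k<n. (\<rho>h k + s) / (\<zeta>h (Suc k) + s) * ((1 + \<zeta>h (Suc k)) / (1 + \<rho>h k))) * neg_factor n s
    = s * ((1 + \<rho>h n) / (\<rho>h n + s))"
proof (induction n)
  case 0
  then show ?case using s by (simp add: neg_factor_def rho0)
next
  case (Suc n)
  have step: "(1 + 1 / x) / (1 + 1 / z) * ((r + s) / (z + s) * ((1 + z) / (1 + r))) * ((1 + s / z) / (1 + s / x))
      = (r + s) / (1 + r) * ((1 + x) / (x + s))" if "x > 0" "z > 0" "r \<ge> 0" for x z r :: real
  proof -
    have "1 + 1 / x = (1 + x) / x" "1 + s / x = (x + s) / x" using that by (simp_all add: field_simps)
    then have "(1 + 1 / x) / (1 + s / x) = (1 + x) / (x + s)" using that by simp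
    moreover have "(1 + z) / (1 + 1 / z) * ((1 + s / z) / (z + s)) = 1"
    proof -
      have e: "1 + 1 / z = (1 + z) / z" "1 + s / z = (z + s) / z" using that by (simp_all add: field_simps)
      show ?thesis unfolding e using that s by simp
    qed
    moreover have "(1 + 1 / x) / (1 + 1 / z) * ((r + s) / (z + s) * ((1 + z) / (1 + r))) * ((1 + s / z) / (1 + s / x))
      = ((1 + z) / (1 + 1 / z) * ((1 + s / z) / (z + s))) * ((r + s) / (1 + r) * ((1 + 1 / x) / (1 + s / x)))"
      by (simp only: times_divide_times_eq mult_ac)
    ultimately show ?thesis by (simp only: mult_1_left)
  qed
  have r: "\<rho>h n \<ge> 0" using N.\<beta>_pos rho0 by (cases n) (auto simp: less_imp_le)
  have "(\<Prod>k<Suc n. (1 + 1 / \<rho>h (Suc k)) / (1 + 1 / \<zeta>h (Suc k)))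
      * (\<Prod>k<Suc n. (\<rho>h k + s) / (\<zeta>h (Suc k) + s) * ((1 + \<zeta>h (Suc k)) / (1 + \<rho>h k))) * neg_factor (Suc n) s
    = s * ((1 + \<rho>h n) / (\<rho>h n + s)) * ((1 + 1 / \<rho>h (Suc n)) / (1 + 1 / \<zeta>h (Suc n)) * ((\<rho>h n + s) / (\<zeta>h (Suc n) + s) * ((1 + \<zeta>h (Suc n)) / (1 + \<rho>h n))) * ((1 + s / \<zeta>h (Suc n)) / (1 + s / \<rho>h (Suc n))))"
    unfolding Suc.IH[symmetric] by (simp only: neg_factor_def prod.lessThan_Suc mult_ac)
  also have "\<dots> = s * ((1 + \<rho>h (Suc n)) / (\<rho>h (Suc n) + s))"
    unfolding step[OF N.\<beta>_pos N.\<alpha>_pos r] using r s by simp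
  finally show ?case .
qed

lemma telescoping_limit:
  assumes "0 < s" shows "(\<lambda>n. s * ((1 + \<rho>h n) / (\<rho>h n + s))) \<longlonglongrightarrow> s"
proof -
  have "filterlim (\<lambda>n. (s - 1) + (1 + \<rho>h n)) at_top sequentially"
    by (rule filterlim_tendsto_add_at_top[OF tendsto_const U.unbounded])
  then have "filterlim (\<lambda>n. \<rho>h n + s) at_infinity sequentially"
    by (intro filterlim_at_top_imp_at_infinity) (simp add: algebra_simps)
  then have "(\<lambda>n. s * (1 + (1 - s) / (\<rho>h n + s))) \<longlonglongrightarrow> s * (1 + 0)"
    by (intro tendsto_intros tendsto_divide_0[OF tendsto_const])
  moreover have "1 + (1 - s) / (\<rho>h n + s) = (1 + \<rho>h n) / (\<rho>h n + s)" for n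
  proof -
    have "\<rho>h n \<ge> 0" using N.\<beta>_pos rho0 by (cases n) (auto simp: less_imp_le)
    then show ?thesis using assms by (simp add: field_simps)
  qed
  ultimately show ?thesis by simp
qed

text \<open>The step formulas of the two beta products and the product formula for
  \<open>q - \<kappa> s\<close> are all limits of partial products over the same indices. Multiplied
  by the partial products for \<open>C\<close>, the negative half-line telescopes to
  \<open>s\<close>, and the factors of the positive half-line match.\<close>

lemma mellin_quotient_recursion:
  assumes s: "0 < s" "s < \<zeta> 1"
  shows "mellin_quotient (of_real s + 1) = of_real (s / (q - \<kappa> s)) * mellin_quotient (of_real s)"
proof -
  define z where "z = complex_of_real s"
  define A where "A n = (\<Prod>k<n. (\<rho>h k + s) / (\<zeta>h (Suc k) + s) * ((1 + \<zeta>h (Suc k)) / (1 + \<rho>h k)))" for n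
  define c where "c n = (\<Prod>k<n. (1 + 1 / \<rho>h (Suc k)) / (1 + 1 / \<zeta>h (Suc k)))" for n
  have "(\<lambda>n. \<Prod>k<n. (of_real (1 + \<rho>h k) + (z - 1)) / (of_real (1 + \<zeta>h (Suc k)) + (z - 1)) * of_real ((1 + \<zeta>h (Suc k)) / (1 + \<rho>h k)))
      \<longlonglongrightarrow> U.mellin (z - 1 + 1) / U.mellin (z - 1)"
    by (rule U.mellin_step) (use s in \<open>simp add: z_def rho0\<close>)
  then have A: "(\<lambda>n. complex_of_real (A n)) \<longlonglongrightarrow> U.mellin z / U.mellin (z - 1)" by (simp add: A_def z_def)
  have "(\<lambda>n. \<Prod>k<n. (of_real (\<zeta> (Suc k)) + (- z)) / (of_real (\<rho> (Suc k)) + (- z)) * of_real (\<rho> (Suc k) / \<zeta> (Suc k)))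
      \<longlonglongrightarrow> P.mellin (- z + 1) / P.mellin (- z)"
    by (rule P.mellin_step) (use s in \<open>simp add: z_def\<close>)
  moreover have "(of_real (\<zeta> (Suc k)) + (- z)) / (of_real (\<rho> (Suc k)) + (- z)) * of_real (\<rho> (Suc k) / \<zeta> (Suc k))
      = of_real ((1 - s / \<zeta> (Suc k)) / (1 - s / \<rho> (Suc k)))" for k
  proof -
    have e: "1 - s / \<zeta> (Suc k) = (\<zeta> (Suc k) - s) / \<zeta> (Suc k)" "1 - s / \<rho> (Suc k) = (\<rho> (Suc k) - s) / \<rho> (Suc k)"
      using P.\<alpha>_pos[of k] P.\<beta>_pos[of k] by (simp_all add: field_simps)
    show ?thesis unfolding e by (simp add: z_def)
  qed
  ultimately have B: "(\<lambda>n. complex_of_real (pos_factor n s)) \<longlonglongrightarrow> P.mellin (1 - z) / P.mellin (- z)"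
    by (simp only: pos_factor_def of_real_prod) simp
  \<comment> \<open>One sequence with two limits: first factor by factor, then after telescoping.
    Their equality is the recursion up to nonzero factors.\<close>
  have "(\<lambda>n. complex_of_real (c n) * of_real (A n) * of_real (q * (pos_factor n s * neg_factor n s)))
      \<longlonglongrightarrow> of_real (q * C) * (U.mellin z / U.mellin (z - 1)) * of_real (q - \<kappa> s)"
    unfolding c_def by (intro tendsto_mult tendsto_of_real A C_tendsto exponent_factorization(1)[OF s])
  moreover have "complex_of_real (c n) * of_real (A n) * of_real (q * (pos_factor n s * neg_factor n s))
      = of_real q * of_real (pos_factor n s) * of_real (s * ((1 + \<rho>h n) / (\<rho>h n + s)))" for n
    unfolding telescoping_product[OF s(1), symmetric, of n] c_def[symmetric] A_def[symmetric] by simp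
  moreover have "(\<lambda>n. complex_of_real q * of_real (pos_factor n s) * of_real (s * ((1 + \<rho>h n) / (\<rho>h n + s))))
      \<longlonglongrightarrow> of_real q * (P.mellin (1 - z) / P.mellin (- z)) * of_real s"
    by (intro tendsto_mult tendsto_const tendsto_of_real B telescoping_limit s)
  ultimately have "of_real (q * C) * (U.mellin z / U.mellin (z - 1)) * of_real (q - \<kappa> s)
      = of_real q * (P.mellin (1 - z) / P.mellin (- z)) * of_real s"
    by (simp only: LIMSEQ_unique)
  then have key: "of_real C * (U.mellin z / U.mellin (z - 1)) * complex_of_real (q - \<kappa> s) = P.mellin (1 - z) / P.mellin (- z) * of_real s"
    using q by (simp only: of_real_mult mult.assoc mult_left_cancel of_real_eq_0_iff less_imp_neq[THEN not_sym] not_False_eq_True)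
  have n: "U.mellin (z - 1) \<noteq> 0" "P.mellin (- z) \<noteq> 0" "complex_of_real (q - \<kappa> s) \<noteq> 0"
    using s exponent_factorization(2)[OF s] by (auto intro!: U.mellin_nonzero P.mellin_nonzero simp: z_def rho0)
  have f1: "of_real C * (U.mellin z * P.mellin (- z)) = of_real s / complex_of_real (q - \<kappa> s) * (U.mellin (z - 1) * P.mellin (1 - z))"
    using key n by (simp add: divide_simps mult_ac del: of_real_diff)
  have f2: "complex_of_real C powr z = of_real C powr (z - 1) * of_real C"
    using powr_add[of "complex_of_real C" "z - 1" 1] C_pos by simp
  have "mellin_quotient (z + 1) = of_real C powr z * U.mellin z * P.mellin (- z)"
    by (simp add: mellin_quotient_def)
  also have "\<dots> = of_real C powr (z - 1) * (of_real C * (U.mellin z * P.mellin (- z)))"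
    by (simp only: f2 mult.assoc)
  also have "\<dots> = of_real (s / (q - \<kappa> s)) * mellin_quotient z"
    unfolding f1 by (simp only: mellin_quotient_def of_real_divide mult_ac)
  finally show ?thesis by (simp only: z_def)
qed

lemma strip_conditions:
  assumes "0 < Re s" "Re s < 1 + \<zeta> 1"
  shows "1 + \<rho>h 0 + Re (s - 1) > 0" "\<zeta> (Suc 0) + Re (1 - s) > 0" "\<zeta> (Suc 0) - Re (s - 1) > 0"
  using assms by (simp_all add: rho0)

lemma mellin_quotient_nonzero: "0 < Re s \<Longrightarrow> Re s < 1 + \<zeta> 1 \<Longrightarrow> mellin_quotient s \<noteq> 0"
  unfolding mellin_quotient_def using C_pos U.mellin_nonzero[OF strip_conditions(1)] P.mellin_nonzero[OF strip_conditions(2)]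
  by simp

lemma mellin_quotient_eq:
  assumes "0 < Re s" "Re s < 1 + \<zeta> 1"
  shows "(LINT z|BQ.law. complex_of_real (BQ.quotient z) powr (s - 1)) = mellin_quotient s"
  using BQ.quotient_mellin(2)[OF strip_conditions(1,3)[OF assms]] by (simp add: mellin_quotient_def)

text \<open>Holomorphy is read off from the integral representation over the product law, so that
  uniform convergence of the gamma products does not enter.\<close>

lemma mellin_quotient_holomorphic: "mellin_quotient holomorphic_on {s. 0 < Re s \<and> Re s < 1 + \<zeta> 1}"
proof -
  have "(\<lambda>s. LINT z|BQ.law. complex_of_real (BQ.quotient z) powr s) holomorphic_on {s. - 1 < Re s \<and> Re s < \<zeta> 1}"
    by (rule mellin_transform_holomorphic[OF BQ.quotient_measurable BQ.quotient_pos BQ.quotient_integrable]) (auto simp: rho0)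
  then have "((\<lambda>s. LINT z|BQ.law. complex_of_real (BQ.quotient z) powr s) \<circ> (\<lambda>s. s - 1)) holomorphic_on {s. 0 < Re s \<and> Re s < 1 + \<zeta> 1}"
    by (rule holomorphic_on_compose_gen[rotated]) (auto intro!: holomorphic_intros)
  then show ?thesis by (rule holomorphic_transform) (simp only: comp_def mem_Collect_eq mellin_quotient_eq)
qed

text \<open>Each beta product contributes one gamma decay, evaluated at the distance of
  \<open>Re s\<close> from its own edge of the strip.\<close>

lemma norm_mellin_quotient_ge:
  assumes s: "0 < Re s" "Re s < 1 + \<zeta> 1"
  shows "norm (mellin_quotient s) \<ge> gamma_decay (Im s) (Re s) * gamma_decay (- Im s) (1 + \<zeta> 1 - Re s) * norm (mellin_quotient (of_real (Re s)))"
proof -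
  have u: "norm (U.mellin (s - 1)) \<ge> gamma_decay (Im s) (Re s) * norm (U.mellin (of_real (Re s) - 1))"
    using U.norm_mellin_ge[OF strip_conditions(1)[OF s]] by (simp add: rho0)
  have p: "norm (P.mellin (1 - s)) \<ge> gamma_decay (- Im s) (1 + \<zeta> 1 - Re s) * norm (P.mellin (1 - of_real (Re s)))"
    using P.norm_mellin_ge[OF strip_conditions(2)[OF s]] by (simp add: algebra_simps)
  have g: "gamma_decay (Im s) (Re s) \<ge> 0" "gamma_decay (- Im s) (1 + \<zeta> 1 - Re s) \<ge> 0"
    using s by (auto intro!: less_imp_le gamma_decay_pos)
  have "(gamma_decay (Im s) (Re s) * norm (U.mellin (of_real (Re s) - 1))) * (gamma_decay (- Im s) (1 + \<zeta> 1 - Re s) * norm (P.mellin (1 - of_real (Re s))))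
      \<le> norm (U.mellin (s - 1)) * norm (P.mellin (1 - s))"
    using u p g by (intro mult_mono mult_nonneg_nonneg) auto
  then have "C powr (Re s - 1) * ((gamma_decay (Im s) (Re s) * norm (U.mellin (of_real (Re s) - 1))) * (gamma_decay (- Im s) (1 + \<zeta> 1 - Re s) * norm (P.mellin (1 - of_real (Re s)))))
      \<le> C powr (Re s - 1) * (norm (U.mellin (s - 1)) * norm (P.mellin (1 - s)))"
    by (rule mult_left_mono) simp
  then show ?thesis
    unfolding mellin_quotient_def norm_mult norm_complex_of_real_powr[OF C_pos] by (simp add: mult_ac)
qed

lemma decay_limit: "((\<lambda>t. K * (exp (pi * t) * (c + t)\<^sup>2 / c\<^sup>2) * exp (- 2 * pi * t)) \<longlongrightarrow> 0) at_top" for K c :: real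
proof -
  have "((\<lambda>t. (c + t)\<^sup>2 * exp (- p * t)) \<longlongrightarrow> 0) at_top" if "p > 0" for p
    using that by real_asymp
  from this[of pi] have "((\<lambda>t. K / c\<^sup>2 * ((c + t)\<^sup>2 * exp (- pi * t))) \<longlongrightarrow> K / c\<^sup>2 * 0) at_top"
    by (intro tendsto_intros) simp
  moreover have "K * (exp (pi * t) * (c + t)\<^sup>2 / c\<^sup>2) * exp (- 2 * pi * t) = K / c\<^sup>2 * ((c + t)\<^sup>2 * exp (- pi * t))" for t
  proof -
    have "exp (- pi * t) = exp (pi * t) * exp (- 2 * pi * t)" by (simp flip: exp_add)
    then show ?thesis by (simp only: times_divide_eq_left times_divide_eq_right mult_ac)
  qed
  ultimately show ?thesis by (simp only: mult_zero_right)
qed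

text \<open>The quotient of the two transforms is periodic and grows at most like
  \<open>exp (pi * \<bar>Im s\<bar>)\<close> times a polynomial, below the threshold of
  \<open>periodic_in_strip_constant\<close>.\<close>

lemma mellin_identity:
  assumes s: "0 < Re s" "Re s < 1 + \<zeta> 1"
  shows "moment_Y s = mellin_quotient s"
proof -
  define R where "R s = moment_Y s / mellin_quotient s" for s
  \<comment> \<open>Centres a closed strip of width one in the open strip of width
    \<open>1 + \<zeta> 1\<close>: the margin on either side is \<open>c\<close>.\<close>
  define c where "c = \<zeta> 1 / 2"
  have c: "0 < c" "c + 1 < 1 + \<zeta> 1" using interlacing_pos(1) by (simp_all add: c_def)
  have hol: "R holomorphic_on {s. 0 < Re s \<and> Re s < 1 + \<zeta> 1}"
    unfolding R_def[abs_def] by (intro holomorphic_on_divide moment_Y_holomorphic mellin_quotient_holomorphic) (use mellin_quotient_nonzero in auto)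
  have sub: "{s. 0 < Re s \<and> Re s < \<zeta> 1} \<subseteq> {s. 0 < Re s \<and> Re s < 1 + \<zeta> 1}" by auto
  have shift: "(\<lambda>s. f (s + 1)) holomorphic_on {s. 0 < Re s \<and> Re s < \<zeta> 1}"
    if "f holomorphic_on {s. 0 < Re s \<and> Re s < 1 + \<zeta> 1}" for f
  proof -
    have "f \<circ> (\<lambda>s. s + 1) holomorphic_on {s. 0 < Re s \<and> Re s < \<zeta> 1}"
      by (rule holomorphic_on_compose_gen[OF _ that]) (auto intro!: holomorphic_intros)
    then show ?thesis by (simp add: comp_def)
  qed
  have per: "R (s + 1) = R s" if "0 < Re s" "Re s + 1 < 1 + \<zeta> 1" for s
  proof -
    \<comment> \<open>The recursions are known for real exponents only. Cross-multiplied they are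
      identities between holomorphic functions and continue to the strip.\<close>
    have key: "moment_Y (s + 1) * mellin_quotient s = moment_Y s * mellin_quotient (s + 1)"
    proof (rule holomorphic_eq_on_strip[where a=0 and b="\<zeta> 1" and c=0 and d="\<zeta> 1"
          and f="\<lambda>s. moment_Y (s + 1) * mellin_quotient s" and g="\<lambda>s. moment_Y s * mellin_quotient (s + 1)"])
      show "(\<lambda>s. moment_Y (s + 1) * mellin_quotient s) holomorphic_on {s. 0 < Re s \<and> Re s < \<zeta> 1}"
        by (intro holomorphic_on_mult shift[OF moment_Y_holomorphic] holomorphic_on_subset[OF mellin_quotient_holomorphic sub])
      show "(\<lambda>s. moment_Y s * mellin_quotient (s + 1)) holomorphic_on {s. 0 < Re s \<and> Re s < \<zeta> 1}"
        by (intro holomorphic_on_mult shift[OF mellin_quotient_holomorphic] holomorphic_on_subset[OF moment_Y_holomorphic sub])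
      show "moment_Y (of_real x + 1) * mellin_quotient (of_real x) = moment_Y (of_real x) * mellin_quotient (of_real x + 1)"
        if "0 < x" "x < \<zeta> 1" for x
        unfolding moment_Y_recursion[OF that] mellin_quotient_recursion[OF that] by (simp only: mult_ac)
    qed (use that interlacing_pos(1) in auto)
    have "mellin_quotient (s + 1) \<noteq> 0" "mellin_quotient s \<noteq> 0"
      by (rule mellin_quotient_nonzero; use that in simp)+
    from frac_eq_eq[OF this] show ?thesis unfolding R_def using key by (rule iffD2)
  qed
  \<comment> \<open>Compactness bounds the quotient on the real segment; off the axis numerator and
    denominator are each compared with their values at \<open>Re s\<close>.\<close>
  have "continuous_on {c..c + 1} (\<lambda>x. R (of_real x))"
    by (rule continuous_on_compose2[OF holomorphic_on_imp_continuous_on[OF hol]]) (use c in \<open>auto intro!: continuous_intros\<close>)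
  then have "compact ((\<lambda>x. R (of_real x)) ` {c..c + 1})" by (rule compact_continuous_image) simp
  then have "bounded ((\<lambda>x. R (of_real x)) ` {c..c + 1})" by (rule compact_imp_bounded)
  then obtain K where "\<forall>x\<in>(\<lambda>x. R (of_real x)) ` {c..c + 1}. norm x \<le> K" unfolding bounded_iff by blast
  then have K: "norm (R (of_real x)) \<le> K" if "c \<le> x" "x \<le> c + 1" for x using that by simp
  have bound: "norm (R s) \<le> K * (exp (pi * \<bar>Im s\<bar>) * (c + \<bar>Im s\<bar>)\<^sup>2 / c\<^sup>2)" if "c \<le> Re s" "Re s \<le> c + 1" for s
  proof -
    have s: "0 < Re s" "Re s < 1 + \<zeta> 1" "c \<le> 1 + \<zeta> 1 - Re s" using that c by (auto simp: c_def)
    \<comment> \<open>The lower bound for the decay at the point \<open>c\<close>. Both decays are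
      taken at points not smaller than \<open>c\<close>, so by monotonicity it bounds each of
      them.\<close>
    define e where "e = exp (- pi / 2 * \<bar>Im s\<bar>) * c / (c + \<bar>Im s\<bar>)"
    have e: "e > 0" using c by (simp add: e_def add_pos_nonneg)
    have "e \<le> gamma_decay (Im s) (Re s)"
      using gamma_decay_ge[OF c(1), of "Im s"] gamma_decay_mono[OF c(1) that(1), of "Im s"] by (simp add: e_def)
    moreover have "e \<le> gamma_decay (- Im s) (1 + \<zeta> 1 - Re s)"
      using gamma_decay_ge[OF c(1), of "- Im s"] gamma_decay_mono[OF c(1) s(3), of "- Im s"] by (simp add: e_def)
    ultimately have "e * e \<le> gamma_decay (Im s) (Re s) * gamma_decay (- Im s) (1 + \<zeta> 1 - Re s)"
      using e by (intro mult_mono) auto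
    then have "e * e * norm (mellin_quotient (of_real (Re s)))
        \<le> gamma_decay (Im s) (Re s) * gamma_decay (- Im s) (1 + \<zeta> 1 - Re s) * norm (mellin_quotient (of_real (Re s)))"
      by (rule mult_right_mono) simp
    also have "\<dots> \<le> norm (mellin_quotient s)" by (rule norm_mellin_quotient_ge[OF s(1,2)])
    finally have lower: "e * e * norm (mellin_quotient (of_real (Re s))) \<le> norm (mellin_quotient s)" .
    have nz: "norm (mellin_quotient (of_real (Re s))) > 0" using mellin_quotient_nonzero[of "of_real (Re s)"] s by simp
    have "norm (R s) = norm (moment_Y s) / norm (mellin_quotient s)" by (simp add: R_def norm_divide)
    also have "\<dots> \<le> norm (moment_Y (of_real (Re s))) / (e * e * norm (mellin_quotient (of_real (Re s))))"
      using norm_moment_Y_le[OF s(1,2)] lower e nz by (intro frac_le) auto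
    also have "\<dots> = norm (R (of_real (Re s))) * (1 / (e * e))" by (simp add: R_def norm_divide)
    also have "\<dots> \<le> K * (1 / (e * e))" using K[OF that] e by (intro mult_right_mono) auto
    also have "1 / (e * e) = exp (pi * \<bar>Im s\<bar>) * (c + \<bar>Im s\<bar>)\<^sup>2 / c\<^sup>2"
    proof -
      have "exp (- pi / 2 * \<bar>Im s\<bar>) * exp (- pi / 2 * \<bar>Im s\<bar>) = 1 / exp (pi * \<bar>Im s\<bar>)"
      proof -
        have "- pi / 2 * \<bar>Im s\<bar> + - pi / 2 * \<bar>Im s\<bar> = - (pi * \<bar>Im s\<bar>)" by simp
        then show ?thesis by (simp only: exp_add[symmetric] exp_minus inverse_eq_divide)
      qed
      moreover have "e * e = (exp (- pi / 2 * \<bar>Im s\<bar>) * exp (- pi / 2 * \<bar>Im s\<bar>)) * (c\<^sup>2 / (c + \<bar>Im s\<bar>)\<^sup>2)"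
        unfolding e_def power2_eq_square times_divide_times_eq times_divide_eq_left times_divide_eq_right by (simp only: mult_ac divide_divide_eq_left)
      ultimately have "e * e = 1 / exp (pi * \<bar>Im s\<bar>) * (c\<^sup>2 / (c + \<bar>Im s\<bar>)\<^sup>2)" by (simp only:)
      then show ?thesis by (simp only: times_divide_times_eq mult_1_left divide_divide_eq_right)
    qed
    finally show ?thesis .
  qed
  have "R s = R 1"
    by (rule periodic_in_strip_constant[OF hol per c bound decay_limit]) (use s interlacing_pos(1) in auto)
  \<comment> \<open>Normalisation: at \<open>s = 1\<close> both transforms are total masses of
    probability measures.\<close>
  also have "R 1 = 1"
  proof -
    have "moment_Y 1 = of_real (LINT \<omega>|M. Y \<omega> powr 0)" using moment_Y_of_real[of 1] by simp
    also have "(LINT \<omega>|M. Y \<omega> powr 0) = (LINT \<omega>|M. 1)"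
      using AE_Y_pos by (intro integral_cong_AE) (auto elim!: eventually_mono)
    finally have "moment_Y 1 = 1" by (simp add: prob_space)
    moreover have "mellin_quotient 1 = 1" using C_pos by (simp add: mellin_quotient_def U.mellin_0 P.mellin_0)
    ultimately show ?thesis by (simp add: R_def)
  qed
  finally show ?thesis using mellin_quotient_nonzero[OF s] by (simp add: R_def)
qed

lemma law_eq: "beta_product_law (\<lambda>n. 1 + \<rho>h (n - 1)) (\<lambda>n. 1 + \<zeta>h n) \<Otimes>\<^sub>M beta_product_law \<zeta> \<rho> = BQ.law"
  unfolding beta_product_law_def U.inf_prod_def[abs_def] P.inf_prod_def[abs_def] diff_Suc_1 ..

text \<open>The line \<open>Re s = 1\<close> lies inside the strip, and on it the transforms are the
  characteristic functions of the logarithms.\<close>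

lemma distribution_identity: "distr M borel Y = distr BQ.law borel BQ.quotient"
proof (rule distr_eq_if_mellin_eq[OF prob_space_axioms BQ.prob_space_law Y_measurable BQ.quotient_measurable AE_Y_pos BQ.quotient_pos])
  fix t :: real
  have s: "0 < Re (1 + \<i> * of_real t)" "Re (1 + \<i> * of_real t) < 1 + \<zeta> 1" using interlacing_pos(1) by auto
  have e: "1 + \<i> * of_real t - 1 = \<i> * of_real t" by simp
  show "(LINT \<omega>|M. complex_of_real (Y \<omega>) powr (\<i> * of_real t)) = (LINT z|BQ.law. complex_of_real (BQ.quotient z) powr (\<i> * of_real t))"
    using mellin_identity[OF s] mellin_quotient_eq[OF s] unfolding moment_Y_def e by (rule trans[OF _ sym])
qed

text \<open>The factors for the positive half-line enter with exponent \<open>1 - s\<close>, which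
  turns \<open>\<rho> / \<zeta>\<close> into its reciprocal. The limit being nonzero, it equals
  \<open>prodinf\<close>.\<close>

lemma mellin_product:
  assumes s: "0 < Re s" "Re s < 1 + \<zeta> 1"
  shows "mellin_quotient s = of_real C powr (s - 1) *
          (\<Prod>n. (Gamma (of_real (\<zeta>h (Suc n) + 1)) * Gamma (of_real (\<rho>h n) + s))
                / (Gamma (of_real (\<rho>h n + 1)) * Gamma (of_real (\<zeta>h (Suc n)) + s))
                * of_real ((\<zeta>h (Suc n) + 1) / (\<rho>h n + 1)) powr (s - 1)
                * ((Gamma (of_real (\<rho> (Suc n))) * Gamma (of_real (\<zeta> (Suc n)) + 1 - s))
                   / (Gamma (of_real (\<zeta> (Suc n))) * Gamma (of_real (\<rho> (Suc n)) + 1 - s)))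
                * of_real (\<zeta> (Suc n) / \<rho> (Suc n)) powr (s - 1))" (is "_ = _ * prodinf ?f")
proof -
  have "?f n = gamma_ratio (1 + \<rho>h n) (1 + \<zeta>h (Suc n)) (s - 1) * gamma_ratio (\<zeta> (Suc n)) (\<rho> (Suc n)) (1 - s)" for n
  proof -
    have pos: "\<rho> (Suc n) / \<zeta> (Suc n) > 0" "\<zeta> (Suc n) / \<rho> (Suc n) > 0" using P.\<alpha>_pos[of n] P.\<beta>_pos[of n] by auto
    have "ln (\<zeta> (Suc n) / \<rho> (Suc n)) = - ln (\<rho> (Suc n) / \<zeta> (Suc n))" using P.\<alpha>_pos[of n] P.\<beta>_pos[of n] by (simp add: ln_div)
    then have pw: "complex_of_real (\<rho> (Suc n) / \<zeta> (Suc n)) powr (1 - s) = of_real (\<zeta> (Suc n) / \<rho> (Suc n)) powr (s - 1)"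
      unfolding complex_of_real_powr[OF pos(1)] complex_of_real_powr[OF pos(2)] by (simp add: algebra_simps)
    have arg: "complex_of_real (1 + \<rho>h n) + (s - 1) = of_real (\<rho>h n) + s" "complex_of_real (1 + \<zeta>h (Suc n)) + (s - 1) = of_real (\<zeta>h (Suc n)) + s"
      "complex_of_real (\<zeta> (Suc n)) + (1 - s) = of_real (\<zeta> (Suc n)) + 1 - s" "complex_of_real (\<rho> (Suc n)) + (1 - s) = of_real (\<rho> (Suc n)) + 1 - s"
      by simp_all
    show ?thesis
      unfolding gamma_ratio_def arg pw unfolding add.commute[of 1 "\<rho>h n"] add.commute[of 1 "\<zeta>h (Suc n)"] by (simp only: mult_ac)
  qed
  then have "(\<lambda>n. \<Prod>k<n. ?f k) \<longlonglongrightarrow> U.mellin (s - 1) * P.mellin (1 - s)"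
    using tendsto_mult[OF U.mellin_limit[OF strip_conditions(1)[OF s]] P.mellin_limit[OF strip_conditions(2)[OF s]]]
    by (simp only: prod.distrib)
  then have "prodinf ?f = U.mellin (s - 1) * P.mellin (1 - s)"
    by (rule prodinf_eq_limit) (use U.mellin_nonzero[OF strip_conditions(1)[OF s]] P.mellin_nonzero[OF strip_conditions(2)[OF s]] in simp)
  then show ?thesis by (simp only: mellin_quotient_def mult.assoc)
qed

end

theorem theorem2:
  fixes M :: "'a measure" and X :: "real \<Rightarrow> 'a \<Rightarrow> real" and T :: "'a \<Rightarrow> real"
    and \<sigma> \<mu> q C :: real
    and a ah \<rho> \<rho>h \<zeta> \<zeta>h :: "nat \<Rightarrow> real"
  assumes X: "meromorphic_levy_process M X \<sigma> \<mu> a ah \<rho> \<rho>h"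
    and q: "q > 0"
    and roots: "{z. z \<notin> mero_poles \<rho> \<rho>h \<and> mero_exponent \<sigma> \<mu> a ah \<rho> \<rho>h z = of_real q}
                = {of_real (\<zeta> n) |n. n \<ge> 1} \<union> {of_real (- \<zeta>h n) |n. n \<ge> 1}"
    and interlacing_pos: "0 < \<zeta> 1" "\<And>n. n \<ge> 1 \<Longrightarrow> \<zeta> n < \<rho> n \<and> \<rho> n < \<zeta> (Suc n)"
    and interlacing_neg: "0 < \<zeta>h 1" "\<And>n. n \<ge> 1 \<Longrightarrow> \<zeta>h n < \<rho>h n \<and> \<rho>h n < \<zeta>h (Suc n)"
    and T: "distributed M lborel T (exponential_density q)"
    and indep: "indep_of_process M T X"
    and rho0: "\<rho>h 0 = 0"
    and C: "C = inverse q * (\<Prod>n. (1 + 1 / \<rho>h (Suc n)) / (1 + 1 / \<zeta>h (Suc n)))"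
  shows "exp_functional X T \<in> borel_measurable M
    \<and> distr M borel (exp_functional X T)
      = distr (beta_product_law (\<lambda>n. 1 + \<rho>h (n - 1)) (\<lambda>n. 1 + \<zeta>h n)
               \<Otimes>\<^sub>M beta_product_law \<zeta> \<rho>) borel (\<lambda>(x, y). C * (x / y))
    \<and> (\<forall>s::complex. 0 < Re s \<and> Re s < 1 + \<zeta> 1 \<longrightarrow>
        integrable M (\<lambda>\<omega>. complex_of_real (exp_functional X T \<omega>) powr (s - 1)) \<and>
        (LINT \<omega>|M. complex_of_real (exp_functional X T \<omega>) powr (s - 1))
        = of_real C powr (s - 1) *
          (\<Prod>n. (Gamma (of_real (\<zeta>h (Suc n) + 1)) * Gamma (of_real (\<rho>h n) + s))
                / (Gamma (of_real (\<rho>h n + 1)) * Gamma (of_real (\<zeta>h (Suc n)) + s))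
                * of_real ((\<zeta>h (Suc n) + 1) / (\<rho>h n + 1)) powr (s - 1)
                * ((Gamma (of_real (\<rho> (Suc n))) * Gamma (of_real (\<zeta> (Suc n)) + 1 - s))
                   / (Gamma (of_real (\<zeta> (Suc n))) * Gamma (of_real (\<rho> (Suc n)) + 1 - s)))
                * of_real (\<zeta> (Suc n) / \<rho> (Suc n)) powr (s - 1)))"

proof -
  interpret meromorphic_killed M X T \<sigma> \<mu> q C a ah \<rho> \<rho>h \<zeta> \<zeta>h
    by (intro meromorphic_killed.intro assms)
  show ?thesis
  proof (intro conjI allI impI)
    show "Y \<in> borel_measurable M" by (rule Y_measurable)
    show "distr M borel Y = distr (beta_product_law (\<lambda>n. 1 + \<rho>h (n - 1)) (\<lambda>n. 1 + \<zeta>h n)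
               \<Otimes>\<^sub>M beta_product_law \<zeta> \<rho>) borel (\<lambda>(x, y). C * (x / y))"
      using distribution_identity unfolding law_eq BQ.quotient_def .
  next
    fix s :: complex assume "0 < Re s \<and> Re s < 1 + \<zeta> 1"
    then have s: "0 < Re s" "Re s < 1 + \<zeta> 1" by (rule conjunct1, rule conjunct2)
    show "integrable M (\<lambda>\<omega>. complex_of_real (Y \<omega>) powr (s - 1))" by (rule Y_integrable_complex[OF s])
    show "(LINT \<omega>|M. complex_of_real (exp_functional X T \<omega>) powr (s - 1))
        = of_real C powr (s - 1) *
          (\<Prod>n. (Gamma (of_real (\<zeta>h (Suc n) + 1)) * Gamma (of_real (\<rho>h n) + s))
                / (Gamma (of_real (\<rho>h n + 1)) * Gamma (of_real (\<zeta>h (Suc n)) + s))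
                * of_real ((\<zeta>h (Suc n) + 1) / (\<rho>h n + 1)) powr (s - 1)
                * ((Gamma (of_real (\<rho> (Suc n))) * Gamma (of_real (\<zeta> (Suc n)) + 1 - s))
                   / (Gamma (of_real (\<zeta> (Suc n))) * Gamma (of_real (\<rho> (Suc n)) + 1 - s)))
                * of_real (\<zeta> (Suc n) / \<rho> (Suc n)) powr (s - 1))"
      by (rule trans[OF mellin_identity[OF s, unfolded moment_Y_def] mellin_product[OF s]])
  qed
qed

end
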